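(* Let $\mathcal C=\{L_1,L_2\}$ be a pseudo-fibered pair and $G$ be a subgroup of $\operatorname{Aut}(\mathcal C)$. Let $\mathcal G$ be a gap of $\mathcal C$ (i.e. of $L_1$ or $L_2$) whose stabilizer $\operatorname{Stab}_G(\mathcal G)$ is non-trivial. Then $\operatorname{Stab}_G(\mathcal G)$ falls into one of the following cases. (1) When $\mathcal G$ is an ideal polygon: (a) $\operatorname{Stab}_G(\mathcal G)$ is generated by an elliptic automorphism $e$ of order $n$ in $\operatorname{Stab}_G(\mathcal G)$ and so $\operatorname{Stab}_G(\mathcal G)\cong\mathbb Z_n$. (b) $\operatorname{Stab}_G(\mathcal G)$ is generated by a pA-like element in $\operatorname{Stab}_G(\mathcal G)$ without fixed point and $\operatorname{Stab}_G(\mathcal G)\cong\mathbb Z$. (c) $\operatorname{Stab}_G(\mathcal G)$ is generated by a properly pseudo-Anosov in $\operatorname{Aut}(\mathcal C)$ and $\operatorname{Stab}_G(\mathcal G)\cong\mathbb Z$. (d) $\operatorname{Stab}_G(\mathcal G)$ is generated by a pA-like automorphism $g$ and an elliptic automorphism $e$ of order $n$ in $\operatorname{Stab}_G(\mathcal G)$ and $\operatorname{Stab}_G(\mathcal G)=\langle g,e\mid[g,e]=1,\ e^n=1\rangle\cong\mathbb Z\times\mathbb Z_n$. (2) When $\mathcal G$ is a crown: (a) $\operatorname{Stab}_G(\mathcal G)$ is generated by a parabolic element in $\operatorname{Stab}_G(\mathcal G)$ and $\operatorname{Stab}_G(\mathcal G)\cong\mathbb Z$. (b) $\operatorname{Stab}_G(\mathcal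 G)$ is generated by a properly pseudo-Anosov in $\operatorname{Stab}_G(\mathcal G)$ and $\operatorname{Stab}_G(\mathcal G)\cong\mathbb Z$. (c) $\operatorname{Stab}_G(\mathcal G)$ is generated by a properly pseudo-Anosov $g$ and a parabolic element $h$ in $\operatorname{Stab}_G(\mathcal G)$ and $\operatorname{Stab}_G(\mathcal G)=\langle g,h\mid[g,h]=1\rangle\cong\mathbb Z\times\mathbb Z$.
   Context: Lamination systems. $S^1$ is the unit circle with its counter-clockwise circular order. For distinct $u,v\in S^1$, $(u,v)_{S^1}$ is the set of $z$ with $(u,z,v)$ counter-clockwise; such sets are called good intervals, and $(u,v)_{S^1}^*:=(v,u)_{S^1}$. For a good interval $I$ put $\ell(I)=\{I,I^*\}$; $\ell(I)$ lies on an open interval $J$ if $I\subseteq J$ or $I^*\subseteq J$. A lamination system is a nonempty set $L$ of good intervals such that (i) $I\in L\Rightarrow I^*\in L$; (ii) for $I,J\in L$, $\ell(I)$ lies on $J$ or on $J^*$; (iii) if $I_1\subseteq I_2\subseteq\cdots$ are in $L$ and $\bigcup_k I_k$ is a good interval, then $\bigcup_k I_k\in L$. The leaves of $L$ are the $\ell(I)$, $I\in L$. A gap of $L$ is a subset $\mathcal G\subseteq L$ whose distinct elements are disjoint and such that every leaf of $L$ lies on some element of $\mathcal G$. Each leaf is itself a gap; a non-leaf gap is a gap which is not a leaf. The vertex set of $\mathcal G$ is $v(\mathcal G)=S^1\setminus\bigcup\mathcal G$. $E(L)=\bigcup_{I\in L}v(\ell(I))$. An ideal polygon is a gap with finitely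 many vertices (leaves included). A crown is a gap $\{(t_k,t_{k+1})_{S^1}:k\in\mathbb Z\}$ with vertex set $\{t_k:k\in\mathbb Z\}\cup\{p\}$ and $p\neq t_k$ for all $k$. $L$ is quite full if every gap is an ideal polygon or a crown; a quite full $L$ is loose if distinct non-leaf gaps have disjoint vertex sets. Pseudo-fibered pairs. A pair $\{L_1,L_2\}$ of lamination systems is pseudo-fibered if both are quite full and loose and $E(L_1)\cap E(L_2)=\emptyset$. Gaps $\mathcal G_1$ of $L_1$ and $\mathcal G_2$ of $L_2$ interleave if for each $i\in\{1,2\}$ (cyclic indices) $I\cap v(\mathcal G_{i+1})$ is a singleton for every $I\in\mathcal G_i$; then $(\mathcal G_1,\mathcal G_2)$ is an interleaving pair. Automorphisms. $\operatorname{Aut}(\mathcal C)$ is the group of orientation preserving homeomorphisms $g$ of $S^1$ with $g(L_1)=L_1$ and $g(L_2)=L_2$; $\operatorname{Stab}_G(\mathcal G)=\{g\in G:g(\mathcal G)=\mathcal G\}$. A non-trivial $g$ is elliptic if it has finite order, and parabolic if it has a unique fixed point on $S^1$; $g\in\operatorname{Aut}(\mathcal C)$ is pA-like if it is non-trivial, neither elliptic nor parabolic, and preserves an interleaving pair of $\mathcal C$; a properly pseudo-Anosov is a pA-like automorphism with non-empty fixed point set. $\mathbb Z_n$ is the cyclic group of order $n$. *)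

theory Defs
  imports "HOL-Analysis.Analysis" "HOL-Algebra.Algebra"
begin

section \<open>The circle and good intervals\<close>

abbreviation circle :: "complex set" where
  "circle \<equiv> sphere 0 1"

text \<open>\<open>ccw u z v\<close>: the triple \<open>(u, z, v)\<close> consists of distinct points of the circle in
  counter-clockwise order.\<close>

definition ccw :: "complex \<Rightarrow> complex \<Rightarrow> complex \<Rightarrow> bool" where
  "ccw u z v \<longleftrightarrow> (\<exists>a b c. u = cis a \<and> z = cis b \<and> v = cis c \<and> a < b \<and> b < c \<and> c < a + 2 * pi)"

definition arc_between :: "complex \<Rightarrow> complex \<Rightarrow> complex set" where
  "arc_between u v = {z. ccw u z v}"

definition good_interval :: "complex set \<Rightarrow> bool" where
  "good_interval I \<longleftrightarrow> (\<exists>u\<in>circle. \<exists>v\<in>circle. u \<noteq> v \<and> I = arc_between u v)"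

text \<open>The interval \<open>I\<^sup>*\<close>. A good interval determines its ordered pair of end points, so this is
  well defined; see \<open>dual_arc_between\<close> below.\<close>

definition dual :: "complex set \<Rightarrow> complex set" where
  "dual I = (THE J. \<exists>u\<in>circle. \<exists>v\<in>circle. u \<noteq> v \<and> I = arc_between u v \<and> J = arc_between v u)"

lemma cis_eq_cis: "cis a = cis b \<longleftrightarrow> (\<exists>k::int. a = b + 2 * pi * k)"
proof
  assume "cis a = cis b"
  then have "sin a = sin b \<and> cos a = cos b"
    by (simp add: complex_eq_iff)
  then obtain k :: int where "a = b + 2 * pi * k"
    by (auto simp: sin_cos_eq_iff)
  then show "\<exists>k::int. a = b + 2 * pi * k" by blast
next
  assume "\<exists>k::int. a = b + 2 * pi * k"
  then show "cis a = cis b"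
    by (auto simp: complex_eq_iff) (metis sin_cos_eq_iff mult.commute)+
qed

lemma circle_cis_from:
  assumes "w \<in> circle"
  obtains b where "a \<le> b" "b < a + 2 * pi" "w = cis b"
proof -
  obtain t where t: "w = cis t"
    using assms by (metis cis_Arg_unique[of w] complex_norm_eq_1_exp cis_conv_exp
        dist_0_norm mem_sphere)
  define k where "k = - \<lfloor>(t - a) / (2 * pi)\<rfloor>"
  define b where "b = t + 2 * pi * of_int k"
  have *: "of_int \<lfloor>(t - a) / (2 * pi)\<rfloor> * (2 * pi) \<le> t - a"
    using floor_divide_lower[of "2 * pi" "t - a"] by simp
  have **: "t - a < (of_int \<lfloor>(t - a) / (2 * pi)\<rfloor> + 1) * (2 * pi)"
    using floor_divide_upper[of "2 * pi" "t - a"] by simp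
  have "a \<le> b" "b < a + 2 * pi"
    using * ** unfolding b_def k_def by (simp_all add: algebra_simps)
  moreover have "w = cis b"
    unfolding t b_def by (metis cis_eq_cis)
  ultimately show thesis using that by blast
qed

lemma two_pi_int_less:
  fixes k :: int
  assumes "2 * pi * k < 2 * pi" "- (2 * pi) < 2 * pi * k"
  shows "k = 0"
proof -
  have "of_int k < (1::real)" using assms(1) by simp
  moreover have "- 1 < (of_int k :: real)"
    using assms(2) mult_less_cancel_left_pos[of "2 * pi" "- 1" "of_int k"] by simp
  ultimately show ?thesis by linarith
qed

lemma cis_inj_interval:
  assumes "cis s = cis t" "a \<le> s" "s < a + 2 * pi" "a \<le> t" "t < a + 2 * pi"
  shows "s = t"
proof -
  obtain k :: int where k: "s = t + 2 * pi * k" using assms(1) cis_eq_cis by blast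
  have "k = 0" by (rule two_pi_int_less) (use k assms in linarith)+
  with k show ?thesis by simp
qed

lemma arc_between_cis:
  assumes "a < c" "c < a + 2 * pi"
  shows "arc_between (cis a) (cis c) = cis ` {a<..<c}"
proof
  show "cis ` {a<..<c} \<subseteq> arc_between (cis a) (cis c)"
    using assms unfolding arc_between_def ccw_def by fastforce
next
  show "arc_between (cis a) (cis c) \<subseteq> cis ` {a<..<c}"
  proof
    fix z assume "z \<in> arc_between (cis a) (cis c)"
    then obtain a' b' c' where z: "cis a = cis a'" "z = cis b'" "cis c = cis c'"
      "a' < b'" "b' < c'" "c' < a' + 2 * pi"
      unfolding arc_between_def ccw_def by auto
    obtain k :: int where k: "a = a' + 2 * pi * k" using z(1) cis_eq_cis by blast
    have "c = c' + 2 * pi * k"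
    proof (rule cis_inj_interval[where a = a])
      show "cis c = cis (c' + 2 * pi * k)" using z(3) cis_eq_cis by metis
    qed (use assms z k in linarith)+
    moreover have "z = cis (b' + 2 * pi * k)" using z(2) cis_eq_cis by metis
    ultimately show "z \<in> cis ` {a<..<c}" using z k by auto
  qed
qed

lemma circle_pair_cis:
  assumes "u = cis a" "v \<in> circle" "u \<noteq> v"
  obtains c where "a < c" "c < a + 2 * pi" "v = cis c"
proof -
  obtain c where "a \<le> c" "c < a + 2 * pi" "v = cis c" by (rule circle_cis_from[OF assms(2)])
  moreover have "a \<noteq> c" using assms calculation by auto
  ultimately show thesis using that by force
qed

lemma arc_between_inj:
  assumes "u \<in> circle" "v \<in> circle" "u \<noteq> v" "u' \<in> circle" "v' \<in> circle" "u' \<noteq> v'"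
    and eq: "arc_between u v = arc_between u' v'"
  shows "u = u' \<and> v = v'"
proof -
  obtain a where a: "u = cis a" using circle_cis_from[OF assms(1), of 0] by metis
  obtain c where c: "a < c" "c < a + 2 * pi" "v = cis c"
    using circle_pair_cis[OF a assms(2,3)] by metis
  obtain a' where a': "a \<le> a'" "a' < a + 2 * pi" "u' = cis a'"
    using circle_cis_from[OF assms(4), of a] by metis
  obtain c' where c': "a' < c'" "c' < a' + 2 * pi" "v' = cis c'"
    using circle_pair_cis[OF a'(3) assms(5,6)] by metis
  have I: "cis ` {a<..<c} = cis ` {a'<..<c'}"
    using eq arc_between_cis[OF c(1,2)] arc_between_cis[OF c'(1,2)] a c(3) a'(3) c'(3) by simp
  have "\<not> (a < a' \<and> a' < c)"
  proof
    assume "a < a' \<and> a' < c"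
    then have "cis a' \<in> cis ` {a'<..<c'}" unfolding I[symmetric] by simp
    then obtain s where "a' < s" "s < c'" "cis a' = cis s" by auto
    then show False using cis_inj_interval[of a' s a'] c' by auto
  qed
  moreover have "\<not> c \<le> a'"
  proof
    assume h: "c \<le> a'"
    obtain t where t: "a' < t" "t < c'" "t < a + 2 * pi"
      using dense[of a' "min c' (a + 2 * pi)"] c' a' by auto
    then have "cis t \<in> cis ` {a<..<c}" unfolding I by simp
    then obtain s where "a < s" "s < c" "cis t = cis s" by auto
    then show False using cis_inj_interval[of t s a] c h t by auto
  qed
  ultimately have [simp]: "a' = a" using a'(1) by linarith
  have "\<not> c < c'"
  proof
    assume "c < c'"
    then have "cis c \<in> cis ` {a<..<c}" unfolding I using c by simp
    then obtain s where "a < s" "s < c" "cis c = cis s" by auto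
    then show False using cis_inj_interval[of c s a] c by auto
  qed
  moreover have "\<not> c' < c"
  proof
    assume "c' < c"
    then have "cis c' \<in> cis ` {a'<..<c'}" unfolding I[symmetric] using c' by simp
    then obtain s where "a < s" "s < c'" "cis c' = cis s" by auto
    then show False using cis_inj_interval[of c' s a] c' by auto
  qed
  ultimately show ?thesis using a c a' c' by auto
qed

lemma dual_arc_between:
  assumes "u \<in> circle" "v \<in> circle" "u \<noteq> v"
  shows "dual (arc_between u v) = arc_between v u"
  unfolding dual_def
proof (rule the_equality)
  show "\<exists>u'\<in>circle. \<exists>v'\<in>circle. u' \<noteq> v' \<and> arc_between u v = arc_between u' v' \<and>
      arc_between v u = arc_between v' u'"
    using assms by blast
qed (use assms arc_between_inj in metis)


section \<open>Lamination systems and gaps\<close>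

definition leaf_of :: "complex set \<Rightarrow> complex set set" where
  "leaf_of I = {I, dual I}"

text \<open>\<open>lies_on I J\<close>: the leaf \<open>leaf_of I\<close> lies on the open interval \<open>J\<close>.\<close>

definition lies_on :: "complex set \<Rightarrow> complex set \<Rightarrow> bool" where
  "lies_on I J \<longleftrightarrow> I \<subseteq> J \<or> dual I \<subseteq> J"

definition lamination_system :: "complex set set \<Rightarrow> bool" where
  "lamination_system L \<longleftrightarrow>
     L \<noteq> {} \<and> (\<forall>I\<in>L. good_interval I) \<and>
     (\<forall>I\<in>L. dual I \<in> L) \<and>
     (\<forall>I\<in>L. \<forall>J\<in>L. lies_on I J \<or> lies_on I (dual J)) \<and>
     (\<forall>A :: nat \<Rightarrow> complex set.
        (\<forall>k. A k \<in> L) \<and> (\<forall>k. A k \<subseteq> A (Suc k)) \<and> good_interval (\<Union>k. A k)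
          \<longrightarrow> (\<Union>k. A k) \<in> L)"

definition leaves :: "complex set set \<Rightarrow> complex set set set" where
  "leaves L = leaf_of ` L"

definition gap :: "complex set set \<Rightarrow> complex set set \<Rightarrow> bool" where
  "gap L \<G> \<longleftrightarrow>
     \<G> \<subseteq> L \<and> (\<forall>I\<in>\<G>. \<forall>J\<in>\<G>. I \<noteq> J \<longrightarrow> I \<inter> J = {}) \<and>
     (\<forall>I\<in>L. \<exists>J\<in>\<G>. lies_on I J)"

definition non_leaf_gap :: "complex set set \<Rightarrow> complex set set \<Rightarrow> bool" where
  "non_leaf_gap L \<G> \<longleftrightarrow> gap L \<G> \<and> \<G> \<notin> leaves L"

definition vertices :: "complex set set \<Rightarrow> complex set" where
  "vertices \<G> = circle - \<Union>\<G>"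

definition end_points :: "complex set set \<Rightarrow> complex set" where
  "end_points L = (\<Union>I\<in>L. vertices (leaf_of I))"

definition ideal_polygon :: "complex set set \<Rightarrow> complex set set \<Rightarrow> bool" where
  "ideal_polygon L \<G> \<longleftrightarrow> gap L \<G> \<and> finite (vertices \<G>)"

definition crown :: "complex set set \<Rightarrow> complex set set \<Rightarrow> bool" where
  "crown L \<G> \<longleftrightarrow> gap L \<G> \<and>
     (\<exists>(t :: int \<Rightarrow> complex) p.
        (\<forall>k. t k \<in> circle) \<and> p \<in> circle \<and> (\<forall>k. p \<noteq> t k) \<and>
        \<G> = {arc_between (t k) (t (k + 1)) | k. True} \<and>
        vertices \<G> = range t \<union> {p})"

definition quite_full :: "complex set set \<Rightarrow> bool" where
  "quite_full L \<longleftrightarrow> (\<forall>\<G>. gap L \<G> \<longrightarrow> ideal_polygon L \<G> \<or> crown L \<G>)"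

text \<open>Looseness is only defined for quite full lamination systems; fullness is required
  separately below.\<close>

definition loose :: "complex set set \<Rightarrow> bool" where
  "loose L \<longleftrightarrow>
     (\<forall>\<G> \<H>. non_leaf_gap L \<G> \<and> non_leaf_gap L \<H> \<and> \<G> \<noteq> \<H> \<longrightarrow> vertices \<G> \<inter> vertices \<H> = {})"

definition pseudo_fibered :: "complex set set \<Rightarrow> complex set set \<Rightarrow> bool" where
  "pseudo_fibered L1 L2 \<longleftrightarrow>
     lamination_system L1 \<and> lamination_system L2 \<and>
     quite_full L1 \<and> quite_full L2 \<and> loose L1 \<and> loose L2 \<and>
     end_points L1 \<inter> end_points L2 = {}"

definition interleaving_pair ::
  "complex set set \<Rightarrow> complex set set \<Rightarrow> complex set set \<Rightarrow> complex set set \<Rightarrow> bool" where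
  "interleaving_pair L1 L2 \<G>1 \<G>2 \<longleftrightarrow>
     gap L1 \<G>1 \<and> gap L2 \<G>2 \<and>
     (\<forall>I\<in>\<G>1. is_singleton (I \<inter> vertices \<G>2)) \<and>
     (\<forall>I\<in>\<G>2. is_singleton (I \<inter> vertices \<G>1))"


section \<open>Automorphisms\<close>

definition orientation_preserving :: "(complex \<Rightarrow> complex) \<Rightarrow> bool" where
  "orientation_preserving g \<longleftrightarrow>
     (\<forall>u\<in>circle. \<forall>z\<in>circle. \<forall>v\<in>circle. ccw (g u) (g z) (g v) \<longleftrightarrow> ccw u z v)"

text \<open>The action of a map on a set of intervals.\<close>

definition act :: "(complex \<Rightarrow> complex) \<Rightarrow> complex set set \<Rightarrow> complex set set" where
  "act g \<A> = (\<lambda>I. g ` I) ` \<A>"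

text \<open>As in \<open>BijGroup\<close>, a self-map of the circle is represented by the function on \<open>complex\<close>
  that is \<open>undefined\<close> off the circle, so that equality of functions is equality of maps.\<close>

definition Aut :: "complex set set \<Rightarrow> complex set set \<Rightarrow> (complex \<Rightarrow> complex) monoid" where
  "Aut L1 L2 = (BijGroup circle)\<lparr>carrier :=
     {g \<in> Bij circle. (\<exists>h. homeomorphism circle circle g h) \<and> orientation_preserving g \<and>
        act g L1 = L1 \<and> act g L2 = L2}\<rparr>"

definition stabilizer_group ::
  "complex set set \<Rightarrow> complex set set \<Rightarrow> (complex \<Rightarrow> complex) set \<Rightarrow> complex set set
     \<Rightarrow> (complex \<Rightarrow> complex) monoid" where
  "stabilizer_group L1 L2 G \<G> = (Aut L1 L2)\<lparr>carrier := {g \<in> G. act g \<G> = \<G>}\<rparr>"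

definition fixed_points :: "(complex \<Rightarrow> complex) \<Rightarrow> complex set" where
  "fixed_points g = {x \<in> circle. g x = x}"

definition elliptic :: "complex set set \<Rightarrow> complex set set \<Rightarrow> (complex \<Rightarrow> complex) \<Rightarrow> bool" where
  "elliptic L1 L2 g \<longleftrightarrow> g \<in> carrier (Aut L1 L2) \<and> g \<noteq> \<one>\<^bsub>Aut L1 L2\<^esub> \<and>
     (\<exists>n::nat. n > 0 \<and> g [^]\<^bsub>Aut L1 L2\<^esub> n = \<one>\<^bsub>Aut L1 L2\<^esub>)"

definition parabolic :: "complex set set \<Rightarrow> complex set set \<Rightarrow> (complex \<Rightarrow> complex) \<Rightarrow> bool" where
  "parabolic L1 L2 g \<longleftrightarrow> g \<in> carrier (Aut L1 L2) \<and> g \<noteq> \<one>\<^bsub>Aut L1 L2\<^esub> \<and>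
     is_singleton (fixed_points g)"

definition pA_like :: "complex set set \<Rightarrow> complex set set \<Rightarrow> (complex \<Rightarrow> complex) \<Rightarrow> bool" where
  "pA_like L1 L2 g \<longleftrightarrow> g \<in> carrier (Aut L1 L2) \<and> g \<noteq> \<one>\<^bsub>Aut L1 L2\<^esub> \<and>
     \<not> elliptic L1 L2 g \<and> \<not> parabolic L1 L2 g \<and>
     (\<exists>\<G>1 \<G>2. interleaving_pair L1 L2 \<G>1 \<G>2 \<and> act g \<G>1 = \<G>1 \<and> act g \<G>2 = \<G>2)"

definition properly_pseudo_Anosov ::
  "complex set set \<Rightarrow> complex set set \<Rightarrow> (complex \<Rightarrow> complex) \<Rightarrow> bool" where
  "properly_pseudo_Anosov L1 L2 g \<longleftrightarrow> pA_like L1 L2 g \<and> fixed_points g \<noteq> {}"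


section \<open>Group presentations\<close>

text \<open>A word is a list of letters; \<open>(x, True)\<close> stands for the generator \<open>x\<close> and \<open>(x, False)\<close> for
  its formal inverse. The relation \<open>word_eq R\<close> identifies two words iff they represent the same
  element of the free group modulo the normal closure of the relators \<open>R\<close>.\<close>

type_synonym 'x word = "('x \<times> bool) list"

inductive word_eq :: "'x word set \<Rightarrow> 'x word \<Rightarrow> 'x word \<Rightarrow> bool" for R where
  refl: "word_eq R w w"
| sym: "word_eq R v w \<Longrightarrow> word_eq R w v"
| trans: "word_eq R u v \<Longrightarrow> word_eq R v w \<Longrightarrow> word_eq R u w"
| cancel: "word_eq R (u @ [(x, b), (x, \<not> b)] @ v) (u @ v)"
| relator: "r \<in> R \<Longrightarrow> word_eq R (u @ r @ v) (u @ v)"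

primrec word_val :: "('a, 'm) monoid_scheme \<Rightarrow> ('x \<Rightarrow> 'a) \<Rightarrow> 'x word \<Rightarrow> 'a" where
  "word_val H f [] = \<one>\<^bsub>H\<^esub>"
| "word_val H f (l # w) = (if snd l then f (fst l) else inv\<^bsub>H\<^esub> (f (fst l))) \<otimes>\<^bsub>H\<^esub> word_val H f w"

text \<open>\<open>presents H f R\<close>: sending each letter \<open>x\<close> to \<open>f x\<close> induces an isomorphism from the
  group presented by all letters of the type \<open>'x\<close> and the relators \<open>R\<close> onto \<open>H\<close>.\<close>

definition presents :: "('a, 'm) monoid_scheme \<Rightarrow> ('x \<Rightarrow> 'a) \<Rightarrow> 'x word set \<Rightarrow> bool" where
  "presents H f R \<longleftrightarrow>
     range f \<subseteq> carrier H \<and> carrier H = generate H (range f) \<and>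
     (\<forall>w. word_val H f w = \<one>\<^bsub>H\<^esub> \<longleftrightarrow> word_eq R w [])"

datatype two_letters = LetterA | LetterB

primrec two_gens :: "'a \<Rightarrow> 'a \<Rightarrow> two_letters \<Rightarrow> 'a" where
  "two_gens g h LetterA = g"
| "two_gens g h LetterB = h"

definition commutator_word :: "two_letters word" where
  "commutator_word = [(LetterA, True), (LetterB, True), (LetterA, False), (LetterB, False)]"

definition power_word :: "nat \<Rightarrow> two_letters word" where
  "power_word n = replicate n (LetterB, True)"

end

theory Submission imports Defs begin

text \<open>
  Transport everything to the ordered set of angles. An automorphism preserving a gap shifts the cyclic
  (polygon) or bi-infinite (crown) sequence of its vertices, which gives a homomorphism to the integers, modulo
  the number of vertices for a polygon. The point is that its kernel \<open>N\<close>, the maps fixing all vertices,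
  is trivial or infinite cyclic and central.

  The main tool is rigidity: an automorphism fixing two leaves of one lamination without common end point that
  are crossed by a common leaf of the other lamination is the identity. To embed \<open>N\<close> into the integers,
  look at one side of a leaf of the gap and at the top end points of the leaves of the other lamination crossing it.
  The smallest leaves separating two of these points from the given leaf form a family in which every increasing
  or decreasing chain is locally finite, so \<open>N\<close> acts on it by translations far out, and a map with
  translation number zero is the identity by rigidity. Centrality holds because every non-trivial element of \<open>N\<close>
  is either attracting at all vertices or repelling at all vertices, and this is invariant under conjugation.
  Finally, non-trivial elements of \<open>N\<close> provide an interleaving pair preserved by their centralizer, and
  the group is an extension of a cyclic group by a central cyclic group.
\<close>

section \<open>Groups with two commuting generators\<close>

text \<open>Centrality is the group theoretic obstacle: an extension of one infinite cyclic group by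
  another can be a Klein bottle group, so it has to be excluded that a shift of the vertices inverts
  \<open>N\<close>. For a polygon, moreover, a power of a shift may be a non-trivial element of
  \<open>N\<close>; the torsion then becomes visible only after a change of basis of a rank two
  lattice.

  The dynamical obstacle is that the end points of crossing leaves cannot be counted directly, since
  they may accumulate at one another. The separating leaves cannot accumulate: a limit leaf would
  belong to the same lamination, while its end points would be limits of end points of crossing
  leaves of the other one, hence common to both laminations.

  The extra vertex of a crown needs separate care, because no leaves shrink down to it. Rigidity
  excludes such points at the end points of leaves fixed by a non-trivial automorphism, and this is
  what makes small leaves available there.

  Working with angles in a half-open interval turns every assertion about the cyclic position of
  finitely many points into linear arithmetic.\<close>

lemma int_subgroup_dvd:
  fixes A :: "int set"
  assumes A: "0 \<in> A" "\<And>x y. x \<in> A ==> y \<in> A ==> x + y \<in> A" "\<And>x. x \<in> A ==> - x \<in> A"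
  shows "\<exists>d\<ge>0. \<forall>x. x \<in> A \<longleftrightarrow> d dvd x"
proof (cases "A = {0}")
  case False
  then obtain x where "x \<in> A" "x \<noteq> 0" using A(1) by auto
  then have ex: "\<exists>n. 0 < n \<and> int n \<in> A" using A(3)[of x]
    by (intro exI[of _ "nat \<bar>x\<bar>"]) (auto simp: abs_if)
  define m where "m = (LEAST n. 0 < n \<and> int n \<in> A)"
  have m: "0 < m" "int m \<in> A" using LeastI_ex[OF ex] unfolding m_def by auto
  have min: "m \<le> n" if "0 < n" "int n \<in> A" for n unfolding m_def by (rule Least_le) (use that in simp)
  have nm: "int k * y \<in> A" if "y \<in> A" for y k
  proof (induction k)
    case (Suc k) then show ?case using A(2)[OF that Suc] by (simp add: algebra_simps)
  qed (simp add: A(1))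
  have mult: "k * y \<in> A" if "y \<in> A" for y k
    using nm[OF that, of "nat k"] nm[OF A(3)[OF that], of "nat (- k)"] by (cases "0 \<le> k") simp_all
  have "int m dvd x" if x: "x \<in> A" for x
  proof -
    have "x mod int m = x + (- (x div int m)) * int m" by (simp add: minus_div_mult_eq_mod[symmetric])
    then have r: "x mod int m \<in> A" using A(2)[OF x mult[OF m(2), of "- (x div int m)"]] by (simp only:)
    have "0 \<le> x mod int m" "x mod int m < int m" using m(1) by simp_all
    then have "x mod int m = 0" using min[of "nat (x mod int m)"] r by (cases "x mod int m = 0") auto
    then show ?thesis by auto
  qed
  moreover have "x \<in> A" if "int m dvd x" for x using that mult[OF m(2)] by (metis dvd_def mult.commute)
  ultimately show ?thesis by (intro exI[of _ "int m"]) auto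
qed (intro exI[of _ 0], auto)

context group
begin

text \<open>Conjugation by \<open>x\<close> is an endomorphism fixing \<open>y\<close>, hence it
  fixes all powers of \<open>y\<close>.\<close>

lemma commuting_pow:
  assumes "x \<in> carrier G" "y \<in> carrier G" "x \<otimes> y = y \<otimes> x"
  shows "x \<otimes> (y [^] (k::int)) = (y [^] k) \<otimes> x"
proof -
  have "x \<otimes> y \<otimes> inv x = y" using assms by (simp add: inv_solve_right' m_assoc)
  moreover have "(\<lambda>z. x \<otimes> z \<otimes> inv x) \<in> hom G G"
    by (rule homI) (use assms in \<open>simp_all add: m_assoc inv_solve_left\<close>)
  then have "x \<otimes> (y [^] k) \<otimes> inv x = (x \<otimes> y \<otimes> inv x) [^] k"
    using hom_int_pow[OF _ assms(2), of "\<lambda>z. x \<otimes> z \<otimes> inv x" G k] is_group by simp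
  ultimately have "x \<otimes> (y [^] k) \<otimes> inv x = y [^] k" by simp
  then show ?thesis using assms by (simp add: inv_solve_right')
qed

lemma commuting_pow2:
  assumes x: "x \<in> carrier G" and y: "y \<in> carrier G" and c: "x \<otimes> y = y \<otimes> x"
  shows "(x [^] (a::int)) \<otimes> (y [^] (b::int)) = (y [^] b) \<otimes> (x [^] a)"
proof -
  have "y [^] b \<otimes> x = x \<otimes> y [^] b" using commuting_pow[OF x y c] by simp
  from commuting_pow[OF int_pow_closed[OF y] x this] show ?thesis by simp
qed

lemma commuting_mult:
  assumes x: "x \<in> carrier G" and y: "y \<in> carrier G" and c: "x \<otimes> y = y \<otimes> x"
  shows "(x [^] (a::int) \<otimes> y [^] (b::int)) \<otimes> (x [^] c' \<otimes> y [^] d) = x [^] (a + c') \<otimes> y [^] (b + d)"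
proof -
  have "(x [^] a \<otimes> y [^] b) \<otimes> (x [^] c' \<otimes> y [^] d) = x [^] a \<otimes> (y [^] b \<otimes> x [^] c') \<otimes> y [^] d"
    using x y by (simp add: m_assoc)
  also have "\<dots> = x [^] a \<otimes> (x [^] c' \<otimes> y [^] b) \<otimes> y [^] d" using commuting_pow2[OF x y c] by simp
  also have "\<dots> = (x [^] a \<otimes> x [^] c') \<otimes> (y [^] b \<otimes> y [^] d)" using x y by (simp add: m_assoc)
  finally show ?thesis using x y by (simp add: int_pow_mult)
qed

lemma commuting_int_pow:
  assumes x: "x \<in> carrier G" and y: "y \<in> carrier G" and c: "x \<otimes> y = y \<otimes> x"
  shows "(x [^] (a::int) \<otimes> y [^] (b::int)) [^] (k::int) = x [^] (a * k) \<otimes> y [^] (b * k)"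
  using int_pow_mult_distrib[OF commuting_pow2[OF x y c], of a b k] x y by (simp add: int_pow_pow)

lemma two_generators:
  assumes x: "x \<in> carrier G" and y: "y \<in> carrier G"
    and all: "\<And>f. f \<in> carrier G ==> \<exists>a b. f = x [^] (a::int) \<otimes> y [^] (b::int)"
  shows "carrier G = generate G {x, y}"
proof
  have s: "subgroup (generate G {x, y}) G" by (rule generate_is_subgroup) (use x y in simp)
  have xy: "x \<in> generate G {x, y}" "y \<in> generate G {x, y}" by (auto intro: generate.incl)
  show "carrier G \<subseteq> generate G {x, y}"
  proof
    fix f assume "f \<in> carrier G"
    then obtain a b where "f = x [^] (a::int) \<otimes> y [^] (b::int)" using all by blast
    then show "f \<in> generate G {x, y}"
      using subgroup_int_pow_closed[OF s xy(1)] subgroup_int_pow_closed[OF s xy(2)] subgroup.m_closed[OF s] by simp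
  qed
qed (rule generate_incl, use x y in simp)

text \<open>The isomorphism is the inverse of the map sending a pair of exponents to the
  corresponding product of powers. With \<open>n = 0\<close> divisibility means equality to zero and
  \<open>integer_mod_group 0\<close> is the group of integers, so one proof serves both kinds of
  product.\<close>

lemma product_iso:
  assumes x: "x \<in> carrier G" and y: "y \<in> carrier G" and c: "x \<otimes> y = y \<otimes> x"
    and all: "\<And>f. f \<in> carrier G ==> \<exists>a b. f = x [^] (a::int) \<otimes> y [^] (b::int)"
    and triv: "\<And>a b. x [^] (a::int) \<otimes> y [^] (b::int) = \<one> \<longleftrightarrow> a = 0 \<and> int n dvd b"
  shows "G \<cong> integer_group \<times>\<times> integer_mod_group n"
proof -
  have inj: "x [^] a \<otimes> y [^] b = x [^] a' \<otimes> y [^] b' \<longleftrightarrow> a = a' \<and> int n dvd (b - b')" for a a' b b' :: int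
  proof -
    have "x [^] a \<otimes> y [^] b = x [^] a' \<otimes> y [^] b' \<longleftrightarrow> (x [^] a \<otimes> y [^] b) \<otimes> (x [^] (- a') \<otimes> y [^] (- b')) = \<one>"
    proof -
      have e: "(x [^] a' \<otimes> y [^] b') \<otimes> (x [^] (- a') \<otimes> y [^] (- b')) = \<one>" unfolding commuting_mult[OF x y c] by simp
      show ?thesis
      proof
        assume "(x [^] a \<otimes> y [^] b) \<otimes> (x [^] (- a') \<otimes> y [^] (- b')) = \<one>"
        then have "(x [^] a \<otimes> y [^] b) \<otimes> (x [^] (- a') \<otimes> y [^] (- b')) = (x [^] a' \<otimes> y [^] b') \<otimes> (x [^] (- a') \<otimes> y [^] (- b'))"
          using e by simp
        then show "x [^] a \<otimes> y [^] b = x [^] a' \<otimes> y [^] b'" using x y by (subst (asm) right_cancel) simp_all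
      qed (use e in simp)
    qed
    then show ?thesis unfolding commuting_mult[OF x y c] triv by simp
  qed
  \<comment> \<open>Addition in \<open>integer_mod_group n\<close> reduces modulo \<open>n\<close>;
    the map respects products because powers of \<open>y\<close> depend only on the residue of the
    exponent.\<close>
  have ymod: "y [^] (b mod int n) = y [^] b" for b
    using inj[of 0 "b mod int n" 0 b] y by (simp add: mod_eq_dvd_iff[symmetric])
  have "(\<lambda>(a, b). x [^] a \<otimes> y [^] b) \<in> iso (integer_group \<times>\<times> integer_mod_group n) G"
  proof (rule isoI)
    show "(\<lambda>(a, b). x [^] a \<otimes> y [^] b) \<in> hom (integer_group \<times>\<times> integer_mod_group n) G"
      by (rule homI) (use x y in \<open>auto simp: commuting_mult[OF x y c] ymod\<close>)
    show "bij_betw (\<lambda>(a, b). x [^] a \<otimes> y [^] b) (carrier (integer_group \<times>\<times> integer_mod_group n)) (carrier G)"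
      unfolding bij_betw_def
    proof
      show "inj_on (\<lambda>(a, b). x [^] a \<otimes> y [^] b) (carrier (integer_group \<times>\<times> integer_mod_group n))"
      proof (rule inj_onI, clarify)
        fix a b a' b' assume m: "(a, b) \<in> carrier (integer_group \<times>\<times> integer_mod_group n)"
          "(a', b') \<in> carrier (integer_group \<times>\<times> integer_mod_group n)" and "x [^] a \<otimes> y [^] b = x [^] a' \<otimes> y [^] b'"
        then have ab: "a = a'" "int n dvd (b - b')" using inj by auto
        have "b = b'"
        proof (cases "n = 0")
          case False
          then have "b \<in> {0..<int n}" "b' \<in> {0..<int n}" using m by (simp_all add: carrier_integer_mod_group)
          moreover have "b mod int n = b' mod int n" using ab(2) by (simp add: mod_eq_dvd_iff)
          ultimately show ?thesis by simp
        qed (use ab in simp)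
        then show "a = a' \<and> b = b'" using ab by simp
      qed
      show "(\<lambda>(a, b). x [^] a \<otimes> y [^] b) ` carrier (integer_group \<times>\<times> integer_mod_group n) = carrier G"
      proof
        show "carrier G \<subseteq> (\<lambda>(a, b). x [^] a \<otimes> y [^] b) ` carrier (integer_group \<times>\<times> integer_mod_group n)"
        proof
          fix f assume "f \<in> carrier G"
          then obtain a b where "f = x [^] (a::int) \<otimes> y [^] (b::int)" using all by blast
          then have "f = (\<lambda>(a, b). x [^] a \<otimes> y [^] b) (a, b mod int n)" using ymod by simp
          moreover have "(a, b mod int n) \<in> carrier (integer_group \<times>\<times> integer_mod_group n)"
            by (simp add: carrier_integer_mod_group)
          ultimately show "f \<in> (\<lambda>(a, b). x [^] a \<otimes> y [^] b) ` carrier (integer_group \<times>\<times> integer_mod_group n)" by (rule image_eqI)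
        qed
      qed (use x y in auto)
    qed
  qed
  then have "integer_group \<times>\<times> integer_mod_group n \<cong> G" unfolding is_iso_def by blast
  then show ?thesis
    by (rule group.iso_sym[OF DirProd_group[OF group_integer_group group_integer_mod_group]])
qed

lemma cyclic_iso:
  assumes x: "x \<in> carrier G" and gen: "carrier G = generate G {x}"
    and triv: "\<And>a. x [^] (a::int) = \<one> \<longleftrightarrow> int n dvd a"
  shows "G \<cong> integer_mod_group n"
proof -
  have inj: "x [^] a = x [^] a' \<longleftrightarrow> int n dvd (a - a')" for a a' :: int
    using triv[of "a - a'"] x by (simp add: int_pow_diff inv_solve_right' flip: triv)
  have xmod: "x [^] (b mod int n) = x [^] b" for b
    using inj by (simp add: mod_eq_dvd_iff[symmetric])
  have "(\<lambda>a. x [^] a) \<in> iso (integer_mod_group n) G"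
  proof (rule isoI)
    show "(\<lambda>a. x [^] a) \<in> hom (integer_mod_group n) G"
      by (rule homI) (use x in \<open>auto simp: xmod int_pow_mult\<close>)
    show "bij_betw (\<lambda>a. x [^] a) (carrier (integer_mod_group n)) (carrier G)" unfolding bij_betw_def
    proof
      show "inj_on (\<lambda>a. x [^] a) (carrier (integer_mod_group n))"
      proof (rule inj_onI)
        fix b b' :: int assume m: "b \<in> carrier (integer_mod_group n)" "b' \<in> carrier (integer_mod_group n)" "x [^] b = x [^] b'"
        then have ab: "int n dvd (b - b')" using inj by auto
        show "b = b'"
        proof (cases "n = 0")
          case False
          then have "b \<in> {0..<int n}" "b' \<in> {0..<int n}" using m by (simp_all add: carrier_integer_mod_group)
          moreover have "b mod int n = b' mod int n" using ab by (simp add: mod_eq_dvd_iff)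
          ultimately show ?thesis by simp
        qed (use ab in simp)
      qed
      show "(\<lambda>a. x [^] a) ` carrier (integer_mod_group n) = carrier G"
      proof
        show "carrier G \<subseteq> (\<lambda>a. x [^] a) ` carrier (integer_mod_group n)"
        proof
          fix f assume "f \<in> carrier G"
          then obtain a :: int where "f = x [^] a" unfolding gen generate_pow[OF x] by blast
          then have "f = x [^] (a mod int n)" using xmod by simp
          moreover have "a mod int n \<in> carrier (integer_mod_group n)" by (simp add: carrier_integer_mod_group)
          ultimately show "f \<in> (\<lambda>a. x [^] a) ` carrier (integer_mod_group n)" by (rule image_eqI)
        qed
      qed (use x in auto)
    qed
  qed
  then have "integer_mod_group n \<cong> G" unfolding is_iso_def by blast
  then show ?thesis by (rule group.iso_sym[OF group_integer_mod_group])
qed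

end

section \<open>Words in two commuting letters and presentations\<close>

lemma word_eq_context: "word_eq R u v ==> word_eq R (x @ u @ y) (x @ v @ y)"
proof (induction rule: word_eq.induct)
  case (cancel u a b v)
  show ?case using word_eq.cancel[of R "x @ u" a b "v @ y"] by simp
next
  case (relator r u v)
  then show ?case using word_eq.relator[of r R "x @ u" "v @ y"] by simp
qed (auto intro: word_eq.intros)

lemma word_eq_append: "word_eq R u u' ==> word_eq R v v' ==> word_eq R (u @ v) (u' @ v')"
  using word_eq_context[of R u u' "[]" v] word_eq_context[of R v v' u' "[]"] word_eq.trans by fastforce

text \<open>Append a cancelling pair \<open>(x, s)\<close>, \<open>(x, \<not> s)\<close> on the
  right, exchange the inner two letters by the hypothesis, and cancel the pair that has formed on
  the left.\<close>

lemma word_eq_commute_flip: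
  assumes "word_eq R [(x, s), (y, t)] [(y, t), (x, s)]"
  shows "word_eq R [(x, \<not> s), (y, t)] [(y, t), (x, \<not> s)]"
proof -
  have 1: "word_eq R ([(x, \<not> s), (y, t)] @ [(x, s), (x, \<not> s)] @ []) ([(x, \<not> s), (y, t)] @ [])" by (rule word_eq.cancel)
  have 2: "word_eq R ([] @ [(x, \<not> s), (x, \<not> \<not> s)] @ [(y, t), (x, \<not> s)]) ([] @ [(y, t), (x, \<not> s)])" by (rule word_eq.cancel)
  have 3: "word_eq R ([(x, \<not> s)] @ [(x, s), (y, t)] @ [(x, \<not> s)]) ([(x, \<not> s)] @ [(y, t), (x, s)] @ [(x, \<not> s)])"
    by (rule word_eq_context[OF assms])
  have 3: "word_eq R [(x, \<not> s), (y, t), (x, s), (x, \<not> s)] [(x, \<not> s), (x, s), (y, t), (x, \<not> s)]" using word_eq.sym[OF 3] by simp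
  have "word_eq R [(x, \<not> s), (y, t)] [(x, \<not> s), (y, t), (x, s), (x, \<not> s)]" using word_eq.sym[OF 1] by simp
  from word_eq.trans[OF word_eq.trans[OF this 3]] 2 show ?thesis by simp
qed

definition power_of :: "'x \<Rightarrow> int \<Rightarrow> 'x word" where
  "power_of x k = (if 0 \<le> k then replicate (nat k) (x, True) else replicate (nat (- k)) (x, False))"

lemma power_of_step: "word_eq R ((x, s) # power_of x k) (power_of x (if s then k + 1 else k - 1))"
proof -
  have p: "power_of x (int m) = replicate m (x, True)" "power_of x (- int m) = replicate m (x, False)" for m
    by (simp_all add: power_of_def)
  show ?thesis
  proof (cases s)
    case True
    show ?thesis
    proof (cases "k \<ge> 0")
      case k: True
      define m where "m = nat k"
      have m: "k = int m" "k + 1 = int (Suc m)" using k unfolding m_def by simp_all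
      have "(x, s) # power_of x k = power_of x (k + 1)" unfolding m(2) p(1) unfolding m(1) p(1) using True by simp
      then show ?thesis using True word_eq.refl[of R] by simp
    next
      case k: False
      define m where "m = nat (- k - 1)"
      have m: "k = - int (Suc m)" "k + 1 = - int m" using k unfolding m_def by simp_all
      have "power_of x k = (x, False) # power_of x (k + 1)" unfolding m(2) p(2) unfolding m(1) p(2) by simp
      then show ?thesis using word_eq.cancel[of R "[]" x True "power_of x (k + 1)"] True by simp
    qed
  next
    case False
    show ?thesis
    proof (cases "k \<le> 0")
      case k: True
      define m where "m = nat (- k)"
      have m: "k = - int m" "k - 1 = - int (Suc m)" using k unfolding m_def by simp_all
      have "(x, s) # power_of x k = power_of x (k - 1)" unfolding m(2) p(2) unfolding m(1) p(2) using False by simp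
      then show ?thesis using False word_eq.refl[of R] by simp
    next
      case k: False
      define m where "m = nat (k - 1)"
      have m: "k = int (Suc m)" "k - 1 = int m" using k unfolding m_def by simp_all
      have "power_of x k = (x, True) # power_of x (k - 1)" unfolding m(2) p(1) unfolding m(1) p(1) by simp
      then show ?thesis using word_eq.cancel[of R "[]" x False "power_of x (k - 1)"] False by simp
    qed
  qed
qed

lemma word_eq_past_power:
  assumes c: "\<And>s t. word_eq R [(y, t), (x, s)] [(x, s), (y, t)]"
  shows "word_eq R ((y, t) # power_of x k) (power_of x k @ [(y, t)])"
proof -
  have "word_eq R ((y, t) # replicate m (x, s)) (replicate m (x, s) @ [(y, t)])" for m s
  proof (induction m)
    case (Suc m)
    have "word_eq R ([(y, t), (x, s)] @ replicate m (x, s)) ([(x, s), (y, t)] @ replicate m (x, s))"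
      by (rule word_eq_append[OF c word_eq.refl])
    moreover have "word_eq R ([(x, s)] @ ((y, t) # replicate m (x, s))) ([(x, s)] @ (replicate m (x, s) @ [(y, t)]))"
      by (rule word_eq_append[OF word_eq.refl Suc])
    ultimately show ?case by (simp add: word_eq.trans)
  qed (simp add: word_eq.refl)
  then show ?thesis unfolding power_of_def by simp
qed

text \<open>Positive multiples of \<open>n\<close> are removed by the relator. For a negative
  exponent the positive word, already known to be trivial, is appended, and the result cancels
  freely. With \<open>n = 0\<close> only the empty word remains.\<close>

lemma word_eq_power_trivial:
  assumes r: "n = 0 \<or> replicate n (x, True) \<in> R" and k: "int n dvd k"
  shows "word_eq R (power_of x k) []"
proof -
  obtain m :: int where m: "k = int n * m" using k by auto
  have pos: "word_eq R (replicate (n * j) (x, True)) []" for j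
  proof (induction j)
    case (Suc j)
    have "word_eq R (replicate n (x, True)) []"
      using r word_eq.relator[of "replicate n (x, True)" R "[]" "[]"] by (auto simp: word_eq.refl)
    from word_eq_append[OF this Suc] show ?case by (simp add: replicate_add)
  qed (simp add: word_eq.refl)
  have canc: "word_eq R (replicate j (x, False) @ replicate j (x, True)) []" for j
  proof (induction j)
    case (Suc j)
    have "replicate (Suc j) (x, False) @ replicate (Suc j) (x, True) = replicate j (x, False) @ [(x, False), (x, \<not> False)] @ replicate j (x, True)"
      by (simp add: replicate_append_same[symmetric])
    moreover have "word_eq R (replicate j (x, False) @ [(x, False), (x, \<not> False)] @ replicate j (x, True)) (replicate j (x, False) @ replicate j (x, True))"
      by (rule word_eq.cancel)
    ultimately show ?case using Suc word_eq.trans by metis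
  qed (simp add: word_eq.refl)
  show ?thesis
  proof (cases "0 \<le> m")
    case True
    then have "power_of x k = replicate (n * nat m) (x, True)" unfolding m power_of_def by (simp add: nat_mult_distrib)
    then show ?thesis using pos by simp
  next
    case False
    let ?j = "n * nat (- m)"
    have "power_of x k = replicate ?j (x, False)"
    proof (cases "n = 0")
      case False
      have "\<not> 0 \<le> int n * m" using False \<open>\<not> 0 \<le> m\<close> by (simp add: zero_le_mult_iff)
      moreover have "nat (- (int n * m)) = ?j" using nat_mult_distrib[of "int n" "- m"] by simp
      ultimately show ?thesis unfolding m power_of_def by simp
    qed (simp add: m power_of_def)
    moreover have "word_eq R (replicate ?j (x, False) @ []) (replicate ?j (x, False) @ replicate ?j (x, True))"
      by (rule word_eq_append[OF word_eq.refl word_eq.sym[OF pos]])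
    ultimately show ?thesis using word_eq.trans[OF _ canc] by simp
  qed
qed

text \<open>The commutator relator lets the two positive letters commute,
  \<open>word_eq_commute_flip\<close> extends this to all signs, and induction on the word then
  moves each new letter into its block.\<close>

lemma word_eq_normal_form:
  fixes w :: "two_letters word"
  assumes "commutator_word \<in> R"
  shows "\<exists>a b. word_eq R w (power_of LetterA a @ power_of LetterB b)"
proof -
  let ?A = "(LetterA, True)" and ?B = "(LetterB, True)"
  \<comment> \<open>The word \<open>A B A^-1 B^-1 B A\<close> equals \<open>B A\<close> by the
    relator and \<open>A B\<close> by free cancellation.\<close>
  have "word_eq R ([] @ commutator_word @ [?B, ?A]) ([] @ [?B, ?A])" by (rule word_eq.relator[OF assms])
  moreover have "word_eq R ([?A, ?B, (LetterA, False)] @ [(LetterB, False), (LetterB, \<not> False)] @ [?A]) ([?A, ?B, (LetterA, False)] @ [?A])"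
    by (rule word_eq.cancel)
  moreover have "word_eq R ([?A, ?B] @ [(LetterA, False), (LetterA, \<not> False)] @ []) ([?A, ?B] @ [])" by (rule word_eq.cancel)
  ultimately have "word_eq R [?A, ?B, (LetterA, False), (LetterB, False), ?B, ?A] [?B, ?A]"
    "word_eq R [?A, ?B, (LetterA, False), (LetterB, False), ?B, ?A] [?A, ?B, (LetterA, False), ?A]"
    "word_eq R [?A, ?B, (LetterA, False), ?A] [?A, ?B]" by (simp_all add: commutator_word_def)
  then have 1: "word_eq R [?B, ?A] [?A, ?B]" by (meson word_eq.sym word_eq.trans)
  have 2: "word_eq R [(LetterB, s), ?A] [?A, (LetterB, s)]" for s using 1 word_eq_commute_flip[OF 1] by (cases s) simp_all
  have 3: "word_eq R [(LetterB, s), (LetterA, t)] [(LetterA, t), (LetterB, s)]" for s t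
    using 2[of s] word_eq.sym[OF word_eq_commute_flip[OF word_eq.sym[OF 2[of s]]]] by (cases t) simp_all
  show ?thesis
  proof (induction w)
    case Nil
    show ?case by (intro exI[of _ 0]) (simp add: power_of_def word_eq.refl)
  next
    case (Cons l w)
    obtain a b where ab: "word_eq R w (power_of LetterA a @ power_of LetterB b)" using Cons by auto
    obtain x s where l: "l = (x, s)" by fastforce
    have lw: "word_eq R (l # w) (l # power_of LetterA a @ power_of LetterB b)"
      using word_eq_append[OF word_eq.refl[of R "[l]"] ab] by simp
    show ?case
    proof (cases x)
      case LetterA
      have "word_eq R ((l # power_of LetterA a) @ power_of LetterB b) (power_of LetterA (if s then a + 1 else a - 1) @ power_of LetterB b)"
        unfolding l LetterA by (rule word_eq_append[OF power_of_step word_eq.refl])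
      then have "word_eq R (l # power_of LetterA a @ power_of LetterB b) (power_of LetterA (if s then a + 1 else a - 1) @ power_of LetterB b)" by simp
      from word_eq.trans[OF lw this] show ?thesis by (intro exI)
    next
      case LetterB
      have "word_eq R ((l # power_of LetterA a) @ power_of LetterB b) ((power_of LetterA a @ [l]) @ power_of LetterB b)"
        unfolding l LetterB by (rule word_eq_append[OF word_eq_past_power[OF 3] word_eq.refl])
      then have m1: "word_eq R (l # power_of LetterA a @ power_of LetterB b) (power_of LetterA a @ (l # power_of LetterB b))" by simp
      have m2: "word_eq R (power_of LetterA a @ (l # power_of LetterB b)) (power_of LetterA a @ power_of LetterB (if s then b + 1 else b - 1))"
        unfolding l LetterB by (rule word_eq_append[OF word_eq.refl power_of_step])
      from word_eq.trans[OF word_eq.trans[OF lw m1] m2] show ?thesis by (intro exI)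
    qed
  qed
qed

context group
begin

lemma word_val_closed: "range f \<subseteq> carrier G ==> word_val G f w \<in> carrier G"
  by (induction w) auto

lemma word_val_append: "range f \<subseteq> carrier G ==> word_val G f (u @ v) = word_val G f u \<otimes> word_val G f v"
  by (induction u) (auto simp: m_assoc word_val_closed range_subsetD)

lemma word_val_eq:
  assumes f: "range f \<subseteq> carrier G" and R: "\<And>r. r \<in> R ==> word_val G f r = \<one>"
  shows "word_eq R u v ==> word_val G f u = word_val G f v"
proof (induction rule: word_eq.induct)
  case (cancel u x b v)
  have "f x \<in> carrier G" using f by auto
  then have "word_val G f [(x, b), (x, \<not> b)] = \<one>" by (cases b) simp_all
  then show ?case using f by (simp only: word_val_append[OF f]) (simp add: word_val_closed)
next
  case (relator r u v)
  then show ?case using f R[of r] by (simp only: word_val_append[OF f]) (simp add: word_val_closed)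
qed auto

lemma word_val_power_of:
  assumes "range f \<subseteq> carrier G" shows "word_val G f (power_of x k) = f x [^] k"
proof -
  have x: "f x \<in> carrier G" using assms by auto
  have "word_val G f (replicate m (x, True)) = f x [^] int m" "word_val G f (replicate m (x, False)) = f x [^] (- int m)" for m
  proof (induction m)
    case (Suc m)
    { case 1 show ?case using Suc(1) int_pow_mult[OF x, of 1 "int m"] x by simp }
    { case 2 show ?case using Suc(2) int_pow_mult[OF x, of "- 1" "- int m"] x by (simp add: int_pow_neg algebra_simps) }
  qed simp_all
  from this[of "nat k"] this[of "nat (- k)"] show ?thesis unfolding power_of_def by simp
qed

text \<open>Completeness comes from the normal form: a word of value one has exponents
  \<open>a = 0\<close> and \<open>b\<close> divisible by \<open>n\<close>, so its normal form is
  removed by the power relator. The conditions on \<open>R\<close> admit the presentation with this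
  relator as well as, for \<open>n = 0\<close>, the one without it.\<close>

lemma presents_product:
  assumes x: "x \<in> carrier G" and y: "y \<in> carrier G" and c: "x \<otimes> y = y \<otimes> x"
    and all: "\<And>f. f \<in> carrier G ==> \<exists>a b. f = x [^] (a::int) \<otimes> y [^] (b::int)"
    and triv: "\<And>a b. x [^] (a::int) \<otimes> y [^] (b::int) = \<one> \<longleftrightarrow> a = 0 \<and> int n dvd b"
    and R: "commutator_word \<in> R" "R \<subseteq> {commutator_word, power_word n}" "n = 0 \<or> power_word n \<in> R"
  shows "presents G (two_gens x y) R"
  unfolding presents_def
proof (intro conjI allI)
  have UN: "range (two_gens x y) = {x, y}"
  proof
    show "range (two_gens x y) \<subseteq> {x, y}"
    proof (rule image_subsetI)
      fix l show "two_gens x y l \<in> {x, y}" by (cases l) simp_all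
    qed
    show "{x, y} \<subseteq> range (two_gens x y)" using rangeI[of "two_gens x y" LetterA] rangeI[of "two_gens x y" LetterB] by simp
  qed
  show rg: "range (two_gens x y) \<subseteq> carrier G" unfolding UN using x y by simp
  show "carrier G = generate G (range (two_gens x y))" unfolding UN by (rule two_generators[OF x y all])
  have "word_val G (two_gens x y) commutator_word = \<one>"
  proof -
    have "word_val G (two_gens x y) commutator_word = (x \<otimes> y) \<otimes> inv (y \<otimes> x)"
      using x y by (simp add: commutator_word_def inv_mult_group m_assoc)
    then show ?thesis using x y c by simp
  qed
  moreover have "word_val G (two_gens x y) (power_word n) = \<one>"
    using word_val_power_of[OF rg, of LetterB "int n"] triv[of 0 "int n"] y by (simp add: power_of_def power_word_def)
  ultimately have Rv: "word_val G (two_gens x y) r = \<one>" if "r \<in> R" for r using R(2) that by auto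
  fix w
  show "word_val G (two_gens x y) w = \<one> \<longleftrightarrow> word_eq R w []"
  proof
    assume "word_eq R w []"
    then show "word_val G (two_gens x y) w = \<one>" using word_val_eq[OF rg Rv] by simp
  next
    assume v: "word_val G (two_gens x y) w = \<one>"
    obtain a b where ab: "word_eq R w (power_of LetterA a @ power_of LetterB b)" using word_eq_normal_form[OF R(1)] by blast
    have "x [^] a \<otimes> y [^] b = \<one>"
      using word_val_eq[OF rg Rv ab] v by (simp add: word_val_append[OF rg] word_val_power_of[OF rg])
    then have "a = 0" "int n dvd b" using triv by simp_all
    moreover have "word_eq R (power_of LetterB b) []"
      by (rule word_eq_power_trivial[OF _ \<open>int n dvd b\<close>]) (use R(3) in \<open>simp add: power_word_def\<close>)
    ultimately show "word_eq R w []" using word_eq.trans[OF ab] by (simp add: power_of_def)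
  qed
qed

end

section \<open>Extensions of a cyclic group of shifts by a central cyclic group\<close>

context group
begin

text \<open>\<open>R f r\<close> is to be read as: \<open>f\<close> shifts the vertices of the gap
  by \<open>r\<close>, a number determined modulo \<open>n\<close> only; \<open>s\<close> is a
  translation number on the kernel of the shift. The kernel embeds into the integers, so it is
  generated by some \<open>y\<close>, and the attained shifts are the multiples of some
  \<open>d\<close>, the shift of \<open>x\<close>. Conjugation by \<open>x\<close> sends
  \<open>y\<close> to itself or to its inverse, and \<open>noinv\<close> excludes the
  latter.\<close>

lemma translation_extension:
  fixes R :: "'a \<Rightarrow> int \<Rightarrow> bool" and s :: "'a \<Rightarrow> int"
  assumes ex: "\<And>f. f \<in> carrier G ==> \<exists>r. R f r"
    and uniq: "\<And>f r t. f \<in> carrier G ==> R f r ==> R f t \<longleftrightarrow> n dvd (t - r)"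
    and mult: "\<And>f g r t. f \<in> carrier G ==> g \<in> carrier G ==> R f r ==> R g t ==> R (f \<otimes> g) (r + t)"
    and one: "R \<one> 0"
    and add: "\<And>f g. f \<in> carrier G ==> g \<in> carrier G ==> R f 0 ==> R g 0 ==> s (f \<otimes> g) = s f + s g"
    and inj: "\<And>f. f \<in> carrier G ==> R f 0 ==> s f = 0 ==> f = \<one>"
    and noinv: "\<And>f h. f \<in> carrier G ==> h \<in> carrier G ==> R h 0 ==> f \<otimes> h \<otimes> inv f = inv h ==> h = \<one>"
  obtains x y and d :: int where "x \<in> carrier G" "y \<in> carrier G" "x \<otimes> y = y \<otimes> x" "0 \<le> d" "R x d" "R y 0"
    "\<And>f. f \<in> carrier G ==> \<exists>a b. f = x [^] (a::int) \<otimes> y [^] (b::int)"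
    "\<And>b::int. y [^] b = \<one> ==> y \<noteq> \<one> ==> b = 0"
    "\<And>f r. f \<in> carrier G ==> R f r ==> d dvd r"
    "\<And>h. h \<in> carrier G ==> R h 0 ==> \<exists>b::int. h = y [^] b"
    "\<And>a::int. R (x [^] a) (a * d)"
proof -
  have Rinv: "R (inv f) (- r)" if f: "f \<in> carrier G" "R f r" for f r
  proof -
    obtain t where t: "R (inv f) t" using ex[of "inv f"] f by auto
    have "R \<one> (r + t)" using mult[OF f(1) _ f(2) t] f(1) by simp
    then have "n dvd (r + t)" using uniq[OF _ one, of "r + t"] by simp
    then have "n dvd (- r - t)" by (metis dvd_minus_iff minus_add_distrib diff_conv_add_uminus)
    then show ?thesis using uniq[OF _ t, of "- r"] f(1) by simp
  qed
  have Rpow: "R (f [^] k) (k * r)" if f: "f \<in> carrier G" "R f r" for f r and k :: int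
  proof -
    have nat: "R (f [^] int m) (int m * r)" if f: "f \<in> carrier G" "R f r" for f r m
    proof (induction m)
      case (Suc m)
      have "f [^] int (Suc m) = f \<otimes> f [^] int m" using int_pow_mult[OF f(1), of 1 "int m"] f(1) by simp
      then show ?case using mult[OF f(1) _ f(2) Suc] f(1) by (simp add: algebra_simps)
    qed (simp add: one)
    show ?thesis
    proof (cases "0 \<le> k")
      case True then show ?thesis using nat[OF f, of "nat k"] by simp
    next
      case False
      then show ?thesis using Rinv[OF _ nat[OF f, of "nat (- k)"]] f(1) by (simp add: int_pow_neg)
    qed
  qed
  have sinv: "s (inv h) = - s h" if h: "h \<in> carrier G" "R h 0" for h
    using add[OF h(1) _ h(2), of "inv h"] Rinv[OF h] add[OF one_closed one_closed one one] h(1) by simp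
  have spow: "s (h [^] k) = k * s h" if h: "h \<in> carrier G" "R h 0" for h and k :: int
  proof -
    have nat: "s (h [^] int m) = int m * s h" for m
    proof (induction m)
      case 0 show ?case using add[OF one_closed one_closed one one] by simp
    next
      case (Suc m)
      have "h [^] int (Suc m) = h \<otimes> h [^] int m" using int_pow_mult[OF h(1), of 1 "int m"] h(1) by simp
      then show ?case using add[OF h(1) _ h(2), of "h [^] int m"] Rpow[OF h, of "int m"] h(1) Suc by (simp add: algebra_simps)
    qed
    show ?thesis
    proof (cases "0 \<le> k")
      case True then show ?thesis using nat[of "nat k"] by simp
    next
      case False
      then show ?thesis using sinv[of "h [^] int (nat (- k))"] nat[of "nat (- k)"] Rpow[OF h, of "int (nat (- k))"] h(1)
        by (simp add: int_pow_neg)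
    qed
  qed
  \<comment> \<open>The values of \<open>s\<close> on the kernel are the multiples of
    \<open>c\<close>. A preimage \<open>y\<close> of \<open>c\<close> generates the kernel because
    \<open>s\<close> is injective there.\<close>
  obtain c where c: "0 \<le> c" "\<And>z. z \<in> s ` {h \<in> carrier G. R h 0} \<longleftrightarrow> c dvd z"
  proof -
    have "\<exists>c\<ge>0. \<forall>z. z \<in> s ` {h \<in> carrier G. R h 0} \<longleftrightarrow> c dvd z"
    proof (rule int_subgroup_dvd)
      show "0 \<in> s ` {h \<in> carrier G. R h 0}" using add[OF one_closed one_closed one one] one
        by (intro image_eqI[of _ _ \<one>]) simp_all
      fix z w assume "z \<in> s ` {h \<in> carrier G. R h 0}" "w \<in> s ` {h \<in> carrier G. R h 0}"
      then obtain h k where "z = s h" "w = s k" "h \<in> carrier G" "k \<in> carrier G" "R h 0" "R k 0" by auto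
      then show "z + w \<in> s ` {h \<in> carrier G. R h 0}" using add[of h k] mult[of h k 0 0]
        by (intro image_eqI[of _ _ "h \<otimes> k"]) simp_all
    next
      fix z assume "z \<in> s ` {h \<in> carrier G. R h 0}"
      then obtain h where "z = s h" "h \<in> carrier G" "R h 0" by auto
      then show "- z \<in> s ` {h \<in> carrier G. R h 0}" using sinv[of h] Rinv[of h 0] by (intro image_eqI[of _ _ "inv h"]) simp_all
    qed
    then show thesis using that by blast
  qed
  have "c \<in> s ` {h \<in> carrier G. R h 0}" using c(2)[of c] by simp
  then obtain y where y: "y \<in> carrier G" "R y 0" "s y = c" by auto
  have Ny: "\<exists>b::int. h = y [^] b" if h: "h \<in> carrier G" "R h 0" for h
  proof -
    have "c dvd s h" using c(2)[of "s h"] h by auto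
    then obtain b where b: "s h = c * b" by auto
    have R: "R (y [^] (- b)) 0" using Rpow[OF y(1,2), of "- b"] by simp
    have "s (h \<otimes> y [^] (- b)) = 0" using add[OF h(1) _ h(2) R] spow[OF y(1,2), of "- b"] y b by simp
    moreover have "R (h \<otimes> y [^] (- b)) 0" using mult[OF h(1) _ h(2) R] y(1) by simp
    ultimately have "h \<otimes> y [^] (- b) = \<one>" using inj[of "h \<otimes> y [^] (- b)"] h(1) y(1) by simp
    then have "h = y [^] b" using h(1) y(1) by (simp add: int_pow_neg inv_solve_right')
    then show ?thesis by blast
  qed
  have ytriv: "b = 0" if "y [^] b = \<one>" "y \<noteq> \<one>" for b :: int
  proof -
    have "b * c = 0" using spow[OF y(1,2), of b] y(3) that(1) spow[OF y(1,2), of 0] by simp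
    moreover have "c \<noteq> 0" using inj[OF y(1,2)] y(3) that(2) by auto
    ultimately show ?thesis by simp
  qed
  obtain d where d: "0 \<le> d" "\<And>r. r \<in> {r. \<exists>f\<in>carrier G. R f r} \<longleftrightarrow> d dvd r"
  proof -
    have "\<exists>d\<ge>0. \<forall>r. r \<in> {r. \<exists>f\<in>carrier G. R f r} \<longleftrightarrow> d dvd r"
    proof (rule int_subgroup_dvd)
      show "0 \<in> {r. \<exists>f\<in>carrier G. R f r}" using one by auto
      show "r + t \<in> {r. \<exists>f\<in>carrier G. R f r}" if r: "r \<in> {r. \<exists>f\<in>carrier G. R f r}" and t: "t \<in> {r. \<exists>f\<in>carrier G. R f r}" for r t
      proof -
        obtain f g where fg: "f \<in> carrier G" "R f r" "g \<in> carrier G" "R g t" using r t by auto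
        show ?thesis using mult[OF fg(1,3,2,4)] m_closed[OF fg(1,3)] by blast
      qed
      show "- r \<in> {r. \<exists>f\<in>carrier G. R f r}" if r: "r \<in> {r. \<exists>f\<in>carrier G. R f r}" for r
      proof -
        obtain f where f: "f \<in> carrier G" "R f r" using r by auto
        show ?thesis using Rinv[OF f] inv_closed[OF f(1)] by blast
      qed
    qed
    then show thesis using that by blast
  qed
  have "d \<in> {r. \<exists>f\<in>carrier G. R f r}" unfolding d(2) by simp
  then obtain x where x: "x \<in> carrier G" "R x d" by blast
  have dd: "d dvd r" if "f \<in> carrier G" "R f r" for f r using d(2)[of r] that by auto
  have all: "\<exists>a b. f = x [^] (a::int) \<otimes> y [^] (b::int)" if f: "f \<in> carrier G" for f
  proof -
    obtain r where r: "R f r" using ex[OF f] by auto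
    obtain a where a: "r = d * a" using dd[OF f r] by auto
    have "R (x [^] (- a) \<otimes> f) ((- a) * d + r)" by (rule mult[OF _ f Rpow[OF x] r]) (use x(1) in simp)
    then have "R (x [^] (- a) \<otimes> f) 0" using a by simp
    then obtain b :: int where "x [^] (- a) \<otimes> f = y [^] b" using Ny[of "x [^] (- a) \<otimes> f"] f x(1) by auto
    then have "f = x [^] a \<otimes> y [^] b" using f x(1) y(1) by (simp add: int_pow_neg inv_solve_left')
    then show ?thesis by blast
  qed
  have conj: "\<exists>k::int. f \<otimes> y \<otimes> inv f = y [^] k" if f: "f \<in> carrier G" for f
  proof -
    obtain r where r: "R f r" using ex[OF f] by auto
    have "R (f \<otimes> y \<otimes> inv f) (r + 0 + - r)"
      by (rule mult[OF _ _ mult[OF f y(1) r y(2)] Rinv[OF f r]]) (use f y(1) in simp_all)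
    then show ?thesis using Ny[of "f \<otimes> y \<otimes> inv f"] f y(1) by simp
  qed
  \<comment> \<open>Conjugating by \<open>x\<close> and then back turns \<open>y\<close> into the
    power with exponent \<open>k * l\<close>. As a non-trivial \<open>y\<close> has infinite order,
    \<open>k * l = 1\<close>.\<close>
  obtain k where k: "x \<otimes> y \<otimes> inv x = y [^] (k::int)" using conj[OF x(1)] by auto
  obtain l where l: "inv x \<otimes> y \<otimes> inv (inv x) = y [^] (l::int)" using conj[of "inv x"] x(1) by auto
  have comm: "x \<otimes> y = y \<otimes> x"
  proof (cases "y = \<one>")
    case True then show ?thesis using x(1) by simp
  next
    case False
    have hom: "(\<lambda>z. x \<otimes> z \<otimes> inv x) \<in> hom G G"
      by (rule homI) (use x(1) in \<open>simp_all add: m_assoc inv_solve_left\<close>)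
    have "x \<otimes> (y [^] l) \<otimes> inv x = y" unfolding l[symmetric] using x(1) y(1) by (simp add: m_assoc) (simp flip: m_assoc)
    moreover have "x \<otimes> (y [^] l) \<otimes> inv x = (x \<otimes> y \<otimes> inv x) [^] l"
      using hom_int_pow[OF hom y(1) is_group is_group, of l] by simp
    ultimately have "y [^] (k * l) = y" unfolding k using y(1) by (simp add: int_pow_pow)
    then have "y [^] (k * l - 1) = \<one>" using y(1) by (simp add: int_pow_diff)
    then have "k * l = 1" using ytriv[of "k * l - 1"] False by simp
    then have "k = 1 \<or> k = - 1" by (simp add: zmult_eq_1_iff) auto
    moreover have "k \<noteq> - 1" using noinv[OF x(1) y(1,2)] k False y(1) by (auto simp: int_pow_neg)
    ultimately have "x \<otimes> y \<otimes> inv x = y" using k y(1) by simp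
    then show ?thesis using x(1) y(1) by (simp add: inv_solve_right')
  qed
  show thesis by (rule that[OF x(1) y(1) comm d(1) x(2) y(2) all ytriv dd Ny Rpow[OF x]])
qed

text \<open>The group is the quotient of the lattice of exponent pairs by the multiples of
  \<open>(m, -k)\<close>. With \<open>d = gcd m k\<close>, \<open>m = d m'\<close>,
  \<open>k = d k'\<close> and the Bezout relation \<open>p m' + q k' = 1\<close>, the vectors
  \<open>(q, p)\<close> and \<open>(m', -k')\<close> have determinant -1 and form a basis. The
  relation is \<open>d\<close> times the second vector, which therefore gives the torsion generator
  \<open>e\<close>.\<close>

lemma rotation_basis:
  assumes x: "x \<in> carrier G" and y: "y \<in> carrier G" and c: "x \<otimes> y = y \<otimes> x"
    and all: "\<And>f. f \<in> carrier G ==> \<exists>a b. f = x [^] (a::int) \<otimes> y [^] (b::int)"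
    and y0: "\<And>b::int. y [^] b = \<one> ==> b = 0"
    and m: "0 < (m::int)" "x [^] m = y [^] (k::int)" "\<And>a b::int. x [^] a = y [^] b ==> m dvd a"
  obtains g e and d :: nat where "0 < d" "g \<in> carrier G" "e \<in> carrier G" "g \<otimes> e = e \<otimes> g"
    "\<And>f. f \<in> carrier G ==> \<exists>a b. f = g [^] (a::int) \<otimes> e [^] (b::int)"
    "\<And>a b. g [^] (a::int) \<otimes> e [^] (b::int) = \<one> \<longleftrightarrow> a = 0 \<and> int d dvd b"
proof -
  define d where "d = gcd m k"
  have d: "0 < d" unfolding d_def using m(1) by simp
  have dvd: "d dvd m" "d dvd k" unfolding d_def by simp_all
  obtain m' where m': "m = d * m'" using dvd(1) by (elim dvdE)
  obtain k' where k': "k = d * k'" using dvd(2) by (elim dvdE)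
  obtain p q where "p * m + q * k = d" unfolding d_def using bezout_int by blast
  then have "d * (p * m' + q * k') = d * 1" unfolding m' k' by (simp add: algebra_simps)
  then have bez: "p * m' + q * k' = 1" using d by simp
  define P where "P a b = x [^] (a::int) \<otimes> y [^] (b::int)" for a b
  have Pc: "P a b \<in> carrier G" for a b unfolding P_def using x y by simp
  have Pm: "P a b \<otimes> P a' b' = P (a + a') (b + b')" for a b a' b' unfolding P_def by (rule commuting_mult[OF x y c])
  have Pp: "P a b [^] z = P (a * z) (b * z)" for a b and z :: int unfolding P_def by (rule commuting_int_pow[OF x y c])
  have P1: "P a b = \<one> \<longleftrightarrow> (\<exists>t. a = m * t \<and> b = - (k * t))" for a b
  proof
    assume ab: "P a b = \<one>"
    then have xa: "x [^] a = y [^] (- b)" unfolding P_def using x y by (simp add: int_pow_neg inv_equality inv_solve_right')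
    then obtain t where t: "a = m * t" using m(3) by (metis dvdE)
    have "x [^] a = y [^] (k * t)" using int_pow_pow[OF x, of m t] int_pow_pow[OF y, of k t] m(2) t by simp
    then have "y [^] (k * t + b) = \<one>" using xa y ab unfolding P_def by (simp add: int_pow_mult)
    then have "b = - (k * t)" using y0[of "k * t + b"] by simp
    then show "\<exists>t. a = m * t \<and> b = - (k * t)" using t by auto
  next
    assume "\<exists>t. a = m * t \<and> b = - (k * t)"
    then obtain t where t: "a = m * t" "b = - (k * t)" by auto
    have "x [^] a = y [^] (k * t)" using int_pow_pow[OF x, of m t] int_pow_pow[OF y, of k t] m(2) t by simp
    then show "P a b = \<one>" unfolding P_def t using y t by (simp add: int_pow_neg)
  qed
  define e where "e = P m' (- k')"
  define g where "g = P q p"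
  have ge: "g [^] a \<otimes> e [^] b = P (q * a + m' * b) (p * a - k' * b)" for a b :: int
    unfolding g_def e_def Pp Pm by simp
  have "\<exists>a b. f = g [^] (a::int) \<otimes> e [^] (b::int)" if f: "f \<in> carrier G" for f
  proof -
    obtain A B where AB: "f = P A B" using all[OF f] unfolding P_def by blast
    \<comment> \<open>The coefficients come from inverting the base change matrix, whose determinant
      is a unit by \<open>bez\<close>.\<close>
    have "q * (k' * A + m' * B) + m' * (p * A - q * B) = (p * m' + q * k') * A"
      "p * (k' * A + m' * B) - k' * (p * A - q * B) = (p * m' + q * k') * B" by (simp_all add: algebra_simps)
    then have "f = g [^] (k' * A + m' * B) \<otimes> e [^] (p * A - q * B)" unfolding ge AB bez by simp
    then show ?thesis by blast
  qed
  moreover have "g [^] a \<otimes> e [^] b = \<one> \<longleftrightarrow> a = 0 \<and> int (nat d) dvd b" for a b :: int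
  proof -
    have "g [^] a \<otimes> e [^] b = \<one> \<longleftrightarrow> (\<exists>t. q * a + m' * b = m * t \<and> p * a - k' * b = - (k * t))" unfolding ge P1 ..
    also have "\<dots> \<longleftrightarrow> a = 0 \<and> d dvd b"
    proof
      assume "\<exists>t. q * a + m' * b = m * t \<and> p * a - k' * b = - (k * t)"
      then obtain t where t: "q * a + m' * b = d * m' * t" "p * a - k' * b = - (d * k' * t)" unfolding m' k' by auto
      have "(p * m' + q * k') * a = k' * (q * a + m' * b) + m' * (p * a - k' * b)" by (simp add: algebra_simps)
      also have "\<dots> = 0" unfolding t by (simp add: algebra_simps)
      finally have a: "a = 0" unfolding bez by simp
      have "m' \<noteq> 0" using m(1) m' by auto
      then have "b = d * t" using t(1) a by simp
      then show "a = 0 \<and> d dvd b" using a by simp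
    next
      assume "a = 0 \<and> d dvd b"
      then show "\<exists>t. q * a + m' * b = m * t \<and> p * a - k' * b = - (k * t)" unfolding m' k' by auto
    qed
    finally show ?thesis using d by simp
  qed
  moreover have "g \<otimes> e = e \<otimes> g" unfolding g_def e_def Pm by (simp add: add.commute)
  ultimately show thesis using that[of "nat d" g e] d Pc unfolding g_def[symmetric] e_def[symmetric]
    using Pc[of q p] Pc[of m' "- k'"] unfolding g_def e_def by simp
qed

end

section \<open>The circle as a cyclically ordered set\<close>

text \<open>A copy of the circle that carries the linear order of angles; the cyclic order is then a
  disjunction of three chains of inequalities.\<close>

typedef circ = "{0..<2 * pi :: real}" morphisms ang Circ
  by (rule exI[of _ 0]) simp

instantiation circ :: linorder
begin
definition "x \<le> y \<longleftrightarrow> ang x \<le> ang y"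
definition "x < y \<longleftrightarrow> ang x < ang y"
instance
  by standard (auto simp: less_eq_circ_def less_circ_def ang_inject)
end

definition cyc :: "circ \<Rightarrow> circ \<Rightarrow> circ \<Rightarrow> bool" where
  "cyc x y z \<longleftrightarrow> x < y \<and> y < z \<or> y < z \<and> z < x \<or> z < x \<and> x < y"

definition oarc :: "circ \<Rightarrow> circ \<Rightarrow> circ set" where
  "oarc a b = {z. cyc a z b}"

lemma mem_oarc [simp]: "z \<in> oarc a b \<longleftrightarrow> cyc a z b"
  by (simp add: oarc_def)

lemma ang_bounds: "0 \<le> ang x" "ang x < 2 * pi"
  using ang[of x] by auto

lemma circ_eq_iff: "x = y \<longleftrightarrow> ang x = ang y"
  by (simp add: ang_inject)

lemma cyc_ang: "cyc x y z \<longleftrightarrow> ang x < ang y \<and> ang y < ang z \<or> ang y < ang z \<and> ang z < ang x \<or> ang z < ang x \<and> ang x < ang y"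
  by (simp add: cyc_def less_circ_def)

lemma cyc_irrefl [simp]: "\<not> cyc x x y" "\<not> cyc x y y" "\<not> cyc x y x"
  by (auto simp: cyc_def)

lemma cyc_dense: assumes "a \<noteq> b" obtains z where "cyc a z b"
proof (cases "a < b")
  case True
  then have "ang a < ang b" by (simp add: less_circ_def)
  then obtain t where t: "ang a < t" "t < ang b" using dense by blast
  have "t \<in> {0..<2*pi}" using t ang_bounds[of a] ang_bounds[of b] by auto
  then have "ang (Circ t) = t" by (rule Circ_inverse)
  then show thesis using t that[of "Circ t"] by (auto simp: cyc_ang)
next
  case False
  then have "ang b < ang a" using assms by (auto simp: less_circ_def circ_eq_iff)
  define t where "t = (ang a + 2 * pi) / 2"
  have t: "ang a < t" "t < 2 * pi" using ang_bounds[of a] by (auto simp: t_def)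
  have "t \<in> {0..<2*pi}" using t ang_bounds[of a] by auto
  then have "ang (Circ t) = t" by (rule Circ_inverse)
  then show thesis using t \<open>ang b < ang a\<close> that[of "Circ t"] by (auto simp: cyc_ang)
qed

lemma oarc_eq_empty_iff: "oarc a b = {} \<longleftrightarrow> a = b"
  using cyc_dense[of a b] by (auto simp: oarc_def)

text \<open>The last clause fixes the order of the inner end points; otherwise the inner arc could
  run the other way round, through the complement of the outer arc. Inclusions of arcs are always
  unfolded by this criterion, so that they can be settled by arithmetic on angles.\<close>

lemma oarc_subset_iff:
  assumes "a \<noteq> b"
  shows "oarc a b \<subseteq> oarc c d \<longleftrightarrow>
    c \<noteq> d \<and> (a = c \<or> cyc c a d) \<and> (b = d \<or> cyc c b d) \<and> (a = c \<or> b = d \<or> cyc c a b)" (is "?l = ?r")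
proof
  assume ?r
  then show ?l using assms unfolding oarc_def subset_iff mem_Collect_eq cyc_ang circ_eq_iff by smt
next
  assume l: ?l
  obtain z where z: "cyc a z b" using cyc_dense[OF assms] by blast
  have cd: "c \<noteq> d" using l assms oarc_eq_empty_iff by blast
  have sub: "\<And>z. cyc a z b ==> cyc c z d" using l by auto
  have 1: "\<not> cyc a c b" "\<not> cyc a d b" using sub[of c] sub[of d] by auto
  note z' = sub[OF z]
  show ?r using 1 cd z z' assms unfolding cyc_ang circ_eq_iff by smt
qed

lemma oarc_eq_iff: "a \<noteq> b ==> oarc a b = oarc c d \<longleftrightarrow> a = c \<and> b = d"
proof
  assume ab: "a \<noteq> b" and eq: "oarc a b = oarc c d"
  have cd: "c \<noteq> d" using ab eq oarc_eq_empty_iff by metis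
  have "oarc a b \<subseteq> oarc c d" "oarc c d \<subseteq> oarc a b" using eq by auto
  then show "a = c \<and> b = d" unfolding oarc_subset_iff[OF ab] oarc_subset_iff[OF cd]
    using ab cd unfolding cyc_ang circ_eq_iff by smt
qed auto

text \<open>The counter-clockwise angular distance from \<open>p\<close> to \<open>x\<close>, that
  is, the coordinate obtained by cutting the circle at \<open>p\<close>.\<close>

definition pos :: "circ \<Rightarrow> circ \<Rightarrow> real" where
  "pos p x = (if ang p \<le> ang x then ang x - ang p else ang x - ang p + 2 * pi)"

lemma pos_bounds: "0 \<le> pos p x" "pos p x < 2 * pi"
  using ang_bounds[of x] ang_bounds[of p] by (auto simp: pos_def)

lemma pos_self [simp]: "pos p p = 0"
  by (simp add: pos_def)

lemma pos_eq_iff: "x = y \<longleftrightarrow> pos p x = pos p y"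
  using ang_bounds[of x] ang_bounds[of y] ang_bounds[of p] unfolding circ_eq_iff pos_def
  by (auto split: if_splits)

lemma cyc_shift:
  fixes x y z p c :: real
  assumes "0 \<le> x" "x < c" "0 \<le> y" "y < c" "0 \<le> z" "z < c" "0 \<le> p" "p < c"
    and "x' = (if p \<le> x then x - p else x - p + c)" "y' = (if p \<le> y then y - p else y - p + c)"
      "z' = (if p \<le> z then z - p else z - p + c)"
  shows "x < y \<and> y < z \<or> y < z \<and> z < x \<or> z < x \<and> x < y \<longleftrightarrow>
    x' < y' \<and> y' < z' \<or> y' < z' \<and> z' < x' \<or> z' < x' \<and> x' < y'"
  using assms by (smt (verit))

lemma cyc_pos: "cyc x y z \<longleftrightarrow> pos p x < pos p y \<and> pos p y < pos p z \<or>
    pos p y < pos p z \<and> pos p z < pos p x \<or> pos p z < pos p x \<and> pos p x < pos p y"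
  unfolding cyc_ang using ang_bounds by (intro cyc_shift[of _ "2 * pi" _ _ "ang p"]) (simp_all add: pos_def)

lemma pos_surj:
  assumes "0 \<le> t" "t < 2 * pi"
  obtains x where "pos p x = t"
proof -
  let ?s = "if ang p + t < 2 * pi then ang p + t else ang p + t - 2 * pi"
  have "?s \<in> {0..<2*pi}" using assms ang_bounds[of p] by auto
  then have "ang (Circ ?s) = ?s" by (rule Circ_inverse)
  then have "pos p (Circ ?s) = t" using assms ang_bounds[of p] by (simp add: pos_def)
  then show thesis by (rule that)
qed

lemma countable_dense_circ:
  obtains Q :: "circ set" where "countable Q" "\<And>a b. a \<noteq> b ==> \<exists>q\<in>Q. cyc a q b"
proof -
  let ?Q = "{x. ang x \<in> \<rat>}"
  have "countable (ang ` ?Q)"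
    by (rule countable_subset[OF _ countable_rat]) auto
  then have "countable ?Q"
    by (rule countable_image_inj_on) (auto simp: inj_on_def ang_inject)
  moreover have "\<exists>q\<in>?Q. cyc a q b" if "a \<noteq> b" for a b
  proof -
    have "\<exists>t\<in>\<rat>. 0 \<le> t \<and> t < 2 * pi \<and> (ang a < ang b --> ang a < t \<and> t < ang b) \<and>
       (ang b < ang a --> ang a < t)"
    proof (cases "ang a < ang b")
      case True
      then show ?thesis using Rats_dense_in_real[OF True] ang_bounds[of a] ang_bounds[of b]
        by (metis less_eq_real_def less_trans not_less_iff_gr_or_eq)
    next
      case False
      then show ?thesis using Rats_dense_in_real[of "ang a" "2*pi"] ang_bounds[of a]
        by (metis less_eq_real_def less_trans)
    qed
    then obtain t where t: "t \<in> \<rat>" "0 \<le> t" "t < 2 * pi" "ang a < ang b --> ang a < t \<and> t < ang b"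
      "ang b < ang a --> ang a < t" by blast
    then have "ang (Circ t) = t" by (simp add: Circ_inverse)
    then have "Circ t \<in> ?Q" "cyc a (Circ t) b" using t that unfolding cyc_ang circ_eq_iff by auto
    then show ?thesis by blast
  qed
  ultimately show thesis by (rule that)
qed

section \<open>Unions of chains of arcs\<close>

text \<open>Cut the circle at a point \<open>x0\<close> of one member. A member through
  \<open>x0\<close> is then the complement of a segment \<open>[r b, r a]\<close>, so the union is
  the complement of \<open>[B, A]\<close> with \<open>B\<close> the supremum of the lower and
  \<open>A\<close> the infimum of the upper bounds. The two points missed by all members guarantee
  \<open>B < A\<close>.\<close>

lemma chain_Union_oarc:
  assumes ne: "C \<noteq> {}" and arcs: "\<And>I. I \<in> C ==> \<exists>a b. a \<noteq> b \<and> I = oarc a b"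
    and chain: "\<And>I J. I \<in> C ==> J \<in> C ==> I \<subseteq> J \<or> J \<subseteq> I"
    and uv: "u \<noteq> v" "\<And>I. I \<in> C ==> u \<notin> I \<and> v \<notin> I"
  shows "\<exists>a b. a \<noteq> b \<and> \<Union>C = oarc a b"
proof -
  obtain I0 where I0: "I0 \<in> C" using ne by blast
  then obtain x0 where x0: "x0 \<in> I0" using arcs oarc_eq_empty_iff by (metis ex_in_conv)
  define r where "r = pos x0"
  have r0: "r x0 = 0" by (simp add: r_def)
  have rb: "0 \<le> r x" "r x < 2 * pi" for x using pos_bounds by (auto simp: r_def)
  have rc: "cyc x y z \<longleftrightarrow> r x < r y \<and> r y < r z \<or> r y < r z \<and> r z < r x \<or> r z < r x \<and> r x < r y" for x y z
    unfolding r_def by (rule cyc_pos)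
  have req: "x = y \<longleftrightarrow> r x = r y" for x y unfolding r_def by (rule pos_eq_iff)
  define P where "P = {(a,b). a \<noteq> b \<and> oarc a b \<in> C \<and> x0 \<in> oarc a b}"
  have Cx: "\<exists>a b. (a,b) \<in> P \<and> x \<in> oarc a b" if "x \<in> I" "I \<in> C" for x I
  proof (cases "I0 \<subseteq> I")
    case True then show ?thesis using that arcs[of I] x0 unfolding P_def by blast
  next
    case False then have "I \<subseteq> I0" using chain I0 that by blast
    then show ?thesis using that arcs[of I0] x0 I0 unfolding P_def by blast
  qed
  have UC: "\<Union>C = {x. \<exists>a b. (a,b) \<in> P \<and> x \<in> oarc a b}"
  proof
    show "\<Union>C \<subseteq> {x. \<exists>a b. (a,b) \<in> P \<and> x \<in> oarc a b}" using Cx by blast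
    show "{x. \<exists>a b. (a,b) \<in> P \<and> x \<in> oarc a b} \<subseteq> \<Union>C"
      unfolding P_def by (simp del: mem_oarc) blast
  qed
  have Pm: "r b < r a \<and> 0 < r b" if "(a,b) \<in> P" for a b
    using that unfolding P_def mem_Collect_eq split_conv mem_oarc rc r0 using rb(1)[of a] rb(1)[of b] by auto
  have Pm2: "r b' \<le> r a" if "(a,b) \<in> P" "(a',b') \<in> P" for a b a' b'
  proof -
    have "oarc a b \<in> C" "oarc a' b' \<in> C" using that unfolding P_def by auto
    then have sub: "oarc a b \<subseteq> oarc a' b' \<or> oarc a' b' \<subseteq> oarc a b" by (rule chain)
    have "cyc a' x0 b'" "cyc a x0 b" "a \<noteq> b" "a' \<noteq> b'" using that unfolding P_def by auto
    moreover have "(a = a' \<or> cyc a' a b') \<and> (b = b' \<or> cyc a' b b') \<and> (a = a' \<or> b = b' \<or> cyc a' a b) \<or>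
      (a' = a \<or> cyc a a' b) \<and> (b' = b \<or> cyc a b' b) \<and> (a' = a \<or> b' = b \<or> cyc a a' b')"
      using sub oarc_subset_iff \<open>a \<noteq> b\<close> \<open>a' \<noteq> b'\<close> by metis
    ultimately show ?thesis unfolding rc req r0 using rb(1)[of a] rb(1)[of b] rb(1)[of a'] rb(1)[of b'] by smt
  qed
  obtain a0 b0 where P0: "(a0,b0) \<in> P" using Cx[OF x0 I0] by blast
  define B where "B = (SUP p\<in>P. r (snd p))"
  define A where "A = (INF p\<in>P. r (fst p))"
  have bddB: "bdd_above ((\<lambda>p. r (snd p)) ` P)"
  proof (rule bdd_aboveI2)
    fix p assume "p \<in> P" then show "r (snd p) \<le> r a0" using Pm2[OF P0, of "fst p" "snd p"] by simp
  qed
  have bddA: "bdd_below ((\<lambda>p. r (fst p)) ` P)"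
    by (rule bdd_belowI2[of _ 0]) (rule rb(1))
  have BA: "B \<le> A" unfolding B_def
  proof (rule cSUP_least)
    show "P \<noteq> {}" using P0 by auto
    fix p assume p: "p \<in> P"
    show "r (snd p) \<le> A" unfolding A_def
    proof (rule cINF_greatest)
      show "P \<noteq> {}" using P0 by auto
      fix q assume "q \<in> P" then show "r (snd p) \<le> r (fst q)" using Pm2[of "fst q" "snd q" "fst p" "snd p"] p by simp
    qed
  qed
  have "r b0 \<le> B" unfolding B_def using cSUP_upper[OF P0 bddB] by simp
  then have B0: "0 < B" using Pm[OF P0] by linarith
  have "A \<le> r a0" unfolding A_def using cINF_lower[OF bddA P0] by simp
  then have A2: "A < 2 * pi" using rb(2)[of a0] by linarith
  obtain \<alpha> where \<alpha>: "r \<alpha> = A" unfolding r_def using pos_surj[of A x0] A2 B0 BA by (metis less_eq_real_def order_trans)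
  obtain \<beta> where \<beta>: "r \<beta> = B" unfolding r_def using pos_surj[of B x0] A2 B0 BA by (metis less_eq_real_def order_le_less_trans)
  have mem: "x \<in> \<Union>C \<longleftrightarrow> r x < B \<or> A < r x" for x
  proof
    assume "x \<in> \<Union>C"
    then obtain a b where ab: "(a,b) \<in> P" "x \<in> oarc a b" unfolding UC by blast
    have "r b \<le> B" unfolding B_def using cSUP_upper[OF ab(1) bddB] by simp
    moreover have "A \<le> r a" unfolding A_def using cINF_lower[OF bddA ab(1)] by simp
    moreover have "r x < r b \<or> r a < r x" using ab Pm[OF ab(1)] unfolding mem_oarc rc by auto
    ultimately show "r x < B \<or> A < r x" by linarith
  next
    assume "r x < B \<or> A < r x"
    then show "x \<in> \<Union>C"
    proof
      assume "r x < B"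
      then obtain p where "p \<in> P" "r x < r (snd p)" unfolding B_def using less_cSUP_iff[OF _ bddB] P0 by (metis empty_iff)
      note rp = this
      then have p: "(fst p, snd p) \<in> P" by simp
      have "x \<in> oarc (fst p) (snd p)" using Pm[OF p] rp(2) unfolding mem_oarc rc by linarith
      then show ?thesis unfolding UC using p by blast
    next
      assume "A < r x"
      then obtain p where "p \<in> P" "r (fst p) < r x" unfolding A_def using cINF_less_iff[OF _ bddA] P0 by (metis empty_iff)
      note rp = this
      then have p: "(fst p, snd p) \<in> P" by simp
      have "x \<in> oarc (fst p) (snd p)" using Pm[OF p] rp(2) unfolding mem_oarc rc by linarith
      then show ?thesis unfolding UC using p by blast
    qed
  qed
  have "u \<notin> \<Union>C" "v \<notin> \<Union>C" using uv by auto
  then have "B \<le> r u" "r u \<le> A" "B \<le> r v" "r v \<le> A" "r u \<noteq> r v" using mem[of u] mem[of v] uv(1) req[of u v] by linarith+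
  then have "B < A" by linarith
  then have "\<alpha> \<noteq> \<beta>" using \<alpha> \<beta> by auto
  moreover have "\<Union>C = oarc \<alpha> \<beta>"
    unfolding set_eq_iff mem mem_oarc rc \<alpha> \<beta> using \<open>B < A\<close> by auto
  ultimately show ?thesis by blast
qed

text \<open>Lamination systems are closed under unions of sequences only, while the gap
  constructions need arbitrary chains. Choose a member of the chain through each point of a
  countable dense set inside the union and take running maxima. A point \<open>x\<close> of a member
  lies between two dense points of this member; some \<open>A n\<close> contains both, and it
  contains \<open>x\<close> because \<open>u\<close> lies outside.\<close>

lemma chain_Union_seq:
  assumes ne: "C \<noteq> {}" and arcs: "\<And>I. I \<in> C ==> \<exists>a b. a \<noteq> b \<and> I = oarc a b"
    and chain: "\<And>I J. I \<in> C ==> J \<in> C ==> I \<subseteq> J \<or> J \<subseteq> I"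
    and u: "\<And>I. I \<in> C ==> u \<notin> I"
  shows "\<exists>A :: nat \<Rightarrow> circ set. (\<forall>k. A k \<in> C) \<and> (\<forall>k. A k \<subseteq> A (Suc k)) \<and> (\<Union>k. A k) = \<Union>C"
proof -
  obtain Q :: "circ set" where Q: "countable Q" "\<And>a b. a \<noteq> b ==> \<exists>q\<in>Q. cyc a q b"
    using countable_dense_circ by metis
  obtain I0 where I0: "I0 \<in> C" using ne by blast
  define S where "S = insert I0 ((\<lambda>q. SOME I. I \<in> C \<and> q \<in> I) ` (Q \<inter> \<Union>C))"
  have S: "countable S" "S \<noteq> {}" unfolding S_def using Q(1) by auto
  have pick: "(SOME I. I \<in> C \<and> q \<in> I) \<in> C \<and> q \<in> (SOME I. I \<in> C \<and> q \<in> I)" if "q \<in> \<Union>C" for q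
    using someI_ex[of "\<lambda>I. I \<in> C \<and> q \<in> I"] that by blast
  have SC: "S \<subseteq> C" unfolding S_def using I0 pick by auto
  define f where "f = from_nat_into S"
  have f: "f n \<in> C" for n using SC from_nat_into[OF S(2)] unfolding f_def by blast
  have rf: "range f = S" unfolding f_def using range_from_nat_into[OF S(2,1)] .
  have cov: "\<exists>n. q \<in> f n" if q: "q \<in> Q" "q \<in> \<Union>C" for q
  proof -
    have "(SOME I. I \<in> C \<and> q \<in> I) \<in> range f" unfolding rf S_def using q by blast
    then obtain n where "(SOME I. I \<in> C \<and> q \<in> I) = f n" by (rule imageE)
    then show ?thesis using pick[OF q(2)] by (intro exI[of _ n]) simp
  qed
  define A where "A = (\<lambda>n. rec_nat (f 0) (\<lambda>n J. if J \<subseteq> f (Suc n) then f (Suc n) else J) n)"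
  have A0: "A 0 = f 0" and AS: "A (Suc n) = (if A n \<subseteq> f (Suc n) then f (Suc n) else A n)" for n
    by (simp_all add: A_def)
  have AC: "A n \<in> C" for n by (induction n) (simp_all add: A0 AS f)
  have mono: "A n \<subseteq> A (Suc n)" for n by (simp add: AS)
  have fA: "f n \<subseteq> A n" for n
  proof (cases n)
    case (Suc m) then show ?thesis using chain[OF AC[of m] f[of n]] by (auto simp: AS)
  qed (simp add: A0)
  have "x \<in> (\<Union>k. A k)" if x: "x \<in> I" "I \<in> C" for x I
  proof -
    obtain a b where ab: "a \<noteq> b" "I = oarc a b" using arcs x by blast
    have axb: "cyc a x b" using x ab by auto
    then have "a \<noteq> x" "x \<noteq> b" by auto
    then obtain q q' where q: "q \<in> Q" "cyc a q x" "q' \<in> Q" "cyc x q' b" using Q(2) by meson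
    have "cyc a q b" "cyc a q' b" using axb q(2,4) unfolding cyc_ang by linarith+
    then have "q \<in> \<Union>C" "q' \<in> \<Union>C" using ab x by auto
    then have "\<exists>n. q \<in> f n" "\<exists>n. q' \<in> f n" using cov q by blast+
    then obtain n n' where n: "q \<in> f n" "q' \<in> f n'" by blast
    have "A n \<subseteq> A (max n n')" "A n' \<subseteq> A (max n n')"
      using lift_Suc_mono_le[of A n "max n n'"] lift_Suc_mono_le[of A n' "max n n'"] mono by auto
    then have qq: "q \<in> A (max n n')" "q' \<in> A (max n n')" using n fA by blast+
    obtain c d where cd: "c \<noteq> d" "A (max n n') = oarc c d" using arcs AC by blast
    have "u \<notin> oarc c d" using u[OF AC[of "max n n'"]] cd by simp
    moreover have "u \<notin> oarc a b" using u[OF x(2)] ab by simp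
    ultimately have "cyc c x d" using qq[unfolded cd(2)] axb q(2,4) unfolding mem_oarc cyc_ang by smt
    then show ?thesis using cd by auto
  qed
  then have "(\<Union>k. A k) = \<Union>C" using AC by blast
  then show ?thesis using AC mono by blast
qed

section \<open>Lamination systems and their gaps\<close>

definition co :: "circ set \<Rightarrow> circ set" where
  "co I = (THE J. \<exists>a b. a \<noteq> b \<and> I = oarc a b \<and> J = oarc b a)"

lemma co_oarc [simp]: "a \<noteq> b ==> co (oarc a b) = oarc b a"
  unfolding co_def by (rule the_equality) (auto simp: oarc_eq_iff)

lemma not_both_oarc: "x \<in> oarc a b ==> x \<notin> oarc b a"
  by (auto simp: cyc_ang)

lemma oarc_disjoint_iff:
  assumes "a \<noteq> b" "c \<noteq> d"
  shows "oarc a b \<inter> oarc c d = {} \<longleftrightarrow> oarc a b \<subseteq> oarc d c"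
proof
  assume dj: "oarc a b \<inter> oarc c d = {}"
  have no: "\<not> (cyc a z b \<and> cyc c z d)" for z using dj by auto
  have 1: "\<not> cyc a c b"
  proof
    assume acb: "cyc a c b"
    then have "c \<noteq> b" by auto
    obtain z where z: "cyc c z b" using cyc_dense[OF \<open>c \<noteq> b\<close>] .
    obtain z' where z': "cyc c z' d" using cyc_dense[OF assms(2)] .
    show False using no[of z] no[of z'] z z' acb assms unfolding cyc_ang circ_eq_iff by (smt (z3))
  qed
  have 2: "\<not> cyc a d b"
  proof
    assume adb: "cyc a d b"
    then have "a \<noteq> d" by auto
    obtain z where z: "cyc a z d" using cyc_dense[OF \<open>a \<noteq> d\<close>] .
    obtain z' where z': "cyc c z' d" using cyc_dense[OF assms(2)] .
    show False using no[of z] no[of z'] z z' adb assms unfolding cyc_ang circ_eq_iff by (smt (z3))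
  qed
  obtain z where "cyc a z b" using cyc_dense assms by blast
  moreover have "\<not> cyc c z d" using dj \<open>cyc a z b\<close> by auto
  ultimately show "oarc a b \<subseteq> oarc d c" unfolding oarc_subset_iff[OF assms(1)]
    using 1 2 assms unfolding cyc_ang circ_eq_iff by (smt (z3))
next
  assume "oarc a b \<subseteq> oarc d c"
  then have "\<And>x. x \<in> oarc a b ==> x \<in> oarc d c" by blast
  then show "oarc a b \<inter> oarc c d = {}" using not_both_oarc by blast
qed

lemma mem_co_cases: "a \<noteq> b ==> x = a \<or> x = b \<or> x \<in> oarc a b \<or> x \<in> oarc b a"
  by (auto simp: cyc_ang circ_eq_iff)

text \<open>The four alternatives are the positions of unlinked arcs in the form of
  \<open>oarc_subset_iff\<close>: first in second, second in first, disjoint, and complement of the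
  first in the second.\<close>

lemma four_cyc:
  assumes "a \<noteq> b" "c \<noteq> d" "\<not> (cyc a c b \<and> cyc b d a)" "\<not> (cyc a d b \<and> cyc b c a)"
  shows "(c \<noteq> d \<and> (a = c \<or> cyc c a d) \<and> (b = d \<or> cyc c b d) \<and> (a = c \<or> b = d \<or> cyc c a b)) \<or>
   (a \<noteq> b \<and> (c = a \<or> cyc a c b) \<and> (d = b \<or> cyc a d b) \<and> (c = a \<or> d = b \<or> cyc a c d)) \<or>
   (d \<noteq> c \<and> (a = d \<or> cyc d a c) \<and> (b = c \<or> cyc d b c) \<and> (a = d \<or> b = c \<or> cyc d a b)) \<or>
   (c \<noteq> d \<and> (b = c \<or> cyc c b d) \<and> (a = d \<or> cyc c a d) \<and> (b = c \<or> a = d \<or> cyc c b a))"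
  using assms unfolding cyc_ang circ_eq_iff by (smt (z3))

text \<open>Lamination systems on angles. Condition (ii) becomes: end points are not linked. In the
  closure axiom sequences are replaced by arbitrary chains, and the requirement that the union be a
  good interval by two points missed by all members; \<open>chain_Union_seq\<close> and
  \<open>chain_Union_oarc\<close> justify these changes.\<close>

locale lam =
  fixes L :: "circ set set"
  assumes nonempty: "L \<noteq> {}"
    and oarcs: "I \<in> L ==> \<exists>a b. a \<noteq> b \<and> I = oarc a b"
    and dual: "oarc a b \<in> L ==> oarc b a \<in> L"
    and unlinked: "oarc a b \<in> L ==> oarc c d \<in> L ==> cyc a c b ==> cyc b d a ==> False"
    and sup: "C \<subseteq> L ==> C \<noteq> {} ==> (\<And>I J. I \<in> C ==> J \<in> C ==> I \<subseteq> J \<or> J \<subseteq> I) ==>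
      u \<noteq> v ==> (\<And>I. I \<in> C ==> u \<notin> I \<and> v \<notin> I) ==> \<Union>C \<in> L"

definition endp :: "circ set set \<Rightarrow> circ \<Rightarrow> bool" where
  "endp L x \<longleftrightarrow> (\<exists>y. oarc x y \<in> L)"

definition isgap :: "circ set set \<Rightarrow> circ set set \<Rightarrow> bool" where
  "isgap L \<G> \<longleftrightarrow> \<G> \<subseteq> L \<and> (\<forall>I\<in>\<G>. \<forall>J\<in>\<G>. I \<noteq> J --> I \<inter> J = {}) \<and>
    (\<forall>I\<in>L. \<exists>J\<in>\<G>. I \<subseteq> J \<or> co I \<subseteq> J)"

definition nlg :: "circ set set \<Rightarrow> circ set set \<Rightarrow> bool" where
  "nlg L \<G> \<longleftrightarrow> isgap L \<G> \<and> \<not> (\<exists>I\<in>L. \<G> = {I, co I})"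

definition verts :: "circ set set \<Rightarrow> circ set" where
  "verts \<G> = - \<Union>\<G>"

text \<open>The extra vertex \<open>p\<close> of a crown, described without reference to an
  enumeration: a vertex at which no element of the gap ends.\<close>

definition pivot :: "circ set set \<Rightarrow> circ \<Rightarrow> bool" where
  "pivot \<G> p \<longleftrightarrow> p \<in> verts \<G> \<and> (\<forall>a b. a \<noteq> b --> oarc a b \<in> \<G> --> p \<noteq> a \<and> p \<noteq> b)"

context lam
begin

lemma ne_oarc: "oarc a b \<in> L ==> a \<noteq> b"
  using oarcs oarc_eq_empty_iff by metis

lemma L_cases:
  assumes "I \<in> L" obtains a b where "a \<noteq> b" "I = oarc a b" "oarc a b \<in> L" "co I = oarc b a" "oarc b a \<in> L"
proof -
  obtain a b where "a \<noteq> b" "I = oarc a b" using oarcs[OF assms] by blast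
  then show thesis using that[of a b] dual assms by simp
qed

lemma co_in: "I \<in> L ==> co I \<in> L"
  by (erule L_cases) simp

lemma co_co: "I \<in> L ==> co (co I) = I"
  by (erule L_cases) simp

lemma co_disj: "I \<in> L ==> I \<inter> co I = {}"
  by (erule L_cases) (use not_both_oarc in blast)

lemma disj_iff: assumes "I \<in> L" "J \<in> L" shows "I \<inter> J = {} \<longleftrightarrow> I \<subseteq> co J"
proof -
  obtain a b where ab: "a \<noteq> b" "I = oarc a b" "oarc a b \<in> L" "co I = oarc b a" "oarc b a \<in> L"
    by (rule L_cases[OF assms(1)])
  obtain c d where cd: "c \<noteq> d" "J = oarc c d" "oarc c d \<in> L" "co J = oarc d c" "oarc d c \<in> L"
    by (rule L_cases[OF assms(2)])
  show ?thesis unfolding cd(4) unfolding ab(2) cd(2) by (rule oarc_disjoint_iff[OF ab(1) cd(1)])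
qed

lemma co_anti: "I \<in> L ==> J \<in> L ==> I \<subseteq> J \<longleftrightarrow> co J \<subseteq> co I"
  using disj_iff[of I "co J"] disj_iff[of "co J" I] co_in[of J] co_co[of J] by (simp add: Int_commute)

lemma in_ne: "I \<in> L ==> I \<noteq> {}"
  using oarcs[of I] oarc_eq_empty_iff by blast

lemma endp1: "oarc a b \<in> L ==> endp L a" and endp2: "oarc a b \<in> L ==> endp L b"
  using dual by (auto simp: endp_def)

lemma in_or_co: assumes "I \<in> L" "\<not> endp L x" shows "x \<in> I \<or> x \<in> co I"
proof -
  obtain a b where ab: "a \<noteq> b" "I = oarc a b" "oarc a b \<in> L" "co I = oarc b a" "oarc b a \<in> L"
    by (rule L_cases[OF assms(1)])
  have "x \<noteq> a" "x \<noteq> b" using endp1[OF ab(3)] endp2[OF ab(3)] assms(2) by auto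
  then show ?thesis using mem_co_cases[OF ab(1), of x] unfolding ab(4) unfolding ab(2) by simp
qed

lemma in_co_iff: "I \<in> L ==> \<not> endp L x ==> x \<in> co I \<longleftrightarrow> x \<notin> I"
  using in_or_co co_disj by blast

lemma four:
  assumes "I \<in> L" "J \<in> L"
  shows "I \<subseteq> J \<or> J \<subseteq> I \<or> I \<inter> J = {} \<or> co I \<subseteq> J"
proof -
  obtain a b where ab: "a \<noteq> b" "I = oarc a b" "oarc a b \<in> L" "co I = oarc b a" "oarc b a \<in> L"
    by (rule L_cases[OF assms(1)])
  obtain c d where cd: "c \<noteq> d" "J = oarc c d" "oarc c d \<in> L" "co J = oarc d c" "oarc d c \<in> L"
    by (rule L_cases[OF assms(2)])
  have "\<not> (cyc a c b \<and> cyc b d a)" "\<not> (cyc a d b \<and> cyc b c a)" using unlinked ab cd by blast+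
  note four_cyc[OF ab(1) cd(1) this]
  then show ?thesis unfolding disj_iff[OF assms] ab(4) cd(4)
    unfolding ab(2) cd(2) oarc_subset_iff[OF ab(1)] oarc_subset_iff[OF cd(1)] oarc_subset_iff[OF ab(1)[symmetric]] .
qed

text \<open>Of the four positions, disjointness is excluded by \<open>x\<close>. If the complement
  of \<open>I\<close> were contained in \<open>J\<close>, the points \<open>u\<close> and
  \<open>u'\<close> would be the two end points of both arcs, so that \<open>J\<close> would be the
  complement of \<open>I\<close> and could not contain \<open>x\<close>.\<close>

lemma nested:
  assumes IJ: "I \<in> L" "J \<in> L" "x \<in> I" "x \<in> J" and u: "u \<notin> I" "u \<notin> J" "u' \<notin> I" "u' \<notin> J" "u \<noteq> u'"
  shows "I \<subseteq> J \<or> J \<subseteq> I"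
proof (rule ccontr)
  assume n: "\<not> ?thesis"
  then have c: "co I \<subseteq> J" using four[OF IJ(1,2)] IJ by blast
  obtain a b where ab: "a \<noteq> b" "I = oarc a b" "oarc a b \<in> L" "co I = oarc b a" "oarc b a \<in> L"
    by (rule L_cases[OF IJ(1)])
  obtain c d where cd: "c \<noteq> d" "J = oarc c d" "oarc c d \<in> L" "co J = oarc d c" "oarc d c \<in> L"
    by (rule L_cases[OF IJ(2)])
  have uu: "u = a \<and> u' = b \<or> u = b \<and> u' = a"
  proof -
    have "u \<notin> co I" "u' \<notin> co I" using c u(2,4) by blast+
    then have "u \<notin> oarc a b" "u \<notin> oarc b a" "u' \<notin> oarc a b" "u' \<notin> oarc b a" using u(1,3) ab(2,4) by simp_all
    then have "u = a \<or> u = b" "u' = a \<or> u' = b" using mem_co_cases[OF ab(1)] by blast+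
    then show ?thesis using u(5) by blast
  qed
  then have nn: "\<not> cyc c a d" "\<not> cyc c b d" using u cd by auto
  have "(b = c \<or> cyc c b d) \<and> (a = d \<or> cyc c a d)"
    using c unfolding ab(4) cd(2) oarc_subset_iff[OF ab(1)[symmetric]] by blast
  then have "c = b \<and> d = a" using nn by blast
  then show False using IJ(3,4) ab cd not_both_oarc by metis
qed

lemma nested':
  assumes "I \<in> L" "J \<in> L" "x \<in> I" "x \<in> J" "u \<notin> I" "u \<notin> J" "\<not> endp L u"
  shows "I \<subseteq> J \<or> J \<subseteq> I"
proof -
  have "u \<in> co I" using in_or_co[OF assms(1,7)] assms(5) by simp
  then show ?thesis using four[OF assms(1,2)] assms(3,4,6) by auto
qed

section \<open>Construction of gaps from a choice of sides\<close>

text \<open>Choose sides of all leaves such that chosen sides are pairwise nested or disjoint and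
  chains of them are bounded by a chosen side. By Zorn's lemma every chosen side lies in a maximal
  one, and the maximal ones form a gap. The later constructions differ only in the choice
  \<open>Or\<close>.\<close>

lemma gap_construct:
  assumes Or: "Or \<subseteq> L" "\<And>I. I \<in> L ==> I \<in> Or \<or> co I \<in> Or"
    and nd: "\<And>I J. I \<in> Or ==> J \<in> Or ==> I \<subseteq> J \<or> J \<subseteq> I \<or> I \<inter> J = {}"
    and ch: "\<And>C. C \<subseteq> Or ==> C \<noteq> {} ==> (\<And>I J. I \<in> C ==> J \<in> C ==> I \<subseteq> J \<or> J \<subseteq> I) ==> \<exists>U\<in>Or. \<Union>C \<subseteq> U"
  shows "isgap L {M \<in> Or. \<forall>N\<in>Or. M \<subseteq> N --> N = M}" (is "isgap L ?G")
    and "\<And>I. I \<in> Or ==> \<exists>M\<in>{M \<in> Or. \<forall>N\<in>Or. M \<subseteq> N --> N = M}. I \<subseteq> M"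
proof -
  show mx: "\<exists>M\<in>?G. I \<subseteq> M" if I: "I \<in> Or" for I
  proof -
    have "\<exists>M\<in>{J\<in>Or. I \<subseteq> J}. \<forall>Xs\<in>{J\<in>Or. I \<subseteq> J}. M \<subseteq> Xs --> Xs = M"
    proof (rule subset_Zorn)
      fix C assume "subset.chain {J\<in>Or. I \<subseteq> J} C"
      then have C1: "C \<subseteq> {J\<in>Or. I \<subseteq> J}" and C2: "\<forall>I\<in>C. \<forall>J\<in>C. I \<subseteq> J \<or> J \<subseteq> I"
        by (auto simp add: subset_chain_def)
      have C3: "C \<subseteq> Or" using C1 by auto
      show "\<exists>U\<in>{J\<in>Or. I \<subseteq> J}. \<forall>Xs\<in>C. Xs \<subseteq> U"
      proof (cases "C = {}")
        case True then show ?thesis using I by blast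
      next
        case False
        obtain U where U: "U \<in> Or" "\<Union>C \<subseteq> U" using ch[OF C3 False] C2 by auto
        obtain J where "J \<in> C" using False by auto
        then have "I \<subseteq> U" using C1 U by auto
        then show ?thesis using U by (intro bexI[of _ U]) auto
      qed
    qed
    then obtain M where M: "M \<in> Or" "I \<subseteq> M" "\<And>Xs. Xs \<in> Or ==> I \<subseteq> Xs ==> M \<subseteq> Xs ==> Xs = M" by auto
    have "M \<in> ?G" using M(1) M(3)[OF _ subset_trans[OF M(2)]] by simp
    then show ?thesis using M(2) by (rule bexI[rotated])
  qed
  show "isgap L ?G" unfolding isgap_def
  proof (intro conjI ballI impI)
    show "?G \<subseteq> L" using Or(1) by auto
    fix I J assume "I \<in> ?G" "J \<in> ?G" "I \<noteq> J" then show "I \<inter> J = {}" using nd[of I J] by auto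
  next
    fix I assume "I \<in> L"
    then have "I \<in> Or \<or> co I \<in> Or" by (rule Or(2))
    then show "\<exists>J\<in>?G. I \<subseteq> J \<or> co I \<subseteq> J" using mx[of I] mx[of "co I"] by auto
  qed
qed

lemma gap_in: "isgap L \<G> ==> I \<in> \<G> ==> I \<in> L"
  unfolding isgap_def by (elim conjE) (rule subsetD)

lemma gap_disj: "isgap L \<G> ==> I \<in> \<G> ==> J \<in> \<G> ==> x \<in> I ==> x \<in> J ==> I = J"
  unfolding isgap_def by blast

lemma gap_lies: "isgap L \<G> ==> I \<in> L ==> \<exists>J\<in>\<G>. I \<subseteq> J \<or> co I \<subseteq> J"
  unfolding isgap_def by blast

lemma nlg_gap: "nlg L \<G> ==> isgap L \<G>"
  unfolding nlg_def by blast

lemma gap_verts: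
  assumes "isgap L \<G>" "oarc a b \<in> \<G>"
  shows "a \<in> verts \<G>" "b \<in> verts \<G>"
proof -
  have ab: "a \<noteq> b" using gap_in[OF assms] ne_oarc by blast
  have False if J: "J \<in> \<G>" "a \<in> J \<or> b \<in> J" for J
  proof -
    obtain c d where cd: "c \<noteq> d" "J = oarc c d" using gap_in[OF assms(1) J(1)] oarcs by blast
    have "oarc a b \<noteq> J" using J(2) by auto
    then have "oarc a b \<inter> J = {}" using assms J unfolding isgap_def by blast
    then have "oarc a b \<subseteq> oarc d c" using oarc_disjoint_iff[OF ab cd(1)] cd by simp
    then show False using J(2) ab unfolding cd oarc_subset_iff[OF ab] mem_oarc cyc_ang circ_eq_iff by (smt (z3))
  qed
  then show "a \<in> verts \<G>" "b \<in> verts \<G>" unfolding verts_def by blast+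
qed

lemma verts_cases:
  assumes "isgap L \<G>" "x \<notin> verts \<G>"
  obtains a b where "a \<noteq> b" "oarc a b \<in> \<G>" "cyc a x b" "a \<in> verts \<G>" "b \<in> verts \<G>"
proof -
  obtain J where J: "J \<in> \<G>" "x \<in> J" using assms unfolding verts_def by blast
  obtain a b where "a \<noteq> b" "J = oarc a b" using gap_in[OF assms(1) J(1)] oarcs by blast
  then show thesis using that J gap_verts[OF assms(1)] by auto
qed

lemma leaf_gapI:
  assumes "isgap L \<G>" "I \<in> \<G>" "co I \<in> \<G>"
  shows "\<not> nlg L \<G>"
proof -
  have IL: "I \<in> L" using gap_in assms by blast
  have "J = I \<or> J = co I" if J: "J \<in> \<G>" for J
  proof (rule ccontr)
    assume n: "\<not> ?thesis"
    have JL: "J \<in> L" using gap_in assms J by blast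
    have "J \<inter> I = {}" "J \<inter> co I = {}" using n J assms unfolding isgap_def by blast+
    then have "J \<subseteq> co I" "J \<subseteq> I" using disj_iff JL IL co_in co_co by metis+
    then show False using in_ne[OF JL] co_disj[OF IL] by blast
  qed
  then have "\<G> = {I, co I}" using assms by blast
  then show ?thesis using IL unfolding nlg_def by blast
qed

lemma nlg_no_cover:
  assumes "nlg L \<G>" "A \<in> \<G>" "B \<in> \<G>" shows "\<not> co A \<subseteq> B"
proof
  assume s: "co A \<subseteq> B"
  have g: "isgap L \<G>" using assms nlg_gap by blast
  have AL: "A \<in> L" "B \<in> L" using gap_in[OF g] assms by blast+
  show False
  proof (cases "A = B")
    case True then show False using s co_disj[OF AL(1)] in_ne[OF co_in[OF AL(1)]] by blast
  next
    case False
    then have "A \<inter> B = {}" using g assms unfolding isgap_def by blast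
    then have "B \<subseteq> co A" using disj_iff AL by (metis Int_commute)
    then have "B = co A" using s by blast
    then show False using leaf_gapI[OF g assms(2)] assms by blast
  qed
qed

text \<open>Choose the sides inside the complement of \<open>oarc a b\<close> and those strictly
  inside \<open>oarc a b\<close>. Since no leaf strictly inside contains the finite set
  \<open>F\<close>, unions of chains remain strictly inside, so \<open>oarc b a\<close> is itself
  maximal. The result is a non-leaf gap bordering the leaf on its inner side, and it separates the
  points of \<open>F\<close>.\<close>

lemma side:
  assumes ab: "oarc a b \<in> L"
    and F: "finite F" "F \<subseteq> oarc a b" "F \<noteq> {}" "\<And>K. K \<in> L ==> K \<subset> oarc a b ==> F \<subseteq> K ==> False"
  shows "\<exists>\<G>. nlg L \<G> \<and> oarc b a \<in> \<G> \<and> (\<forall>K\<in>\<G>. \<not> F \<subseteq> K)"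
proof -
  let ?I = "oarc a b" and ?D = "oarc b a"
  have ne: "a \<noteq> b" using ne_oarc ab by blast
  have D: "?D \<in> L" using dual ab by blast
  define Or where "Or = {K \<in> L. K \<subseteq> ?D \<or> K \<subset> ?I}"
  have dis: "?I \<inter> ?D = {}" using not_both_oarc by blast
  have OL: "Or \<subseteq> L" unfolding Or_def by blast
  have cov: "I \<in> Or \<or> co I \<in> Or" if I: "I \<in> L" for I
  proof (cases "I = ?I \<or> co I = ?I")
    case True then have "I = ?D \<or> co I = ?D" using co_co[OF I] ne by (metis co_oarc)
    then show ?thesis using D I co_in[OF I] unfolding Or_def by auto
  next
    case False
    have "I \<subseteq> ?I \<or> ?I \<subseteq> I \<or> I \<inter> ?I = {} \<or> co I \<subseteq> ?I" using four[OF I ab] .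
    moreover have "?I \<subseteq> I \<longleftrightarrow> co I \<subseteq> ?D" using co_anti[OF ab I] ne by simp
    moreover have "I \<inter> ?I = {} \<longleftrightarrow> I \<subseteq> ?D" using disj_iff[OF I ab] ne by simp
    ultimately show ?thesis using False I co_in[OF I] unfolding Or_def by blast
  qed
  have nd: "I \<subseteq> J \<or> J \<subseteq> I \<or> I \<inter> J = {}" if "I \<in> Or" "J \<in> Or" for I J
  proof (cases "I \<inter> J = {}")
    case False
    then obtain x where x: "x \<in> I" "x \<in> J" by blast
    have "a \<notin> ?I" "a \<notin> ?D" "b \<notin> ?I" "b \<notin> ?D" by auto
    then have "a \<notin> I" "a \<notin> J" "b \<notin> I" "b \<notin> J" using that unfolding Or_def by blast+
    then show ?thesis using nested[of I J x a b] that x OL ne by blast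
  qed blast
  have ch: "\<exists>U\<in>Or. \<Union>C \<subseteq> U" if C: "C \<subseteq> Or" "C \<noteq> {}" "\<And>I J. I \<in> C ==> J \<in> C ==> I \<subseteq> J \<or> J \<subseteq> I" for C
  proof (cases "\<exists>K\<in>C. K \<subseteq> ?D")
    case True
    have "K \<subseteq> ?D" if K: "K \<in> C" for K
    proof -
      obtain K0 where K0: "K0 \<in> C" "K0 \<subseteq> ?D" using True by blast
      have "K0 \<noteq> {}" "K \<noteq> {}" using K0 K C(1) OL in_ne by blast+
      then have "\<not> K \<subseteq> ?I" using C(3)[OF K K0(1)] K0 dis by blast
      then show ?thesis using K C(1) unfolding Or_def by blast
    qed
    then show ?thesis using D unfolding Or_def by blast
  next
    case False
    then have sub: "K \<subset> ?I" if "K \<in> C" for K using that C(1) unfolding Or_def by blast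
    have "\<Union>C \<in> L"
    proof (rule sup[of C a b])
      fix K assume "K \<in> C"
      then have "K \<subseteq> ?I" using sub by blast
      moreover have "a \<notin> ?I" "b \<notin> ?I" by auto
      ultimately show "a \<notin> K \<and> b \<notin> K" by blast
    next
      show "C \<subseteq> L" using C(1) OL by (rule subset_trans)
    qed (fact C(2), fact C(3), fact ne)
    moreover have "\<Union>C \<noteq> ?I"
    proof
      assume eq: "\<Union>C = ?I"
      \<comment> \<open>A finite subset of the union of a chain lies in a single member, which
        \<open>F(4)\<close> forbids.\<close>
      have "\<exists>K\<in>C. F \<subseteq> K" using F(1,3,2)
      proof (induction F rule: finite_ne_induct)
        case (singleton x) then show ?case using eq by blast
      next
        case (insert x F)
        then have "F \<subseteq> ?I" "x \<in> \<Union>C" unfolding eq by simp_all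
        then obtain K K' where K: "K \<in> C" "F \<subseteq> K" "K' \<in> C" "x \<in> K'" using insert.hyps insert.IH by (metis UnionE)
        then have "insert x F \<subseteq> K \<or> insert x F \<subseteq> K'" using C(3)[OF K(1,3)] by auto
        then show ?case using K(1,3) by auto
      qed
      then show False using F(4) sub C(1) OL by blast
    qed
    ultimately show ?thesis using sub unfolding Or_def by blast
  qed
  define G where "G = {M \<in> Or. \<forall>N\<in>Or. M \<subseteq> N --> N = M}"
  have G: "isgap L G" unfolding G_def by (rule gap_construct(1)[OF OL cov nd ch])
  have "N = ?D" if N: "N \<in> Or" "?D \<subseteq> N" for N
  proof -
    obtain x where "x \<in> ?D" using in_ne[OF D] by blast
    then have "x \<in> N" "x \<notin> ?I" using N dis by blast+
    then have "N \<subseteq> ?D" using N(1) unfolding Or_def by blast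
    then show ?thesis using N(2) by blast
  qed
  then have DG: "?D \<in> G" unfolding G_def using D unfolding Or_def by blast
  have IG: "?I \<notin> G" using dis in_ne[OF ab] unfolding G_def Or_def by blast
  have nl: "nlg L G"
  proof (rule ccontr)
    assume "\<not> nlg L G"
    then obtain J where J: "J \<in> L" "G = {J, co J}" using G unfolding nlg_def by blast
    then have "?D = J \<or> ?D = co J" using DG by blast
    then have "co ?D \<in> G" using J co_co by auto
    then show False using IG ne by simp
  qed
  have nf: "\<not> F \<subseteq> K" if K: "K \<in> G" for K
  proof
    assume FK: "F \<subseteq> K"
    have "K \<in> Or" using K unfolding G_def by simp
    then have KL: "K \<in> L" "K \<subseteq> ?D \<or> K \<subset> ?I" unfolding Or_def by simp_all
    obtain x where x: "x \<in> F" using F(3) by auto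
    then have "x \<notin> ?D" using F(2) dis by auto
    then have "\<not> K \<subseteq> ?D" using x FK by auto
    then show False using F(4)[OF KL(1) _ FK] KL(2) by simp
  qed
  show ?thesis by (intro exI[of _ G] conjI ballI nl DG nf)
qed

end

definition sep3 :: "circ \<Rightarrow> circ \<Rightarrow> circ \<Rightarrow> circ set \<Rightarrow> bool" where
  "sep3 x y z M \<longleftrightarrow> \<not> (x \<in> M \<and> y \<in> M) \<and> \<not> (x \<in> M \<and> z \<in> M) \<and> \<not> (y \<in> M \<and> z \<in> M)"

text \<open>Indexing by all integers treats both kinds of gaps alike: the enumeration is periodic
  for a polygon and injective for a crown, whose extra vertex is left out of it.\<close>

definition gseq :: "circ set set \<Rightarrow> (int \<Rightarrow> circ) \<Rightarrow> bool" where
  "gseq \<G> v \<longleftrightarrow> \<G> = range (\<lambda>k. oarc (v k) (v (k + 1))) \<and> (\<forall>k. v k \<noteq> v (k + 1)) \<and>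
    ((\<exists>n\<ge>2. verts \<G> = range v \<and> inj_on v {0..<n} \<and> (\<forall>k. v (k + n) = v k)) \<or>
     (\<exists>p. verts \<G> = insert p (range v) \<and> p \<notin> range v \<and> inj v \<and> pivot \<G> p))"

context lam
begin

text \<open>Turn every leaf away from \<open>b\<close>. If all leaves around \<open>b\<close> meet
  the finite set \<open>F\<close>, the union of a chain of sides missing \<open>b\<close> also
  misses a point of this set, hence is again such a side. The resulting gap has \<open>b\<close> as
  a vertex, and \<open>b\<close> is a pivot because it is not an end point of a leaf.\<close>

lemma rainbow_or_pivot:
  assumes b: "\<not> endp L b" and np: "\<not> (\<exists>\<G>. isgap L \<G> \<and> pivot \<G> b)" and F: "finite F" "b \<notin> F"
  shows "\<exists>M\<in>L. b \<in> M \<and> M \<inter> F = {}"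
proof (rule ccontr)
  assume no: "\<not> ?thesis"
  obtain I0 where "I0 \<in> L" using nonempty by auto
  then obtain a0 b0 :: circ where "a0 \<noteq> b0" using oarcs[of I0] by blast
  then obtain c where c: "c \<noteq> b" by metis
  \<comment> \<open>A point is added to make the set non-empty; a point of it outside the union,
    together with \<open>b\<close>, gives the two missed points that the closure axiom asks
    for.\<close>
  define F' where "F' = insert c F"
  have F': "finite F'" "b \<notin> F'" "F' \<noteq> {}" "\<And>M. M \<in> L ==> b \<in> M ==> M \<inter> F' \<noteq> {}"
    using F c no unfolding F'_def by auto
  define Or where "Or = {M \<in> L. b \<notin> M}"
  have OL: "Or \<subseteq> L" unfolding Or_def by simp
  have cov: "I \<in> Or \<or> co I \<in> Or" if "I \<in> L" for I
    using that co_disj[OF that] co_in[OF that] unfolding Or_def by auto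
  have nd: "I \<subseteq> J \<or> J \<subseteq> I \<or> I \<inter> J = {}" if "I \<in> Or" "J \<in> Or" for I J
  proof (cases "I \<inter> J = {}")
    case False
    then obtain x where x: "x \<in> I" "x \<in> J" by auto
    have "I \<in> L" "J \<in> L" "b \<notin> I" "b \<notin> J" using that unfolding Or_def by auto
    then show ?thesis using nested'[of I J x b] x b by auto
  qed simp
  have ch: "\<exists>U\<in>Or. \<Union>C \<subseteq> U" if C: "C \<subseteq> Or" "C \<noteq> {}" "\<And>I J. I \<in> C ==> J \<in> C ==> I \<subseteq> J \<or> J \<subseteq> I" for C
  proof -
    have nF: "\<not> F' \<subseteq> \<Union>C"
    proof
      assume sub: "F' \<subseteq> \<Union>C"
      have "\<exists>K\<in>C. F' \<subseteq> K" using F'(1,3) sub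
      proof (induction F' rule: finite_ne_induct)
        case (singleton x) then show ?case by auto
      next
        case (insert x F)
        then obtain K K' where "K \<in> C" "F \<subseteq> K" "K' \<in> C" "x \<in> K'" by auto
        then show ?case using C(3)[of K K'] by auto
      qed
      then obtain K where K: "K \<in> C" "F' \<subseteq> K" by auto
      then have KL: "K \<in> L" "b \<notin> K" using C(1) unfolding Or_def by auto
      then have "b \<in> co K" using in_or_co[OF KL(1) b] by simp
      then have "co K \<inter> F' \<noteq> {}" using F'(4) co_in[OF KL(1)] by simp
      then show False using co_disj[OF KL(1)] K by auto
    qed
    then obtain f where f: "f \<in> F'" "f \<notin> \<Union>C" by auto
    have bC: "b \<notin> \<Union>C" using C(1) unfolding Or_def by auto
    have "\<Union>C \<in> L"
    proof (rule sup[of C b f])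
      show "C \<subseteq> L" using C(1) OL by (rule subset_trans)
      show "b \<noteq> f" using f F' by auto
      show "b \<notin> K \<and> f \<notin> K" if "K \<in> C" for K using that f bC by auto
    qed (fact C(2), fact C(3))
    then show ?thesis using bC unfolding Or_def by auto
  qed
  define G where "G = {M \<in> Or. \<forall>N\<in>Or. M \<subseteq> N --> N = M}"
  have G: "isgap L G" unfolding G_def by (rule gap_construct(1)[OF OL cov nd ch])
  have "b \<in> verts G" unfolding verts_def G_def Or_def by auto
  moreover have "b \<noteq> x \<and> b \<noteq> y" if "oarc x y \<in> G" for x y
    using gap_in[OF G that] endp1 endp2 b by auto
  ultimately have "pivot G b" unfolding pivot_def by auto
  then show False using np G by auto
qed

text \<open>Choose the side of each leaf that contains at most one of the three points. A union of a
  chain of such sides again contains at most one of them, so two points remain outside.\<close>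

lemma median_gap:
  assumes w: "x \<noteq> y" "x \<noteq> z" "y \<noteq> z" and e: "\<not> endp L x" "\<not> endp L y" "\<not> endp L z"
  shows "\<exists>\<G>. isgap L \<G> \<and> (\<forall>M\<in>\<G>. sep3 x y z M)"
proof -
  define Or where "Or = {M \<in> L. sep3 x y z M}"
  have OL: "Or \<subseteq> L" unfolding Or_def by simp
  have cov: "I \<in> Or \<or> co I \<in> Or" if "I \<in> L" for I
    using co_disj[OF that] co_in[OF that] that unfolding Or_def sep3_def by auto
  have nd: "I \<subseteq> J \<or> J \<subseteq> I \<or> I \<inter> J = {}" if "I \<in> Or" "J \<in> Or" for I J
  proof -
    have IJ: "I \<in> L" "J \<in> L" "sep3 x y z I" "sep3 x y z J" using that unfolding Or_def by auto
    have "\<not> co I \<subseteq> J" using IJ(3,4) in_co_iff[OF IJ(1)] e unfolding sep3_def by blast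
    then show ?thesis using four[OF IJ(1,2)] by simp
  qed
  have ch: "\<exists>U\<in>Or. \<Union>C \<subseteq> U" if C: "C \<subseteq> Or" "C \<noteq> {}" "\<And>I J. I \<in> C ==> J \<in> C ==> I \<subseteq> J \<or> J \<subseteq> I" for C
  proof -
    have no: "\<not> (u \<in> \<Union>C \<and> v \<in> \<Union>C)" if uv: "\<And>M. sep3 x y z M ==> \<not> (u \<in> M \<and> v \<in> M)" for u v
    proof
      assume "u \<in> \<Union>C \<and> v \<in> \<Union>C"
      then obtain K K' where K: "K \<in> C" "u \<in> K" "K' \<in> C" "v \<in> K'" by auto
      then obtain K'' where "K'' \<in> C" "u \<in> K''" "v \<in> K''" using C(3)[of K K'] by auto
      then show False using uv[of K''] C(1) unfolding Or_def by auto
    qed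
    have s: "sep3 x y z (\<Union>C)" using no[of x y] no[of x z] no[of y z] unfolding sep3_def by simp
    then obtain u v where uv: "u \<noteq> v" "u \<notin> \<Union>C" "v \<notin> \<Union>C" using w unfolding sep3_def by metis
    have "\<Union>C \<in> L"
    proof (rule sup[of C u v])
      show "C \<subseteq> L" using C(1) OL by (rule subset_trans)
      show "u \<notin> K \<and> v \<notin> K" if "K \<in> C" for K using that uv by auto
    qed (fact C(2), fact C(3), fact uv(1))
    then show ?thesis using s unfolding Or_def by auto
  qed
  have "isgap L {M \<in> Or. \<forall>N\<in>Or. M \<subseteq> N --> N = M}" by (rule gap_construct(1)[OF OL cov nd ch])
  then show ?thesis unfolding Or_def by (intro exI conjI) (assumption, simp)
qed

text \<open>The complement of a side with at most one of the three points contains at least two of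
  them and does not fit into another such side. Hence each element of one gap lies in an element of
  the other, and disjointness forces equality. Uniqueness is what makes constructions with this gap
  invariant under automorphisms.\<close>

lemma median_unique:
  assumes e: "\<not> endp L x" "\<not> endp L y" "\<not> endp L z"
    and G: "isgap L \<G>" "\<And>M. M \<in> \<G> ==> sep3 x y z M" and H: "isgap L \<H>" "\<And>M. M \<in> \<H> ==> sep3 x y z M"
  shows "\<G> \<subseteq> \<H>"
proof
  have sub: "M \<subseteq> N \<or> \<not> (M \<subseteq> N \<or> co M \<subseteq> N)" if "M \<in> L" "sep3 x y z M" "sep3 x y z N" for M N
    using that in_co_iff[OF that(1)] e unfolding sep3_def by blast
  fix M assume M: "M \<in> \<G>"
  have MinL: "M \<in> L" using gap_in[OF G(1) M] .
  obtain N where N: "N \<in> \<H>" "M \<subseteq> N \<or> co M \<subseteq> N" using gap_lies[OF H(1) MinL] by auto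
  have MN: "M \<subseteq> N" using sub[OF MinL G(2)[OF M] H(2)[OF N(1)]] N(2) by simp
  have NL: "N \<in> L" using gap_in[OF H(1) N(1)] .
  obtain M' where M': "M' \<in> \<G>" "N \<subseteq> M' \<or> co N \<subseteq> M'" using gap_lies[OF G(1) NL] by auto
  have NM: "N \<subseteq> M'" using sub[OF NL H(2)[OF N(1)] G(2)[OF M'(1)]] M'(2) by simp
  obtain u where "u \<in> M" using in_ne[OF MinL] by auto
  then have "M = M'" using gap_disj[OF G(1) M M'(1), of u] MN NM by auto
  then show "M \<in> \<H>" using MN NM N(1) by simp
qed

lemma gap_next:
  assumes G: "isgap L \<G>" and ab: "a \<in> verts \<G>" "b \<in> verts \<G>" "a \<noteq> b" "oarc a b \<inter> verts \<G> = {}"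
  shows "oarc a b \<in> \<G>"
proof -
  obtain z where z: "cyc a z b" using cyc_dense[OF ab(3)] .
  then have "z \<notin> verts \<G>" using ab(4) by auto
  then obtain c d where cd: "c \<noteq> d" "oarc c d \<in> \<G>" "cyc c z d" "c \<in> verts \<G>" "d \<in> verts \<G>"
    by (rule verts_cases[OF G])
  have 1: "\<not> cyc a c b" "\<not> cyc a d b" using ab(4) cd(4,5) by auto
  have 2: "\<not> cyc c a d" "\<not> cyc c b d" using ab(1,2) cd(2) unfolding verts_def by auto
  have "a = c \<and> b = d" using 1 2 z cd(1,3) ab(3) unfolding cyc_ang circ_eq_iff by (smt (z3))
  then show ?thesis using cd by simp
qed

lemma gap_start: assumes G: "isgap L \<G>" and "oarc a b \<in> \<G>" "oarc a c \<in> \<G>" shows "b = c"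
proof -
  have ne: "a \<noteq> b" "a \<noteq> c" using assms gap_in[OF G] ne_oarc by auto
  obtain x where x: "cyc a x b" using cyc_dense[OF ne(1)] .
  obtain y where y: "cyc a y c" using cyc_dense[OF ne(2)] .
  have "cyc a x c \<or> cyc a y b" using x y unfolding cyc_ang by linarith
  then have "oarc a b = oarc a c" using gap_disj[OF G assms(2,3), of x] gap_disj[OF G assms(2,3), of y] x y by auto
  then show ?thesis using oarc_eq_iff[OF ne(1)] by simp
qed

lemma gap_stop: assumes G: "isgap L \<G>" and "oarc b a \<in> \<G>" "oarc c a \<in> \<G>" shows "b = c"
proof -
  have ne: "b \<noteq> a" "c \<noteq> a" using assms gap_in[OF G] ne_oarc by auto
  obtain x where x: "cyc b x a" using cyc_dense[OF ne(1)] .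
  obtain y where y: "cyc c y a" using cyc_dense[OF ne(2)] .
  have "cyc c x a \<or> cyc b y a" using x y unfolding cyc_ang by linarith
  then have "oarc b a = oarc c a" using gap_disj[OF G assms(2,3), of x] gap_disj[OF G assms(2,3), of y] x y by auto
  then show ?thesis using oarc_eq_iff[OF ne(1)] by simp
qed

text \<open>An element of the gap near \<open>p\<close> cannot contain \<open>p\<close> or end at
  it, so one of its end points separates it from \<open>p\<close>: vertices accumulate at a pivot
  from both sides.\<close>

lemma pivot_accum:
  assumes G: "isgap L \<G>" and p: "pivot \<G> p" and z: "z \<noteq> p"
  shows "\<exists>w\<in>verts \<G>. cyc p w z" and "\<exists>w\<in>verts \<G>. cyc z w p"
proof -
  have pv: "p \<in> verts \<G>" using p unfolding pivot_def by simp
  obtain y where y: "cyc p y z" using cyc_dense[of p z] z by auto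
  show "\<exists>w\<in>verts \<G>. cyc p w z"
  proof (cases "y \<in> verts \<G>")
    case True then show ?thesis using y by auto
  next
    case False
    then obtain c d where cd: "c \<noteq> d" "oarc c d \<in> \<G>" "cyc c y d" "c \<in> verts \<G>" "d \<in> verts \<G>"
      by (rule verts_cases[OF G])
    have "p \<noteq> c" "\<not> cyc c p d" using p cd unfolding pivot_def verts_def by auto
    then have "cyc p c z" using y cd(3) unfolding cyc_ang circ_eq_iff by (smt (z3))
    then show ?thesis using cd(4) by auto
  qed
  obtain y where y: "cyc z y p" using cyc_dense[of z p] z by auto
  show "\<exists>w\<in>verts \<G>. cyc z w p"
  proof (cases "y \<in> verts \<G>")
    case True then show ?thesis using y by auto
  next
    case False
    then obtain c d where cd: "c \<noteq> d" "oarc c d \<in> \<G>" "cyc c y d" "c \<in> verts \<G>" "d \<in> verts \<G>"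
      by (rule verts_cases[OF G])
    have "p \<noteq> d" "\<not> cyc c p d" using p cd unfolding pivot_def verts_def by auto
    then have "cyc z d p" using y cd(3) unfolding cyc_ang circ_eq_iff by (smt (z3))
    then show ?thesis using cd(5) by auto
  qed
qed

lemma gap_two_verts:
  assumes G: "isgap L \<G>"
  obtains a b where "oarc a b \<in> \<G>" "a \<noteq> b" "a \<in> verts \<G>" "b \<in> verts \<G>"
proof -
  obtain I where "I \<in> L" using nonempty by auto
  then obtain J where J: "J \<in> \<G>" using gap_lies[OF G] by auto
  obtain a b where "a \<noteq> b" "J = oarc a b" using oarcs[OF gap_in[OF G J]] by auto
  then show thesis using that[of a b] J gap_verts[OF G] by simp
qed

end

section \<open>Enumerating the vertices of a gap\<close>

lemma sorted_list_cyc_succ: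
  fixes V :: "circ set"
  assumes V: "finite V" and n: "n = card V" "2 \<le> n"
  shows "\<exists>v :: int \<Rightarrow> circ. range v = V \<and> inj_on v {0..<int n} \<and> (\<forall>k. v (k + int n) = v k) \<and>
     (\<forall>k. v k \<noteq> v (k + 1) \<and> oarc (v k) (v (k + 1)) \<inter> V = {})"
proof -
  define xs where "xs = sorted_list_of_set V"
  have xs: "length xs = n" "set xs = V" "distinct xs" "sorted xs"
    using V n unfolding xs_def by (simp_all add: )
  have ss: "xs ! i < xs ! j" if "i < j" "j < n" for i j
    using sorted_nth_mono[OF xs(4), of i j] nth_eq_iff_index_eq[OF xs(3), of i j] that xs(1) by auto
  define v where "v = (\<lambda>k :: int. xs ! nat (k mod int n))"
  have idx: "nat (k mod int n) < n" for k using n(2) by (simp add: nat_less_iff)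
  have vi: "v (int i) = xs ! i" if "i < n" for i using that by (simp add: v_def)
  have per: "v (k + int n) = v k" for k by (simp add: v_def)
  have ran: "range v = V"
  proof
    have "v k \<in> set xs" for k unfolding v_def using idx[of k] xs(1) by (intro nth_mem) simp
    then show "range v \<subseteq> V" using xs(2) by auto
    show "V \<subseteq> range v"
    proof
      fix x assume "x \<in> V"
      then obtain i where "i < n" "x = xs ! i" using xs by (auto simp: in_set_conv_nth)
      then have "x = v (int i)" using vi by simp
      then show "x \<in> range v" by simp
    qed
  qed
  have inj: "inj_on v {0..<int n}"
  proof (rule inj_onI)
    fix i j assume ij: "i \<in> {0..<int n}" "j \<in> {0..<int n}" "v i = v j"
    then have "xs ! nat i = xs ! nat j" by (simp add: v_def)
    then have "nat i = nat j" using ij nth_eq_iff_index_eq[OF xs(3), of "nat i" "nat j"] xs(1) by (auto simp: nat_less_iff)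
    then show "i = j" using ij by auto
  qed
  have nxt: "v k \<noteq> v (k + 1) \<and> oarc (v k) (v (k + 1)) \<inter> V = {}" for k
  proof -
    define i where "i = nat (k mod int n)"
    have i: "i < n" unfolding i_def by (rule idx)
    have vk: "v k = xs ! i" by (simp add: v_def i_def)
    have V_ex: "\<exists>j<n. z = xs ! j" if "z \<in> V" for z using that xs by (auto simp: in_set_conv_nth)
    have imod: "k mod int n = int i" unfolding i_def using n(2) by simp
    show ?thesis
    proof (cases "i + 1 < n")
      case True
      have "(k + 1) mod int n = (k mod int n + 1) mod int n" by (simp add: mod_add_left_eq)
      also have "\<dots> = int (i + 1)" using True imod by simp
      finally have vk1: "v (k + 1) = xs ! (i + 1)" by (simp only: v_def nat_int)
      have lt: "xs ! i < xs ! (i + 1)" using ss True by simp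
      have "False" if z: "z \<in> V" "cyc (xs ! i) z (xs ! (i + 1))" for z
      proof -
        obtain j where j: "j < n" "z = xs ! j" using V_ex[OF z(1)] by auto
        have "xs ! i < z \<and> z < xs ! (i + 1)" using z(2) lt unfolding cyc_def by auto
        moreover have "j \<le> i \<or> i + 1 \<le> j" by auto
        moreover have "xs ! j \<le> xs ! i" if "j \<le> i" using sorted_nth_mono[OF xs(4) that] i xs(1) by simp
        moreover have "xs ! (i + 1) \<le> xs ! j" if "i + 1 \<le> j" using sorted_nth_mono[OF xs(4) that] j xs(1) by simp
        ultimately show False using j by auto
      qed
      then show ?thesis using lt vk vk1 by auto
    next
      case False
      then have i': "i = n - 1" using i by simp
      have "(k + 1) mod int n = (k mod int n + 1) mod int n" by (simp add: mod_add_left_eq)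
      also have "\<dots> = 0" using imod i' n(2) by simp
      finally have vk1: "v (k + 1) = xs ! 0" by (simp only: v_def nat_0)
      have lt: "xs ! 0 < xs ! i" using ss[of 0 i] i' n(2) by simp
      have "False" if z: "z \<in> V" "cyc (xs ! i) z (xs ! 0)" for z
      proof -
        obtain j where j: "j < n" "z = xs ! j" using V_ex[OF z(1)] by auto
        have "xs ! 0 \<le> z" using sorted_nth_mono[OF xs(4), of 0 j] j xs(1) by simp
        moreover have "z \<le> xs ! i" using sorted_nth_mono[OF xs(4), of j i] j i' i xs(1) by simp
        ultimately show False using z(2) lt unfolding cyc_def by auto
      qed
      then show ?thesis using lt vk vk1 by auto
    qed
  qed
  show ?thesis using ran inj per nxt by (intro exI[of _ v]) simp
qed

locale qlam = lam +
  assumes quite_full: "isgap L \<G> ==> finite (verts \<G>) \<or>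
      (\<exists>(t :: int \<Rightarrow> circ) p. (\<forall>k. p \<noteq> t k) \<and> \<G> = {oarc (t k) (t (k + 1)) | k. True} \<and> verts \<G> = range t \<union> {p})"
    and loose: "nlg L \<G> ==> nlg L \<H> ==> x \<in> verts \<G> ==> x \<in> verts \<H> ==> \<G> = \<H>"
begin

lemma gap_seq_finite:
  assumes G: "isgap L \<G>" and fin: "finite (verts \<G>)"
  shows "\<exists>(v :: int \<Rightarrow> circ) n. \<G> = range (\<lambda>k. oarc (v k) (v (k + 1))) \<and> (\<forall>k. v k \<noteq> v (k + 1)) \<and>
    2 \<le> n \<and> verts \<G> = range v \<and> inj_on v {0..<n} \<and> (\<forall>k. v (k + n) = v k)"
proof -
  obtain a b where ab: "oarc a b \<in> \<G>" "a \<noteq> b" "a \<in> verts \<G>" "b \<in> verts \<G>" by (rule gap_two_verts[OF G])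
  have "card {a, b} \<le> card (verts \<G>)" using ab by (intro card_mono fin) auto
  then have n: "2 \<le> card (verts \<G>)" using ab(2) by simp
  obtain v :: "int \<Rightarrow> circ" where v: "range v = verts \<G>" "inj_on v {0..<int (card (verts \<G>))}"
     "\<forall>k. v (k + int (card (verts \<G>))) = v k" "\<forall>k. v k \<noteq> v (k + 1) \<and> oarc (v k) (v (k + 1)) \<inter> verts \<G> = {}"
    using sorted_list_cyc_succ[OF fin HOL.refl n] by auto
  have el: "oarc (v k) (v (k + 1)) \<in> \<G>" for k
    using gap_next[OF G, of "v k" "v (k + 1)"] v(1,4) by auto
  have "\<G> = range (\<lambda>k. oarc (v k) (v (k + 1)))"
  proof
    show "range (\<lambda>k. oarc (v k) (v (k + 1))) \<subseteq> \<G>" using el by auto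
    show "\<G> \<subseteq> range (\<lambda>k. oarc (v k) (v (k + 1)))"
    proof
      fix J assume J: "J \<in> \<G>"
      obtain c d where cd: "c \<noteq> d" "J = oarc c d" using oarcs[OF gap_in[OF G J]] by auto
      have "c \<in> verts \<G>" using gap_verts(1)[OF G] J cd by simp
      then obtain k where k: "c = v k" using v(1) by auto
      have "d = v (k + 1)" using gap_start[OF G, of c d "v (k + 1)"] J cd(2) el[of k] k by simp
      then show "J \<in> range (\<lambda>k. oarc (v k) (v (k + 1)))" using cd k by auto
    qed
  qed
  then show ?thesis using v n by (intro exI[of _ v] exI[of _ "int (card (verts \<G>))"] conjI) simp_all
qed

text \<open>The enumeration in the definition of a crown is not given as injective. A repeated value
  would make it periodic, since every enumerated vertex is the start of one element and the end of
  one element, and then there would be only finitely many vertices.\<close>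

lemma gap_seq:
  assumes G: "isgap L \<G>" shows "\<exists>v. gseq \<G> v"
proof (cases "finite (verts \<G>)")
  case True
  show ?thesis using gap_seq_finite[OF G True] unfolding gseq_def by blast
next
  case False
  then obtain t :: "int \<Rightarrow> circ" and p where t: "\<And>k. p \<noteq> t k" "\<G> = {oarc (t k) (t (k + 1)) | k. True}"
    "verts \<G> = range t \<union> {p}" using quite_full[OF G] by auto
  have el: "oarc (t k) (t (k + 1)) \<in> \<G>" for k using t(2) by auto
  have ne: "t k \<noteq> t (k + 1)" for k using gap_in[OF G el] ne_oarc by simp
  have up: "t (i + int k) = t (j + int k)" if "t i = t j" for i j k
  proof (induction k)
    case (Suc k)
    have "t (i + int k + 1) = t (j + int k + 1)"
      using gap_start[OF G el[of "i + int k"]] el[of "j + int k"] Suc by simp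
    then show ?case by (simp add: ac_simps)
  qed (use that in simp)
  have dn: "t (i - int k) = t (j - int k)" if "t i = t j" for i j k
  proof (induction k)
    case (Suc k)
    have "t (i - int (Suc k)) = t (j - int (Suc k))"
      using gap_stop[OF G, of "t (i - int (Suc k))" "t (i - int k)" "t (j - int (Suc k))"]
         el[of "i - int (Suc k)"] el[of "j - int (Suc k)"] Suc by simp
    then show ?case .
  qed (use that in simp)
  have "inj t"
  proof (rule ccontr)
    assume "\<not> inj t"
    then obtain i j where ij: "t i = t j" "i < j" unfolding inj_def by (metis linorder_neqE)
    have per: "t (k + (j - i)) = t k" for k
    proof (cases "i \<le> k")
      case True
      then show ?thesis using up[OF ij(1), of "nat (k - i)"] by (simp add: algebra_simps)
    next
      case False
      then show ?thesis using dn[OF ij(1), of "nat (i - k)"] by (simp add: algebra_simps)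
    qed
    have per2: "t (k + int m * (j - i)) = t k" for k m
    proof (induction m)
      case (Suc m)
      have "t (k + int (Suc m) * (j - i)) = t (k + int m * (j - i) + (j - i))" by (simp add: algebra_simps)
      then show ?case using per Suc by simp
    qed simp
    have "t k \<in> t ` {0..<j - i}" for k
    proof -
      have m0: "0 \<le> k mod (j - i)" "k mod (j - i) < j - i" using ij(2) by simp_all
      have dm: "k mod (j - i) + k div (j - i) * (j - i) = k" by (rule mod_div_mult_eq)
      have "t k = t (k mod (j - i))"
      proof (cases "0 \<le> k div (j - i)")
        case True
        then show ?thesis using per2[of "k mod (j - i)" "nat (k div (j - i))"] dm by simp
      next
        case False
        then have "k + int (nat (- (k div (j - i)))) * (j - i) = k mod (j - i)"
          using dm by (simp add: algebra_simps)
        then show ?thesis using per2[of k "nat (- (k div (j - i)))"] by simp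
      qed
      then show ?thesis using m0 by auto
    qed
    then have "range t \<subseteq> t ` {0..<j - i}" by auto
    then have "finite (verts \<G>)" using t(3) finite_subset[of "range t" "t ` {0..<j - i}"] by simp
    then show False using False by simp
  qed
  moreover have "pivot \<G> p" unfolding pivot_def
  proof (intro conjI allI impI)
    show "p \<in> verts \<G>" using t(3) by simp
    fix a b assume "a \<noteq> b" "oarc a b \<in> \<G>"
    then obtain k where "a = t k" "b = t (k + 1)" using t(2) oarc_eq_iff[of a b] by auto
    then show "p \<noteq> a" "p \<noteq> b" using t(1) by auto
  qed
  ultimately show ?thesis unfolding gseq_def using t ne
    by (intro exI[of _ t] conjI disjI2 exI[of _ p] allI) auto
qed

lemma gseq_el: "gseq \<G> v ==> oarc (v k) (v (k + 1)) \<in> \<G>"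
  unfolding gseq_def by auto

lemma gseq_cases: assumes "isgap L \<G>" "gseq \<G> v" "oarc a b \<in> \<G>" shows "\<exists>k. a = v k \<and> b = v (k + 1)"
proof -
  have "a \<noteq> b" using ne_oarc[OF gap_in[OF assms(1,3)]] .
  moreover have "\<G> = range (\<lambda>k. oarc (v k) (v (k + 1)))" using assms(2) unfolding gseq_def by (rule conjunct1)
  then obtain k where "oarc a b = oarc (v k) (v (k + 1))" using assms(3) by auto
  ultimately show ?thesis using oarc_eq_iff[of a b] by auto
qed

lemma gseq_vert: "gseq \<G> v ==> x \<in> verts \<G> ==> pivot \<G> x \<or> x \<in> range v"
  unfolding gseq_def by auto

lemma gseq_no_pivot: assumes v: "gseq \<G> v" and p: "pivot \<G> p" shows "p \<notin> range v"
proof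
  assume "p \<in> range v"
  then obtain k where k: "p = v k" by auto
  have "v k \<noteq> v (k + 1)" using v unfolding gseq_def by simp
  then show False using p gseq_el[OF v, of k] k unfolding pivot_def by blast
qed

lemma pivot_unique:
  assumes G: "isgap L \<G>" and "pivot \<G> p" "pivot \<G> q" shows "p = q"
proof -
  obtain v where v: "gseq \<G> v" using gap_seq[OF G] by auto
  have no: "p \<notin> range v" "q \<notin> range v" using gseq_no_pivot[OF v] assms by auto
  have "p \<in> verts \<G>" "q \<in> verts \<G>" using assms unfolding pivot_def by auto
  then show ?thesis using v no unfolding gseq_def by auto
qed

end

section \<open>Automorphisms\<close>

definition cycauto :: "(circ \<Rightarrow> circ) \<Rightarrow> bool" where
  "cycauto g \<longleftrightarrow> bij g \<and> (\<forall>x y z. cyc (g x) (g y) (g z) \<longleftrightarrow> cyc x y z)"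

definition auto_on :: "circ set set \<Rightarrow> (circ \<Rightarrow> circ) \<Rightarrow> bool" where
  "auto_on L g \<longleftrightarrow> cycauto g \<and> (\<forall>a b. oarc (g a) (g b) \<in> L \<longleftrightarrow> oarc a b \<in> L)"

lemma cycauto_cyc: "cycauto g ==> cyc (g x) (g y) (g z) \<longleftrightarrow> cyc x y z"
  by (simp add: cycauto_def)

lemma cycauto_eq: "cycauto g ==> g x = g y \<longleftrightarrow> x = y"
  by (auto simp: cycauto_def bij_def inj_def)

lemma cycauto_surj: "cycauto g ==> \<exists>x. y = g x"
  by (auto simp: cycauto_def bij_def surj_def)

lemma cycauto_inv: assumes g: "cycauto g" shows "cycauto (inv_into UNIV g)" "g (inv_into UNIV g x) = x" "inv_into UNIV g (g x) = x"
proof -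
  have b: "bij g" using g by (simp add: cycauto_def)
  show 1: "g (inv_into UNIV g x) = x" for x using b by (simp add: bij_def surj_f_inv_f)
  show 2: "inv_into UNIV g (g x) = x" for x using b by (simp add: bij_def inv_f_f)
  show "cycauto (inv_into UNIV g)" unfolding cycauto_def
  proof (intro conjI allI)
    show "bij (inv_into UNIV g)" using b by (rule bij_imp_bij_inv)
    show "cyc (inv_into UNIV g x) (inv_into UNIV g y) (inv_into UNIV g z) = cyc x y z" for x y z
      using cycauto_cyc[OF g, of "inv_into UNIV g x" "inv_into UNIV g y" "inv_into UNIV g z"] 1 by simp
  qed
qed

lemma cycauto_comp: "cycauto f ==> cycauto g ==> cycauto (f \<circ> g)"
  unfolding cycauto_def by (auto intro: bij_comp)

lemma cycauto_image: assumes g: "cycauto g" shows "g ` oarc a b = oarc (g a) (g b)"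
proof
  show "g ` oarc a b \<subseteq> oarc (g a) (g b)" using cycauto_cyc[OF g] by auto
  show "oarc (g a) (g b) \<subseteq> g ` oarc a b"
  proof
    fix y assume y: "y \<in> oarc (g a) (g b)"
    obtain x where "y = g x" using cycauto_surj[OF g] by auto
    then show "y \<in> g ` oarc a b" using y cycauto_cyc[OF g] by auto
  qed
qed

lemma auto_on_cyc: "auto_on L g ==> cycauto g"
  by (simp add: auto_on_def)

lemma auto_on_inv: assumes "auto_on L g" shows "auto_on L (inv_into UNIV g)"
proof -
  have g: "cycauto g" using assms by (rule auto_on_cyc)
  have "oarc (inv_into UNIV g a) (inv_into UNIV g b) \<in> L \<longleftrightarrow> oarc a b \<in> L" for a b
    using assms cycauto_inv[OF g] unfolding auto_on_def by metis
  then show ?thesis using cycauto_inv(1)[OF g] unfolding auto_on_def by simp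
qed

lemma auto_on_comp: "auto_on L f ==> auto_on L g ==> auto_on L (f \<circ> g)"
  unfolding auto_on_def using cycauto_comp by auto

lemma auto_on_id: "auto_on L id" "cycauto id"
  unfolding auto_on_def cycauto_def by auto

lemma auto_on_funpow: "auto_on L g ==> auto_on L (g ^^ n)"
  by (induction n) (auto simp: auto_on_id(1) intro: auto_on_comp)

lemma image_fixed_arc:
  assumes "cycauto g" "a \<noteq> b" shows "g ` oarc a b = oarc a b \<longleftrightarrow> g a = a \<and> g b = b"
proof -
  have "g a \<noteq> g b" using assms cycauto_eq by auto
  then show ?thesis unfolding cycauto_image[OF assms(1)] using oarc_eq_iff by blast
qed

section \<open>Action of automorphisms on leaves and gaps\<close>

context lam
begin

lemma image_in: "auto_on L g ==> g ` I \<in> L \<longleftrightarrow> I \<in> L"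
proof
  assume g: "auto_on L g"
  have gc: "cycauto g" using g by (rule auto_on_cyc)
  { assume "I \<in> L"
    then obtain a b where "a \<noteq> b" "I = oarc a b" using oarcs by blast
    then show "g ` I \<in> L" using g \<open>I \<in> L\<close> unfolding auto_on_def by (simp add: cycauto_image) }
  { assume i: "g ` I \<in> L"
    then obtain a b where ab: "a \<noteq> b" "g ` I = oarc a b" using oarcs by blast
    have "inv_into UNIV g ` (g ` I) = I" using cycauto_inv(3)[OF gc] by (auto simp: image_image)
    then have "I = oarc (inv_into UNIV g a) (inv_into UNIV g b)" using ab cycauto_image[OF cycauto_inv(1)[OF gc]] by simp
    then show "I \<in> L" using auto_on_inv[OF g] i ab unfolding auto_on_def by simp }
qed

lemma co_image: assumes "auto_on L g" "I \<in> L" shows "co (g ` I) = g ` co I"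
proof -
  have gc: "cycauto g" using assms by (auto simp: auto_on_def)
  obtain a b where ab: "a \<noteq> b" "I = oarc a b" "oarc a b \<in> L" "co I = oarc b a" "oarc b a \<in> L"
    by (rule L_cases[OF assms(2)])
  have "g a \<noteq> g b" using ab cycauto_eq[OF gc] by simp
  then show ?thesis unfolding ab(4) unfolding ab(2) by (simp add: cycauto_image[OF gc])
qed

lemma endp_image: assumes "auto_on L g" shows "endp L (g x) \<longleftrightarrow> endp L x"
proof
  have gc: "cycauto g" using assms by (auto simp: auto_on_def)
  show "endp L x ==> endp L (g x)" using assms unfolding endp_def auto_on_def by auto
  assume "endp L (g x)"
  then obtain y where y: "oarc (g x) y \<in> L" unfolding endp_def by auto
  obtain z where "y = g z" using cycauto_surj[OF gc] by auto
  then show "endp L x" using assms y unfolding endp_def auto_on_def by auto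
qed

lemma inj_auto: "auto_on L g ==> inj g"
  by (simp add: auto_on_def cycauto_def bij_def)

lemma verts_image: assumes "auto_on L g" shows "verts ((`) g ` \<G>) = g ` verts \<G>"
proof -
  have "bij g" using assms by (simp add: auto_on_def cycauto_def)
  then have "g ` (- \<Union>\<G>) = - g ` \<Union>\<G>" by (rule bij_image_Compl_eq)
  then show ?thesis unfolding verts_def by (auto simp: image_Union)
qed

lemma gap_image: assumes g: "auto_on L g" and G: "isgap L \<G>" shows "isgap L ((`) g ` \<G>)"
  unfolding isgap_def
proof (intro conjI ballI impI)
  show "(`) g ` \<G> \<subseteq> L" using image_in[OF g] gap_in[OF G] by auto
  fix I J assume "I \<in> (`) g ` \<G>" "J \<in> (`) g ` \<G>" "I \<noteq> J"
  then obtain I' J' where IJ: "I = g ` I'" "J = g ` J'" "I' \<in> \<G>" "J' \<in> \<G>" "I' \<noteq> J'" by auto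
  then have "I' \<inter> J' = {}" using G unfolding isgap_def by simp
  then show "I \<inter> J = {}" unfolding IJ(1,2) image_Int[OF inj_auto[OF g], symmetric] by simp
next
  fix I assume I: "I \<in> L"
  have gc: "cycauto g" using g by (rule auto_on_cyc)
  define I' where "I' = inv_into UNIV g ` I"
  have I': "I = g ` I'" using cycauto_inv(2)[OF gc] unfolding I'_def by (simp add: image_image)
  then have "I' \<in> L" using I image_in[OF g] by simp
  then obtain J where J: "J \<in> \<G>" "I' \<subseteq> J \<or> co I' \<subseteq> J" using gap_lies[OF G] by auto
  have "I \<subseteq> g ` J \<or> co I \<subseteq> g ` J" using J(2) co_image[OF g \<open>I' \<in> L\<close>] I' by auto
  then show "\<exists>J\<in>(`) g ` \<G>. I \<subseteq> J \<or> co I \<subseteq> J" using J(1) by auto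
qed

lemma image_inj_eq: "auto_on L g ==> g ` A = g ` B \<longleftrightarrow> A = B"
  using inj_auto inj_image_eq_iff by metis

lemma nlg_image: assumes g: "auto_on L g" and G: "nlg L \<G>" shows "nlg L ((`) g ` \<G>)"
  unfolding nlg_def
proof
  show "isgap L ((`) g ` \<G>)" using gap_image[OF g nlg_gap[OF G]] .
  show "\<not> (\<exists>I\<in>L. (`) g ` \<G> = {I, co I})"
  proof
    assume "\<exists>I\<in>L. (`) g ` \<G> = {I, co I}"
    then obtain I where I: "I \<in> L" "(`) g ` \<G> = {I, co I}" by auto
    then obtain I' where I': "I = g ` I'" "I' \<in> \<G>" by (metis imageE insertI1)
    have L': "I' \<in> L" using gap_in[OF nlg_gap[OF G] I'(2)] .
    have "(`) g ` \<G> = (`) g ` {I', co I'}" using I co_image[OF g L'] I' by simp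
    moreover have "inj ((`) g)" using image_inj_eq[OF g] by (auto simp: inj_def)
    ultimately have "\<G> = {I', co I'}" using inj_image_eq_iff[of "(`) g" \<G> "{I', co I'}"] by simp
    then show False using G L' unfolding nlg_def by auto
  qed
qed

lemma fixed_mem: assumes "cycauto g" "g x = x" shows "x \<in> g ` I \<longleftrightarrow> x \<in> I"
  using assms cycauto_eq[OF assms(1), of x] by (metis imageE image_eqI)

lemma fixed_co: "auto_on L g ==> I \<in> L ==> g ` I = I ==> g ` co I = co I"
  using co_image by metis

lemma nonleaf_pivot: assumes "isgap L \<G>" "pivot \<G> p" shows "nlg L \<G>"
proof (rule ccontr)
  assume "\<not> nlg L \<G>"
  then obtain I where I: "I \<in> L" "\<G> = {I, co I}" using assms(1) unfolding nlg_def by auto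
  obtain a b where ab: "a \<noteq> b" "I = oarc a b" "oarc a b \<in> L" "co I = oarc b a" "oarc b a \<in> L"
    by (rule L_cases[OF I(1)])
  have "\<G> = {oarc a b, oarc b a}" using I(2) ab by simp
  then have "p \<notin> oarc a b" "p \<notin> oarc b a" "p \<noteq> a" "p \<noteq> b" using assms(2) ab(1) unfolding pivot_def verts_def by auto
  then show False using mem_co_cases[OF ab(1), of p] by simp
qed

end

context qlam
begin

text \<open>By looseness a non-leaf gap is determined by any one of its vertices.\<close>

lemma nlg_stable:
  assumes "auto_on L g" "nlg L \<G>" "w \<in> verts \<G>" "g w \<in> verts \<G>"
  shows "(`) g ` \<G> = \<G>"
  using loose[OF nlg_image[OF assms(1,2)] assms(2), of "g w"] assms(3,4) verts_image[OF assms(1)] by simp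

text \<open>At each enumerated vertex one element starts and one ends, so the image of a single
  vertex determines the images of its neighbours in both directions.\<close>

lemma gap_shift:
  assumes g: "auto_on L g" and G: "isgap L \<G>" and st: "(`) g ` \<G> = \<G>" and v: "gseq \<G> v"
    and st0: "g (v i) = v j"
  shows "g (v (i + k)) = v (j + k)"
proof -
  have gc: "cycauto g" using g by (rule auto_on_cyc)
  have img: "oarc (g (v m)) (g (v (m + 1))) \<in> \<G>" for m
  proof -
    have "g ` oarc (v m) (v (m + 1)) \<in> (`) g ` \<G>" using gseq_el[OF v] by simp
    then show ?thesis unfolding st cycauto_image[OF gc] .
  qed
  have up: "g (v (i + int n)) = v (j + int n)" for n
  proof (induction n)
    case (Suc n)
    have "g (v (i + int n + 1)) = v (j + int n + 1)"
      using gap_start[OF G img[of "i + int n"], of "v (j + int n + 1)"] gseq_el[OF v, of "j + int n"] Suc by simp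
    then show ?case by (simp add: ac_simps)
  qed (simp add: st0)
  have dn: "g (v (i - int n)) = v (j - int n)" for n
  proof (induction n)
    case (Suc n)
    have "g (v (i - int (Suc n))) = v (j - int (Suc n))"
      using gap_stop[OF G img[of "i - int (Suc n)"], of "v (j - int (Suc n))"] gseq_el[OF v, of "j - int (Suc n)"] Suc by simp
    then show ?case .
  qed (simp add: st0)
  show ?thesis
  proof (cases "0 \<le> k")
    case True then show ?thesis using up[of "nat k"] by simp
  next
    case False then show ?thesis using dn[of "nat (- k)"] by simp
  qed
qed

lemma gap_maps_seq:
  assumes g: "auto_on L g" and G: "isgap L \<G>" and st: "(`) g ` \<G> = \<G>" and v: "gseq \<G> v"
  shows "\<exists>r. \<forall>k. g (v k) = v (k + r)"
proof -
  have gc: "cycauto g" using g by (rule auto_on_cyc)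
  have "g ` oarc (v 0) (v (0 + 1)) \<in> (`) g ` \<G>" using gseq_el[OF v] by blast
  then have "oarc (g (v 0)) (g (v 1)) \<in> \<G>" unfolding st cycauto_image[OF gc] by simp
  then obtain j where "g (v 0) = v j" using gseq_cases[OF G v] by blast
  then have "\<forall>k. g (v k) = v (k + j)" using gap_shift[OF g G st v, of 0 j] by (simp add: add.commute)
  then show ?thesis by blast
qed

lemma pivot_fixed:
  assumes g: "auto_on L g" and G: "isgap L \<G>" and st: "(`) g ` \<G> = \<G>" and p: "pivot \<G> p"
  shows "g p = p"
proof -
  obtain v where v: "gseq \<G> v" using gap_seq[OF G] by auto
  obtain r where r: "\<And>k. g (v k) = v (k + r)" using gap_maps_seq[OF g G st v] by auto
  have "g p \<in> verts \<G>" using p st verts_image[OF g, of \<G>] unfolding pivot_def by auto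
  moreover have "g p \<notin> range v"
  proof
    assume "g p \<in> range v"
    then obtain k where "g p = v k" by auto
    then have "g p = g (v (k - r))" using r[of "k - r"] by simp
    then have "p = v (k - r)" using cycauto_eq[OF auto_on_cyc[OF g]] by simp
    then show False using gseq_no_pivot[OF v p] by auto
  qed
  ultimately have "pivot \<G> (g p)" using gseq_vert[OF v] by auto
  then show ?thesis using pivot_unique[OF G p, of "g p"] by simp
qed

lemma gap_fix:
  assumes g: "auto_on L g" and G: "isgap L \<G>" and st: "(`) g ` \<G> = \<G>" and ab: "oarc a b \<in> \<G>" "g a = a"
    and w: "w \<in> verts \<G>"
  shows "g w = w"
proof -
  obtain v where v: "gseq \<G> v" using gap_seq[OF G] by auto
  obtain i where i: "a = v i" using gseq_cases[OF G v ab(1)] by auto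
  have "pivot \<G> w \<or> w \<in> range v" using gseq_vert[OF v w] .
  then show ?thesis
  proof
    assume "w \<in> range v"
    then obtain k where "w = v k" by auto
    then show ?thesis using gap_shift[OF g G st v, of i i "k - i"] ab(2) i by simp
  qed (rule pivot_fixed[OF g G st])
qed

lemma nlg_fix:
  assumes g: "auto_on L g" and G: "nlg L \<G>" and ab: "oarc a b \<in> \<G>" "g a = a"
  shows "(`) g ` \<G> = \<G>" "w \<in> verts \<G> ==> g w = w"
proof -
  have "a \<in> verts \<G>" using gap_verts(1)[OF nlg_gap[OF G] ab(1)] .
  then show st: "(`) g ` \<G> = \<G>" using nlg_stable[OF g G] ab(2) by metis
  show "w \<in> verts \<G> ==> g w = w" using gap_fix[OF g nlg_gap[OF G] st ab] .
qed

lemma vert_ends: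
  assumes G: "isgap L \<G>" and w: "w \<in> verts \<G>" "\<not> pivot \<G> w"
  obtains a b where "oarc a w \<in> \<G>" "oarc w b \<in> \<G>"
proof -
  obtain v where v: "gseq \<G> v" using gap_seq[OF G] by auto
  then obtain k where "w = v k" using gseq_vert[OF v w(1)] w(2) by auto
  then show thesis using that[of "v (k - 1)" "v (k + 1)"] gseq_el[OF v, of "k - 1"] gseq_el[OF v, of k] by simp
qed

end

section \<open>Pairs of lamination systems\<close>

definition bd :: "circ set \<Rightarrow> circ set" where
  "bd I = {x. x \<notin> I \<and> x \<notin> co I}"

lemma bd_oarc: assumes "a \<noteq> b" shows "bd (oarc a b) = {a, b}"
  unfolding bd_def co_oarc[OF assms] using mem_co_cases[OF assms] by auto

context lam
begin

lemma bd_co: "I \<in> L ==> bd (co I) = bd I"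
  unfolding bd_def using co_co by auto

lemma bd_image: assumes "auto_on L g" "I \<in> L" shows "bd (g ` I) = g ` bd I"
proof -
  have gc: "cycauto g" using assms by (auto simp: auto_on_def)
  obtain a b where ab: "a \<noteq> b" "I = oarc a b" using oarcs[OF assms(2)] by auto
  have "g a \<noteq> g b" using ab cycauto_eq[OF gc] by simp
  then show ?thesis unfolding ab(2) cycauto_image[OF gc] using bd_oarc ab(1) by simp
qed

lemma bd_verts: "isgap L \<G> ==> I \<in> \<G> ==> bd I \<subseteq> verts \<G>"
proof -
  assume G: "isgap L \<G>" "I \<in> \<G>"
  obtain a b where ab: "a \<noteq> b" "I = oarc a b" using oarcs[OF gap_in[OF G]] by auto
  then show ?thesis using bd_oarc[OF ab(1)] gap_verts[OF G(1)] G(2) by simp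
qed

lemma fixed_bd: assumes "cycauto g" "I \<in> L" shows "g ` I = I \<longleftrightarrow> (\<forall>x\<in>bd I. g x = x)"
proof -
  obtain a b where ab: "a \<noteq> b" "I = oarc a b" using oarcs[OF assms(2)] by auto
  show ?thesis using image_fixed_arc[OF assms(1) ab(1)] bd_oarc[OF ab(1)] ab(2) by simp
qed

lemma least_arc:
  assumes xy: "x \<noteq> y" "\<not> endp L x" "\<not> endp L y" and N0: "N0 \<in> L" "x \<in> N0" "y \<in> N0" "u \<notin> N0" "u' \<notin> N0"
    and u: "u \<noteq> u' \<or> \<not> endp L u"
  shows "\<exists>N\<in>L. x \<in> N \<and> y \<in> N \<and> u \<notin> N \<and> u' \<notin> N \<and>
     (\<forall>N'\<in>L. x \<in> N' --> y \<in> N' --> u \<notin> N' --> u' \<notin> N' --> N \<subseteq> N') \<and>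
     (\<exists>\<G>. nlg L \<G> \<and> co N \<in> \<G> \<and> (\<forall>K\<in>\<G>. \<not> (x \<in> K \<and> y \<in> K)))"
proof -
  define Fa where "Fa = {N \<in> L. x \<in> N \<and> y \<in> N \<and> u \<notin> N \<and> u' \<notin> N}"
  have Fn: "A \<subseteq> B \<or> B \<subseteq> A" if "A \<in> Fa" "B \<in> Fa" for A B
  proof (cases "u = u'")
    case False then show ?thesis using nested[of A B x u u'] that unfolding Fa_def by auto
  next
    case True then show ?thesis using nested'[of A B x u] u that unfolding Fa_def by auto
  qed
  have N0F: "N0 \<in> Fa" using N0 unfolding Fa_def by simp
  define K where "K = \<Union>(co ` Fa)"
  have KL: "K \<in> L" unfolding K_def
  proof (rule sup[of _ x y])
    show "co ` Fa \<subseteq> L" using co_in unfolding Fa_def by auto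
    show "co ` Fa \<noteq> {}" using N0F by auto
    show "x \<noteq> y" by (rule xy(1))
    fix I assume "I \<in> co ` Fa"
    then obtain A where A: "A \<in> Fa" "I = co A" by auto
    then show "x \<notin> I \<and> y \<notin> I" using co_disj[of A] unfolding Fa_def by auto
    fix J assume "J \<in> co ` Fa"
    then obtain B where B: "B \<in> Fa" "J = co B" by auto
    show "I \<subseteq> J \<or> J \<subseteq> I" using Fn[OF A(1) B(1)] co_anti[of A B] co_anti[of B A] A B unfolding Fa_def by auto
  qed
  define N where "N = co K"
  have NL: "N \<in> L" unfolding N_def using co_in[OF KL] .
  have xyK: "x \<notin> K" "y \<notin> K" unfolding K_def Fa_def using co_disj by auto
  then have xyN: "x \<in> N" "y \<in> N" unfolding N_def using in_or_co[OF KL] xy by auto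
  have least: "N \<subseteq> N'" if "N' \<in> Fa" for N'
  proof -
    have N'L: "N' \<in> L" using that unfolding Fa_def by simp
    have "co N' \<subseteq> K" using that unfolding K_def by auto
    then have "co K \<subseteq> co (co N')" using co_anti[OF co_in[OF N'L] KL] by simp
    then show ?thesis unfolding N_def using co_co[OF N'L] by simp
  qed
  have NF: "N \<in> Fa" using least[OF N0F] N0 xyN NL unfolding Fa_def by auto
  obtain a b where ab: "a \<noteq> b" "N = oarc a b" "oarc a b \<in> L" "co N = oarc b a" "oarc b a \<in> L"
    by (rule L_cases[OF NL])
  have "\<exists>\<G>. nlg L \<G> \<and> oarc b a \<in> \<G> \<and> (\<forall>K\<in>\<G>. \<not> {x, y} \<subseteq> K)"
  proof (rule side[OF ab(3)])
    fix K' assume K': "K' \<in> L" "K' \<subset> oarc a b" "{x, y} \<subseteq> K'"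
    then have "K' \<in> Fa" using NF ab(2) unfolding Fa_def by auto
    then show False using least[of K'] K'(2) ab(2) by auto
  qed (use xyN ab in auto)
  then obtain \<G> where "nlg L \<G>" "co N \<in> \<G>" "\<forall>K\<in>\<G>. \<not> (x \<in> K \<and> y \<in> K)" unfolding ab(4) by auto
  then show ?thesis using NF least unfolding Fa_def by (intro bexI[of _ N]) auto
qed

text \<open>The invariant sides between \<open>A\<close> and \<open>K\<close> form a chain missing
  the two end points of \<open>K\<close>, so their union is an invariant side as well.\<close>

lemma fix_sup:
  assumes g: "auto_on L g" and A: "A \<in> L" "K \<in> L" "A \<subseteq> K" "g ` A = A"
  shows "\<exists>B\<in>L. g ` B = B \<and> A \<subseteq> B \<and> B \<subseteq> K \<and> (\<forall>B'\<in>L. A \<subseteq> B' --> B' \<subseteq> K --> g ` B' = B' --> B' \<subseteq> B)"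
proof -
  define Fa where "Fa = {B \<in> L. A \<subseteq> B \<and> B \<subseteq> K \<and> g ` B = B}"
  obtain a b where ab: "a \<noteq> b" "K = oarc a b" using oarcs[OF A(2)] by auto
  have no: "a \<notin> B" "b \<notin> B" if "B \<subseteq> K" for B using that ab by auto
  obtain x where x: "x \<in> A" using in_ne[OF A(1)] by auto
  have "\<Union>Fa \<in> L"
  proof (rule sup[of _ a b])
    show "Fa \<noteq> {}" unfolding Fa_def using A by auto
    show "B \<subseteq> B' \<or> B' \<subseteq> B" if "B \<in> Fa" "B' \<in> Fa" for B B'
      using nested[of B B' x a b] that no[of B] no[of B'] x ab(1) unfolding Fa_def by auto
    show "a \<notin> B \<and> b \<notin> B" if "B \<in> Fa" for B using no that unfolding Fa_def by auto
  qed (use ab Fa_def in auto)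
  moreover have "g ` \<Union>Fa = \<Union>Fa"
  proof -
    have "g ` \<Union>Fa = \<Union>((`) g ` Fa)" by auto
    moreover have "(`) g ` Fa = Fa" unfolding Fa_def by force
    ultimately show ?thesis by simp
  qed
  moreover have "A \<subseteq> \<Union>Fa" "\<Union>Fa \<subseteq> K" unfolding Fa_def using A by auto
  moreover have "\<forall>B'\<in>L. A \<subseteq> B' --> B' \<subseteq> K --> g ` B' = B' --> B' \<subseteq> \<Union>Fa" unfolding Fa_def by auto
  ultimately show ?thesis by (intro bexI[of _ "\<Union>Fa"]) auto
qed

lemma fix_inf:
  assumes g: "auto_on L g" and A: "A \<in> L" "K \<in> L" "K \<subseteq> A" "g ` A = A"
  shows "\<exists>B\<in>L. g ` B = B \<and> K \<subseteq> B \<and> B \<subseteq> A \<and> (\<forall>B'\<in>L. K \<subseteq> B' --> B' \<subseteq> A --> g ` B' = B' --> B \<subseteq> B')"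
proof -
  have "co A \<subseteq> co K" "g ` co A = co A" using co_anti A fixed_co[OF g] by auto
  then obtain B where B: "B \<in> L" "g ` B = B" "co A \<subseteq> B" "B \<subseteq> co K"
    "\<And>B'. B' \<in> L ==> co A \<subseteq> B' ==> B' \<subseteq> co K ==> g ` B' = B' ==> B' \<subseteq> B"
    using fix_sup[OF g co_in[OF A(1)] co_in[OF A(2)]] by auto
  show ?thesis
  proof (intro bexI[of _ "co B"] conjI ballI impI)
    show "co B \<in> L" using co_in[OF B(1)] .
    show "g ` co B = co B" using fixed_co[OF g B(1,2)] .
    show "K \<subseteq> co B" using co_anti[OF B(1) co_in[OF A(2)]] B(4) co_co[OF A(2)] by simp
    show "co B \<subseteq> A" using co_anti[OF co_in[OF A(1)] B(1)] B(3) co_co[OF A(1)] by simp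
    fix B' assume B': "B' \<in> L" "K \<subseteq> B'" "B' \<subseteq> A" "g ` B' = B'"
    have "co B' \<subseteq> B"
    proof (rule B(5))
      show "co B' \<in> L" using co_in B' by simp
      show "co A \<subseteq> co B'" using co_anti B' A by simp
      show "co B' \<subseteq> co K" using co_anti B' A by simp
      show "g ` co B' = co B'" using fixed_co[OF g B'(1,4)] .
    qed
    then show "co B \<subseteq> B'" using co_anti[OF co_in[OF B'(1)] B(1)] co_co[OF B'(1)] by simp
  qed
qed

text \<open>If \<open>h\<close> expands \<open>K\<close>, its iterates increase to an invariant
  side, provided that they keep missing two points. A fixed point in the limit lies in some iterate,
  hence already in \<open>K\<close>.\<close>

lemma orbit_sup:
  assumes h: "auto_on L h" and K: "K \<in> L" "K \<subseteq> h ` K" and uv: "u \<noteq> v" "\<And>n. u \<notin> (h ^^ n) ` K \<and> v \<notin> (h ^^ n) ` K"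
  defines "U \<equiv> (\<Union>n. (h ^^ n) ` K)"
  shows "U \<in> L" "h ` U = U" "K \<subseteq> U" "h w = w ==> w \<in> U ==> w \<in> K"
proof -
  have step: "(h ^^ n) ` K \<subseteq> (h ^^ Suc n) ` K" for n
  proof -
    have "(h ^^ n) ` K \<subseteq> (h ^^ n) ` (h ` K)" using K(2) by (rule image_mono)
    then show ?thesis by (simp add: image_comp funpow_swap1 comp_def)
  qed
  have mono: "(h ^^ m) ` K \<subseteq> (h ^^ n) ` K" if "m \<le> n" for m n
    using lift_Suc_mono_le[of "\<lambda>n. (h ^^ n) ` K", OF step that] .
  show "U \<in> L" unfolding U_def
  proof (rule sup[of _ u v])
    show "range (\<lambda>n. (h ^^ n) ` K) \<subseteq> L" using image_in[OF auto_on_funpow[OF h]] K(1) by auto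
    fix I assume I: "I \<in> range (\<lambda>n. (h ^^ n) ` K)"
    then show "u \<notin> I \<and> v \<notin> I" using uv(2) by auto
    fix J assume "J \<in> range (\<lambda>n. (h ^^ n) ` K)"
    then obtain m n where "I = (h ^^ m) ` K" "J = (h ^^ n) ` K" using I by auto
    then show "I \<subseteq> J \<or> J \<subseteq> I" using mono[of m n] mono[of n m] by (cases "m \<le> n") auto
  qed (use uv(1) in auto)
  show KU: "K \<subseteq> U" unfolding U_def using UN_upper[of 0 UNIV "\<lambda>n. (h ^^ n) ` K"] by simp
  show "h ` U = U"
  proof
    have "h ` (h ^^ n) ` K = (h ^^ Suc n) ` K" for n by (simp add: image_comp)
    then show "h ` U \<subseteq> U" unfolding U_def by fastforce
    have "(h ^^ n) ` K \<subseteq> h ` U" for n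
    proof -
      have "(h ^^ n) ` K \<subseteq> (h ^^ Suc n) ` K" by (rule step)
      also have "\<dots> = h ` (h ^^ n) ` K" by (simp add: image_comp)
      also have "\<dots> \<subseteq> h ` U" unfolding U_def by auto
      finally show ?thesis .
    qed
    then show "U \<subseteq> h ` U" unfolding U_def by auto
  qed
  assume w: "h w = w" "w \<in> U"
  then obtain n where n: "w \<in> (h ^^ n) ` K" unfolding U_def by auto
  have "(h ^^ n) w = w" by (induction n) (simp_all add: w(1))
  then show "w \<in> K" using n fixed_mem[OF auto_on_cyc[OF auto_on_funpow[OF h]], of n w K] by simp
qed

end

locale pf = A: qlam L + B: qlam M for L M +
  assumes ends_disj: "endp L x ==> endp M x ==> False"

lemma pf_swap: "pf L M ==> pf M L"
  unfolding pf_def pf_axioms_def by blast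

section \<open>Crossing leaves and leaves with a common end point\<close>

context pf
begin

text \<open>Otherwise \<open>a\<close> and \<open>b\<close> are on the same side of every leaf of
  \<open>M\<close>. Choosing the sides that miss both gives a gap with vertices \<open>a\<close> and
  \<open>b\<close>; neither is an end point of \<open>M\<close>, so the gap would have two
  pivots.\<close>

lemma crossing_exists:
  assumes ab: "oarc a b \<in> L" shows "\<exists>N\<in>M. a \<in> N \<and> b \<notin> N"
proof (rule ccontr)
  assume no: "\<not> ?thesis"
  have ne: "a \<noteq> b" using A.ne_oarc[OF ab] .
  have e: "\<not> endp M a" "\<not> endp M b" using ends_disj A.endp1[OF ab] A.endp2[OF ab] by auto
  define Or where "Or = {N \<in> M. a \<notin> N \<and> b \<notin> N}"
  have OL: "Or \<subseteq> M" unfolding Or_def by simp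
  have cov: "I \<in> Or \<or> co I \<in> Or" if I: "I \<in> M" for I
  proof (cases "a \<in> I")
    case True
    then have "b \<in> I" using no I by auto
    then show ?thesis using True B.co_disj[OF I] B.co_in[OF I] unfolding Or_def by auto
  next
    case False
    then have "a \<in> co I" using B.in_or_co[OF I e(1)] by simp
    then have "b \<in> co I" using no B.co_in[OF I] by auto
    then have "b \<notin> I" using B.co_disj[OF I] by auto
    then show ?thesis using False I unfolding Or_def by simp
  qed
  have nd: "I \<subseteq> J \<or> J \<subseteq> I \<or> I \<inter> J = {}" if "I \<in> Or" "J \<in> Or" for I J
  proof (cases "I \<inter> J = {}")
    case False
    then obtain x where "x \<in> I" "x \<in> J" by auto
    then show ?thesis using B.nested'[of I J x a] that e(1) unfolding Or_def by auto
  qed simp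
  have ch: "\<exists>U\<in>Or. \<Union>C \<subseteq> U" if C: "C \<subseteq> Or" "C \<noteq> {}" "\<And>I J. I \<in> C ==> J \<in> C ==> I \<subseteq> J \<or> J \<subseteq> I" for C
  proof -
    have "\<Union>C \<in> M"
    proof (rule B.sup[of C a b])
      show "C \<subseteq> M" using C(1) OL by (rule subset_trans)
      show "a \<notin> K \<and> b \<notin> K" if "K \<in> C" for K using that C(1) unfolding Or_def by auto
    qed (fact C(2), fact C(3), fact ne)
    then show ?thesis using C(1) unfolding Or_def by auto
  qed
  define G where "G = {M \<in> Or. \<forall>N\<in>Or. M \<subseteq> N --> N = M}"
  have G: "isgap M G" unfolding G_def by (rule B.gap_construct(1)[OF OL cov nd ch])
  have v: "a \<in> verts G" "b \<in> verts G" unfolding verts_def G_def Or_def by auto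
  have "a \<noteq> x \<and> a \<noteq> y \<and> b \<noteq> x \<and> b \<noteq> y" if "oarc x y \<in> G" for x y
    using B.gap_in[OF G that] B.endp1 B.endp2 e by auto
  then have "pivot G a" "pivot G b" using v unfolding pivot_def by auto
  then show False using B.pivot_unique[OF G] ne by blast
qed

text \<open>Take the median gap of three points of an arc without end points of \<open>M\<close>. An
  element meeting the arc would contain two of the three points, so the arc consists of vertices of
  the gap. None of them is an end point, so there would be more than one pivot.\<close>

lemma endp_dense:
  assumes xy: "x \<noteq> y" shows "\<exists>z. cyc x z y \<and> endp M z"
proof (rule ccontr)
  assume no: "\<not> ?thesis"
  obtain a where a: "cyc x a y" using cyc_dense[OF xy] .
  then have "a \<noteq> y" by auto
  then obtain b where b: "cyc a b y" using cyc_dense by blast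
  then have "b \<noteq> y" by auto
  then obtain c where c: "cyc b c y" using cyc_dense by blast
  have ord: "cyc x b y" "cyc x c y" "a \<noteq> b" "a \<noteq> c" "b \<noteq> c" using a b c unfolding cyc_ang circ_eq_iff by (smt (z3))+
  have nea: "\<not> endp M a" "\<not> endp M b" "\<not> endp M c" using no a ord(1,2) by auto
  obtain \<G> where G: "isgap M \<G>" "\<And>N. N \<in> \<G> ==> sep3 a b c N"
    using B.median_gap[OF ord(3,4,5) nea] by auto
  have "w \<in> verts \<G>" if w: "cyc x w y" for w
  proof (rule ccontr)
    assume "w \<notin> verts \<G>"
    then obtain p q where pq: "p \<noteq> q" "oarc p q \<in> \<G>" "cyc p w q" "p \<in> verts \<G>" "q \<in> verts \<G>"
      by (rule B.verts_cases[OF G(1)])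
    have "endp M p" "endp M q" using B.gap_in[OF G(1) pq(2)] B.endp1 B.endp2 by auto
    then have "\<not> cyc x p y" "\<not> cyc x q y" using no by auto
    then have "cyc p a q \<and> cyc p b q" using w a ord(1) pq(1,3) unfolding cyc_ang circ_eq_iff by (smt (z3))
    then show False using G(2)[OF pq(2)] unfolding sep3_def by simp
  qed
  then have "a \<in> verts \<G>" "b \<in> verts \<G>" using a ord by auto
  moreover have "\<not> endp M a" "\<not> endp M b" using no a ord by auto
  then have "a \<noteq> p \<and> a \<noteq> q \<and> b \<noteq> p \<and> b \<noteq> q" if "oarc p q \<in> \<G>" for p q
    using B.gap_in[OF G(1) that] B.endp1 B.endp2 by auto
  ultimately have "pivot \<G> a" "pivot \<G> b" unfolding pivot_def by auto
  then show False using B.pivot_unique[OF G(1)] ord(3) by blast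
qed

text \<open>The innermost leaf from \<open>p\<close> beyond a barrier \<open>b\<close> between
  \<open>q1\<close> and \<open>q2\<close> ends at a point \<open>c0\<close>. A leaf strictly inside
  it around \<open>q1\<close> and \<open>b\<close> cannot cross the leaf from \<open>p\<close> to
  \<open>q1\<close>, so it would start at \<open>p\<close> and contradict the choice of
  \<open>c0\<close>. Hence \<open>side\<close> yields a gap there.\<close>

lemma two_leaves_gap:
  assumes q1: "oarc p q1 \<in> L" and q2: "oarc p q2 \<in> L" and c: "cyc p q1 q2"
  shows "\<exists>\<G> q. nlg L \<G> \<and> oarc q p \<in> \<G> \<and> oarc p q \<in> L \<and> cyc p q1 q \<and> (q = q2 \<or> cyc p q q2)"
proof -
  have "q1 \<noteq> q2" using c by auto
  \<comment> \<open>An end point of \<open>M\<close> is never one of \<open>L\<close>, so the limit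
    of leaves ending beyond \<open>b\<close> still ends strictly beyond \<open>b\<close>.\<close>
  then obtain b where b: "cyc q1 b q2" "endp M b" using endp_dense by blast
  have pb: "cyc p b q2" "cyc p q1 b" "b \<noteq> p" using b(1) c unfolding cyc_ang circ_eq_iff by (smt (z3))+
  define Q where "Q = {q. oarc p q \<in> L \<and> cyc p b q \<and> (q = q2 \<or> cyc p q q2)}"
  have q2Q: "q2 \<in> Q" unfolding Q_def using q2 pb by simp
  have QL: "oarc q p \<in> L" if "q \<in> Q" for q using that A.dual unfolding Q_def by simp
  have "\<Union>((\<lambda>q. oarc q p) ` Q) \<in> L"
  proof (rule A.sup[of _ b p])
    show "(\<lambda>q. oarc q p) ` Q \<subseteq> L" using QL by auto
    show "(\<lambda>q. oarc q p) ` Q \<noteq> {}" using q2Q by auto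
    show "b \<noteq> p" by (rule pb(3))
    fix I assume "I \<in> (\<lambda>q. oarc q p) ` Q"
    then obtain q where q: "q \<in> Q" "I = oarc q p" by auto
    have qb: "cyc p b q" using q(1) unfolding Q_def by simp
    then show "b \<notin> I \<and> p \<notin> I" using q(2) by (auto simp: cyc_ang)
    fix J assume "J \<in> (\<lambda>q. oarc q p) ` Q"
    then obtain r where r: "r \<in> Q" "J = oarc r p" by auto
    have rb: "cyc p b r" using r(1) unfolding Q_def by simp
    have ne: "q \<noteq> p" "r \<noteq> p" using qb rb by auto
    show "I \<subseteq> J \<or> J \<subseteq> I" unfolding q(2) r(2) oarc_subset_iff[OF ne(1)] oarc_subset_iff[OF ne(2)]
      using ne unfolding cyc_ang circ_eq_iff by (smt (z3))
  qed
  then obtain c0 d where U: "c0 \<noteq> d" "\<Union>((\<lambda>q. oarc q p) ` Q) = oarc c0 d" "oarc c0 d \<in> L" using A.oarcs by metis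
  have sub: "oarc q p \<subseteq> oarc c0 d" if "q \<in> Q" for q using that U(2) by auto
  have pn: "\<not> cyc c0 p d" "\<not> cyc c0 b d"
  proof -
    have "x \<notin> \<Union>((\<lambda>q. oarc q p) ` Q)" if "x = p \<or> x = b" for x
      using that unfolding Q_def by (auto simp: cyc_ang)
    then show "\<not> cyc c0 p d" "\<not> cyc c0 b d" unfolding U(2) by auto
  qed
  have q2p: "q2 \<noteq> p" using A.ne_oarc[OF q2] by simp
  have d: "d = p" using sub[OF q2Q] pn(1) unfolding oarc_subset_iff[OF q2p] cyc_ang circ_eq_iff by (smt (z3))
  have c0L: "oarc p c0 \<in> L" "oarc c0 p \<in> L" using U(3) A.dual d by auto
  have "b \<noteq> c0" using A.endp1[OF c0L(2)] b(2) ends_disj by auto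
  then have c0b: "cyc p b c0" using pn(2) U(1) pb(3) unfolding d cyc_ang circ_eq_iff by (smt (z3))
  have c0q: "c0 = q2 \<or> cyc p c0 q2" using sub[OF q2Q] c0b U(1) unfolding d oarc_subset_iff[OF q2p] cyc_ang circ_eq_iff by (smt (z3))
  have min: False if t: "oarc p t \<in> L" "cyc p b t" "cyc p t c0" for t
  proof -
    have "t \<in> Q" unfolding Q_def using t c0q by (auto simp: cyc_ang)
    then have "oarc t p \<subseteq> oarc c0 p" using sub d by simp
    moreover have "t \<noteq> p" using t by auto
    ultimately show False using t(3) unfolding oarc_subset_iff[OF \<open>t \<noteq> p\<close>] by (auto simp: cyc_ang)
  qed
  have q1c: "cyc p q1 c0" using pb c0b unfolding cyc_ang by linarith
  have "\<exists>\<G>. nlg L \<G> \<and> oarc c0 p \<in> \<G> \<and> (\<forall>K\<in>\<G>. \<not> {q1, b} \<subseteq> K)"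
  proof (rule A.side[OF c0L(1)])
    fix K assume K: "K \<in> L" "K \<subset> oarc p c0" "{q1, b} \<subseteq> K"
    obtain s t where st: "s \<noteq> t" "K = oarc s t" using A.oarcs[OF K(1)] by auto
    have i: "cyc s q1 t" "cyc s b t" using K(3) st by auto
    have "\<not> cyc s p t" using K(2) st by auto
    have nl: "\<not> (cyc s q1 t \<and> cyc t p s)" using A.unlinked[of s t q1 p] K(1) st A.dual[OF q1] by auto
    have sub': "oarc s t \<subseteq> oarc p c0" "oarc s t \<noteq> oarc p c0" using K(2) st by auto
    have "s = p \<and> cyc p b t \<and> cyc p t c0"
      using sub' i nl \<open>\<not> cyc s p t\<close> st(1) unfolding oarc_subset_iff[OF st(1)] oarc_eq_iff[OF st(1)] cyc_ang circ_eq_iff by (smt (z3))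
    then show False using min[of t] K(1) st(2) by simp
  qed (use q1c c0b in auto)
  then show ?thesis using c0L c0q q1c by blast
qed

text \<open>Two consecutive pairs of leaves at \<open>p\<close> would each give a non-leaf gap with
  vertex \<open>p\<close>. Looseness identifies the two gaps, but their elements ending at
  \<open>p\<close> are different.\<close>

lemma no_three_aux:
  assumes "oarc p x \<in> L" "oarc p y \<in> L" "oarc p z \<in> L" "cyc p x y" "cyc p y z" shows False
proof -
  obtain \<G> q where G: "nlg L \<G>" "oarc q p \<in> \<G>" "cyc p x q" "q = y \<or> cyc p q y"
    using two_leaves_gap[OF assms(1,2,4)] by auto
  obtain \<H> r where H: "nlg L \<H>" "oarc r p \<in> \<H>" "cyc p y r" using two_leaves_gap[OF assms(2,3,5)] by auto
  have "p \<in> verts \<G>" "p \<in> verts \<H>" using A.gap_verts A.nlg_gap G H by auto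
  then have "\<G> = \<H>" using A.loose[OF G(1) H(1)] by simp
  then have "q = r" using A.gap_stop[OF A.nlg_gap[OF G(1)] G(2)] H(2) by simp
  then show False using G(4) H(3) by (auto simp: cyc_ang)
qed

lemma no_three:
  assumes "oarc p x \<in> L" "oarc p y \<in> L" "oarc p z \<in> L" shows "x = y \<or> y = z \<or> x = z"
proof (rule ccontr)
  assume n: "\<not> ?thesis"
  have "p \<noteq> x" "p \<noteq> y" "p \<noteq> z" using A.ne_oarc assms by auto
  then have "cyc p x y \<and> cyc p y z \<or> cyc p x z \<and> cyc p z y \<or> cyc p y x \<and> cyc p x z \<or>
     cyc p y z \<and> cyc p z x \<or> cyc p z x \<and> cyc p x y \<or> cyc p z y \<and> cyc p y x"
    using n unfolding cyc_ang circ_eq_iff by (smt (z3))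
  then show False using no_three_aux assms by blast
qed

lemma no_three':
  assumes "oarc x p \<in> L" "oarc y p \<in> L" "oarc z p \<in> L" shows "x = y \<or> y = z \<or> x = z"
  using no_three[of p x y z] assms A.dual by simp

text \<open>A leaf at the vertex \<open>a\<close> that does not border the gap lies under an element
  \<open>J\<close> ending at \<open>a\<close>. Either a smaller leaf inside \<open>J\<close>
  surrounds \<open>b\<close>; not being linked with the given leaf it ends at \<open>a\<close>, so
  three leaves meet there. Or \<open>side\<close> gives a gap on the other side of \<open>J\<close>,
  with the same vertices as ends of \<open>J\<close>, against looseness.\<close>

lemma leaf_at_vertex:
  assumes G: "nlg L \<G>" and a: "a \<in> verts \<G>" and ab: "oarc a b \<in> L"
  shows "oarc a b \<in> \<G> \<or> oarc b a \<in> \<G>"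
proof (rule ccontr)
  assume n: "\<not> ?thesis"
  have g: "isgap L \<G>" using A.nlg_gap[OF G] .
  have ne: "a \<noteq> b" "b \<noteq> a" using A.ne_oarc[OF ab] by auto
  obtain J where J: "J \<in> \<G>" "oarc a b \<subseteq> J \<or> co (oarc a b) \<subseteq> J" using A.gap_lies[OF g ab] by auto
  obtain c d where cd: "c \<noteq> d" "J = oarc c d" "oarc c d \<in> L" "co J = oarc d c" "oarc d c \<in> L"
    by (rule A.L_cases[OF A.gap_in[OF g J(1)]])
  have aJ: "\<not> cyc c a d" using a J(1) cd(2) unfolding verts_def by auto
  have nn: False if "nlg L \<G>'" "oarc d c \<in> \<G>'" for \<G>'
  proof -
    have "c \<in> verts \<G>" "c \<in> verts \<G>'" using A.gap_verts[OF g] A.gap_verts[OF A.nlg_gap[OF that(1)]] J cd that by auto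
    then have "\<G>' = \<G>" using A.loose[OF that(1) G] by simp
    then have "co J \<in> \<G>" using that(2) cd(4) by simp
    then show False using A.leaf_gapI[OF g J(1)] G by simp
  qed
  have ex: "\<exists>K\<in>L. K \<subset> oarc c d \<and> b \<in> K" if "cyc c b d"
  proof (rule ccontr)
    assume no: "\<not> ?thesis"
    have "\<exists>\<G>. nlg L \<G> \<and> oarc d c \<in> \<G> \<and> (\<forall>K\<in>\<G>. \<not> {b} \<subseteq> K)"
      by (rule A.side[OF cd(3)]) (use no that in auto)
    then show False using nn by blast
  qed
  show False using J(2)
  proof
    assume s: "oarc a b \<subseteq> J"
    have ac: "a = c" "cyc c b d" using s aJ n J(1) cd(1,2) unfolding cd(2) oarc_subset_iff[OF ne(1)] by auto
    obtain K where K: "K \<in> L" "K \<subset> oarc c d" "b \<in> K" using ex[OF ac(2)] by auto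
    obtain s t where st: "s \<noteq> t" "K = oarc s t" using A.oarcs[OF K(1)] by auto
    have sub': "oarc s t \<subseteq> oarc c d" "oarc s t \<noteq> oarc c d" "cyc s b t" using K st by auto
    have nl: "\<not> (cyc s b t \<and> cyc t a s)" using A.unlinked[of s t b a] K(1) st A.dual[OF ab] by auto
    have "s = a \<and> t \<noteq> d \<and> t \<noteq> b" using sub' nl ac unfolding oarc_subset_iff[OF st(1)] oarc_eq_iff[OF st(1)] cyc_ang circ_eq_iff by (smt (z3))
    then show False using no_three[of a b d t] ab cd(3) ac K(1) st by auto
  next
    assume "co (oarc a b) \<subseteq> J"
    then have s: "oarc b a \<subseteq> J" using ne by simp
    have ac: "a = d" "cyc c b d" using s aJ n J(1) cd(1,2) unfolding cd(2) oarc_subset_iff[OF ne(2)] by auto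
    obtain K where K: "K \<in> L" "K \<subset> oarc c d" "b \<in> K" using ex[OF ac(2)] by auto
    obtain s t where st: "s \<noteq> t" "K = oarc s t" using A.oarcs[OF K(1)] by auto
    have sub': "oarc s t \<subseteq> oarc c d" "oarc s t \<noteq> oarc c d" "cyc s b t" using K st by auto
    have nl: "\<not> (cyc s b t \<and> cyc t a s)" using A.unlinked[of s t b a] K(1) st A.dual[OF ab] by auto
    have "t = a \<and> s \<noteq> c \<and> s \<noteq> b" using sub' nl ac unfolding oarc_subset_iff[OF st(1)] oarc_eq_iff[OF st(1)] cyc_ang circ_eq_iff by (smt (z3))
    then show False using no_three'[of b a c s] A.dual[OF ab] cd(3) ac K(1) st by auto
  qed
qed

end

section \<open>Rigidity\<close>

text \<open>The second invariant leaf and the crossing leaf are hidden in the definition, so that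
  the property belongs to a single leaf and can be passed on from leaf to leaf and from one
  lamination to the other.\<close>

definition rig :: "circ set set \<Rightarrow> circ set set \<Rightarrow> (circ \<Rightarrow> circ) \<Rightarrow> circ set \<Rightarrow> bool" where
  "rig L M g I \<longleftrightarrow> I \<in> L \<and> g ` I = I \<and> (\<exists>I2\<in>L. g ` I2 = I2 \<and> bd I \<inter> bd I2 = {} \<and>
    (\<exists>p q. oarc p q \<in> M \<and> p \<in> I \<and> p \<in> I2 \<and> q \<notin> I \<and> q \<notin> I2))"

lemma bd_trans:
  assumes "A = oarc a1 a2" "B = oarc b1 b2" "C = oarc c1 c2" "a1 \<noteq> a2" "b1 \<noteq> b2" "c1 \<noteq> c2"
    "A \<subseteq> B" "B \<subseteq> C" "bd A \<inter> bd B = {} \<or> bd B \<inter> bd C = {}"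
  shows "bd A \<inter> bd C = {}"
proof -
  have "a1 \<noteq> b1 \<and> a2 \<noteq> b2 \<or> b1 \<noteq> c1 \<and> b2 \<noteq> c2" using assms(9) unfolding assms(1-3) bd_oarc[OF assms(4)] bd_oarc[OF assms(5)] bd_oarc[OF assms(6)] by auto
  then have "a1 \<noteq> c1 \<and> a1 \<noteq> c2 \<and> a2 \<noteq> c1 \<and> a2 \<noteq> c2"
    using assms(4-8) unfolding assms(1-3) oarc_subset_iff[OF assms(4)] oarc_subset_iff[OF assms(5)] cyc_ang circ_eq_iff by (smt (z3))
  then show ?thesis unfolding assms(1-3) bd_oarc[OF assms(4)] bd_oarc[OF assms(6)] by auto
qed

context lam
begin

lemma bd_trans':
  assumes "A \<in> L" "B \<in> L" "C \<in> L" "A \<subseteq> B" "B \<subseteq> C" "bd A \<inter> bd B = {} \<or> bd B \<inter> bd C = {}"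
  shows "bd A \<inter> bd C = {}"
proof -
  obtain a1 a2 where "a1 \<noteq> a2" "A = oarc a1 a2" using oarcs[OF assms(1)] by auto
  moreover obtain b1 b2 where "b1 \<noteq> b2" "B = oarc b1 b2" using oarcs[OF assms(2)] by auto
  moreover obtain c1 c2 where "c1 \<noteq> c2" "C = oarc c1 c2" using oarcs[OF assms(3)] by auto
  ultimately show ?thesis using bd_trans assms(4-6) by metis
qed

lemma image_eq_if_le:
  assumes g: "auto_on L g" and "N \<subseteq> g ` N" "N \<subseteq> inv_into UNIV g ` N" shows "g ` N = N"
proof
  have gc: "cycauto g" using g by (rule auto_on_cyc)
  have "g ` N \<subseteq> g ` inv_into UNIV g ` N" using assms(3) by (rule image_mono)
  also have "\<dots> = N" using cycauto_inv(2)[OF gc] by (simp add: image_image)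
  finally show "g ` N \<subseteq> N" .
qed (rule assms(2))

lemma fixed_inv: "cycauto g ==> g x = x ==> inv_into UNIV g x = x"
  using cycauto_inv(3) by metis

lemma fixed_image_inv: assumes g: "cycauto g" and "g ` I = I" shows "inv_into UNIV g ` I = I"
proof -
  have "inv_into UNIV g ` g ` I = I" using cycauto_inv(3)[OF g] by (simp add: image_image)
  then show ?thesis using assms(2) by simp
qed

text \<open>A least side is characterized by the fixed points it contains and misses. Its images
  under \<open>g\<close> and under the inverse meet the same conditions, so both contain it.\<close>

lemma fixed_least:
  assumes g: "auto_on L g" and fx: "g x = x" "g y = y" "g u = u" "g u' = u'"
    and N: "N \<in> L" "x \<in> N" "y \<in> N" "u \<notin> N" "u' \<notin> N"
      "\<forall>N'\<in>L. x \<in> N' --> y \<in> N' --> u \<notin> N' --> u' \<notin> N' --> N \<subseteq> N'"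
  shows "g ` N = N"
proof -
  have gc: "cycauto g" using g by (rule auto_on_cyc)
  have gi: "auto_on L (inv_into UNIV g)" using auto_on_inv[OF g] .
  have fi: "inv_into UNIV g x = x" "inv_into UNIV g y = y" "inv_into UNIV g u = u" "inv_into UNIV g u' = u'" using fixed_inv[OF gc] fx by auto
  have le: "N \<subseteq> h ` N" if h: "auto_on L h" "h x = x" "h y = y" "h u = u" "h u' = u'" for h
  proof -
    have "cycauto h" using h by (auto simp: auto_on_def)
    note fm = fixed_mem[OF this]
    have "h ` N \<in> L" using image_in[OF h(1)] N(1) by simp
    moreover have "x \<in> h ` N" "y \<in> h ` N" "u \<notin> h ` N" "u' \<notin> h ` N"
      using fm[OF h(2)] fm[OF h(3)] fm[OF h(4)] fm[OF h(5)] N(2-5) by simp_all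
    ultimately show ?thesis using N(6) by simp
  qed
  show ?thesis by (rule image_eq_if_le[OF g le[OF g fx] le[OF gi fi]])
qed

lemma fixed_ends: assumes "cycauto g" "I \<in> L" "g ` I = I" "I = oarc a b" shows "g a = a" "g b = b"
proof -
  have "a \<noteq> b" using ne_oarc assms by auto
  then show "g a = a" "g b = b" using image_fixed_arc[OF assms(1), of a b] assms(3,4) by auto
qed

end

context qlam
begin

lemma nlg_fix_el:
  assumes g: "auto_on L g" and G: "nlg L \<G>" and J: "J \<in> \<G>" "g ` J = J"
  shows "w \<in> verts \<G> ==> g w = w" "K \<in> \<G> ==> g ` K = K"
proof -
  have gc: "cycauto g" using g by (rule auto_on_cyc)
  have JL: "J \<in> L" using gap_in[OF nlg_gap[OF G] J(1)] .
  obtain a b where ab: "a \<noteq> b" "J = oarc a b" using oarcs[OF JL] by auto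
  have fa: "g a = a" using fixed_ends[OF gc JL J(2) ab(2)] by simp
  have v: "g w = w" if "w \<in> verts \<G>" for w using nlg_fix(2)[OF g G _ fa that] J(1) ab by simp
  then show "w \<in> verts \<G> ==> g w = w" .
  assume K: "K \<in> \<G>"
  obtain c d where cd: "c \<noteq> d" "K = oarc c d" using oarcs[OF gap_in[OF nlg_gap[OF G] K]] by auto
  have "g c = c" "g d = d" using v gap_verts[OF nlg_gap[OF G]] K cd by auto
  then show "g ` K = K" unfolding cd(2) cycauto_image[OF gc] by simp
qed

end

section \<open>Invariance of leaves between and beyond invariant leaves\<close>

context pf
begin

lemma swap: "pf M L"
  using pf_swap pf_axioms .

text \<open>An end point common to \<open>A\<close> and \<open>C\<close> would also be one of
  \<open>B\<close>, and three leaves would meet there.\<close>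

lemma bd_three:
  assumes ABC: "A \<in> L" "B \<in> L" "C \<in> L" "A \<subset> B" "B \<subset> C" shows "bd A \<inter> bd C = {}"
proof -
  obtain a1 a2 where a: "a1 \<noteq> a2" "A = oarc a1 a2" using A.oarcs[OF ABC(1)] by auto
  obtain b1 b2 where b: "b1 \<noteq> b2" "B = oarc b1 b2" using A.oarcs[OF ABC(2)] by auto
  obtain c1 c2 where c: "c1 \<noteq> c2" "C = oarc c1 c2" using A.oarcs[OF ABC(3)] by auto
  have sub: "oarc a1 a2 \<subseteq> oarc b1 b2" "oarc b1 b2 \<subseteq> oarc c1 c2" "\<not> (a1 = b1 \<and> a2 = b2)" "\<not> (b1 = c1 \<and> b2 = c2)"
    using ABC(4,5) a b c by auto
  have 1: "\<not> (a1 = b1 \<and> b1 = c1)"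
  proof
    assume e: "a1 = b1 \<and> b1 = c1"
    then have "a2 = b2 \<or> b2 = c2 \<or> a2 = c2" using no_three[of a1 a2 b2 c2] ABC a b c by simp
    then show False using sub e a(1) b(1) unfolding oarc_subset_iff[OF a(1)] oarc_subset_iff[OF b(1)] cyc_ang circ_eq_iff by (smt (z3))
  qed
  have 2: "\<not> (a2 = b2 \<and> b2 = c2)"
  proof
    assume e: "a2 = b2 \<and> b2 = c2"
    then have "a1 = b1 \<or> b1 = c1 \<or> a1 = c1" using no_three'[of a1 a2 b1 c1] ABC a b c by simp
    then show False using sub e a(1) b(1) unfolding oarc_subset_iff[OF a(1)] oarc_subset_iff[OF b(1)] cyc_ang circ_eq_iff by (smt (z3))
  qed
  have "a1 \<noteq> c1 \<and> a1 \<noteq> c2 \<and> a2 \<noteq> c1 \<and> a2 \<noteq> c2"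
    using sub 1 2 a(1) b(1) c(1) unfolding oarc_subset_iff[OF a(1)] oarc_subset_iff[OF b(1)] cyc_ang circ_eq_iff by (smt (z3))
  then show ?thesis unfolding a(2) c(2) bd_oarc[OF a(1)] bd_oarc[OF c(1)] by auto
qed

text \<open>A common end point is a vertex of the gap, so by \<open>leaf_at_vertex\<close> the gap
  contains a side of the leaf of \<open>I\<close>; neither side is compatible with
  \<open>co J\<close> being an element and \<open>J\<close> lying strictly inside
  \<open>I\<close>.\<close>

lemma leaf_off_vertex:
  assumes G: "nlg L \<G>" and JI: "J \<in> L" "J \<subset> I" "co J \<in> \<G>" "I \<in> L" shows "bd J \<inter> bd I = {}"
proof (rule ccontr)
  assume "bd J \<inter> bd I \<noteq> {}"
  then obtain e where e: "e \<in> bd J" "e \<in> bd I" by auto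
  have g: "isgap L \<G>" using A.nlg_gap[OF G] .
  have "e \<in> verts \<G>" using A.bd_verts[OF g JI(3)] e(1) A.bd_co[OF JI(1)] by auto
  obtain a b where ab: "a \<noteq> b" "I = oarc a b" "oarc a b \<in> L" "co I = oarc b a" "oarc b a \<in> L"
    by (rule A.L_cases[OF JI(4)])
  have "e = a \<or> e = b" using e(2) unfolding ab(2) bd_oarc[OF ab(1)] by auto
  then have "I \<in> \<G> \<or> co I \<in> \<G>"
    using leaf_at_vertex[OF G \<open>e \<in> verts \<G>\<close>, of a] leaf_at_vertex[OF G \<open>e \<in> verts \<G>\<close>, of b] ab by auto
  then show False
  proof
    assume IG: "I \<in> \<G>"
    have "\<not> I \<subseteq> J" using JI(2) by auto
    then have "I \<inter> co J \<noteq> {}" using A.disj_iff[OF JI(4) A.co_in[OF JI(1)]] A.co_co[OF JI(1)] by simp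
    then have "I = co J" using A.gap_disj[OF g IG JI(3)] by auto
    then show False using JI(2) A.co_disj[OF JI(1)] A.in_ne[OF JI(1)] by auto
  next
    assume IG: "co I \<in> \<G>"
    have "co I \<subseteq> co J" using A.co_anti[OF JI(1,4)] JI(2) by auto
    then have "co I = co J" using A.gap_disj[OF g IG JI(3)] A.in_ne[OF A.co_in[OF JI(4)]] by auto
    then show False using A.co_co JI by (metis psubset_eq)
  qed
qed

text \<open>\<open>J\<close> is the least leaf of \<open>M\<close> around the fixed points
  \<open>x1\<close> and \<open>x2\<close> that misses \<open>y1\<close>, hence it is invariant. The
  gap next to it is the source of further fixed points, as an automorphism fixing one element of a
  non-leaf gap fixes all of its vertices.\<close>

lemma extreme:
  assumes gL: "auto_on L g" and gM: "auto_on M g"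
    and xy: "oarc x1 y1 \<in> L" "oarc x2 y2 \<in> L" "g x1 = x1" "g y1 = y1" "g x2 = x2" "g y2 = y2" "x1 \<noteq> x2"
    and N: "N \<in> M" "x1 \<in> N" "x2 \<in> N" "y1 \<notin> N" "y2 \<notin> N"
  shows "\<exists>J \<G>. J \<in> M \<and> x1 \<in> J \<and> x2 \<in> J \<and> y1 \<notin> J \<and> y2 \<notin> J \<and> J \<subseteq> N \<and> g ` J = J \<and>
     nlg M \<G> \<and> co J \<in> \<G> \<and> (\<forall>K\<in>\<G>. \<not> (x1 \<in> K \<and> x2 \<in> K))"
proof -
  have e: "\<not> endp M x1" "\<not> endp M x2" "\<not> endp M y1" using ends_disj A.endp1 A.endp2 xy(1,2) by blast+
  obtain J where J: "J \<in> M" "x1 \<in> J" "x2 \<in> J" "y1 \<notin> J"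
     "\<forall>N'\<in>M. x1 \<in> N' --> x2 \<in> N' --> y1 \<notin> N' --> y1 \<notin> N' --> J \<subseteq> N'"
     "\<exists>\<G>. nlg M \<G> \<and> co J \<in> \<G> \<and> (\<forall>K\<in>\<G>. \<not> (x1 \<in> K \<and> x2 \<in> K))"
    using B.least_arc[OF xy(7) e(1,2) N(1,2,3,4,4)] e(3) by auto
  have "g ` J = J" using B.fixed_least[OF gM xy(3,5,4,4) J(1,2,3,4,4,5)] .
  moreover have "J \<subseteq> N" using J(5) N by auto
  ultimately show ?thesis using J N(5) by blast
qed

text \<open>\<open>extreme\<close> is applied on both sides of \<open>N\<close>. A common end point
  of the two results would identify their gaps by looseness; the complements of the disjoint sides
  \<open>J1\<close> and \<open>J2\<close> would then be two elements covering too much, which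
  \<open>nlg_no_cover\<close> excludes.\<close>

lemma rect:
  assumes gL: "auto_on L g" and gM: "auto_on M g"
    and xy: "oarc x1 y1 \<in> L" "oarc x2 y2 \<in> L" "g x1 = x1" "g y1 = y1" "g x2 = x2" "g y2 = y2" "x1 \<noteq> x2" "y1 \<noteq> y2"
    and N: "N \<in> M" "x1 \<in> N" "x2 \<in> N" "y1 \<notin> N" "y2 \<notin> N"
  shows "\<exists>J1 J2 \<G>1 \<G>2. J1 \<in> M \<and> J2 \<in> M \<and> x1 \<in> J1 \<and> x2 \<in> J1 \<and> y1 \<notin> J1 \<and> y2 \<notin> J1 \<and>
     y1 \<in> J2 \<and> y2 \<in> J2 \<and> x1 \<notin> J2 \<and> x2 \<notin> J2 \<and> J1 \<subseteq> N \<and> J2 \<subseteq> co N \<and> g ` J1 = J1 \<and> g ` J2 = J2 \<and>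
     nlg M \<G>1 \<and> co J1 \<in> \<G>1 \<and> (\<forall>K\<in>\<G>1. \<not> (x1 \<in> K \<and> x2 \<in> K)) \<and>
     nlg M \<G>2 \<and> co J2 \<in> \<G>2 \<and> (\<forall>K\<in>\<G>2. \<not> (y1 \<in> K \<and> y2 \<in> K)) \<and> bd J1 \<inter> bd J2 = {}"
proof -
  obtain J1 G1 where J1: "J1 \<in> M" "x1 \<in> J1" "x2 \<in> J1" "y1 \<notin> J1" "y2 \<notin> J1" "J1 \<subseteq> N" "g ` J1 = J1"
     "nlg M G1" "co J1 \<in> G1" "\<forall>K\<in>G1. \<not> (x1 \<in> K \<and> x2 \<in> K)"
    using extreme[OF gL gM xy(1-7) N] by auto
  have e: "\<not> endp M x1" "\<not> endp M x2" "\<not> endp M y1" "\<not> endp M y2" using ends_disj A.endp1 A.endp2 xy(1,2) by blast+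
  have cN: "y1 \<in> co N" "y2 \<in> co N" "x1 \<notin> co N" "x2 \<notin> co N" using B.in_co_iff[OF N(1)] e N by auto
  obtain J2 G2 where J2: "J2 \<in> M" "y1 \<in> J2" "y2 \<in> J2" "x1 \<notin> J2" "x2 \<notin> J2" "J2 \<subseteq> co N" "g ` J2 = J2"
     "nlg M G2" "co J2 \<in> G2" "\<forall>K\<in>G2. \<not> (y1 \<in> K \<and> y2 \<in> K)"
    using extreme[OF gL gM A.dual[OF xy(1)] A.dual[OF xy(2)] xy(4,3,6,5,8) B.co_in[OF N(1)] cN] by auto
  have dj: "J1 \<inter> J2 = {}" using J1(6) J2(6) B.co_disj[OF N(1)] by auto
  have sub: "J2 \<subseteq> co J1" using B.disj_iff[OF J2(1) J1(1)] dj by auto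
  have g1: "isgap M G1" "isgap M G2" using B.nlg_gap J1(8) J2(8) by auto
  have "verts G1 \<inter> verts G2 = {}"
  proof (rule ccontr)
    assume "verts G1 \<inter> verts G2 \<noteq> {}"
    then have eq: "G1 = G2" using B.loose[OF J1(8) J2(8)] by auto
    have "co (co J2) \<subseteq> co J1" using sub B.co_co[OF J2(1)] by simp
    then show False using B.nlg_no_cover[OF J2(8,9), of "co J1"] J1(9) eq by simp
  qed
  moreover have "bd J1 \<subseteq> verts G1" "bd J2 \<subseteq> verts G2"
    using B.bd_verts[OF g1(1) J1(9)] B.bd_verts[OF g1(2) J2(9)] B.bd_co J1(1) J2(1) by auto
  ultimately have "bd J1 \<inter> bd J2 = {}" by auto
  then show ?thesis using J1 J2 by (intro exI[of _ J1] exI[of _ J2] exI[of _ G1] exI[of _ G2]) simp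
qed

text \<open>\<open>P\<close> and \<open>Q\<close> are the invariant sides nearest to the moved side
  \<open>K\<close>. One of \<open>g\<close> and its inverse expands \<open>K\<close>; iterating it
  increases \<open>K\<close> to \<open>Q\<close>, and iterating backwards decreases it to
  \<open>P\<close>. A fixed point between them lies in \<open>K\<close> by the first limit and in
  \<open>co K\<close> by the second.\<close>

lemma no_fixed_between:
  assumes g: "auto_on L g" and K: "P \<in> L" "K \<in> L" "Q \<in> L" "P \<subseteq> K" "K \<subseteq> Q" "g ` P = P" "g ` Q = Q"
    and min: "\<And>B. B \<in> L ==> P \<subseteq> B ==> B \<subseteq> K ==> g ` B = B ==> B = P"
       "\<And>B. B \<in> L ==> K \<subseteq> B ==> B \<subseteq> Q ==> g ` B = B ==> B = Q"
    and w: "g w = w" "w \<in> Q" "w \<in> co P"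
  shows False
proof -
  have aux: False if h: "auto_on L h" "K \<subseteq> h ` K" "h w = w" "h ` P = P" "h ` Q = Q"
     and eqv: "\<And>B. h ` B = B \<longleftrightarrow> g ` B = B" for h
  proof -
    have hc: "cycauto h" using h by (auto simp: auto_on_def)
    have ih: "auto_on L (inv_into UNIV h)" "cycauto (inv_into UNIV h)" using auto_on_inv[OF h(1)] by (auto simp: auto_on_def)
    obtain a b where ab: "a \<noteq> b" "Q = oarc a b" using A.oarcs[OF K(3)] by auto
    have hn: "(h ^^ n) ` K \<subseteq> Q" for n
    proof (induction n)
      case (Suc n)
      have "(h ^^ Suc n) ` K = h ` (h ^^ n) ` K" by (simp add: image_comp)
      then show ?case using image_mono[OF Suc, of h] h(5) by simp
    qed (use K(5) in simp)
    have out: "a \<notin> (h ^^ n) ` K \<and> b \<notin> (h ^^ n) ` K" for n using hn[of n] ab(2) by auto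
    note U = A.orbit_sup[OF h(1) K(2) h(2) ab(1) out]
    have "(\<Union>n. (h ^^ n) ` K) \<subseteq> Q" using hn by (rule UN_least)
    moreover have "g ` (\<Union>n. (h ^^ n) ` K) = (\<Union>n. (h ^^ n) ` K)" using eqv U(2) by (rule iffD1)
    ultimately have "(\<Union>n. (h ^^ n) ` K) = Q" using min(2)[OF U(1,3)] by simp
    then have wK: "w \<in> K" using U(4)[OF h(3)] w(2) by simp
    have "co K \<subseteq> inv_into UNIV h ` co K"
    proof -
      have "h ` K \<in> L" using A.image_in[OF h(1)] K(2) by simp
      then have "h ` co K \<subseteq> co K" using A.co_anti[OF K(2)] h(2) A.co_image[OF h(1) K(2)] by simp
      then have "inv_into UNIV h ` h ` co K \<subseteq> inv_into UNIV h ` co K" by (rule image_mono)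
      then show ?thesis using cycauto_inv(3)[OF hc] by (simp add: image_image)
    qed
    note ck = this
    obtain c d where cd: "c \<noteq> d" "P = oarc c d" "oarc c d \<in> L" "co P = oarc d c" "oarc d c \<in> L"
      by (rule A.L_cases[OF K(1)])
    have hP: "inv_into UNIV h ` co P = co P" using A.fixed_image_inv[OF hc A.fixed_co[OF h(1) K(1) h(4)]] .
    have hn': "(inv_into UNIV h ^^ n) ` co K \<subseteq> co P" for n
    proof (induction n)
      case 0 then show ?case using A.co_anti[OF K(1,2)] K(4) by simp
    next
      case (Suc n)
      have "(inv_into UNIV h ^^ Suc n) ` co K = inv_into UNIV h ` (inv_into UNIV h ^^ n) ` co K" by (simp add: image_comp)
      then show ?case using image_mono[OF Suc, of "inv_into UNIV h"] hP by simp
    qed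
    have out': "d \<notin> (inv_into UNIV h ^^ n) ` co K \<and> c \<notin> (inv_into UNIV h ^^ n) ` co K" for n using hn'[of n] cd(4) by auto
    note V = A.orbit_sup[OF ih(1) A.co_in[OF K(2)] ck cd(1)[symmetric] out']
    let ?V = "\<Union>n. (inv_into UNIV h ^^ n) ` co K"
    have "inv_into UNIV (inv_into UNIV h) = h" using hc unfolding cycauto_def by (simp add: inv_inv_eq)
    then have hV: "h ` ?V = ?V" using A.fixed_image_inv[OF ih(2) V(2)] by simp
    have cV: "h ` co ?V = co ?V" using A.fixed_co[OF h(1) V(1) hV] .
    have "co ?V \<subseteq> K" using A.co_anti[OF A.co_in[OF K(2)] V(1)] V(3) A.co_co[OF K(2)] by simp
    moreover have "?V \<subseteq> co P" using hn' by (rule UN_least)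
    then have "P \<subseteq> co ?V" using A.co_anti[OF V(1) A.co_in[OF K(1)]] A.co_co[OF K(1)] by simp
    moreover have "g ` co ?V = co ?V" using eqv cV by (rule iffD1)
    ultimately have "co ?V = P" using min(1)[OF A.co_in[OF V(1)]] by simp
    then have "w \<in> ?V" using w(3) A.co_co[OF V(1)] by simp
    moreover have "inv_into UNIV h w = w" using A.fixed_inv[OF hc h(3)] .
    ultimately have "w \<in> co K" using V(4) by simp
    then show False using wK A.co_disj[OF K(2)] by auto
  qed
  have gc: "cycauto g" using g by (rule auto_on_cyc)
  have gi: "auto_on L (inv_into UNIV g)" using auto_on_inv[OF g] .
  have gic: "cycauto (inv_into UNIV g)" using gi by (rule auto_on_cyc)
  have ii: "inv_into UNIV (inv_into UNIV g) = g" using gc unfolding cycauto_def by (simp add: inv_inv_eq)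
  have eqi: "inv_into UNIV g ` B = B \<longleftrightarrow> g ` B = B" for B
    using A.fixed_image_inv[OF gc, of B] A.fixed_image_inv[OF gic, of B] ii by auto
  obtain x where x: "x \<in> P" using A.in_ne[OF K(1)] by auto
  obtain a b where ab: "a \<noteq> b" "Q = oarc a b" using A.oarcs[OF K(3)] by auto
  have gK: "P \<subseteq> g ` K" "g ` K \<subseteq> Q" using image_mono[OF K(4), of g] image_mono[OF K(5), of g] K(6,7) by auto
  have "K \<subseteq> g ` K \<or> g ` K \<subseteq> K"
  proof (rule A.nested[of _ _ x a b])
    show "K \<in> L" by (rule K(2))
    show "g ` K \<in> L" using A.image_in[OF g] K(2) by simp
    have "a \<notin> Q" "b \<notin> Q" using ab by auto
    then show "a \<notin> K" "a \<notin> g ` K" "b \<notin> K" "b \<notin> g ` K" using K(5) gK(2) by blast+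
    show "x \<in> K" "x \<in> g ` K" using x K(4) gK(1) by blast+
  qed (rule ab(1))
  then show False
  proof
    assume "K \<subseteq> g ` K"
    then show False using aux[OF g _ w(1) K(6,7)] by simp
  next
    assume "g ` K \<subseteq> K"
    then have "inv_into UNIV g ` g ` K \<subseteq> inv_into UNIV g ` K" by (rule image_mono)
    then have "K \<subseteq> inv_into UNIV g ` K" using cycauto_inv(3)[OF gc] by (simp add: image_image)
    then show False using aux[OF gi _ A.fixed_inv[OF gc w(1)]] eqi K(6,7) by simp
  qed
qed

text \<open>Enclose a moved \<open>K\<close> between the nearest invariant sides \<open>Km\<close>
  and \<open>Kp\<close>. By \<open>bd_three\<close> they have no common end point, and the leaf
  \<open>p q\<close> of \<open>M\<close> crosses both. \<open>extreme\<close> then gives a gap of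
  \<open>M\<close> with fixed vertices, one of which lies between \<open>Km\<close> and
  \<open>Kp\<close>, against \<open>no_fixed_between\<close>.\<close>

lemma between:
  assumes gL: "auto_on L g" and gM: "auto_on M g"
    and I: "P \<in> L" "K \<in> L" "Q \<in> L" "P \<subseteq> K" "K \<subseteq> Q" "g ` P = P" "g ` Q = Q"
    and pq: "oarc p q \<in> M" "p \<in> P" "q \<notin> Q"
  shows "g ` K = K"
proof (rule ccontr)
  assume nf: "g ` K \<noteq> K"
  have gc: "cycauto g" using gL by (rule auto_on_cyc)
  obtain Km where Km: "Km \<in> L" "g ` Km = Km" "P \<subseteq> Km" "Km \<subseteq> K"
     "\<And>B. B \<in> L ==> P \<subseteq> B ==> B \<subseteq> K ==> g ` B = B ==> B \<subseteq> Km"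
    using A.fix_sup[OF gL I(1,2,4,6)] by auto
  obtain Kp where Kp: "Kp \<in> L" "g ` Kp = Kp" "K \<subseteq> Kp" "Kp \<subseteq> Q"
     "\<And>B. B \<in> L ==> K \<subseteq> B ==> B \<subseteq> Q ==> g ` B = B ==> Kp \<subseteq> B"
    using A.fix_inf[OF gL I(3,2,5,7)] by auto
  have nfw: False if "g w = w" "w \<in> Kp" "w \<in> co Km" for w
  proof (rule no_fixed_between[OF gL Km(1) I(2) Kp(1) Km(4) Kp(3) Km(2) Kp(2) _ _ that])
    show "B = Km" if "B \<in> L" "Km \<subseteq> B" "B \<subseteq> K" "g ` B = B" for B using Km(3,5) that by blast
    show "B = Kp" if "B \<in> L" "K \<subseteq> B" "B \<subseteq> Kp" "g ` B = B" for B using Kp(4,5) that by blast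
  qed
  have ps: "Km \<subset> K" "K \<subset> Kp" using nf Km(2,4) Kp(2,3) by auto
  have bdd: "bd Km \<inter> bd Kp = {}" using bd_three[OF Km(1) I(2) Kp(1) ps] .
  obtain xm ym where m: "xm \<noteq> ym" "Km = oarc xm ym" "oarc xm ym \<in> L" "co Km = oarc ym xm" "oarc ym xm \<in> L"
    by (rule A.L_cases[OF Km(1)])
  obtain xp yp where p: "xp \<noteq> yp" "Kp = oarc xp yp" "oarc xp yp \<in> L" "co Kp = oarc yp xp" "oarc yp xp \<in> L"
    by (rule A.L_cases[OF Kp(1)])
  have ne: "xm \<noteq> xp" "ym \<noteq> yp" using bdd unfolding m(2) p(2) bd_oarc[OF m(1)] bd_oarc[OF p(1)] by auto
  have sub: "oarc xm ym \<subseteq> oarc xp yp" using ps m(2) p(2) by auto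
  have fx: "g xm = xm" "g ym = ym" "g xp = xp" "g yp = yp"
    using A.fixed_ends[OF gc Km(1,2) m(2)] A.fixed_ends[OF gc Kp(1,2) p(2)] by auto
  have pne: "p \<noteq> q" using B.ne_oarc[OF pq(1)] .
  have "\<not> endp L q" using ends_disj B.endp2[OF pq(1)] by auto
  then have "q \<noteq> xp" "q \<noteq> yp" using A.endp1[OF p(3)] A.endp2[OF p(3)] by auto
  moreover have "\<not> cyc xp q yp" using pq(3) Kp(4) p(2) by auto
  moreover have "cyc xm p ym" using pq(2) Km(3) m(2) by auto
  ultimately have N: "cyc q xp p" "cyc q xm p" "\<not> cyc q yp p" "\<not> cyc q ym p"
    using sub m(1) p(1) unfolding oarc_subset_iff[OF m(1)] cyc_ang circ_eq_iff by (smt (z3))+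
  obtain J \<G> where J: "J \<in> M" "g ` J = J" "nlg M \<G>" "co J \<in> \<G>" "\<forall>K\<in>\<G>. \<not> (xp \<in> K \<and> xm \<in> K)"
    using extreme[OF gL gM p(3) m(3) fx(3,4,1,2) ne(1)[symmetric] B.dual[OF pq(1)]] N by auto
  have g: "isgap M \<G>" using B.nlg_gap[OF J(3)] .
  have vf: "g w = w" if "w \<in> verts \<G>" for w
    using B.nlg_fix_el(1)[OF gM J(3,4) B.fixed_co[OF gM J(1,2)] that] .
  have e: "\<not> endp M xp" "\<not> endp M xm" using ends_disj A.endp1[OF m(3)] A.endp1[OF p(3)] by auto
  \<comment> \<open>No element contains both points. So either \<open>xp\<close> is a pivot, at
    which vertices accumulate, or the element around \<open>xp\<close> ends before
    \<open>xm\<close>.\<close>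
  have "\<exists>w\<in>verts \<G>. cyc xp w xm"
  proof (cases "xp \<in> verts \<G>")
    case True
    have "xp \<noteq> a \<and> xp \<noteq> b" if "oarc a b \<in> \<G>" for a b
      using B.gap_in[OF g that] B.endp1 B.endp2 e by auto
    then have "pivot \<G> xp" using True unfolding pivot_def by auto
    then show ?thesis using B.pivot_accum(1)[OF g _ ne(1)] by simp
  next
    case False
    then obtain k l where kl: "k \<noteq> l" "oarc k l \<in> \<G>" "cyc k xp l" "k \<in> verts \<G>" "l \<in> verts \<G>"
      by (rule B.verts_cases[OF g])
    have "\<not> cyc k xm l" using bspec[OF J(5) kl(2)] kl(3) by simp
    moreover have "l \<noteq> xm" using B.gap_in[OF g kl(2)] B.endp2 e by auto
    ultimately have "cyc xp l xm" using kl(1,3) ne unfolding cyc_ang circ_eq_iff by (smt (z3))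
    then show ?thesis using kl(5) by auto
  qed
  then obtain w where w: "w \<in> verts \<G>" "cyc xp w xm" by auto
  have "cyc xp w yp" "cyc ym w xm" using w(2) sub ne m(1) p(1) unfolding oarc_subset_iff[OF m(1)] cyc_ang circ_eq_iff by (smt (z3))+
  then have "w \<in> Kp" "w \<in> co Km" unfolding m(4) p(2) by simp_all
  then show False by (rule nfw[OF vf[OF w(1)]])
qed

end

context pf
begin

text \<open>Let \<open>B2\<close> be the largest invariant side from \<open>B\<close> up to
  \<open>N\<close>. The pair \<open>A\<close>, \<open>B2\<close> produces, via \<open>rect\<close>
  in the other lamination, invariant leaves on both sides of the leaf \<open>x y\<close>, and these
  produce an invariant side \<open>co Q\<close> beyond \<open>B2\<close> that misses
  \<open>y\<close>. If \<open>N\<close> is inside \<open>co Q\<close>, \<open>between\<close>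
  applies. Otherwise \<open>co Q = B2\<close> by maximality, and the element \<open>Z\<close> of the
  gap next to \<open>Q\<close> that contains \<open>co N\<close> gives a larger invariant side
  \<open>co Z\<close>.\<close>

lemma beyond:
  assumes gL: "auto_on L g" and gM: "auto_on M g"
    and xy: "oarc x y \<in> L" "g x = x" "g y = y"
    and AB: "A \<in> M" "B \<in> M" "A \<subseteq> B" "g ` A = A" "g ` B = B" "bd A \<inter> bd B = {}" "x \<in> A"
    and N: "N \<in> M" "B \<subseteq> N" "y \<notin> N"
  shows "g ` N = N"
proof (rule ccontr)
  assume nf: "g ` N \<noteq> N"
  have gc: "cycauto g" using gL by (rule auto_on_cyc)
  obtain B2 where B2: "B2 \<in> M" "g ` B2 = B2" "B \<subseteq> B2" "B2 \<subseteq> N"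
     "\<And>B'. B' \<in> M ==> B \<subseteq> B' ==> B' \<subseteq> N ==> g ` B' = B' ==> B' \<subseteq> B2"
    using B.fix_sup[OF gM AB(2) N(1,2) AB(5)] by auto
  have bdd: "bd A \<inter> bd B2 = {}" using B.bd_trans'[OF AB(1,2) B2(1) AB(3) B2(3)] AB(6) by simp
  obtain a1 a2 where a: "a1 \<noteq> a2" "A = oarc a1 a2" "oarc a1 a2 \<in> M" "co A = oarc a2 a1" "oarc a2 a1 \<in> M"
    by (rule B.L_cases[OF AB(1)])
  obtain c1 c2 where c: "c1 \<noteq> c2" "B2 = oarc c1 c2" "oarc c1 c2 \<in> M" "co B2 = oarc c2 c1" "oarc c2 c1 \<in> M"
    by (rule B.L_cases[OF B2(1)])
  have ne: "a1 \<noteq> c1" "a2 \<noteq> c2" using bdd unfolding a(2) c(2) bd_oarc[OF a(1)] bd_oarc[OF c(1)] by auto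
  have e: "\<not> endp M x" "\<not> endp M y" using ends_disj A.endp1[OF xy(1)] A.endp2[OF xy(1)] by auto
  have yx: "oarc y x \<in> L" using A.dual[OF xy(1)] .
  have xne: "x \<noteq> y" using A.ne_oarc[OF xy(1)] .
  have xB2: "x \<in> B2" using AB(3,7) B2(3) by auto
  have yB2: "y \<notin> B2" using B2(4) N(3) by auto
  then have ycB2: "y \<in> co B2" using B.in_or_co[OF B2(1) e(2)] by simp
  have sub: "oarc a1 a2 \<subseteq> oarc c1 c2" using AB(3) B2(3) a(2) c(2) by auto
  have p0: "cyc a1 x a2" "cyc c1 x c2" "cyc c2 y c1" using AB(7) xB2 ycB2 a c by auto
  have inn: "cyc y a1 x" "cyc y c1 x" "\<not> cyc y a2 x" "\<not> cyc y c2 x"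
    using p0 sub a(1) unfolding oarc_subset_iff[OF a(1)] cyc_ang circ_eq_iff by (smt (z3))+
  have fx: "g a1 = a1" "g a2 = a2" "g c1 = c1" "g c2 = c2"
    using B.fixed_ends[OF gc AB(1,4) a(2)] B.fixed_ends[OF gc B2(1,2) c(2)] by auto
  obtain J1 J2 where J: "J1 \<in> L" "J2 \<in> L" "c1 \<in> J1" "c2 \<in> J2" "J1 \<subseteq> oarc y x" "J2 \<subseteq> co (oarc y x)"
     "g ` J1 = J1" "g ` J2 = J2" "bd J1 \<inter> bd J2 = {}"
    using pf.rect[OF swap gM gL a(3) c(3) fx ne yx] inn by auto
  obtain p1 q1 where p1: "p1 \<noteq> q1" "J1 = oarc p1 q1" "oarc p1 q1 \<in> L" "co J1 = oarc q1 p1" "oarc q1 p1 \<in> L"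
    by (rule A.L_cases[OF J(1)])
  obtain p2 q2 where p2: "p2 \<noteq> q2" "J2 = oarc p2 q2" "oarc p2 q2 \<in> L" "co J2 = oarc q2 p2" "oarc q2 p2 \<in> L"
    by (rule A.L_cases[OF J(2)])
  have pne: "p1 \<noteq> q2" "q1 \<noteq> p2" using J(9) unfolding p1(2) p2(2) bd_oarc[OF p1(1)] bd_oarc[OF p2(1)] by auto
  have fp: "g p1 = p1" "g q1 = q1" "g q2 = q2" "g p2 = p2"
    using A.fixed_ends[OF gc J(1,7) p1(2)] A.fixed_ends[OF gc J(2,8) p2(2)] by auto
  have s1: "oarc p1 q1 \<subseteq> oarc y x" and s2: "oarc p2 q2 \<subseteq> oarc x y" using J(5,6) p1(2) p2(2) xne by auto
  have m1: "cyc p1 c1 q1" "cyc p2 c2 q2" using J(3,4) p1(2) p2(2) by auto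
  have i1: "cyc c2 p1 c1" "\<not> cyc c2 q1 c1"
    using s1 m1(1) p0(2,3) unfolding oarc_subset_iff[OF p1(1)] cyc_ang circ_eq_iff by (smt (z3))+
  have i2: "cyc c2 q2 c1" "\<not> cyc c2 p2 c1"
    using s2 m1(2) p0(2,3) unfolding oarc_subset_iff[OF p2(1)] cyc_ang circ_eq_iff by (smt (z3))+
  have inB: "p1 \<in> co B2" "q2 \<in> co B2" "q1 \<notin> co B2" "p2 \<notin> co B2" unfolding c(4) using i1 i2 by simp_all
  \<comment> \<open>\<open>p1\<close> and \<open>q2\<close> are the end points of \<open>J1\<close>
    and \<open>J2\<close> on the side of \<open>y\<close>; a side containing both but not
    \<open>q1\<close> must contain \<open>y\<close>.\<close>
  obtain Q \<Q> where Q: "Q \<in> M" "p1 \<in> Q" "q2 \<in> Q" "q1 \<notin> Q" "p2 \<notin> Q" "Q \<subseteq> co B2" "g ` Q = Q"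
     "nlg M \<Q>" "co Q \<in> \<Q>"
    using extreme[OF gL gM p1(3) p2(5) fp(1,2,3,4) pne(1) B.co_in[OF B2(1)] inB] by auto
  have y0: "y = p1 \<or> cyc y p1 x" "y = q2 \<or> cyc x q2 y" "q1 = x \<or> cyc y q1 x" "cyc y p1 q1 \<or> y = p1 \<or> q1 = x"
    using s1 s2 unfolding oarc_subset_iff[OF p1(1)] oarc_subset_iff[OF p2(1)] by auto
  have yQ: "y \<in> Q"
  proof -
    obtain s t where st: "s \<noteq> t" "Q = oarc s t" using B.oarcs[OF Q(1)] by auto
    have "cyc s p1 t" "cyc s q2 t" "\<not> cyc s q1 t" using Q(2,3,4) st(2) by auto
    then have "cyc s y t" using y0 p1(1) pne(1) xne unfolding cyc_ang circ_eq_iff by (smt (z3))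
    then show ?thesis using st(2) by simp
  qed
  have cQ: "co Q \<in> M" "g ` co Q = co Q" using B.co_in[OF Q(1)] B.fixed_co[OF gM Q(1,7)] by auto
  have xQ: "x \<in> co Q" using B.in_or_co[OF Q(1) e(1)] Q(6) B.co_disj[OF B2(1)] xB2 by auto
  have ycQ: "y \<notin> co Q" using yQ B.co_disj[OF Q(1)] by auto
  have B2Q: "B2 \<subseteq> co Q" using B.co_anti[OF Q(1) B.co_in[OF B2(1)]] Q(6) B.co_co[OF B2(1)] by simp
  have xN: "x \<in> N" using xB2 B2(4) by auto
  have "N \<subseteq> co Q \<or> co Q \<subseteq> N" using B.nested'[OF N(1) cQ(1) xN xQ N(3) ycQ e(2)] .
  then show False
  proof
    assume "N \<subseteq> co Q"
    then have "g ` N = N" using pf.between[OF swap gM gL B2(1) N(1) cQ(1) B2(4) _ B2(2) cQ(2) xy(1) xB2 ycQ] by simp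
    then show False using nf by simp
  next
    assume "co Q \<subseteq> N"
    then have "co Q \<subseteq> B2" using B2(5)[OF cQ(1) _ _ cQ(2)] B2Q B2(3) by auto
    then have eq: "co Q = B2" using B2Q by auto
    have gQ: "isgap M \<Q>" using B.nlg_gap[OF Q(8)] .
    have B2Q': "B2 \<in> \<Q>" using Q(9) eq by simp
    obtain Z where Z: "Z \<in> \<Q>" "N \<subseteq> Z \<or> co N \<subseteq> Z" using B.gap_lies[OF gQ N(1)] by auto
    have ZM: "Z \<in> M" using B.gap_in[OF gQ Z(1)] .
    have "\<not> N \<subseteq> Z"
    proof
      assume "N \<subseteq> Z"
      then have "Z = B2" using B.gap_disj[OF gQ Z(1) B2Q', of x] xN xB2 by auto
      then have "N = B2" using \<open>N \<subseteq> Z\<close> B2(4) by auto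
      then show False using nf B2(2) by simp
    qed
    then have cNZ: "co N \<subseteq> Z" using Z(2) by simp
    have "y \<in> Z" using B.in_or_co[OF N(1) e(2)] N(3) cNZ by auto
    then have "Z \<noteq> B2" using yB2 by auto
    then have "B2 \<inter> Z = {}" using gQ Z(1) B2Q' unfolding isgap_def by auto
    then have 1: "B2 \<subseteq> co Z" using B.disj_iff[OF B2(1) ZM] by simp
    have 2: "co Z \<subseteq> N" using B.co_anti[OF B.co_in[OF N(1)] ZM] cNZ B.co_co[OF N(1)] by simp
    have 3: "g ` co Z = co Z" using B.fixed_co[OF gM ZM] B.nlg_fix_el(2)[OF gM Q(8) B2Q' B2(2) Z(1)] by simp
    have "co Z \<subseteq> B2" using B2(5)[OF B.co_in[OF ZM] _ 2 3] 1 B2(3) by auto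
    then have "co Z = B2" using 1 by auto
    then have "co B2 \<in> \<Q>" using Z(1) B.co_co[OF ZM] by simp
    then show False using B.leaf_gapI[OF gQ B2Q'] Q(8) by simp
  qed
qed

lemma rig_co: assumes gL: "auto_on L g" and r: "rig L M g I" shows "rig L M g (co I)"
proof -
  obtain I2 p q where I: "I \<in> L" "g ` I = I" "I2 \<in> L" "g ` I2 = I2" "bd I \<inter> bd I2 = {}"
    "oarc p q \<in> M" "p \<in> I" "p \<in> I2" "q \<notin> I" "q \<notin> I2" using r unfolding rig_def by auto
  have e: "\<not> endp L p" "\<not> endp L q" using ends_disj B.endp1[OF I(6)] B.endp2[OF I(6)] by auto
  have "q \<in> co I" "q \<in> co I2" "p \<notin> co I" "p \<notin> co I2"
    using A.in_co_iff[OF I(1)] A.in_co_iff[OF I(3)] e I by auto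
  moreover have "bd (co I) \<inter> bd (co I2) = {}" using A.bd_co I(1,3,5) by simp
  ultimately show ?thesis unfolding rig_def
    using A.co_in[OF I(1)] A.co_in[OF I(3)] A.fixed_co[OF gL I(1,2)] A.fixed_co[OF gL I(3,4)] B.dual[OF I(6)] by blast
qed

text \<open>\<open>rect\<close> gives invariant sides \<open>J1\<close> inside \<open>B'\<close>
  that cross the leaf \<open>x y\<close> and have no common end point. \<open>N\<close> is nested
  with both, so it is invariant by \<open>between\<close>, or by \<open>beyond\<close> in one of the
  two directions. For rigidity it is paired with \<open>J1\<close> or \<open>B'\<close>, depending
  on which of them has no end point in common with it.\<close>

lemma rig_cross:
  assumes gL: "auto_on L g" and gM: "auto_on M g" and r: "rig L M g (oarc x y)"
    and N: "N \<in> M" "x \<in> N" "y \<notin> N"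
  shows "g ` N = N" "rig M L g N"
proof -
  have gc: "cycauto g" using gL by (rule auto_on_cyc)
  obtain I2 p q where I: "oarc x y \<in> L" "g ` oarc x y = oarc x y" "I2 \<in> L" "g ` I2 = I2" "bd (oarc x y) \<inter> bd I2 = {}"
    "oarc p q \<in> M" "p \<in> oarc x y" "p \<in> I2" "q \<notin> oarc x y" "q \<notin> I2" using r unfolding rig_def by auto
  have xy: "x \<noteq> y" using A.ne_oarc[OF I(1)] .
  obtain x2 y2 where i2: "x2 \<noteq> y2" "I2 = oarc x2 y2" "oarc x2 y2 \<in> L" "co I2 = oarc y2 x2" "oarc y2 x2 \<in> L"
    by (rule A.L_cases[OF I(3)])
  have ne: "x \<noteq> x2" "y \<noteq> y2" using I(5) unfolding i2(2) bd_oarc[OF xy] bd_oarc[OF i2(1)] by auto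
  have fx: "g x = x" "g y = y" "g x2 = x2" "g y2 = y2"
    using A.fixed_ends[OF gc I(1,2) HOL.refl] A.fixed_ends[OF gc I(3,4) i2(2)] by auto
  have el: "\<not> endp L q" "\<not> endp L p" using ends_disj B.endp1[OF I(6)] B.endp2[OF I(6)] by auto
  have qne: "q \<noteq> x" "q \<noteq> y" "q \<noteq> x2" "q \<noteq> y2" using el A.endp1[OF I(1)] A.endp2[OF I(1)] A.endp1[OF i2(3)] A.endp2[OF i2(3)] by auto
  have m: "cyc x p y" "cyc x2 p y2" "\<not> cyc x q y" "\<not> cyc x2 q y2" using I(7-10) i2(2) by auto
  have n1: "cyc q x p" "\<not> cyc q y p" using m(1,3) qne(1,2) xy unfolding cyc_ang circ_eq_iff by (smt (z3))+
  have n2: "cyc q x2 p" "\<not> cyc q y2 p" using m(2,4) qne(3,4) i2(1) unfolding cyc_ang circ_eq_iff by (smt (z3))+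
  obtain J1 J2 G1 where J: "J1 \<in> M" "J2 \<in> M" "x \<in> J1" "y \<notin> J1" "y \<in> J2" "x \<notin> J2"
     "J1 \<subseteq> oarc q p" "J2 \<subseteq> co (oarc q p)" "g ` J1 = J1" "g ` J2 = J2" "nlg M G1" "co J1 \<in> G1" "bd J1 \<inter> bd J2 = {}"
    using rect[OF gL gM I(1) i2(3) fx ne B.dual[OF I(6)]] n1 n2 by auto
  have e: "\<not> endp M x" "\<not> endp M y" using ends_disj A.endp1[OF I(1)] A.endp2[OF I(1)] by auto
  define B' where "B' = co J2"
  have B': "B' \<in> M" "g ` B' = B'" "x \<in> B'" "y \<notin> B'" "bd J1 \<inter> bd B' = {}" "co B' = J2"
    unfolding B'_def using B.co_in[OF J(2)] B.fixed_co[OF gM J(2,10)] B.in_co_iff[OF J(2)] e J B.bd_co[OF J(2)] B.co_co[OF J(2)] by auto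
  have "J1 \<inter> J2 = {}" using J(7,8) B.co_disj[OF B.dual[OF I(6)]] by auto
  then have J1B: "J1 \<subseteq> B'" unfolding B'_def using B.disj_iff[OF J(1,2)] by simp
  have cb: "bd (co B') \<inter> bd (co J1) = {}" using B.bd_co[OF B'(1)] B.bd_co[OF J(1)] B'(5) by auto
  have N1: "N \<subseteq> J1 \<or> J1 \<subseteq> N" using B.nested'[OF N(1) J(1) N(2) J(3) N(3) J(4) e(2)] .
  have N2: "N \<subseteq> B' \<or> B' \<subseteq> N" using B.nested'[OF N(1) B'(1) N(2) B'(3) N(3) B'(4) e(2)] .
  show fN: "g ` N = N"
  proof (cases "B' \<subseteq> N")
    case True
    then show ?thesis using beyond[OF gL gM I(1) fx(1,2) J(1) B'(1) J1B J(9) B'(2,5) J(3) N(1) True N(3)] by simp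
  next
    case False
    then have NB: "N \<subseteq> B'" using N2 by simp
    show ?thesis
    proof (cases "J1 \<subseteq> N")
      case True
      show ?thesis using pf.between[OF swap gM gL J(1) N(1) B'(1) True NB J(9) B'(2) I(1) J(3) B'(4)] .
    next
      case False
      then have "co J1 \<subseteq> co N" using N1 B.co_anti[OF N(1) J(1)] by simp
      moreover have "x \<notin> co N" using N(2) B.co_disj[OF N(1)] by auto
      moreover have "co B' \<subseteq> co J1" using B.co_anti[OF J(1) B'(1)] J1B by simp
      moreover have "y \<in> co B'" using B'(6) J(5) by simp
      ultimately have "g ` co N = co N"
        using beyond[OF gL gM A.dual[OF I(1)] fx(2,1) B.co_in[OF B'(1)] B.co_in[OF J(1)] _ B.fixed_co[OF gM B'(1,2)]
            B.fixed_co[OF gM J(1,9)] cb _ B.co_in[OF N(1)]] by simp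
      then have "g ` co (co N) = co (co N)" using B.fixed_co[OF gM B.co_in[OF N(1)]] by simp
      then show ?thesis using B.co_co[OF N(1)] by simp
    qed
  qed
  show "rig M L g N"
  proof (cases "J1 \<subset> N")
    case True
    have "bd N \<inter> bd J1 = {}" using pf.leaf_off_vertex[OF swap J(11) J(1) True J(12) N(1)] by auto
    then show ?thesis unfolding rig_def using N(1) fN J(1,9,3,4) I(1) N(2,3) by blast
  next
    case False
    then have NJ: "N \<subseteq> J1" using N1 by auto
    have "bd N \<inter> bd B' = {}" using B.bd_trans'[OF N(1) J(1) B'(1) NJ J1B] B'(5) by simp
    then show ?thesis unfolding rig_def using N(1) fN B'(1-4) I(1) N(2,3) by blast
  qed
qed

text \<open>\<open>g\<close> preserves the gap with pivot \<open>b\<close> and its element around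
  \<open>a\<close>, hence fixes all its vertices, which accumulate at \<open>b\<close>. By looseness
  one side \<open>J\<close> of the leaf \<open>a b\<close> has no gap bordering the leaf from
  inside. There two vertices can be enclosed by a least leaf, which is invariant and disjoint at its
  ends from \<open>a b\<close>, while the element around \<open>a\<close> provides the leaf crossing
  both.\<close>

lemma pivot_rig:
  assumes gL: "auto_on L g" and gM: "auto_on M g"
    and ab: "oarc a b \<in> L" "g a = a" "g b = b" and H: "isgap M \<H>" "pivot \<H> b"
  shows "rig L M g (oarc a b)"
proof -
  have gc: "cycauto g" using gL by (rule auto_on_cyc)
  have ne: "a \<noteq> b" using A.ne_oarc[OF ab(1)] .
  have ba: "oarc b a \<in> L" using A.dual[OF ab(1)] .
  have nH: "nlg M \<H>" using B.nonleaf_pivot[OF H] .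
  have e: "\<not> endp M a" "\<not> endp M b" using ends_disj A.endp1[OF ab(1)] A.endp2[OF ab(1)] by auto
  have bV: "b \<in> verts \<H>" using H(2) unfolding pivot_def by simp
  have "a \<notin> verts \<H>"
  proof
    assume aV: "a \<in> verts \<H>"
    have "a \<noteq> x \<and> a \<noteq> y" if "oarc x y \<in> \<H>" for x y
      using B.gap_in[OF H(1) that] B.endp1 B.endp2 e(1) by auto
    then have "pivot \<H> a" using aV unfolding pivot_def by auto
    then show False using B.pivot_unique[OF H(1) _ H(2)] ne by simp
  qed
  then obtain t0 t1 where t: "t0 \<noteq> t1" "oarc t0 t1 \<in> \<H>" "cyc t0 a t1" "t0 \<in> verts \<H>" "t1 \<in> verts \<H>"
    by (rule B.verts_cases[OF H(1)])
  have tM: "oarc t0 t1 \<in> M" "oarc t1 t0 \<in> M" using B.gap_in[OF H(1) t(2)] B.dual by auto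
  have tb: "t0 \<noteq> b" "t1 \<noteq> b" "\<not> cyc t0 b t1" using H(2) t(1,2) bV unfolding pivot_def verts_def by auto
  have st: "(`) g ` \<H> = \<H>" using B.nlg_stable[OF gM nH bV] bV ab(3) by simp
  have gtH: "g ` oarc t0 t1 \<in> \<H>" using imageI[OF t(2), of "(`) g"] unfolding st .
  have agt: "a \<in> g ` oarc t0 t1" using A.fixed_mem[OF gc ab(2)] t(3) by simp
  have "a \<in> oarc t0 t1" using t(3) by simp
  then have fT: "g ` oarc t0 t1 = oarc t0 t1" using B.gap_disj[OF H(1) gtH t(2) agt] by blast
  have vf: "g w = w" if "w \<in> verts \<H>" for w using B.nlg_fix_el(1)[OF gM nH t(2) fT that] .
  \<comment> \<open>\<open>z\<close>, \<open>z'\<close> are the two ends of the element around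
    \<open>a\<close>, with \<open>z\<close> inside \<open>J\<close>. As no gap borders
    \<open>J\<close> from inside, \<open>side\<close> shows that some leaf strictly inside
    \<open>J\<close> contains \<open>z\<close> and \<open>z2\<close>; the least such leaf borders a
    gap, so \<open>leaf_off_vertex\<close> applies.\<close>
  have main: "rig L M g J"
    if J: "J \<in> L" "bd J = {a, b}" "\<not> (\<exists>\<G>. nlg L \<G> \<and> co J \<in> \<G>)" "g ` J = J"
      and z: "oarc z z' \<in> M" "z \<in> J" "z' \<notin> J" "z \<in> verts \<H>" and z2: "z2 \<in> verts \<H>" "z2 \<in> J" "z2 \<noteq> z" "\<not> endp L z2"
    for J z z' z2
  proof -
    obtain c d where cd: "c \<noteq> d" "J = oarc c d" "oarc c d \<in> L" "co J = oarc d c" "oarc d c \<in> L"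
      by (rule A.L_cases[OF J(1)])
    have "\<exists>K\<in>L. K \<subset> oarc c d \<and> {z, z2} \<subseteq> K"
    proof (rule ccontr)
      assume no: "\<not> ?thesis"
      have "\<exists>\<G>. nlg L \<G> \<and> oarc d c \<in> \<G> \<and> (\<forall>K\<in>\<G>. \<not> {z, z2} \<subseteq> K)"
      proof (rule A.side[OF cd(3)])
        show "{z, z2} \<subseteq> oarc c d" using z(2) z2(2) unfolding cd(2) by simp
        show False if "K \<in> L" "K \<subset> oarc c d" "{z, z2} \<subseteq> K" for K using no that by blast
      qed auto
      then show False using J(3) unfolding cd(4) by blast
    qed
    then obtain K0 where K0: "K0 \<in> L" "K0 \<subset> J" "z \<in> K0" "z2 \<in> K0" unfolding cd(2) by auto
    have ez: "\<not> endp L z" "\<not> endp L z'" using ends_disj B.endp1[OF z(1)] B.endp2[OF z(1)] by auto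
    have "a \<notin> J" "b \<notin> J" using J(2) unfolding bd_def by auto
    then have abK: "a \<notin> K0" "b \<notin> K0" using K0(2) by auto
    obtain K where K: "K \<in> L" "z \<in> K" "z2 \<in> K" "a \<notin> K" "b \<notin> K"
      "\<forall>N'\<in>L. z \<in> N' --> z2 \<in> N' --> a \<notin> N' --> b \<notin> N' --> K \<subseteq> N'"
      "\<exists>\<G>. nlg L \<G> \<and> co K \<in> \<G> \<and> (\<forall>K\<in>\<G>. \<not> (z \<in> K \<and> z2 \<in> K))"
      using A.least_arc[OF z2(3)[symmetric] ez(1) z2(4) K0(1,3,4) abK] ne by auto
    have gK: "g ` K = K" using A.fixed_least[OF gL vf[OF z(4)] vf[OF z2(1)] ab(2,3) K(1-6)] .
    have KK0: "K \<subseteq> K0" using K(6) K0 abK by auto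
    then have KJ: "K \<subset> J" using K0(2) by auto
    obtain \<G> where G: "nlg L \<G>" "co K \<in> \<G>" using K(7) by auto
    have "bd J \<inter> bd K = {}" using leaf_off_vertex[OF G(1) K(1) KJ G(2) J(1)] by auto
    moreover have "z' \<notin> K" using z(3) KJ by auto
    ultimately show ?thesis unfolding rig_def using J(1,4) K(1,2) gK z(1,2,3) by blast
  qed
  have gab: "g ` oarc a b = oarc a b" "g ` oarc b a = oarc b a" using ab(2,3) by (simp_all add: cycauto_image[OF gc])
  have ev: "\<not> endp L w" if w: "w \<in> verts \<H>" "w \<noteq> b" for w
  proof -
    have "\<not> pivot \<H> w" using B.pivot_unique[OF H(1) _ H(2), of w] w(2) by auto
    then obtain c where "oarc w c \<in> \<H>" using B.vert_ends[OF H(1) w(1)] by blast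
    then have "endp M w" using B.gap_in[OF H(1)] B.endp1 by auto
    then show ?thesis using ends_disj by auto
  qed
  have t1: "cyc a t1 b" "\<not> cyc a t0 b" "cyc b t0 a" "\<not> cyc b t1 a" using t(1,3) tb ne unfolding cyc_ang circ_eq_iff by (smt (z3))+
  show ?thesis
  proof (cases "\<exists>\<G>. nlg L \<G> \<and> co (oarc a b) \<in> \<G>")
    case False
    obtain w where w: "w \<in> verts \<H>" "cyc t1 w b" using B.pivot_accum(2)[OF H, of t1] tb by auto
    have "cyc a w b" "w \<noteq> t1" "w \<noteq> b" using w(2) t1(1) unfolding cyc_ang by auto
    then show ?thesis
      using main[OF ab(1) bd_oarc[OF ne] False gab(1) tM(2) _ _ t(5) w(1)] t1 ev[OF w(1)] by simp
  next
    case True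
    then obtain \<G> where G: "nlg L \<G>" "oarc b a \<in> \<G>" using ne by auto
    have False': "\<not> (\<exists>\<G>. nlg L \<G> \<and> co (oarc b a) \<in> \<G>)"
    proof
      assume "\<exists>\<G>. nlg L \<G> \<and> co (oarc b a) \<in> \<G>"
      then obtain \<G>' where G': "nlg L \<G>'" "oarc a b \<in> \<G>'" using ne by auto
      have "a \<in> verts \<G>" "a \<in> verts \<G>'" using A.gap_verts[OF A.nlg_gap[OF G(1)] G(2)] A.gap_verts[OF A.nlg_gap[OF G'(1)] G'(2)] by auto
      then have "\<G> = \<G>'" using A.loose[OF G(1) G'(1)] by simp
      then show False using A.leaf_gapI[OF A.nlg_gap[OF G(1)] G(2)] G G' ne by simp
    qed
    obtain w where w: "w \<in> verts \<H>" "cyc b w t0" using B.pivot_accum(1)[OF H, of t0] tb by auto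
    have w': "cyc b w a" "w \<noteq> t0" "w \<noteq> b" using w(2) t1(3) unfolding cyc_ang by auto
    have "bd (oarc b a) = {a, b}" using bd_oarc[of b a] ne by auto
    then have "rig L M g (oarc b a)"
      using main[OF ba _ False' gab(2) tM(1) _ _ t(4) w(1)] t1 ev[OF w(1)] w' by simp
    then have "rig L M g (co (oarc b a))" by (rule rig_co[OF gL])
    then show ?thesis using ne by simp
  qed
qed

end

lemma int_induct_both:
  assumes "P i" "\<And>k :: int. P k ==> P (k + 1)" "\<And>k. P (k + 1) ==> P k" shows "P j"
proof (induction j rule: int_induct[where k = i])
  case (step2 j)
  then show ?case using assms(3)[of "j - 1"] by simp
qed (use assms in auto)

section \<open>Propagation of rigidity and the identity theorem\<close>

context pf
begin

text \<open>A leaf of \<open>M\<close> around \<open>b\<close> missing \<open>a\<close> and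
  \<open>c\<close> crosses both leaves at \<open>b\<close>, so two applications of
  \<open>rig_cross\<close> carry rigidity across. If no such leaf exists, \<open>b\<close> is a
  pivot and \<open>pivot_rig\<close> applies.\<close>

lemma rig_next:
  assumes gL: "auto_on L g" and gM: "auto_on M g" and r: "rig L M g (oarc a b)"
    and bc: "oarc b c \<in> L" "g b = b" "g c = c"
  shows "rig L M g (oarc b c)"
proof -
  have abL: "oarc a b \<in> L" using r unfolding rig_def by simp
  have ne: "a \<noteq> b" "b \<noteq> c" using A.ne_oarc abL bc(1) by auto
  have r': "rig L M g (oarc b a)" using rig_co[OF gL r] ne by simp
  have e: "\<not> endp M b" using ends_disj A.endp1[OF bc(1)] by auto
  show ?thesis
  proof (cases "\<exists>\<H>. isgap M \<H> \<and> pivot \<H> b")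
    case True
    then obtain \<H> where H: "isgap M \<H>" "pivot \<H> b" by auto
    have "rig L M g (oarc c b)" by (rule pivot_rig[OF gL gM A.dual[OF bc(1)] bc(3,2) H])
    then have "rig L M g (co (oarc c b))" by (rule rig_co[OF gL])
    then show ?thesis using ne by simp
  next
    case False
    have "finite {a, c}" "b \<notin> {a, c}" using ne by auto
    then obtain N where N: "N \<in> M" "b \<in> N" "N \<inter> {a, c} = {}" using B.rainbow_or_pivot[OF e False] by blast
    then have ac: "a \<notin> N" "c \<notin> N" by auto
    have rN: "rig M L g N" using rig_cross(2)[OF gL gM r' N(1,2) ac(1)] .
    obtain m n where mn: "m \<noteq> n" "N = oarc m n" "oarc m n \<in> M" "co N = oarc n m" "oarc n m \<in> M"
      by (rule B.L_cases[OF N(1)])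
    have cn: "c \<noteq> m" "c \<noteq> n" using ends_disj A.endp2[OF bc(1)] B.endp1[OF mn(3)] B.endp2[OF mn(3)] by auto
    have "cyc m b n" "\<not> cyc m c n" using N(2) ac(2) mn(2) by auto
    then have "cyc b n c" "\<not> cyc b m c" using cn ne unfolding cyc_ang circ_eq_iff by (smt (z3))+
    moreover have "rig M L g (oarc n m)" using pf.rig_co[OF swap gM rN] mn(4) by simp
    ultimately show ?thesis using pf.rig_cross(2)[OF swap gM gL _ bc(1)] by simp
  qed
qed

lemma rig_prev:
  assumes gL: "auto_on L g" and gM: "auto_on M g" and r: "rig L M g (oarc b a)"
    and bc: "oarc c b \<in> L" "g b = b" "g c = c"
  shows "rig L M g (oarc c b)"
proof -
  have abL: "oarc b a \<in> L" using r unfolding rig_def by simp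
  have ne: "a \<noteq> b" "b \<noteq> c" using A.ne_oarc abL bc(1) by auto
  have e: "\<not> endp M b" using ends_disj A.endp2[OF bc(1)] by auto
  show ?thesis
  proof (cases "\<exists>\<H>. isgap M \<H> \<and> pivot \<H> b")
    case True
    then obtain \<H> where H: "isgap M \<H>" "pivot \<H> b" by auto
    show ?thesis by (rule pivot_rig[OF gL gM bc(1) bc(3,2) H])
  next
    case False
    have "finite {a, c}" "b \<notin> {a, c}" using ne by auto
    then obtain N where N: "N \<in> M" "b \<in> N" "N \<inter> {a, c} = {}" using B.rainbow_or_pivot[OF e False] by blast
    then have ac: "a \<notin> N" "c \<notin> N" by auto
    have rN: "rig M L g N" using rig_cross(2)[OF gL gM r N(1,2) ac(1)] .
    obtain m n where mn: "m \<noteq> n" "N = oarc m n" "oarc m n \<in> M" "co N = oarc n m" "oarc n m \<in> M"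
      by (rule B.L_cases[OF N(1)])
    have cn: "c \<noteq> m" "c \<noteq> n" using ends_disj A.endp1[OF bc(1)] B.endp1[OF mn(3)] B.endp2[OF mn(3)] by auto
    have "cyc m b n" "\<not> cyc m c n" using N(2) ac(2) mn(2) by auto
    then have "cyc c m b" "\<not> cyc c n b" using cn ne unfolding cyc_ang circ_eq_iff by (smt (z3))+
    moreover have "rig M L g (oarc m n)" using rN mn(2) by simp
    ultimately show ?thesis using pf.rig_cross(2)[OF swap gM gL _ bc(1)] by simp
  qed
qed

lemma rig_gap:
  assumes gL: "auto_on L g" and gM: "auto_on M g" and G: "nlg L \<G>" and Z: "Z0 \<in> \<G>" "rig L M g Z0" "Z \<in> \<G>"
  shows "rig L M g Z"
proof -
  have g: "isgap L \<G>" using A.nlg_gap[OF G] .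
  obtain v where v: "gseq \<G> v" using A.gap_seq[OF g] by auto
  have "g ` Z0 = Z0" using Z(2) unfolding rig_def by simp
  then have fx: "g (v k) = v k" for k
    using A.nlg_fix_el(1)[OF gL G Z(1)] A.gap_verts(1)[OF g A.gseq_el[OF v]] by simp
  have idx: "\<exists>k. Xs = oarc (v k) (v (k + 1))" if "Xs \<in> \<G>" for Xs using v that unfolding gseq_def by auto
  obtain i where i: "Z0 = oarc (v i) (v (i + 1))" using idx[OF Z(1)] by auto
  obtain j where j: "Z = oarc (v j) (v (j + 1))" using idx[OF Z(3)] by auto
  have el: "oarc (v k) (v (k + 1)) \<in> L" for k using A.gap_in[OF g A.gseq_el[OF v]] .
  have "rig L M g (oarc (v j) (v (j + 1)))"
  proof (rule int_induct_both[of "\<lambda>k. rig L M g (oarc (v k) (v (k + 1)))" i])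
    show "rig L M g (oarc (v i) (v (i + 1)))" using Z(2) i by simp
    show "rig L M g (oarc (v (k + 1)) (v (k + 1 + 1)))" if "rig L M g (oarc (v k) (v (k + 1)))" for k
      using rig_next[OF gL gM that el fx fx] .
    show "rig L M g (oarc (v k) (v (k + 1)))" if "rig L M g (oarc (v (k + 1)) (v (k + 1 + 1)))" for k
      using rig_prev[OF gL gM that el fx fx] .
  qed
  then show ?thesis using j by simp
qed

text \<open>For a moved point \<open>z\<close> let \<open>H\<close> be the limit of the rigid sides
  around \<open>z\<close>. It is rigid itself. Inside \<open>H\<close> there is then either a
  smaller leaf around \<open>z\<close> crossed by a rigid leaf of \<open>M\<close>, or a gap
  bordering \<open>H\<close>, all elements of which are rigid by \<open>rig_gap\<close> and one of
  which contains \<open>z\<close>. Both contradict the minimality of \<open>H\<close>.\<close>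

theorem rig_id:
  assumes gL: "auto_on L g" and gM: "auto_on M g" and r: "rig L M g I"
  shows "g = id"
proof (rule ccontr)
  assume "g \<noteq> id"
  then obtain z where z: "g z \<noteq> z" unfolding fun_eq_iff by auto
  have gc: "cycauto g" using gL by (rule auto_on_cyc)
  have "\<exists>I0. rig L M g I0 \<and> z \<in> I0"
  proof (cases "z \<in> I")
    case False
    have I: "I \<in> L" "g ` I = I" using r unfolding rig_def by auto
    have "z \<notin> bd I" using A.fixed_bd[OF gc I(1)] I(2) z by auto
    then have "z \<in> co I" using False unfolding bd_def by simp
    then show ?thesis using rig_co[OF gL r] by blast
  qed (use r in blast)
  then obtain I0 where I0: "rig L M g I0" "z \<in> I0" by auto
  define Fa where "Fa = {I. rig L M g I \<and> z \<in> I \<and> I \<subseteq> I0}"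
  have FaL: "I \<in> L" "g ` I = I" if "I \<in> Fa" for I using that unfolding Fa_def rig_def by auto
  have I0F: "I0 \<in> Fa" using I0 unfolding Fa_def by simp
  have Faz: "z \<in> I" "g z \<in> I" if "I \<in> Fa" for I using FaL[OF that] that unfolding Fa_def by auto
  obtain s t where st: "s \<noteq> t" "I0 = oarc s t" using A.oarcs[OF FaL(1)[OF I0F]] by auto
  have stI: "s \<notin> I" "t \<notin> I" if "I \<in> Fa" for I
  proof -
    have "s \<notin> I0" "t \<notin> I0" unfolding st(2) by auto
    then show "s \<notin> I" "t \<notin> I" using that unfolding Fa_def by auto
  qed
  have chF: "I \<subseteq> J \<or> J \<subseteq> I" if "I \<in> Fa" "J \<in> Fa" for I J
    using A.nested[OF FaL(1)[OF that(1)] FaL(1)[OF that(2)] Faz(1)[OF that(1)] Faz(1)[OF that(2)]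
        stI(1)[OF that(1)] stI(1)[OF that(2)] stI(2)[OF that(1)] stI(2)[OF that(2)] st(1)] .
  \<comment> \<open>The invariance of the rigid sides keeps both \<open>z\<close> and
    \<open>g z\<close> out of every complement. These are the two distinct points that make the
    union of the complements a side.\<close>
  define K where "K = \<Union>(co ` Fa)"
  have KL: "K \<in> L" unfolding K_def
  proof (rule A.sup[of _ z "g z"])
    show "co ` Fa \<subseteq> L" using A.co_in FaL(1) by auto
    show "co ` Fa \<noteq> {}" using I0F by auto
    fix I assume "I \<in> co ` Fa"
    then obtain I' where I': "I' \<in> Fa" "I = co I'" by auto
    then show "z \<notin> I \<and> g z \<notin> I" using A.co_disj[OF FaL(1)[OF I'(1)]] Faz[OF I'(1)] by auto
    fix J assume "J \<in> co ` Fa"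
    then obtain J' where J': "J' \<in> Fa" "J = co J'" by auto
    show "I \<subseteq> J \<or> J \<subseteq> I"
      using chF[OF I'(1) J'(1)] A.co_anti[OF FaL(1)[OF I'(1)] FaL(1)[OF J'(1)]] A.co_anti[OF FaL(1)[OF J'(1)] FaL(1)[OF I'(1)]] I'(2) J'(2) by auto
  qed (use z in simp)
  have gK: "g ` K = K"
  proof -
    have "g ` co I = co I" if "I \<in> Fa" for I using A.fixed_co[OF gL FaL[OF that]] .
    then show ?thesis unfolding K_def by (auto simp: image_Union image_UN)
  qed
  define H where "H = co K"
  have HL: "H \<in> L" "g ` H = H" "co H = K" unfolding H_def using A.co_in[OF KL] A.fixed_co[OF gL KL gK] A.co_co[OF KL] by auto
  have zK: "z \<notin> K" unfolding K_def using A.co_disj FaL(1) Faz(1) by blast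
  have zH: "z \<in> H"
  proof -
    have "z \<notin> bd K" using A.fixed_bd[OF gc KL] gK z by auto
    then show ?thesis using zK unfolding bd_def H_def by simp
  qed
  have Hle: "H \<subseteq> I" if "I \<in> Fa" for I
  proof -
    have "co I \<subseteq> K" unfolding K_def using that by auto
    then have "co K \<subseteq> co (co I)" using A.co_anti[OF A.co_in[OF FaL(1)[OF that]] KL] by simp
    then show ?thesis unfolding H_def using A.co_co[OF FaL(1)[OF that]] by simp
  qed
  obtain p q where pq: "p \<noteq> q" "H = oarc p q" "oarc p q \<in> L" "co H = oarc q p" "oarc q p \<in> L"
    by (rule A.L_cases[OF HL(1)])
  obtain N where N: "N \<in> M" "p \<in> N" "q \<notin> N" using crossing_exists[OF pq(3)] by auto
  obtain m n where mn: "m \<noteq> n" "N = oarc m n" "oarc m n \<in> M" "co N = oarc n m" "oarc n m \<in> M"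
    by (rule B.L_cases[OF N(1)])
  have e: "\<not> endp L m" "\<not> endp L n" using ends_disj B.endp1[OF mn(3)] B.endp2[OF mn(3)] by auto
  then have mne: "m \<noteq> p" "m \<noteq> q" "n \<noteq> p" "n \<noteq> q" using A.endp1[OF pq(3)] A.endp2[OF pq(3)] by auto
  have "cyc m p n" "\<not> cyc m q n" using N mn(2) by auto
  then have mn': "cyc p n q" "cyc q m p" using mne pq(1) unfolding cyc_ang circ_eq_iff by (smt (z3))+
  have KE: "K = oarc q p" using pq(4) unfolding HL(3) .
  have nH: "n \<in> H" "m \<in> K" using mn' unfolding KE unfolding pq(2) by simp_all
  have mH: "m \<notin> H" using nH(2) HL(3) A.co_disj[OF HL(1)] by auto
  \<comment> \<open>If \<open>H\<close> is not a member, members decrease strictly to it, so a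
    member \<open>I\<close> already misses \<open>m\<close> and a further member \<open>I2\<close>
    lies strictly between. Then \<open>bd_three\<close> separates the ends of \<open>H\<close> and
    \<open>I\<close>, and the leaf from \<open>n\<close> to \<open>m\<close> crosses both.\<close>
  have HF: "H \<in> Fa"
  proof (rule ccontr)
    assume nF: "H \<notin> Fa"
    obtain I where I: "I \<in> Fa" "m \<in> co I" using nH(2) unfolding K_def by auto
    have "\<exists>I2\<in>Fa. I2 \<subset> I"
    proof (rule ccontr)
      assume "\<not> ?thesis"
      then have "I \<subseteq> J" if "J \<in> Fa" for J using chF[OF I(1) that] that by auto
      then have "co J \<subseteq> co I" if "J \<in> Fa" for J using A.co_anti[OF FaL(1)[OF I(1)] FaL(1)[OF that]] that by auto
      then have "K = co I" unfolding K_def using I(1) by auto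
      then have "H = I" unfolding H_def using A.co_co[OF FaL(1)[OF I(1)]] by simp
      then show False using nF I(1) by simp
    qed
    then obtain I2 where I2: "I2 \<in> Fa" "I2 \<subset> I" by auto
    have "H \<subset> I2" using Hle[OF I2(1)] nF I2(1) by auto
    then have bdd: "bd H \<inter> bd I = {}" using bd_three[OF HL(1) FaL(1)[OF I2(1)] FaL(1)[OF I(1)] _ I2(2)] by simp
    have "n \<in> I" using nH(1) Hle[OF I(1)] by auto
    moreover have "m \<notin> I" using I(2) A.co_disj[OF FaL(1)[OF I(1)]] by auto
    ultimately have "rig L M g H" unfolding rig_def using HL(1,2) FaL[OF I(1)] bdd mn(5) nH(1) mH by blast
    moreover have "H \<subseteq> I0" using Hle[OF I0F] .
    ultimately show False using nF zH unfolding Fa_def by simp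
  qed
  have rH: "rig L M g (oarc p q)" using HF pq(2) unfolding Fa_def by simp
  have rN: "rig M L g N" using rig_cross(2)[OF gL gM rH N] .
  have rN': "rig M L g (oarc n m)" using pf.rig_co[OF swap gM rN] mn(4) by simp
  have small: False if J: "J \<subset> H" "rig L M g J" "z \<in> J" for J
  proof -
    have "J \<in> Fa" using J Hle[OF I0F] unfolding Fa_def by auto
    then show False using Hle[of J] J(1) by auto
  qed
  show False
  proof (cases "\<exists>K\<in>L. K \<subset> oarc p q \<and> {n, z} \<subseteq> K")
    case True
    then obtain J where J: "J \<in> L" "J \<subset> oarc p q" "n \<in> J" "z \<in> J" by auto
    have "m \<notin> J" using mH J(2) pq(2) by auto
    then have "rig L M g J" using pf.rig_cross(2)[OF swap gM gL rN' J(1,3)] by simp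
    then show False using small[of J] J pq(2) by simp
  next
    case False
    have "\<exists>\<G>. nlg L \<G> \<and> oarc q p \<in> \<G> \<and> (\<forall>K\<in>\<G>. \<not> {n, z} \<subseteq> K)"
    proof (rule A.side[OF pq(3)])
      show "{n, z} \<subseteq> oarc p q" using nH(1) zH pq(2) by simp
      show False if "K \<in> L" "K \<subset> oarc p q" "{n, z} \<subseteq> K" for K using False that by blast
    qed auto
    then obtain \<G> where G: "nlg L \<G>" "co H \<in> \<G>" unfolding pq(4) by auto
    have gG: "isgap L \<G>" using A.nlg_gap[OF G(1)] .
    have fcH: "g ` co H = co H" using HL(3) gK by simp
    have "z \<notin> verts \<G>" using A.nlg_fix_el(1)[OF gL G fcH] z by auto
    then obtain Z where Z: "Z \<in> \<G>" "z \<in> Z" unfolding verts_def by auto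
    have ZL: "Z \<in> L" using A.gap_in[OF gG Z(1)] .
    have rcH: "rig L M g (co H)" using rig_co[OF gL rH] pq by simp
    have rZ: "rig L M g Z" using rig_gap[OF gL gM G(1,2) rcH Z(1)] .
    have "Z \<noteq> co H" using Z(2) zH A.co_disj[OF HL(1)] by auto
    then have "Z \<inter> co H = {}" using gG Z(1) G(2) unfolding isgap_def by auto
    then have "Z \<subseteq> H" using A.disj_iff[OF ZL A.co_in[OF HL(1)]] A.co_co[OF HL(1)] by simp
    moreover have "Z \<noteq> H" using A.leaf_gapI[OF gG] Z(1) G by auto
    ultimately show False using small[of Z] rZ Z(2) by auto
  qed
qed

lemma no_pivot:
  assumes gL: "auto_on L g" and gM: "auto_on M g" and g: "g \<noteq> id"
    and ab: "oarc a b \<in> L" "g a = a" "g b = b"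
  shows "\<not> (\<exists>\<H>. isgap M \<H> \<and> pivot \<H> b)"
  using pivot_rig[OF gL gM ab] rig_id[OF gL gM] g by blast

lemma rainbow:
  assumes gL: "auto_on L g" and gM: "auto_on M g" and g: "g \<noteq> id"
    and ab: "oarc a b \<in> L" "g a = a" "g b = b" and F: "finite F" "b \<notin> F"
  shows "\<exists>N\<in>M. b \<in> N \<and> N \<inter> F = {}"
proof -
  have "\<not> endp M b" using ends_disj A.endp2[OF ab(1)] by auto
  then show ?thesis using B.rainbow_or_pivot[OF _ no_pivot[OF gL gM g ab] F] by simp
qed

lemma crossing_fixed_share:
  assumes gL: "auto_on L g" and gM: "auto_on M g" and g: "g \<noteq> id"
    and xy: "oarc x y \<in> L" and N: "N \<in> M" "g ` N = N" "x \<in> N" "y \<notin> N"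
    and N': "N' \<in> M" "g ` N' = N'" "x \<in> N'" "y \<notin> N'"
  shows "bd N \<inter> bd N' \<noteq> {}"
proof
  assume "bd N \<inter> bd N' = {}"
  then have "rig M L g N" unfolding rig_def using N N' xy by blast
  then show False using pf.rig_id[OF swap gM gL] g by simp
qed

end

section \<open>Automorphisms fixing a leaf\<close>

lemma nat_first: assumes "\<not> P (0::nat)" "P n" shows "\<exists>k. \<not> P k \<and> P (Suc k)"
  using assms by (induction n) auto

text \<open>The arc from \<open>s\<close> to \<open>e\<close> surrounds \<open>v0\<close> and misses
  \<open>v1\<close>. If \<open>w\<close> is inside while \<open>g w\<close> is outside,
  \<open>g\<close> moves \<open>w\<close> towards \<open>v1\<close>. The second alternative
  expresses the same through the complementary arc and serves for iterates of the inverse.\<close>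

lemma push_right:
  assumes g: "cycauto g" "g v0 = v0" "g v1 = v1"
    and S: "s \<noteq> e" "cyc s v0 e" "\<not> cyc s v1 e" and w: "cyc v0 w v1"
      "cyc s w e \<and> \<not> cyc s (g w) e \<or> \<not> cyc e w s \<and> cyc e (g w) s"
  shows "cyc v0 w (g w)" "cyc w (g w) v1"
proof -
  have "cyc v0 (g w) v1" using cycauto_cyc[OF g(1), of v0 w v1] g w(1) by simp
  then show "cyc v0 w (g w)" "cyc w (g w) v1"
    using S w unfolding cyc_ang circ_eq_iff by (smt (z3))+
qed

context lam
begin

lemma funpow_image: "(g ^^ Suc n) ` A = g ` (g ^^ n) ` A"
  by (simp add: image_comp)

lemma funpow_fixed: "g x = x ==> (g ^^ n) x = x"
  by (induction n) simp_all

text \<open>If \<open>w\<close> were never reached, the iterates of \<open>Q\<close> would miss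
  \<open>w\<close> and \<open>v1\<close>, and by \<open>orbit_sup\<close> they would increase to an
  invariant side that \<open>nofix\<close> forbids.\<close>

lemma exhaust:
  assumes g: "auto_on L g" and v: "g v0 = v0" "g v1 = v1" and Q: "Q \<in> L" "v0 \<in> Q" "v1 \<notin> Q" "Q \<subseteq> g ` Q"
    and nofix: "\<And>N. N \<in> L ==> v0 \<in> N ==> v1 \<notin> N ==> Q \<subseteq> N ==> g ` N \<noteq> N" and w: "w \<noteq> v1" "w \<notin> Q"
  shows "\<exists>n. w \<notin> (g ^^ n) ` Q \<and> w \<in> (g ^^ Suc n) ` Q"
proof -
  have v1: "v1 \<notin> (g ^^ n) ` Q" for n
    using fixed_mem[OF auto_on_cyc[OF auto_on_funpow[OF g]] funpow_fixed[where g = g, OF v(2)]] Q(3) by simp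
  have "\<exists>n. w \<in> (g ^^ n) ` Q"
  proof (rule ccontr)
    assume no: "\<not> ?thesis"
    have out: "w \<notin> (g ^^ n) ` Q \<and> v1 \<notin> (g ^^ n) ` Q" for n using no v1 by simp
    note U = orbit_sup[OF g Q(1,4) w(1) out]
    have "v0 \<in> (\<Union>n. (g ^^ n) ` Q)" using U(3) Q(2) by (rule subsetD)
    moreover have "v1 \<notin> (\<Union>n. (g ^^ n) ` Q)" using v1 by simp
    ultimately show False using nofix[OF U(1) _ _ U(3)] U(2) by simp
  qed
  then obtain n where "w \<in> (g ^^ n) ` Q" by auto
  then show ?thesis using nat_first[of "\<lambda>n. w \<in> (g ^^ n) ` Q" n] w(2) by simp
qed

lemma mem_inv_image: "cycauto g ==> w \<in> inv_into UNIV g ` A \<longleftrightarrow> g w \<in> A"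
  using cycauto_inv(2,3) by (metis imageE image_eqI)

lemma image_mem: "cycauto g ==> g w \<in> g ` A \<longleftrightarrow> w \<in> A"
  using cycauto_eq by (metis imageE image_eqI)

lemma image_subset_inv: assumes g: "auto_on L g" and Q: "Q \<in> L" "Q \<subset> g ` Q" shows "co Q \<subset> inv_into UNIV g ` co Q"
proof -
  have gc: "cycauto g" using g by (rule auto_on_cyc)
  have gQ: "g ` Q \<in> L" using image_in[OF g] Q(1) by simp
  have "g ` co Q \<subseteq> co Q" using co_anti[OF Q(1) gQ] Q(2) co_image[OF g Q(1)] by auto
  then have "inv_into UNIV g ` g ` co Q \<subseteq> inv_into UNIV g ` co Q" by (rule image_mono)
  then have 1: "co Q \<subseteq> inv_into UNIV g ` co Q" using cycauto_inv(3)[OF gc] by (simp add: image_image)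
  have "co Q \<noteq> inv_into UNIV g ` co Q"
  proof
    assume "co Q = inv_into UNIV g ` co Q"
    then have "g ` co Q = g ` inv_into UNIV g ` co Q" by (rule arg_cong)
    also have "\<dots> = co Q" using cycauto_inv(2)[OF gc] by (simp add: image_image)
    finally have "g ` co Q = co Q" .
    then have "g ` co (co Q) = co (co Q)" using fixed_co[OF g co_in[OF Q(1)]] by simp
    then show False using Q co_co[OF Q(1)] by simp
  qed
  then show ?thesis using 1 by auto
qed

end

section \<open>Excluding automorphisms that push from one end of a leaf to the other\<close>

context pf
begin

text \<open>Exhausting by the iterates of \<open>Q\<close>, and by those of \<open>co P\<close>
  under the inverse, shows that points between \<open>v0\<close> and \<open>v1\<close> that are in
  \<open>P\<close> or beyond \<open>Q\<close>, end points included, move towards \<open>v1\<close>.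
  Take the least leaf \<open>c d\<close> of \<open>L\<close> around \<open>a\<close> and
  \<open>g a'\<close>, where \<open>a\<close> and \<open>a'\<close> are the ends of \<open>P\<close>
  and \<open>Q\<close> on this arc. It would be linked with its image unless it ends at
  \<open>v0\<close> or \<open>v1\<close>; then its gap borders the leaf
  \<open>v0 v1\<close>.\<close>

lemma push_gap:
  assumes gL: "auto_on L g" and gM: "auto_on M g" and v: "oarc v0 v1 \<in> L" "g v0 = v0" "g v1 = v1"
    and PQ: "P \<in> M" "Q \<in> M" "P \<subseteq> Q" "v0 \<in> P" "v1 \<notin> Q" "P \<subset> g ` P" "Q \<subset> g ` Q"
    and nofix0: "\<And>N. N \<in> M ==> v0 \<in> N ==> N \<subseteq> P ==> g ` N \<noteq> N"
    and nofix1: "\<And>N. N \<in> M ==> v0 \<in> N ==> v1 \<notin> N ==> Q \<subseteq> N ==> g ` N \<noteq> N"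
  shows "\<exists>\<G>. nlg L \<G> \<and> oarc v1 v0 \<in> \<G>"
proof -
  have gc: "cycauto g" using gL by (rule auto_on_cyc)
  have hM: "auto_on M (inv_into UNIV g)" using auto_on_inv[OF gM] .
  have hc: "cycauto (inv_into UNIV g)" using hM by (rule auto_on_cyc)
  have hv: "inv_into UNIV g v0 = v0" "inv_into UNIV g v1 = v1" using A.fixed_inv[OF gc] v by auto
  have vne: "v0 \<noteq> v1" using A.ne_oarc[OF v(1)] .
  have e: "\<not> endp M v0" "\<not> endp M v1" using ends_disj A.endp1[OF v(1)] A.endp2[OF v(1)] by auto
  have v0Q: "v0 \<in> Q" and v1P: "v1 \<notin> P" using PQ by auto
  have v1cP: "v1 \<in> co P" using B.in_or_co[OF PQ(1) e(2)] v1P by simp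
  have v0cP: "v0 \<notin> co P" using PQ(4) B.co_disj[OF PQ(1)] by auto
  have cP: "co P \<in> M" "co P \<subseteq> inv_into UNIV g ` co P" using B.co_in[OF PQ(1)] B.image_subset_inv[OF gM PQ(1,6)] by auto
  have push1: "cyc v0 w (g w) \<and> cyc w (g w) v1" if w: "cyc v0 w v1" "w \<notin> Q" for w
  proof -
    have "w \<noteq> v1" using w(1) by auto
    obtain n where n: "w \<notin> (g ^^ n) ` Q" "w \<in> (g ^^ Suc n) ` Q"
      using B.exhaust[OF gM v(2,3) PQ(2) v0Q PQ(5) _ nofix1 \<open>w \<noteq> v1\<close> w(2)] PQ(7) by blast
    have gw: "g w \<notin> (g ^^ Suc n) ` Q" unfolding B.funpow_image B.image_mem[OF gc] by (rule n(1))
    have SM: "(g ^^ Suc n) ` Q \<in> M" using B.image_in[OF auto_on_funpow[OF gM]] PQ(2) by blast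
    then obtain s t where st: "s \<noteq> t" "(g ^^ Suc n) ` Q = oarc s t" using B.oarcs by blast
    note fm = B.fixed_mem[OF auto_on_cyc[OF auto_on_funpow[OF gM, of "Suc n"]]]
    have "v0 \<in> (g ^^ Suc n) ` Q" using fm[OF B.funpow_fixed[where g = g, OF v(2)]] v0Q by simp
    moreover have "v1 \<notin> (g ^^ Suc n) ` Q" using fm[OF B.funpow_fixed[where g = g, OF v(3)]] PQ(5) by simp
    ultimately have "cyc s v0 t" "\<not> cyc s v1 t" "cyc s w t" "\<not> cyc s (g w) t"
      using n(2) gw unfolding st(2) by simp_all
    then show ?thesis using push_right[OF gc v(2,3) st(1) _ _ w(1)] by blast
  qed
  have nofix0': "inv_into UNIV g ` N \<noteq> N" if N: "N \<in> M" "v1 \<in> N" "v0 \<notin> N" "co P \<subseteq> N" for N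
  proof
    assume "inv_into UNIV g ` N = N"
    then have "inv_into UNIV (inv_into UNIV g) ` N = N" by (rule B.fixed_image_inv[OF hc])
    then have "g ` N = N" using gc unfolding cycauto_def by (simp add: inv_inv_eq)
    then have gN: "g ` co N = co N" using B.fixed_co[OF gM N(1)] by simp
    have "v0 \<in> co N" using B.in_or_co[OF N(1) e(1)] N(3) by simp
    moreover have "co N \<subseteq> P" using B.co_anti[OF cP(1) N(1)] N(4) B.co_co[OF PQ(1)] by simp
    ultimately show False using nofix0[OF B.co_in[OF N(1)]] gN by simp
  qed
  have push0: "cyc v0 w (g w) \<and> cyc w (g w) v1" if w: "cyc v0 w v1" "w \<notin> co P" for w
  proof -
    have "w \<noteq> v0" using w(1) by auto
    obtain n where n: "w \<notin> (inv_into UNIV g ^^ n) ` co P" "w \<in> (inv_into UNIV g ^^ Suc n) ` co P"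
      using B.exhaust[OF hM hv(2,1) cP(1) v1cP v0cP cP(2) nofix0' \<open>w \<noteq> v0\<close> w(2)] by blast
    have gw: "g w \<in> (inv_into UNIV g ^^ n) ` co P" using n(2) unfolding B.funpow_image B.mem_inv_image[OF gc] .
    define S where "S = (inv_into UNIV g ^^ n) ` co P"
    have SM: "S \<in> M" unfolding S_def using B.image_in[OF auto_on_funpow[OF hM]] cP(1) by simp
    obtain t s where st: "t \<noteq> s" "S = oarc t s" using B.oarcs[OF SM] by blast
    note fm = B.fixed_mem[OF auto_on_cyc[OF auto_on_funpow[OF hM, of n]]]
    have "v0 \<notin> S" unfolding S_def using fm[OF B.funpow_fixed[where g = "inv_into UNIV g", OF hv(1)]] v0cP by simp
    then have s0: "\<not> cyc t v0 s" using st(2) by simp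
    have "v1 \<in> S" unfolding S_def using fm[OF B.funpow_fixed[where g = "inv_into UNIV g", OF hv(2)]] v1cP by simp
    then have s1: "cyc t v1 s" using st(2) by simp
    have ts: "oarc t s \<in> M" using SM st(2) by simp
    have ne: "v0 \<noteq> t" "v0 \<noteq> s" using e(1) B.endp1[OF ts] B.endp2[OF ts] by auto
    have "cyc s v0 t" "\<not> cyc s v1 t" using s0 s1 ne st(1) unfolding cyc_ang circ_eq_iff by (smt (z3))+
    moreover have "\<not> cyc t w s" "cyc t (g w) s" using n(1) gw unfolding S_def[symmetric] st(2) by simp_all
    ultimately show ?thesis using push_right[OF gc v(2,3) st(1)[symmetric] _ _ w(1)] by blast
  qed
  obtain m a where a: "m \<noteq> a" "P = oarc m a" "oarc m a \<in> M" "co P = oarc a m" "oarc a m \<in> M"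
    by (rule B.L_cases[OF PQ(1)])
  obtain m' a' where a': "m' \<noteq> a'" "Q = oarc m' a'" "oarc m' a' \<in> M" "co Q = oarc a' m'" "oarc a' m' \<in> M"
    by (rule B.L_cases[OF PQ(2)])
  have pa: "cyc m v0 a" "\<not> cyc m v1 a" "cyc m' v0 a'" "\<not> cyc m' v1 a'" using PQ(4,5) v0Q v1P a(2) a'(2) by auto
  have ane: "a \<noteq> v1" "a' \<noteq> v1" using e(2) B.endp2[OF a(3)] B.endp2[OF a'(3)] by auto
  have sPQ: "oarc m a \<subseteq> oarc m' a'" using PQ(3) a(2) a'(2) by simp
  have av: "cyc v0 a v1" "cyc v0 a' v1" "a = a' \<or> cyc v0 a a'"
    using pa ane sPQ vne a(1) unfolding oarc_subset_iff[OF a(1)] cyc_ang circ_eq_iff by (smt (z3))+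
  have aP: "a \<notin> co P" "a' \<notin> Q" using a(4) a'(2) by auto
  have ga: "cyc v0 a (g a)" "cyc v0 a' (g a')" "cyc a' (g a') v1" using push0[OF av(1) aP(1)] push1[OF av(2) aP(2)] by auto
  have gav: "cyc v0 (g a') v1" using av(2) ga(2,3) unfolding cyc_ang by linarith
  have aga: "cyc v0 a (g a')" "a \<noteq> g a'" using av(3) ga(2) unfolding cyc_ang circ_eq_iff by (smt (z3))+
  have ea: "\<not> endp L a" "\<not> endp L (g a')"
    using ends_disj B.endp2[OF a(3)] B.endp2[OF a'(3)] B.endp_image[OF gM] by blast+
  have out: "v0 \<notin> oarc v0 v1" "v1 \<notin> oarc v0 v1" by auto
  obtain N \<G> where N: "N \<in> L" "a \<in> N" "g a' \<in> N" "v0 \<notin> N" "v1 \<notin> N" "N \<subseteq> oarc v0 v1"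
    "nlg L \<G>" "co N \<in> \<G>" "\<forall>K\<in>\<G>. \<not> (a \<in> K \<and> g a' \<in> K)"
    using A.least_arc[OF aga(2) ea v(1) _ _ out] vne av(1) gav out v(1) by auto
  have gG: "isgap L \<G>" using A.nlg_gap[OF N(7)] .
  obtain c d where cd: "c \<noteq> d" "N = oarc c d" "oarc c d \<in> L" "co N = oarc d c" "oarc d c \<in> L"
    by (rule A.L_cases[OF N(1)])
  have vc: "c \<in> verts \<G>" "d \<in> verts \<G>" using A.gap_verts[OF gG, of d c] N(8) cd(4) by auto
  have no: "oarc v0 v1 \<notin> \<G>"
  proof
    assume "oarc v0 v1 \<in> \<G>"
    then show False using bspec[OF N(9), of "oarc v0 v1"] av(1) gav by simp
  qed
  have Ncd: "cyc c a d" "cyc c (g a') d" "\<not> cyc c v0 d" "\<not> cyc c v1 d" using N(2-5) cd(2) by auto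
  have "c = v0 \<or> d = v1"
  proof (rule ccontr)
    assume n: "\<not> ?thesis"
    have sN: "oarc c d \<subseteq> oarc v0 v1" using N(6) cd(2) by simp
    have ca: "cyc v0 c a" "cyc v0 (g a') d" "cyc v0 c v1" "cyc v0 d v1" "cyc c (g a') d"
      using sN n Ncd cd(1) av(1) gav aga unfolding oarc_subset_iff[OF cd(1)] cyc_ang circ_eq_iff by (smt (z3))+
    have cco: "\<not> cyc a c m" using ca(1,3) av(1) pa(1,2) unfolding cyc_ang circ_eq_iff by (smt (z3))
    then have pc: "cyc v0 c (g c)" "cyc c (g c) v1" using push0[OF ca(3)] a(4) by auto
    have dQ: "\<not> cyc m' d a'" using ca(2,4) ga(2) av(2) pa(3,4) unfolding cyc_ang circ_eq_iff by (smt (z3))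
    then have pd: "cyc v0 d (g d)" "cyc d (g d) v1" using push1[OF ca(4)] a'(2) by auto
    have "cyc (g v0) (g c) (g a)" using ca(1) cycauto_cyc[OF gc] by blast
    then have gca: "cyc v0 (g c) (g a)" using v(2) by simp
    have "a = a' \<or> cyc (g v0) (g a) (g a')" using av(3) cycauto_cyc[OF gc] by blast
    then have gaa: "g a = g a' \<or> cyc v0 (g a) (g a')" using v(2) by auto
    \<comment> \<open>Read from \<open>v0\<close> to \<open>v1\<close>: \<open>c\<close> is pushed,
      but \<open>g c\<close> stays before \<open>g a\<close>, hence before \<open>g a'\<close> and
      before \<open>d\<close>, while \<open>g d\<close> is beyond \<open>d\<close>.\<close>
    have lk: "cyc c (g c) d" "cyc d (g d) c"
      using pc pd gca gaa ca unfolding cyc_ang circ_eq_iff by (smt (z3))+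
    have "oarc (g c) (g d) \<in> L" using gL cd(3) unfolding auto_on_def by simp
    then show False using A.unlinked[OF cd(3) _ lk] by simp
  qed
  then have "oarc v1 v0 \<in> \<G>"
  proof
    assume "c = v0"
    then show ?thesis using leaf_at_vertex[OF N(7) _ v(1)] vc no by simp
  next
    assume "d = v1"
    then show ?thesis using leaf_at_vertex[OF N(7) _ A.dual[OF v(1)]] vc no by simp
  qed
  then show ?thesis using N(7) by auto
qed

text \<open>The inverse of \<open>g\<close>, with \<open>v0\<close> and \<open>v1\<close> exchanged
  and the sides complemented, satisfies the same hypotheses. So \<open>push_gap\<close> gives
  non-leaf gaps on both sides of the leaf, which looseness forbids.\<close>

lemma no_push:
  assumes gL: "auto_on L g" and gM: "auto_on M g" and v: "oarc v0 v1 \<in> L" "g v0 = v0" "g v1 = v1"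
    and PQ: "P \<in> M" "Q \<in> M" "P \<subseteq> Q" "v0 \<in> P" "v1 \<notin> Q" "P \<subset> g ` P" "Q \<subset> g ` Q"
    and nofix0: "\<And>N. N \<in> M ==> v0 \<in> N ==> N \<subseteq> P ==> g ` N \<noteq> N"
    and nofix1: "\<And>N. N \<in> M ==> v0 \<in> N ==> v1 \<notin> N ==> Q \<subseteq> N ==> g ` N \<noteq> N"
  shows False
proof -
  have gc: "cycauto g" using gL by (rule auto_on_cyc)
  have hM: "auto_on M (inv_into UNIV g)" "auto_on L (inv_into UNIV g)" using auto_on_inv[OF gM] auto_on_inv[OF gL] .
  have hc: "cycauto (inv_into UNIV g)" using hM by (auto simp: auto_on_def)
  have ii: "inv_into UNIV (inv_into UNIV g) = g" using gc unfolding cycauto_def by (simp add: inv_inv_eq)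
  have hv: "inv_into UNIV g v0 = v0" "inv_into UNIV g v1 = v1" using A.fixed_inv[OF gc] v by auto
  have vne: "v0 \<noteq> v1" using A.ne_oarc[OF v(1)] .
  have e: "\<not> endp M v0" "\<not> endp M v1" using ends_disj A.endp1[OF v(1)] A.endp2[OF v(1)] by auto
  obtain \<G> where G: "nlg L \<G>" "oarc v1 v0 \<in> \<G>" using push_gap[OF assms] by auto
  have gco: "g ` co N = co N" if "inv_into UNIV g ` N = N" "N \<in> M" for N
  proof -
    have "inv_into UNIV (inv_into UNIV g) ` N = N" by (rule B.fixed_image_inv[OF hc that(1)])
    then show ?thesis using B.fixed_co[OF gM that(2)] ii by simp
  qed
  have "\<exists>\<G>. nlg L \<G> \<and> oarc v0 v1 \<in> \<G>"
  proof (rule push_gap[OF hM(2,1) A.dual[OF v(1)] hv(2,1) B.co_in[OF PQ(2)] B.co_in[OF PQ(1)]])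
    show "co Q \<subseteq> co P" using B.co_anti[OF PQ(1,2)] PQ(3) by simp
    show "v1 \<in> co Q" using B.in_or_co[OF PQ(2) e(2)] PQ(5) by simp
    show "v0 \<notin> co P" using PQ(4) B.co_disj[OF PQ(1)] by auto
    show "co Q \<subset> inv_into UNIV g ` co Q" by (rule B.image_subset_inv[OF gM PQ(2,7)])
    show "co P \<subset> inv_into UNIV g ` co P" by (rule B.image_subset_inv[OF gM PQ(1,6)])
    show "inv_into UNIV g ` N \<noteq> N" if N: "N \<in> M" "v1 \<in> N" "N \<subseteq> co Q" for N
    proof
      assume "inv_into UNIV g ` N = N"
      then have gN: "g ` co N = co N" by (rule gco[OF _ N(1)])
      have "Q \<subseteq> co N" using B.co_anti[OF N(1) B.co_in[OF PQ(2)]] N(3) B.co_co[OF PQ(2)] by simp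
      moreover have "v1 \<notin> co N" using N(2) B.co_disj[OF N(1)] by auto
      moreover have "v0 \<in> co N" using calculation(1) PQ(3,4) by auto
      ultimately show False using nofix1[OF B.co_in[OF N(1)]] gN by simp
    qed
    show "inv_into UNIV g ` N \<noteq> N" if N: "N \<in> M" "v1 \<in> N" "v0 \<notin> N" "co P \<subseteq> N" for N
    proof
      assume "inv_into UNIV g ` N = N"
      then have gN: "g ` co N = co N" by (rule gco[OF _ N(1)])
      have "co N \<subseteq> P" using B.co_anti[OF B.co_in[OF PQ(1)] N(1)] N(4) B.co_co[OF PQ(1)] by simp
      moreover have "v0 \<in> co N" using B.in_or_co[OF N(1) e(1)] N(3) by simp
      ultimately show False using nofix0[OF B.co_in[OF N(1)]] gN by simp
    qed
  qed
  then obtain \<H> where H: "nlg L \<H>" "oarc v0 v1 \<in> \<H>" by auto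
  have "v0 \<in> verts \<G>" "v0 \<in> verts \<H>" using A.gap_verts[OF A.nlg_gap[OF G(1)] G(2)] A.gap_verts[OF A.nlg_gap[OF H(1)] H(2)] by auto
  then have "\<G> = \<H>" using A.loose[OF G(1) H(1)] by simp
  then show False using A.leaf_gapI[OF A.nlg_gap[OF H(1)] H(2)] G(2) H(1) vne by simp
qed

text \<open>A crossing leaf is nested with its image. If none is invariant, it is strictly expanded
  by \<open>g\<close> or by the inverse, and \<open>no_push\<close> applies with
  \<open>P = Q\<close>.\<close>

lemma fixed_crossing:
  assumes gL: "auto_on L g" and gM: "auto_on M g" and v: "oarc v0 v1 \<in> L" "g v0 = v0" "g v1 = v1"
  shows "\<exists>N\<in>M. v0 \<in> N \<and> v1 \<notin> N \<and> g ` N = N"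
proof (rule ccontr)
  assume no: "\<not> ?thesis"
  have gc: "cycauto g" using gL by (rule auto_on_cyc)
  have hM: "auto_on M (inv_into UNIV g)" "auto_on L (inv_into UNIV g)" using auto_on_inv[OF gM] auto_on_inv[OF gL] .
  have hc: "cycauto (inv_into UNIV g)" using hM by (auto simp: auto_on_def)
  have ii: "inv_into UNIV (inv_into UNIV g) = g" using gc unfolding cycauto_def by (simp add: inv_inv_eq)
  have hv: "inv_into UNIV g v0 = v0" "inv_into UNIV g v1 = v1" using A.fixed_inv[OF gc] v by auto
  have e: "\<not> endp M v0" "\<not> endp M v1" using ends_disj A.endp1[OF v(1)] A.endp2[OF v(1)] by auto
  have no': "g ` N \<noteq> N" if "N \<in> M" "v0 \<in> N" "v1 \<notin> N" for N using no that by auto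
  have no'': "inv_into UNIV g ` N \<noteq> N" if "N \<in> M" "v0 \<in> N" "v1 \<notin> N" for N
    using no'[OF that] B.fixed_image_inv[OF hc, of N] ii by auto
  obtain P where P: "P \<in> M" "v0 \<in> P" "v1 \<notin> P" using crossing_exists[OF v(1)] by auto
  have gP: "g ` P \<in> M" "v0 \<in> g ` P" "v1 \<notin> g ` P"
    using B.image_in[OF gM] P A.fixed_mem[OF gc v(2)] A.fixed_mem[OF gc v(3)] by auto
  have "P \<subseteq> g ` P \<or> g ` P \<subseteq> P" using B.nested'[OF P(1) gP(1) P(2) gP(2) P(3) gP(3) e(2)] .
  then have "P \<subset> g ` P \<or> g ` P \<subset> P" using no'[OF P] by auto
  then show False
  proof
    assume PP: "P \<subset> g ` P"
    show False by (rule no_push[OF gL gM v P(1,1) subset_refl P(2,3) PP PP]) (use no' P(3) in blast)+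
  next
    assume "g ` P \<subset> P"
    then have "inv_into UNIV g ` g ` P \<subseteq> inv_into UNIV g ` P" by (intro image_mono) auto
    then have "P \<subseteq> inv_into UNIV g ` P" using cycauto_inv(3)[OF gc] by (simp add: image_image)
    then have PP: "P \<subset> inv_into UNIV g ` P" using no''[OF P] by auto
    show False by (rule no_push[OF hM(2,1) v(1) hv P(1,1) subset_refl P(2,3) PP PP]) (use no'' P(3) in blast)+
  qed
qed

end

section \<open>Attracting and repelling vertices\<close>

text \<open>Attraction at \<open>v\<close> is expressed by leaves of \<open>M\<close> around
  \<open>v\<close> instead of neighbourhoods, so that conjugation by automorphisms preserves it
  directly.\<close>

definition attr :: "circ set set \<Rightarrow> (circ \<Rightarrow> circ) \<Rightarrow> circ \<Rightarrow> bool" where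
  "attr M g v \<longleftrightarrow> (\<exists>S\<in>M. v \<in> S \<and> (\<forall>N\<in>M. v \<in> N --> N \<subseteq> S --> g ` N \<subset> N))"

context lam
begin

text \<open>A leaf around \<open>v\<close> that misses the two end points of a given side is nested
  with it; missing one more point of the side as well, it is strictly smaller.\<close>

lemma shrink:
  assumes rb: "\<And>F. finite F ==> v \<notin> F ==> \<exists>N\<in>L. v \<in> N \<and> N \<inter> F = {}"
    and S: "S \<in> L" "v \<in> S" "T \<in> L" "v \<in> T" and F: "finite F" "v \<notin> F"
  shows "\<exists>S'\<in>L. v \<in> S' \<and> S' \<subset> S \<and> S' \<subset> T \<and> S' \<inter> F = {}"
proof -
  have one: "\<exists>E. finite E \<and> v \<notin> E \<and> (\<forall>N\<in>L. v \<in> N --> N \<inter> E = {} --> N \<subset> A)" if A: "A \<in> L" "v \<in> A" for A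
  proof -
    obtain s t where st: "s \<noteq> t" "A = oarc s t" using oarcs[OF A(1)] by auto
    have vs: "cyc s v t" using A(2) st(2) by simp
    then have "s \<noteq> v" by auto
    then obtain w where w: "cyc s w v" using cyc_dense by blast
    have wA: "w \<in> A" "w \<noteq> v" using w vs st(2) by (auto simp: cyc_ang)
    have "N \<subset> A" if N: "N \<in> L" "v \<in> N" "N \<inter> {s, t, w} = {}" for N
    proof -
      have "s \<notin> A" "t \<notin> A" using st(2) by auto
      then have "N \<subseteq> A \<or> A \<subseteq> N" using nested[OF N(1) A(1) N(2) A(2), of s t] N(3) st(1) by auto
      then show ?thesis using N(3) wA(1) by auto
    qed
    moreover have "v \<notin> {s, t, w}" using vs wA(2) by auto
    ultimately show ?thesis by (intro exI[of _ "{s, t, w}"]) auto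
  qed
  obtain E1 where E1: "finite E1" "v \<notin> E1" "\<forall>N\<in>L. v \<in> N --> N \<inter> E1 = {} --> N \<subset> S" using one[OF S(1,2)] by auto
  obtain E2 where E2: "finite E2" "v \<notin> E2" "\<forall>N\<in>L. v \<in> N --> N \<inter> E2 = {} --> N \<subset> T" using one[OF S(3,4)] by auto
  have FE: "finite (F \<union> E1 \<union> E2)" "v \<notin> F \<union> E1 \<union> E2" using F E1(1,2) E2(1,2) by auto
  obtain N where N: "N \<in> L" "v \<in> N" "N \<inter> (F \<union> E1 \<union> E2) = {}" using rb[OF FE] by auto
  then have "N \<inter> E1 = {}" "N \<inter> E2 = {}" "N \<inter> F = {}" by auto
  then show ?thesis using N(1,2) bspec[OF E1(3) N(1)] bspec[OF E2(3) N(1)] by auto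
qed

text \<open>Suppose a side \<open>N\<close> inside \<open>S\<close> is expanded. Then
  \<open>N\<close> lies in all iterates of \<open>S\<close>, while the iterates of
  \<open>co S\<close> increase. Their union misses \<open>v1\<close> and another point of
  \<open>N\<close>, so it is an invariant side, and its complement is an invariant side around
  \<open>v1\<close> inside \<open>S\<close>, against \<open>nofix\<close>.\<close>

lemma attr_if_shrinks:
  assumes g: "auto_on L g" and v: "g v1 = v1" "g v0 = v0" "\<not> endp L v0" "\<not> endp L v1"
    and S: "S \<in> L" "v1 \<in> S" "v0 \<notin> S" "g ` S \<subset> S"
    and nofix: "\<And>N. N \<in> L ==> v1 \<in> N ==> N \<subseteq> S ==> g ` N \<noteq> N"
  shows "attr L g v1"
proof -
  have gc: "cycauto g" using g by (rule auto_on_cyc)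
  have "g ` N \<subset> N" if N: "N \<in> L" "v1 \<in> N" "N \<subseteq> S" for N
  proof (rule ccontr)
    assume no: "\<not> ?thesis"
    have gN: "g ` N \<in> L" "v1 \<in> g ` N" "v0 \<notin> g ` N" "v0 \<notin> N"
      using image_in[OF g] N S(3) fixed_mem[OF gc v(1)] fixed_mem[OF gc v(2)] by auto
    have "N \<subseteq> g ` N \<or> g ` N \<subseteq> N" using nested'[OF N(1) gN(1) N(2) gN(2,4,3) v(3)] .
    then have NN: "N \<subseteq> g ` N" using no nofix[OF N] by auto
    have Nn: "N \<subseteq> (g ^^ n) ` N" for n
    proof (induction n)
      case (Suc n)
      have "g ` N \<subseteq> g ` (g ^^ n) ` N" using Suc by (rule image_mono)
      then show ?case unfolding funpow_image using NN by auto
    qed simp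
    obtain s t where st: "s \<noteq> t" "N = oarc s t" using oarcs[OF N(1)] by auto
    have "s \<noteq> v1" using N(2) st(2) by auto
    then obtain u where u: "cyc s u v1" using cyc_dense by blast
    have uN: "u \<in> N" "u \<noteq> v1" using u N(2) st(2) by (auto simp: cyc_ang)
    have gS: "co S \<subseteq> g ` co S"
    proof -
      have "g ` S \<in> L" using image_in[OF g] S(1) by simp
      then show ?thesis using co_anti[of "g ` S" S] S(1,4) co_image[OF g S(1)] by auto
    qed
    have out: "v1 \<notin> (g ^^ n) ` co S \<and> u \<notin> (g ^^ n) ` co S" for n
    proof -
      have gn: "auto_on L (g ^^ n)" using auto_on_funpow[OF g] .
      have "N \<subseteq> (g ^^ n) ` S" using Nn[of n] image_mono[OF N(3), of "g ^^ n"] by auto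
      moreover have "(g ^^ n) ` S \<inter> co ((g ^^ n) ` S) = {}" using co_disj[of "(g ^^ n) ` S"] image_in[OF gn] S(1) by simp
      ultimately show ?thesis unfolding co_image[OF gn S(1), symmetric] using N(2) uN(1) by auto
    qed
    note U = orbit_sup[OF g co_in[OF S(1)] gS uN(2)[symmetric] out]
    let ?U = "\<Union>n. (g ^^ n) ` co S"
    have "v1 \<notin> ?U" using out by simp
    then have "v1 \<in> co ?U" using in_or_co[OF U(1) v(4)] by simp
    moreover have "co ?U \<subseteq> S" using co_anti[OF co_in[OF S(1)] U(1)] U(3) co_co[OF S(1)] by simp
    moreover have "g ` co ?U = co ?U" using fixed_co[OF g U(1,2)] .
    ultimately show False using nofix[OF co_in[OF U(1)]] by simp
  qed
  then have "\<forall>N\<in>L. v1 \<in> N --> N \<subseteq> S --> g ` N \<subset> N" by simp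
  then show ?thesis unfolding attr_def using S(1,2) by (intro bexI[of _ S] conjI)
qed

lemma attr_conj:
  assumes f: "auto_on L f" and a: "attr L g v" shows "attr L (f \<circ> g \<circ> inv_into UNIV f) (f v)"
proof -
  have fc: "cycauto f" using f by (rule auto_on_cyc)
  have fi: "auto_on L (inv_into UNIV f)" using auto_on_inv[OF f] .
  obtain S where S: "S \<in> L" "v \<in> S" "\<forall>N\<in>L. v \<in> N --> N \<subseteq> S --> g ` N \<subset> N" using a unfolding attr_def by auto
  have "(f \<circ> g \<circ> inv_into UNIV f) ` N \<subset> N" if N: "N \<in> L" "f v \<in> N" "N \<subseteq> f ` S" for N
  proof -
    define N' where "N' = inv_into UNIV f ` N"
    have NN: "f ` N' = N" unfolding N'_def using cycauto_inv(2)[OF fc] by (simp add: image_image)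
    have "N' \<in> L" unfolding N'_def using image_in[OF fi] N(1) by simp
    moreover have "v \<in> N'" unfolding N'_def mem_inv_image[OF fc] by (rule N(2))
    moreover have "N' \<subseteq> S" using image_mono[OF N(3), of "inv_into UNIV f"] cycauto_inv(3)[OF fc] unfolding N'_def by (simp add: image_image)
    ultimately have 1: "g ` N' \<subset> N'" using S(3) by simp
    have "f ` g ` N' \<subseteq> f ` N'" using 1 by (intro image_mono) auto
    moreover have "f ` g ` N' \<noteq> f ` N'" using image_inj_eq[OF f] 1 by auto
    ultimately have "f ` g ` N' \<subset> N" unfolding NN by auto
    then show ?thesis unfolding N'_def by (simp add: image_comp comp_assoc)
  qed
  then have 1: "\<forall>N\<in>L. f v \<in> N --> N \<subseteq> f ` S --> (f \<circ> g \<circ> inv_into UNIV f) ` N \<subset> N" by simp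
  have "f ` S \<in> L" "f v \<in> f ` S" using image_in[OF f] S(1,2) by auto
  then show ?thesis unfolding attr_def using 1 by (intro bexI[of _ "f ` S"] conjI)
qed

text \<open>A leaf around \<open>v\<close> that is small enough for both conditions would be
  strictly contracted by \<open>g\<close> and by its inverse.\<close>

lemma attr_exclusive:
  assumes rb: "\<And>F. finite F ==> v \<notin> F ==> \<exists>N\<in>L. v \<in> N \<and> N \<inter> F = {}"
    and g: "cycauto g" and a: "attr L g v" "attr L (inv_into UNIV g) v" shows False
proof -
  obtain S where S: "S \<in> L" "v \<in> S" "\<forall>N\<in>L. v \<in> N --> N \<subseteq> S --> g ` N \<subset> N" using a(1) unfolding attr_def by auto
  obtain T where T: "T \<in> L" "v \<in> T" "\<forall>N\<in>L. v \<in> N --> N \<subseteq> T --> inv_into UNIV g ` N \<subset> N" using a(2) unfolding attr_def by auto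
  obtain N where N: "N \<in> L" "v \<in> N" "N \<subset> S" "N \<subset> T" using shrink[OF rb S(1,2) T(1,2), of "{}"] by auto
  have 1: "g ` N \<subset> N" "inv_into UNIV g ` N \<subset> N" using S(3) T(3) N by auto
  then have "inv_into UNIV g ` g ` N \<subseteq> inv_into UNIV g ` N" by (intro image_mono) auto
  then have "N \<subseteq> inv_into UNIV g ` N" using cycauto_inv(3)[OF g] by (simp add: image_image)
  then show False using 1(2) by auto
qed

end

context pf
begin

text \<open>By rigidity two invariant leaves of \<open>M\<close> crossing the leaf
  \<open>v0 v1\<close> share an end point. Two strict steps below an invariant one this is
  impossible by \<open>bd_three\<close>.\<close>

lemma no_small_fixed:
  assumes gL: "auto_on L g" and gM: "auto_on M g" and g: "g \<noteq> id" and v: "oarc v0 v1 \<in> L" "g v0 = v0" "g v1 = v1"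
  shows "\<exists>S\<in>M. v1 \<in> S \<and> v0 \<notin> S \<and> (\<forall>N\<in>M. v1 \<in> N --> N \<subseteq> S --> g ` N \<noteq> N)"
proof -
  have vne: "v0 \<noteq> v1" using A.ne_oarc[OF v(1)] .
  note rb = rainbow[OF gL gM g v]
  show ?thesis
  proof (cases "\<exists>N0\<in>M. v1 \<in> N0 \<and> v0 \<notin> N0 \<and> g ` N0 = N0")
    case False
    have "finite {v0}" "v1 \<notin> {v0}" using vne by auto
    from rb[OF this] obtain S where S: "S \<in> M" "v1 \<in> S" "v0 \<notin> S" by auto
    moreover have "g ` N \<noteq> N" if "N \<in> M" "v1 \<in> N" "N \<subseteq> S" for N
    proof
      assume "g ` N = N"
      moreover have "v0 \<notin> N" using that(3) S(3) by auto
      ultimately show False using False that(1,2) by auto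
    qed
    ultimately show ?thesis by (intro bexI[of _ S]) auto
  next
    case True
    then obtain N0 where N0: "N0 \<in> M" "v1 \<in> N0" "v0 \<notin> N0" "g ` N0 = N0" by auto
    obtain N1 where N1: "N1 \<in> M" "v1 \<in> N1" "N1 \<subset> N0" using B.shrink[OF rb N0(1,2) N0(1,2), of "{}"] by auto
    obtain N2 where N2: "N2 \<in> M" "v1 \<in> N2" "N2 \<subset> N1" using B.shrink[OF rb N1(1,2) N1(1,2), of "{}"] by auto
    have "g ` N \<noteq> N" if N: "N \<in> M" "v1 \<in> N" "N \<subseteq> N2" for N
    proof
      assume gN: "g ` N = N"
      have "bd N \<inter> bd N0 = {}" using pf.bd_three[OF swap N(1) N1(1) N0(1) _ N1(3)] N(3) N2(3) by auto
      moreover have "v0 \<notin> N" using N(3) N2(3) N1(3) N0(3) by auto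
      ultimately show False
        using crossing_fixed_share[OF gL gM g A.dual[OF v(1)] N(1) gN N(2) _ N0(1,4,2,3)] by simp
    qed
    moreover have "v0 \<notin> N2" using N2(3) N1(3) N0(3) by auto
    ultimately show ?thesis using N2(1,2) by (intro bexI[of _ N2]) auto
  qed
qed

text \<open>A leaf around \<open>v1\<close> that contains no invariant leaf around \<open>v1\<close>
  is nested with its image and different from it, so \<open>g\<close> or the inverse contracts
  it.\<close>

lemma attr_or:
  assumes gL: "auto_on L g" and gM: "auto_on M g" and g: "g \<noteq> id" and v: "oarc v0 v1 \<in> L" "g v0 = v0" "g v1 = v1"
  shows "attr M g v1 \<or> attr M (inv_into UNIV g) v1"
proof -
  have gc: "cycauto g" using gL by (rule auto_on_cyc)
  have hM: "auto_on M (inv_into UNIV g)" using auto_on_inv[OF gM] .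
  have hc: "cycauto (inv_into UNIV g)" using hM by (rule auto_on_cyc)
  have ii: "inv_into UNIV (inv_into UNIV g) = g" using gc unfolding cycauto_def by (simp add: inv_inv_eq)
  have hv: "inv_into UNIV g v0 = v0" "inv_into UNIV g v1 = v1" using A.fixed_inv[OF gc] v by auto
  have e: "\<not> endp M v0" "\<not> endp M v1" using ends_disj A.endp1[OF v(1)] A.endp2[OF v(1)] by auto
  obtain S where S: "S \<in> M" "v1 \<in> S" "v0 \<notin> S" and nf: "\<forall>N\<in>M. v1 \<in> N --> N \<subseteq> S --> g ` N \<noteq> N"
    using no_small_fixed[OF assms] by auto
  have gS: "g ` S \<in> M" "v1 \<in> g ` S" "v0 \<notin> g ` S"
    using B.image_in[OF gM] S A.fixed_mem[OF gc v(2)] A.fixed_mem[OF gc v(3)] by auto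
  have "S \<subseteq> g ` S \<or> g ` S \<subseteq> S" using B.nested'[OF S(1) gS(1) S(2) gS(2) S(3) gS(3) e(1)] .
  moreover have "g ` S \<noteq> S" using nf S by auto
  ultimately have "g ` S \<subset> S \<or> S \<subset> g ` S" by auto
  then show ?thesis
  proof
    assume "g ` S \<subset> S"
    then have "attr M g v1" using B.attr_if_shrinks[OF gM v(3,2) e S] nf by simp
    then show ?thesis ..
  next
    assume SS: "S \<subset> g ` S"
    have nf': "inv_into UNIV g ` N \<noteq> N" if "N \<in> M" "v1 \<in> N" "N \<subseteq> S" for N
    proof
      assume "inv_into UNIV g ` N = N"
      then have "inv_into UNIV (inv_into UNIV g) ` N = N" by (rule B.fixed_image_inv[OF hc])
      then show False using nf that ii by simp
    qed
    have "inv_into UNIV g ` S \<subseteq> inv_into UNIV g ` g ` S" using SS by (intro image_mono) auto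
    then have "inv_into UNIV g ` S \<subseteq> S" using cycauto_inv(3)[OF gc] by (simp add: image_image)
    then have "inv_into UNIV g ` S \<subset> S" using nf'[OF S(1,2)] by auto
    then have "attr M (inv_into UNIV g) v1" using B.attr_if_shrinks[OF hM hv(2,1) e S] nf' by simp
    then show ?thesis ..
  qed
qed

text \<open>If \<open>v1\<close> were attracting and \<open>v0\<close> repelling, a small side at
  \<open>v0\<close> and the complement of a small side at \<open>v1\<close> would both be expanded
  without invariant leaves near the ends, which is the situation of \<open>no_push\<close>.\<close>

lemma attr_other_end:
  assumes gL: "auto_on L g" and gM: "auto_on M g" and g: "g \<noteq> id" and v: "oarc v0 v1 \<in> L" "g v0 = v0" "g v1 = v1"
    and a: "attr M g v1"
  shows "attr M g v0"
proof (rule ccontr)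
  assume "\<not> attr M g v0"
  then have a0: "attr M (inv_into UNIV g) v0" using attr_or[OF gL gM g A.dual[OF v(1)] v(3,2)] by simp
  have gc: "cycauto g" using gL by (rule auto_on_cyc)
  have vne: "v0 \<noteq> v1" using A.ne_oarc[OF v(1)] .
  have e: "\<not> endp M v0" "\<not> endp M v1" using ends_disj A.endp1[OF v(1)] A.endp2[OF v(1)] by auto
  note rb1 = rainbow[OF gL gM g v] and rb0 = rainbow[OF gL gM g A.dual[OF v(1)] v(3,2)]
  obtain S1 where S1: "S1 \<in> M" "v1 \<in> S1" "\<forall>N\<in>M. v1 \<in> N --> N \<subseteq> S1 --> g ` N \<subset> N" using a unfolding attr_def by auto
  obtain S0 where S0: "S0 \<in> M" "v0 \<in> S0" "\<forall>N\<in>M. v0 \<in> N --> N \<subseteq> S0 --> inv_into UNIV g ` N \<subset> N" using a0 unfolding attr_def by auto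
  obtain P where P: "P \<in> M" "v0 \<in> P" "P \<subset> S0" "v1 \<notin> P" using B.shrink[OF rb0 S0(1,2) S0(1,2), of "{v1}"] vne by auto
  have cP: "co P \<in> M" "v1 \<in> co P" using B.co_in[OF P(1)] B.in_or_co[OF P(1) e(2)] P(4) by auto
  obtain Q' where Q': "Q' \<in> M" "v1 \<in> Q'" "Q' \<subset> S1" "Q' \<subset> co P" using B.shrink[OF rb1 S1(1,2) cP, of "{}"] by auto
  define Q where "Q = co Q'"
  have Q: "Q \<in> M" "co Q = Q'" unfolding Q_def using B.co_in[OF Q'(1)] B.co_co[OF Q'(1)] by auto
  have grow: "N \<subset> g ` N" if "inv_into UNIV g ` N \<subset> N" for N
  proof -
    have "g ` inv_into UNIV g ` N \<subseteq> g ` N" using that by (intro image_mono) auto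
    then have "N \<subseteq> g ` N" using cycauto_inv(2)[OF gc] by (simp add: image_image)
    moreover have "N \<noteq> g ` N"
    proof
      assume "N = g ` N"
      then have "inv_into UNIV g ` N = N" using B.fixed_image_inv[OF gc, of N] by simp
      then show False using that by simp
    qed
    ultimately show ?thesis by auto
  qed
  show False
  proof (rule no_push[OF gL gM v P(1) Q(1)])
    show "P \<subseteq> Q" unfolding Q_def using B.co_anti[OF Q'(1) cP(1)] Q'(4) B.co_co[OF P(1)] by auto
    show "v0 \<in> P" by (rule P(2))
    show "v1 \<notin> Q" unfolding Q_def using Q'(2) B.co_disj[OF Q'(1)] by auto
    show "P \<subset> g ` P" by (rule grow) (use S0(3) P in auto)
    have gQ': "g ` Q' \<subset> Q'" using S1(3) Q' by auto
    have gQM: "g ` Q' \<in> M" using B.image_in[OF gM] Q'(1) by simp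
    have "co Q' \<subseteq> g ` co Q'" using B.co_anti[OF gQM Q'(1)] gQ' unfolding B.co_image[OF gM Q'(1)] by blast
    moreover have "g ` co Q' \<noteq> co Q'"
    proof
      assume "g ` co Q' = co Q'"
      then have "g ` co (co Q') = co (co Q')" by (rule B.fixed_co[OF gM B.co_in[OF Q'(1)]])
      then show False using gQ' B.co_co[OF Q'(1)] by simp
    qed
    ultimately show "Q \<subset> g ` Q" unfolding Q_def by auto
    show "g ` N \<noteq> N" if N: "N \<in> M" "v0 \<in> N" "N \<subseteq> P" for N
    proof
      assume "g ` N = N"
      then have "inv_into UNIV g ` N = N" by (rule B.fixed_image_inv[OF gc])
      moreover have "N \<subseteq> S0" using N(3) P(3) by auto
      then have "inv_into UNIV g ` N \<subset> N" using bspec[OF S0(3) N(1)] N(2) by simp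
      ultimately show False by simp
    qed
    show "g ` N \<noteq> N" if N: "N \<in> M" "v0 \<in> N" "v1 \<notin> N" "Q \<subseteq> N" for N
    proof
      assume "g ` N = N"
      then have "g ` co N = co N" by (rule B.fixed_co[OF gM N(1)])
      moreover have "co N \<subseteq> Q'" using B.co_anti[OF Q(1) N(1)] N(4) Q(2) by simp
      moreover have "v1 \<in> co N" using B.in_or_co[OF N(1) e(2)] N(3) by simp
      moreover have "Q' \<subseteq> S1" using Q'(3) by auto
      ultimately show False using bspec[OF S1(3) B.co_in[OF N(1)]] by auto
    qed
  qed
qed

end

section \<open>Interleaving pairs\<close>

definition inter :: "circ set set \<Rightarrow> circ set set \<Rightarrow> bool" where
  "inter \<G> \<H> \<longleftrightarrow> (\<forall>I\<in>\<G>. \<exists>!x. x \<in> I \<and> x \<in> verts \<H>) \<and> (\<forall>I\<in>\<H>. \<exists>!x. x \<in> I \<and> x \<in> verts \<G>)"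

lemma inter_sym: "inter \<G> \<H> \<longleftrightarrow> inter \<H> \<G>"
  unfolding inter_def by auto

lemma cyc_exit:
  assumes "cyc m x n" "\<not> cyc m y n" "x \<noteq> y"
  shows "n \<noteq> y ==> cyc x n y" "m \<noteq> y ==> cyc y m x"
  using assms unfolding cyc_ang circ_eq_iff by (smt (z3))+

context lam
begin

lemma leaf_isgap: assumes I: "I \<in> L" shows "isgap L {I, co I}"
  unfolding isgap_def
proof (intro conjI ballI impI)
  show "{I, co I} \<subseteq> L" using I co_in by simp
  fix J K assume "J \<in> {I, co I}" "K \<in> {I, co I}" "J \<noteq> K" then show "J \<inter> K = {}" using co_disj[OF I] by auto
next
  fix J assume J: "J \<in> L"
  show "\<exists>K\<in>{I, co I}. J \<subseteq> K \<or> co J \<subseteq> K"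
    using four[OF J I] co_anti[OF I J] disj_iff[OF J I] by auto
qed

lemma leaf_verts: "verts {I, co I} = bd I"
  unfolding verts_def bd_def by auto

lemma nlg_no_skip:
  assumes G: "nlg L \<G>" and "oarc a b \<in> \<G>" "oarc b c \<in> \<G>" shows "a \<noteq> c"
proof
  assume "a = c"
  moreover have "a \<noteq> b" using ne_oarc gap_in nlg_gap assms by blast
  ultimately show False using leaf_gapI[OF nlg_gap[OF G] assms(2)] assms(3) G by simp
qed

end

context pf
begin

text \<open>The two end points of \<open>N\<close> lie in two elements of the gap, which give
  invariant leaves of \<open>L\<close> crossed by \<open>N\<close>. A common end point of these
  leaves would be the only vertex on its side of \<open>N\<close>. With two vertices on each side
  the leaves have no common end point, and rigidity makes \<open>g\<close> the identity.\<close>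

lemma fixed_gaps_one_vertex:
  assumes gL: "auto_on L g" and gM: "auto_on M g" and g: "g \<noteq> id"
    and G: "isgap L \<G>" "\<And>w. w \<in> verts \<G> ==> g w = w"
    and N: "N \<in> M" "g ` N = N"
    and w: "w \<in> verts \<G>" "w' \<in> verts \<G>" "w \<noteq> w'" "w \<in> N" "w' \<in> N"
    and u: "u \<in> verts \<G>" "u' \<in> verts \<G>" "u \<noteq> u'" "u \<notin> N" "u' \<notin> N"
  shows False
proof -
  have gc: "cycauto g" using gL by (rule auto_on_cyc)
  obtain m n where mn: "m \<noteq> n" "N = oarc m n" "oarc m n \<in> M" "co N = oarc n m" "oarc n m \<in> M"
    by (rule B.L_cases[OF N(1)])
  have fmn: "g m = m" "g n = n" using B.fixed_ends[OF gc N mn(2)] by auto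
  have e: "\<not> endp L m" "\<not> endp L n" using ends_disj B.endp1[OF mn(3)] B.endp2[OF mn(3)] by auto
  have npv: "x \<notin> verts \<G>" if x: "\<not> endp L x" "oarc x y \<in> M" "g x = x" "g y = y" for x y
  proof
    assume xv: "x \<in> verts \<G>"
    have "x \<noteq> a \<and> x \<noteq> b" if "oarc a b \<in> \<G>" for a b
      using A.gap_in[OF G(1) that] A.endp1 A.endp2 x(1) by auto
    then have "pivot \<G> x" using xv unfolding pivot_def by auto
    then show False using pf.no_pivot[OF swap gM gL g B.dual[OF x(2)] x(4,3)] G(1) by auto
  qed
  have mnv: "m \<notin> verts \<G>" "n \<notin> verts \<G>" using npv[OF e(1) mn(3) fmn] npv[OF e(2) mn(5) fmn(2,1)] .
  obtain k l where kl: "k \<noteq> l" "oarc k l \<in> \<G>" "cyc k m l" "k \<in> verts \<G>" "l \<in> verts \<G>"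
    by (rule A.verts_cases[OF G(1) mnv(1)])
  obtain k' l' where kl': "k' \<noteq> l'" "oarc k' l' \<in> \<G>" "cyc k' n l'" "k' \<in> verts \<G>" "l' \<in> verts \<G>"
    by (rule A.verts_cases[OF G(1) mnv(2)])
  have out: "\<not> cyc k x l" "\<not> cyc k' x l'" if "x \<in> verts \<G>" for x using that kl(2) kl'(2) unfolding verts_def by auto
  have wN: "cyc m w n" "cyc m w' n" using w(4,5) mn(2) by auto
  have une: "u \<noteq> m" "u \<noteq> n" "u' \<noteq> m" "u' \<noteq> n" using u(1,2) mnv by auto
  have uN: "cyc n u m" "cyc n u' m" using u(4,5) une mn(1,2) unfolding mn(2) mem_oarc cyc_ang circ_eq_iff by (smt (z3))+
  have nJ: "\<not> cyc k n l" using out(1)[OF w(1)] out(1)[OF u(1)] wN(1) uN(1) kl(3) unfolding cyc_ang by (smt (z3))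
  have mJ: "\<not> cyc k' m l'" using out(2)[OF w(1)] out(2)[OF u(1)] wN(1) uN(1) kl'(3) unfolding cyc_ang by (smt (z3))
  have lne: "l \<noteq> n" "k \<noteq> n" "l' \<noteq> m" "k' \<noteq> m" using kl(4,5) kl'(4,5) mnv by auto
  have l1: "cyc m l n" "cyc n k m" using nJ kl(3) lne(1,2) mn(1) unfolding cyc_ang circ_eq_iff by (smt (z3))+
  have l2: "cyc m k' n" "cyc n l' m" using mJ kl'(3) lne(3,4) mn(1) unfolding cyc_ang circ_eq_iff by (smt (z3))+
  have in1: "x = l" if x: "x \<in> verts \<G>" "cyc m x n" "l = k'" for x
    using out[OF x(1)] x(2,3) kl(3) kl'(3) l1 l2 unfolding cyc_ang circ_eq_iff by (smt (z3))
  have in2: "x = k" if x: "x \<in> verts \<G>" "cyc n x m" "k = l'" for x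
    using out[OF x(1)] x(2,3) kl(3) kl'(3) l1 l2 unfolding cyc_ang circ_eq_iff by (smt (z3))
  have lk: "l \<noteq> k'" using in1[OF w(1) wN(1)] in1[OF w(2) wN(2)] w(3) by auto
  have kl2: "k \<noteq> l'" using in2[OF u(1) uN(1)] in2[OF u(2) uN(2)] u(3) by auto
  have ll: "l \<noteq> l'" "k \<noteq> k'" using l1 l2 by (auto simp: cyc_ang)
  have JL: "oarc k l \<in> L" "oarc l' k' \<in> L" using A.gap_in[OF G(1)] kl(2) kl'(2) A.dual by auto
  have gJ: "g ` oarc k l = oarc k l" "g ` oarc l' k' = oarc l' k'"
    using G(2) kl(4,5) kl'(4,5) by (simp_all add: cycauto_image[OF gc])
  have bdd: "bd (oarc k l) \<inter> bd (oarc l' k') = {}"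
    unfolding bd_oarc[OF kl(1)] bd_oarc[OF kl'(1)[symmetric]] using lk kl2 ll by auto
  have "cyc l' m k'" using l2 mn(1) unfolding cyc_ang circ_eq_iff by (smt (z3))
  moreover have "\<not> cyc l' n k'" using kl'(3) unfolding cyc_ang by linarith
  ultimately have "rig L M g (oarc k l)" unfolding rig_def
    using JL gJ bdd mn(3) kl(3) nJ by (intro conjI bexI[of _ "oarc l' k'"] exI[of _ m] exI[of _ n]) simp_all
  then show False using rig_id[OF gL gM] g by simp
qed

text \<open>The partner is the gap of \<open>M\<close> that is median to three consecutive vertices.
  By uniqueness it is \<open>g\<close>-invariant, and since \<open>no_pivot\<close> keeps the
  vertices \<open>v k\<close> off its vertex set, its elements around them are fixed. Then all its
  vertices are fixed, and \<open>fixed_gaps_one_vertex\<close>, used in both directions, gives at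
  most one vertex per element.\<close>

lemma interleaving_nonleaf:
  assumes gL: "auto_on L g" and gM: "auto_on M g" and g: "g \<noteq> id"
    and G: "nlg L \<G>" and fx: "\<And>w. w \<in> verts \<G> ==> g w = w"
  shows "\<exists>\<H>. isgap M \<H> \<and> inter \<G> \<H> \<and>
    (\<forall>f. auto_on L f --> auto_on M f --> (`) f ` \<G> = \<G> --> (`) f ` \<H> = \<H>)"
proof -
  have gc: "cycauto g" using gL by (rule auto_on_cyc)
  have gG: "isgap L \<G>" using A.nlg_gap[OF G] .
  obtain v where v: "gseq \<G> v" using A.gap_seq[OF gG] by auto
  have el: "oarc (v k) (v (k + 1)) \<in> \<G>" for k using A.gseq_el[OF v] .
  have elL: "oarc (v k) (v (k + 1)) \<in> L" for k using A.gap_in[OF gG el] .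
  have vv: "v k \<in> verts \<G>" for k using A.gap_verts(1)[OF gG el] .
  have fv: "g (v k) = v k" for k using fx[OF vv] .
  have ne1: "v k \<noteq> v (k + 1)" for k using A.ne_oarc[OF elL] .
  have kk: "k + 1 + 1 = k + (2::int)" "k - 1 + 1 = k" "k - 1 + 2 = k + 1" for k by simp_all
  have el2: "oarc (v (k + 1)) (v (k + 2)) \<in> \<G>" "oarc (v (k - 1)) (v k) \<in> \<G>" for k
    using el[of "k + 1"] el[of "k - 1"] unfolding kk .
  have ne1': "v (k + 1) \<noteq> v (k + 2)" "v (k - 1) \<noteq> v k" for k using ne1[of "k + 1"] ne1[of "k - 1"] unfolding kk .
  have ne2: "v k \<noteq> v (k + 2)" for k using A.nlg_no_skip[OF G el[of k] el2(1)] .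
  have ne2': "v (k - 1) \<noteq> v (k + 1)" for k using ne2[of "k - 1"] unfolding kk .
  have ev: "\<not> endp M (v k)" for k using ends_disj A.endp1[OF elL] by auto
  have ne: "v 0 \<noteq> v 1" "v 0 \<noteq> v 2" "v 1 \<noteq> v 2" using ne1[of 0] ne2[of 0] ne1[of 1] by simp_all
  obtain \<H> where H: "isgap M \<H>" "\<forall>N\<in>\<H>. sep3 (v 0) (v 1) (v 2) N" using B.median_gap[OF ne ev ev ev] by auto
  have uniq: "Xs = \<H>" if "isgap M Xs" "\<And>N. N \<in> Xs ==> sep3 (v 0) (v 1) (v 2) N" for Xs
    using B.median_unique[OF ev ev ev that H(1)] B.median_unique[OF ev ev ev H(1) _ that] H(2) by auto
  have gH: "(`) g ` \<H> = \<H>"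
  proof (rule uniq)
    show "isgap M ((`) g ` \<H>)" using B.gap_image[OF gM H(1)] .
    fix N assume "N \<in> (`) g ` \<H>"
    then obtain N' where N': "N' \<in> \<H>" "N = g ` N'" by auto
    have "v k \<in> N \<longleftrightarrow> v k \<in> N'" for k unfolding N'(2) using A.fixed_mem[OF gc fv] .
    then show "sep3 (v 0) (v 1) (v 2) N" using bspec[OF H(2) N'(1)] unfolding sep3_def by simp
  qed
  have nvH: "v k \<notin> verts \<H>" for k
  proof
    assume xv: "v k \<in> verts \<H>"
    have "v k \<noteq> a \<and> v k \<noteq> b" if "oarc a b \<in> \<H>" for a b
      using B.endp1[OF B.gap_in[OF H(1) that]] B.endp2[OF B.gap_in[OF H(1) that]] ev[of k] by auto
    then have "pivot \<H> (v k)" using xv unfolding pivot_def by auto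
    then show False using no_pivot[OF gL gM g A.gap_in[OF gG el2(2)[of k]] fv fv] H(1) by blast
  qed
  have inH: "\<exists>m n. m \<noteq> n \<and> oarc m n \<in> \<H> \<and> cyc m (v k) n \<and> m \<in> verts \<H> \<and> n \<in> verts \<H>" for k
    using B.verts_cases[OF H(1) nvH[of k]] by metis
  have gN: "g ` N = N" if "N \<in> \<H>" "v k \<in> N" for N k
  proof -
    have "g ` N \<in> \<H>" using imageI[OF that(1), of "(`) g"] unfolding gH .
    moreover have "v k \<in> g ` N" using A.fixed_mem[OF gc fv] that(2) by simp
    ultimately show ?thesis using B.gap_disj[OF H(1) _ that(1) _ that(2)] by blast
  qed
  obtain m0 n0 where mn0: "oarc m0 n0 \<in> \<H>" "cyc m0 (v 0) n0" using inH[of 0] by auto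
  have nH: "nlg M \<H>" unfolding nlg_def
  proof
    show "\<not> (\<exists>I\<in>M. \<H> = {I, co I})"
    proof
      assume "\<exists>I\<in>M. \<H> = {I, co I}"
      then obtain I where I: "I \<in> M" "\<H> = {I, co I}" by auto
      have "v 0 \<in> I \<or> v 0 \<in> co I" "v 1 \<in> I \<or> v 1 \<in> co I" "v 2 \<in> I \<or> v 2 \<in> co I" by (rule B.in_or_co[OF I(1) ev])+
      moreover have "sep3 (v 0) (v 1) (v 2) I" "sep3 (v 0) (v 1) (v 2) (co I)"
        using bspec[OF H(2), of I] bspec[OF H(2), of "co I"] I(2) by simp_all
      ultimately show False unfolding sep3_def by auto
    qed
  qed (rule H(1))
  have g0: "g ` oarc m0 n0 = oarc m0 n0" using gN[OF mn0(1), of 0] mn0(2) by simp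
  have fH: "g w = w" if "w \<in> verts \<H>" for w using B.nlg_fix_el(1)[OF gM nH mn0(1) g0 that] .
  have gNH: "g ` N = N" if "N \<in> \<H>" for N using B.nlg_fix_el(2)[OF gM nH mn0(1) g0 that] .
  have one: "w = w'" if N: "N \<in> \<H>" and w: "w \<in> verts \<G>" "w' \<in> verts \<G>" "w \<in> N" "w' \<in> N" for N w w'
  proof (rule ccontr)
    assume ww: "w \<noteq> w'"
    have s: "sep3 (v 0) (v 1) (v 2) N" using bspec[OF H(2) N] .
    have "\<exists>u u'. u \<in> verts \<G> \<and> u' \<in> verts \<G> \<and> u \<noteq> u' \<and> u \<notin> N \<and> u' \<notin> N"
    proof (cases "v 0 \<in> N")
      case True
      then have "v 1 \<notin> N" "v 2 \<notin> N" using s unfolding sep3_def by auto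
      then show ?thesis using vv ne(3) by (intro exI[of _ "v 1"] exI[of _ "v 2"]) simp
    next
      case False
      have "v 1 \<notin> N \<or> v 2 \<notin> N" using s unfolding sep3_def by auto
      then show ?thesis
      proof
        assume "v 1 \<notin> N" then show ?thesis using False vv ne(1) by (intro exI[of _ "v 0"] exI[of _ "v 1"]) simp
      next
        assume "v 2 \<notin> N" then show ?thesis using False vv ne(2) by (intro exI[of _ "v 0"] exI[of _ "v 2"]) simp
      qed
    qed
    then obtain u u' where u: "u \<in> verts \<G>" "u' \<in> verts \<G>" "u \<noteq> u'" "u \<notin> N" "u' \<notin> N" by auto
    show False using fixed_gaps_one_vertex[OF gL gM g gG fx B.gap_in[OF H(1) N] gNH[OF N] w(1,2) ww w(3,4) u] .
  qed
  have step: "\<exists>x y. x \<in> verts \<H> \<and> y \<in> verts \<H> \<and> cyc (v k) x (v (k + 1)) \<and> cyc (v (k - 1)) y (v k)" for k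
  proof -
    obtain m n where mn: "m \<noteq> n" "oarc m n \<in> \<H>" "cyc m (v k) n" "m \<in> verts \<H>" "n \<in> verts \<H>" using inH by metis
    have "\<not> cyc m (v (k + 1)) n" "n \<noteq> v (k + 1)" using one[OF mn(2) vv vv, of k "k + 1"] ne1[of k] mn(3,5) nvH by auto
    then have 1: "cyc (v k) n (v (k + 1))" using cyc_exit(1)[OF mn(3) _ ne1[of k]] by simp
    have "\<not> cyc m (v (k - 1)) n" "m \<noteq> v (k - 1)" using one[OF mn(2) vv vv, of k "k - 1"] ne1'(2)[of k] mn(3,4) nvH by auto
    then have "cyc (v (k - 1)) m (v k)" using cyc_exit(2)[OF mn(3) _ ne1'(2)[of k, symmetric]] by simp
    then show ?thesis using 1 mn(4,5) by blast
  qed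
  have idx: "\<exists>k. I = oarc (v k) (v (k + 1))" if "I \<in> \<G>" for I using v that unfolding gseq_def by auto
  have one': "x = x'" if J: "J \<in> \<G>" and x: "x \<in> verts \<H>" "x' \<in> verts \<H>" "x \<in> J" "x' \<in> J" for J x x'
  proof (rule ccontr)
    assume xx: "x \<noteq> x'"
    obtain j where j: "J = oarc (v j) (v (j + 1))" using idx[OF J] by auto
    obtain y where y: "y \<in> verts \<H>" "cyc (v (j - 1)) y (v j)" using step[of j] by blast
    obtain y' where y': "y' \<in> verts \<H>" "cyc (v (j + 1)) y' (v (j + 2))" using step[of "j + 1"] unfolding kk by blast
    note a1 = el2(2)[of j] el2(1)[of j]
    have nJ: "oarc (v (j - 1)) (v j) \<noteq> J" "oarc (v (j + 1)) (v (j + 2)) \<noteq> J" "oarc (v (j - 1)) (v j) \<noteq> oarc (v (j + 1)) (v (j + 2))"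
      unfolding j oarc_eq_iff[OF ne1'(2)] oarc_eq_iff[OF ne1'(1)] using ne1[of j] ne1'[of j] ne2'[of j] by auto
    have "y \<notin> J" using A.gap_disj[OF gG a1(1) J, of y] y(2) nJ(1) unfolding mem_oarc by blast
    moreover have "y' \<notin> J" using A.gap_disj[OF gG a1(2) J, of y'] y'(2) nJ(2) unfolding mem_oarc by blast
    moreover have "y \<noteq> y'" using A.gap_disj[OF gG a1, of y] y(2) y'(2) nJ(3) unfolding mem_oarc by blast
    moreover have "g ` J = J" unfolding j by (simp add: cycauto_image[OF gc] fv)
    ultimately show False
      using pf.fixed_gaps_one_vertex[OF swap gM gL g H(1) fH A.gap_in[OF gG J] _ x(1,2) xx x(3,4) y(1) y'(1)] by simp
  qed
  have ex1: "\<exists>!x. x \<in> I \<and> x \<in> verts \<H>" if I: "I \<in> \<G>" for I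
  proof -
    obtain j where j: "I = oarc (v j) (v (j + 1))" using idx[OF I] by auto
    obtain x where x: "x \<in> verts \<H>" "cyc (v j) x (v (j + 1))" using step[of j] by blast
    show ?thesis
    proof (rule ex1I[of _ x])
      show "x \<in> I \<and> x \<in> verts \<H>" using x j by simp
      then show "y = x" if "y \<in> I \<and> y \<in> verts \<H>" for y using one'[OF I, of y x] that by simp
    qed
  qed
  have ex2: "\<exists>!x. x \<in> N \<and> x \<in> verts \<G>" if N: "N \<in> \<H>" for N
  proof -
    have NM: "N \<in> M" using B.gap_in[OF H(1) N] .
    obtain m n where mn: "m \<noteq> n" "N = oarc m n" "oarc m n \<in> M" "co N = oarc n m" "oarc n m \<in> M"
      by (rule B.L_cases[OF NM])
    have mnv: "m \<in> verts \<H>" "n \<in> verts \<H>" using B.gap_verts[OF H(1)] N mn(2) by auto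
    have em: "\<not> endp L m" "\<not> endp L n" using ends_disj B.endp1[OF mn(3)] B.endp2[OF mn(3)] by auto
    have "m \<notin> verts \<G>"
    proof
      assume xv: "m \<in> verts \<G>"
      have "m \<noteq> a \<and> m \<noteq> b" if "oarc a b \<in> \<G>" for a b
        using A.endp1[OF A.gap_in[OF gG that]] A.endp2[OF A.gap_in[OF gG that]] em(1) by auto
      then have "pivot \<G> m" using xv unfolding pivot_def by auto
      then show False using pf.no_pivot[OF swap gM gL g mn(5) fH[OF mnv(2)] fH[OF mnv(1)]] gG by auto
    qed
    then obtain k l where kl: "k \<noteq> l" "oarc k l \<in> \<G>" "cyc k m l" "k \<in> verts \<G>" "l \<in> verts \<G>"
      by (rule A.verts_cases[OF gG])
    have "\<not> cyc k n l" using one'[OF kl(2) mnv] kl(3) mn(1) by auto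
    moreover have "l \<noteq> n" using em A.gap_in[OF gG kl(2)] A.endp2 by auto
    ultimately have "cyc m l n" using kl(1,3) mn(1) unfolding cyc_ang circ_eq_iff by (smt (z3))
    then have lN: "l \<in> N" using mn(2) by simp
    show ?thesis
    proof (rule ex1I[of _ l])
      show "l \<in> N \<and> l \<in> verts \<G>" using lN kl(5) by simp
      then show "y = l" if "y \<in> N \<and> y \<in> verts \<G>" for y using one[OF N, of y l] that by simp
    qed
  qed
  have "inter \<G> \<H>" unfolding inter_def using ex1 ex2 by simp
  moreover have "(`) f ` \<H> = \<H>" if f: "auto_on L f" "auto_on M f" "(`) f ` \<G> = \<G>" for f
  proof (rule uniq)
    have fc: "cycauto f" using f(1) by (rule auto_on_cyc)
    show "isgap M ((`) f ` \<H>)" using B.gap_image[OF f(2) H(1)] .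
    fix N assume "N \<in> (`) f ` \<H>"
    then obtain N' where N': "N' \<in> \<H>" "N = f ` N'" by auto
    \<comment> \<open>\<open>f\<close> may move the three chosen vertices, but it permutes the
      vertices of the gap. So elements of the image gap still contain at most one vertex each, and
      the uniqueness of the median gap applies.\<close>
    have two: "x = y" if xy: "x \<in> verts \<G>" "y \<in> verts \<G>" "x \<in> N" "y \<in> N" for x y
    proof -
      have fV: "verts \<G> = f ` verts \<G>" using A.verts_image[OF f(1), of \<G>] f(3) by simp
      obtain x' where x': "x = f x'" "x' \<in> verts \<G>" using xy(1) fV by blast
      obtain y' where y': "y = f y'" "y' \<in> verts \<G>" using xy(2) fV by blast
      have "x' \<in> N'" "y' \<in> N'" using xy(3,4) unfolding N'(2) x'(1) y'(1) A.image_mem[OF fc] .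
      then show ?thesis using one[OF N'(1) x'(2) y'(2)] x'(1) y'(1) by simp
    qed
    then show "sep3 (v 0) (v 1) (v 2) N" unfolding sep3_def using two[OF vv vv] ne by auto
  qed
  ultimately show ?thesis using H(1) by blast
qed

lemma fixed_crossing_bd:
  assumes N: "N \<in> M" "N' \<in> M" "N \<subset> N'" and x: "x \<in> bd N" "x \<in> bd N'" "y \<in> bd N" "y \<in> bd N'"
  shows "x = y"
proof -
  obtain a b where ab: "a \<noteq> b" "N = oarc a b" using B.oarcs[OF N(1)] by auto
  obtain c d where cd: "c \<noteq> d" "N' = oarc c d" using B.oarcs[OF N(2)] by auto
  have "\<not> (a = c \<and> b = d)" "oarc a b \<subseteq> oarc c d" using N(3) ab cd by auto
  then have "\<not> (a = c \<and> b = d)" "a \<noteq> d" "b \<noteq> c" unfolding oarc_subset_iff[OF ab(1)] by auto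
  then show ?thesis using x unfolding ab(2) cd(2) bd_oarc[OF ab(1)] bd_oarc[OF cd(1)] by auto
qed

text \<open>Any two invariant leaves of \<open>M\<close> crossing the given leaf share an end point,
  and by \<open>bd_three\<close> there are at most two of them. A single one interleaves with the
  given leaf. Two of them meet at a point \<open>x\<close>, at which \<open>M\<close> has a non-leaf
  gap with fixed vertices; \<open>interleaving_nonleaf\<close> with the laminations exchanged then
  provides the pair.\<close>

lemma interleaving_leaf:
  assumes gL: "auto_on L g" and gM: "auto_on M g" and g: "g \<noteq> id"
    and I: "oarc v0 v1 \<in> L" "g v0 = v0" "g v1 = v1"
  shows "\<exists>\<G> \<H>. isgap L \<G> \<and> isgap M \<H> \<and> inter \<G> \<H> \<and>
    (\<forall>f. auto_on L f --> auto_on M f --> (`) f ` {oarc v0 v1, oarc v1 v0} = {oarc v0 v1, oarc v1 v0} --> f \<circ> g = g \<circ> f -->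
      (`) f ` \<G> = \<G> \<and> (`) f ` \<H> = \<H>)"
proof -
  have gc: "cycauto g" using gL by (rule auto_on_cyc)
  have vne: "v0 \<noteq> v1" using A.ne_oarc[OF I(1)] .
  have e: "\<not> endp M v0" "\<not> endp M v1" using ends_disj A.endp1[OF I(1)] A.endp2[OF I(1)] by auto
  define Xs where "Xs = {N \<in> M. v0 \<in> N \<and> v1 \<notin> N \<and> g ` N = N}"
  obtain N where N: "N \<in> Xs" using fixed_crossing[OF gL gM I] unfolding Xs_def by auto
  have XM: "P \<in> M" "v0 \<in> P" "v1 \<notin> P" "g ` P = P" if "P \<in> Xs" for P using that unfolding Xs_def by auto
  \<comment> \<open>Commutation with \<open>g\<close> makes the image invariant again. Since
    \<open>f\<close> may exchange \<open>v0\<close> and \<open>v1\<close>, it is the image or its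
    complement that contains \<open>v0\<close>.\<close>
  have fX: "f ` P \<in> Xs \<or> co (f ` P) \<in> Xs"
    if f: "auto_on L f" "auto_on M f" "(`) f ` {oarc v0 v1, oarc v1 v0} = {oarc v0 v1, oarc v1 v0}" "f \<circ> g = g \<circ> f" and P: "P \<in> Xs" for f P
  proof -
    have fc: "cycauto f" using f(1) by (rule auto_on_cyc)
    have fP: "f ` P \<in> M" using B.image_in[OF f(2)] XM[OF P] by simp
    have gfP: "g ` f ` P = f ` P"
    proof -
      have "g ` f ` P = (g \<circ> f) ` P" by (rule image_comp)
      also have "\<dots> = (f \<circ> g) ` P" using f(4) by simp
      also have "\<dots> = f ` g ` P" by (rule image_comp[symmetric])
      finally show ?thesis using XM(4)[OF P] by simp
    qed
    have "f ` oarc v0 v1 \<in> {oarc v0 v1, oarc v1 v0}"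
      by (rule subst[OF f(3), of "\<lambda>S. f ` oarc v0 v1 \<in> S"]) (rule imageI, rule insertI1)
    then have "f v0 = v0 \<and> f v1 = v1 \<or> f v0 = v1 \<and> f v1 = v0"
      unfolding cycauto_image[OF fc] using oarc_eq_iff[of "f v0" "f v1"] cycauto_eq[OF fc] vne by auto
    then show ?thesis
    proof
      assume a: "f v0 = v0 \<and> f v1 = v1"
      have "v0 \<in> f ` P" "v1 \<notin> f ` P" using A.image_mem[OF fc, of v0 P] A.image_mem[OF fc, of v1 P] XM[OF P] a by auto
      then show ?thesis unfolding Xs_def using fP gfP by simp
    next
      assume a: "f v0 = v1 \<and> f v1 = v0"
      have "v1 \<in> f ` P" "v0 \<notin> f ` P" using A.image_mem[OF fc, of v0 P] A.image_mem[OF fc, of v1 P] XM[OF P] a by auto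
      then have "v0 \<in> co (f ` P)" "v1 \<notin> co (f ` P)" using B.in_co_iff[OF fP] e by auto
      then show ?thesis unfolding Xs_def using B.co_in[OF fP] B.fixed_co[OF gM fP gfP] by simp
    qed
  qed
  have share: "bd P \<inter> bd Q \<noteq> {}" if "P \<in> Xs" "Q \<in> Xs" for P Q
    using crossing_fixed_share[OF gL gM g I(1)] XM[OF that(1)] XM[OF that(2)] by simp
  have nest: "P \<subseteq> Q \<or> Q \<subseteq> P" if "P \<in> Xs" "Q \<in> Xs" for P Q
    using B.nested'[OF XM(1)[OF that(1)] XM(1)[OF that(2)] XM(2)[OF that(1)] XM(2)[OF that(2)] XM(3)[OF that(1)] XM(3)[OF that(2)] e(2)] .
  have three: False if "P \<in> Xs" "Q \<in> Xs" "R \<in> Xs" "P \<subset> Q" "Q \<subset> R" for P Q R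
    using pf.bd_three[OF swap XM(1)[OF that(1)] XM(1)[OF that(2)] XM(1)[OF that(3)] that(4,5)] share[OF that(1,3)] by simp
  show ?thesis
  proof (cases "Xs = {N}")
    case True
    have NM: "N \<in> M" using XM N by simp
    obtain m n where mn: "m \<noteq> n" "N = oarc m n" "oarc m n \<in> M" "co N = oarc n m" "oarc n m \<in> M"
      by (rule B.L_cases[OF NM])
    have el: "\<not> endp L m" "\<not> endp L n" using ends_disj B.endp1[OF mn(3)] B.endp2[OF mn(3)] by auto
    have mne: "m \<noteq> v0" "m \<noteq> v1" "n \<noteq> v0" "n \<noteq> v1" using el A.endp1[OF I(1)] A.endp2[OF I(1)] by auto
    have c1: "cyc m v0 n" "\<not> cyc m v1 n" using XM[OF N] mn(2) by auto
    have c2: "cyc v0 n v1" "\<not> cyc v0 m v1" "cyc v1 m v0" "\<not> cyc v1 n v0" "cyc n v1 m" "\<not> cyc n v0 m"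
      using c1 mne vne mn(1) unfolding cyc_ang circ_eq_iff by (smt (z3))+
    have gL': "isgap L {oarc v0 v1, oarc v1 v0}" using A.leaf_isgap[OF I(1)] vne by simp
    have gM': "isgap M {oarc m n, oarc n m}" using B.leaf_isgap[OF NM] mn(2,4) by simp
    have vL: "verts {oarc v0 v1, oarc v1 v0} = {v0, v1}" using A.leaf_verts[of "oarc v0 v1"] vne bd_oarc[OF vne] by simp
    have vM: "verts {oarc m n, oarc n m} = {m, n}" using B.leaf_verts[of "oarc m n"] mn(1) bd_oarc[OF mn(1)] by simp
    have i1: "inter {oarc v0 v1, oarc v1 v0} {oarc m n, oarc n m}"
      unfolding inter_def vL vM using c1 c2 by auto
    have i2: "(`) f ` {oarc m n, oarc n m} = {oarc m n, oarc n m}"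
      if f: "auto_on L f" "auto_on M f" "(`) f ` {oarc v0 v1, oarc v1 v0} = {oarc v0 v1, oarc v1 v0}" "f \<circ> g = g \<circ> f" for f
    proof -
      have "f ` N = N \<or> co (f ` N) = N" using fX[OF f N] True by simp
      then have "f ` N = N \<or> f ` N = co N" using B.co_co[of "f ` N"] B.image_in[OF f(2)] NM by metis
      moreover have "co (f ` N) = f ` co N" using B.co_image[OF f(2) NM] .
      ultimately have "(f ` N = N \<and> f ` co N = co N) \<or> (f ` N = co N \<and> f ` co N = N)" using B.co_co[OF NM] by auto
      then show ?thesis using mn(2,4) by auto
    qed
    show ?thesis
      by (rule exI[of _ "{oarc v0 v1, oarc v1 v0}"], rule exI[of _ "{oarc m n, oarc n m}"])
        (intro conjI allI impI gL' gM' i1 i2)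
  next
    case False
    then obtain P Q where PQ: "P \<in> Xs" "Q \<in> Xs" "P \<subset> Q"
    proof -
      obtain N' where "N' \<in> Xs" "N' \<noteq> N" using False N by auto
      then show thesis using nest[OF N, of N'] that[of N N'] that[of N' N] N by auto
    qed
    have X2: "Xs = {P, Q}"
    proof
      show "{P, Q} \<subseteq> Xs" using PQ by simp
      show "Xs \<subseteq> {P, Q}"
      proof
        fix R assume R: "R \<in> Xs"
        show "R \<in> {P, Q}"
        proof (rule ccontr)
          assume "R \<notin> {P, Q}"
          then have "R \<subset> P \<or> P \<subset> R" "R \<subset> Q \<or> Q \<subset> R" using nest[OF R PQ(1)] nest[OF R PQ(2)] by auto
          then show False using three[OF R PQ(1,2) _ PQ(3)] three[OF PQ(1) R PQ(2)] three[OF PQ(1,2) R PQ(3)] by auto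
        qed
      qed
    qed
    obtain x where x: "x \<in> bd P" "x \<in> bd Q" using share[OF PQ(1,2)] by auto
    have xl: "\<exists>y. bd S = {x, y} \<and> oarc x y \<in> M" if S: "S \<in> M" "x \<in> bd S" for S
    proof -
      obtain a b where ab: "a \<noteq> b" "S = oarc a b" "oarc a b \<in> M" "co S = oarc b a" "oarc b a \<in> M"
        by (rule B.L_cases[OF S(1)])
      have "x = a \<or> x = b" using S(2) unfolding ab(2) bd_oarc[OF ab(1)] by simp
      then show ?thesis unfolding ab(2) bd_oarc[OF ab(1)] using ab(3,5) by auto
    qed
    obtain p where p: "bd P = {x, p}" "oarc x p \<in> M" using xl[OF XM(1)[OF PQ(1)] x(1)] by auto
    obtain q where q: "bd Q = {x, q}" "oarc x q \<in> M" using xl[OF XM(1)[OF PQ(2)] x(2)] by auto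
    have xpq: "x \<noteq> p" "x \<noteq> q" using B.ne_oarc p q by auto
    have "p \<noteq> q" using fixed_crossing_bd[OF XM(1)[OF PQ(1)] XM(1)[OF PQ(2)] PQ(3), of x p] p(1) q(1) xpq by auto
    then have "cyc x p q \<or> cyc x q p" using xpq unfolding cyc_ang circ_eq_iff by (smt (z3))
    then obtain \<H> r where H: "nlg M \<H>" "oarc r x \<in> \<H>"
      using pf.two_leaves_gap[OF swap p(2) q(2)] pf.two_leaves_gap[OF swap q(2) p(2)] by auto
    have gH: "isgap M \<H>" using B.nlg_gap[OF H(1)] .
    have xv: "x \<in> verts \<H>" using B.gap_verts(2)[OF gH H(2)] .
    have "r \<noteq> x" using B.ne_oarc[OF B.gap_in[OF gH H(2)]] .
    then have "\<not> pivot \<H> x" using H(2) unfolding pivot_def by blast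
    then obtain s where s: "oarc x s \<in> \<H>" using B.vert_ends[OF gH xv] by blast
    have gx: "g x = x" using B.fixed_bd[OF gc XM(1)[OF PQ(1)]] XM(4)[OF PQ(1)] x(1) by simp
    have fxH: "g w = w" if "w \<in> verts \<H>" for w using B.nlg_fix(2)[OF gM H(1) s gx that] .
    obtain \<G> where G: "isgap L \<G>" "inter \<H> \<G>"
      "\<forall>f. auto_on M f --> auto_on L f --> (`) f ` \<H> = \<H> --> (`) f ` \<G> = \<G>"
      using pf.interleaving_nonleaf[OF swap gM gL g H(1) fxH] by auto
    have fH: "(`) f ` \<H> = \<H>"
      if f: "auto_on L f" "auto_on M f" "(`) f ` {oarc v0 v1, oarc v1 v0} = {oarc v0 v1, oarc v1 v0}" "f \<circ> g = g \<circ> f" for f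
    proof -
      have bdf: "bd (f ` S) = bd P \<or> bd (f ` S) = bd Q" if S: "S \<in> Xs" for S
      proof -
        have fS: "f ` S \<in> M" using B.image_in[OF f(2)] XM(1)[OF S] by simp
        have "f ` S \<in> {P, Q} \<or> co (f ` S) \<in> {P, Q}" using fX[OF f S] X2 by simp
        then show ?thesis using B.bd_co[OF fS] by auto
      qed
      have bdi: "bd (f ` S) = f ` bd S" if "S \<in> Xs" for S using B.bd_image[OF f(2) XM(1)[OF that]] .
      have "f ` bd P = bd P \<or> f ` bd P = bd Q" "f ` bd Q = bd P \<or> f ` bd Q = bd Q"
        using bdf[OF PQ(1)] bdf[OF PQ(2)] bdi[OF PQ(1)] bdi[OF PQ(2)] by auto
      moreover have "bd P \<noteq> bd Q" using p(1) q(1) \<open>p \<noteq> q\<close> xpq by (simp add: doubleton_eq_iff)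
      then have "f ` bd P \<noteq> f ` bd Q" using B.image_inj_eq[OF f(2)] by simp
      ultimately have "f x \<in> bd P \<and> f x \<in> bd Q" using x by blast
      then have "f x = x" using fixed_crossing_bd[OF XM(1)[OF PQ(1)] XM(1)[OF PQ(2)] PQ(3)] x by blast
      then show ?thesis using B.nlg_stable[OF f(2) H(1) xv] xv by simp
    qed
    have "inter \<G> \<H>" using G(2) inter_sym by simp
    moreover have "(`) f ` \<G> = \<G>"
      if f: "auto_on L f" "auto_on M f" "(`) f ` {oarc v0 v1, oarc v1 v0} = {oarc v0 v1, oarc v1 v0}" "f \<circ> g = g \<circ> f" for f
      using G(3) f(1,2) fH[OF f] by simp
    ultimately show ?thesis
      by (intro exI[of _ \<G>] exI[of _ \<H>] conjI allI impI G(1) gH fH)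
  qed
qed

end

section \<open>Translation numbers\<close>

text \<open>The members with only finitely many members below them have a greatest one, hence are
  finite in number. A least member outside them would have finitely many members below it as
  well.\<close>

lemma finite_chain_if_wf_both:
  fixes Xs :: "'a set set"
  assumes ch: "\<And>A B. A \<in> Xs ==> B \<in> Xs ==> A \<subseteq> B \<or> B \<subseteq> A"
    and mx: "\<And>Y. Y \<subseteq> Xs ==> Y \<noteq> {} ==> \<exists>A\<in>Y. \<forall>B\<in>Y. B \<subseteq> A"
    and mn: "\<And>Y. Y \<subseteq> Xs ==> Y \<noteq> {} ==> \<exists>A\<in>Y. \<forall>B\<in>Y. A \<subseteq> B"
  shows "finite Xs"
proof (cases "Xs = {}")
  case False
  define F where "F = {A \<in> Xs. finite {B \<in> Xs. B \<subseteq> A}}"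
  obtain A0 where A0: "A0 \<in> Xs" "\<And>B. B \<in> Xs ==> A0 \<subseteq> B" using mn[of Xs] False by auto
  have "{B \<in> Xs. B \<subseteq> A0} \<subseteq> {A0}" using A0 by auto
  then have "finite {B \<in> Xs. B \<subseteq> A0}" using finite_subset by blast
  then have "A0 \<in> F" unfolding F_def using A0(1) by simp
  moreover have FX: "F \<subseteq> Xs" unfolding F_def by auto
  ultimately obtain m where m: "m \<in> F" "\<And>B. B \<in> F ==> B \<subseteq> m" using mx[of F] by blast
  have "F \<subseteq> {B \<in> Xs. B \<subseteq> m}" using m(2) FX by blast
  then have fF: "finite F" using m(1) finite_subset unfolding F_def by blast
  have "Xs - F = {}"
  proof (rule ccontr)
    assume "Xs - F \<noteq> {}"
    then obtain k where k: "k \<in> Xs - F" "\<And>B. B \<in> Xs - F ==> k \<subseteq> B" using mn[of "Xs - F"] by blast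
    have "{B \<in> Xs. B \<subseteq> k} \<subseteq> insert k F" using k by blast
    then have "finite {B \<in> Xs. B \<subseteq> k}" using fF finite_subset by blast
    then show False using k(1) unfolding F_def by simp
  qed
  then show ?thesis using fF FX by (metis Diff_eq_empty_iff finite_subset)
qed simp

text \<open>\<open>r f\<close> counts the members from \<open>e0\<close> up to, but excluding,
  \<open>f\<close>. Far enough out, \<open>g\<close> changes this rank by a constant, which is the
  translation number. If it vanishes, a member and its image are comparable and of equal rank, so
  they coincide.\<close>

lemma translation_hom:
  fixes D :: "'a set set" and K :: "('a \<Rightarrow> 'a) set"
  assumes e0: "e0 \<in> D" and dir: "\<And>a b. a \<in> D ==> b \<in> D ==> \<exists>c\<in>D. a \<subseteq> c \<and> b \<subseteq> c"
    and ch: "\<And>a b. a \<in> D ==> b \<in> D ==> e0 \<subseteq> a ==> e0 \<subseteq> b ==> a \<subseteq> b \<or> b \<subseteq> a"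
    and fin: "\<And>a b. a \<in> D ==> b \<in> D ==> finite {f \<in> D. a \<subseteq> f \<and> f \<subseteq> b}"
    and bij: "\<And>g. g \<in> K ==> bij g" and KD: "\<And>g e. g \<in> K ==> g ` e \<in> D \<longleftrightarrow> e \<in> D"
  shows "\<exists>s :: ('a \<Rightarrow> 'a) \<Rightarrow> int. (\<forall>g\<in>K. \<forall>h\<in>K. g \<circ> h \<in> K --> s (g \<circ> h) = s g + s h) \<and>
    (\<forall>g\<in>K. s g = 0 --> (\<exists>e\<in>D. g ` e = e))"
proof -
  define r where "r f = int (card {h \<in> D. e0 \<subseteq> h \<and> h \<subset> f})" for f
  define ok where "ok g f \<longleftrightarrow> f \<in> D \<and> e0 \<subseteq> f \<and> e0 \<subseteq> g ` f" for g f
  have sub: "g ` a \<subseteq> g ` b \<longleftrightarrow> a \<subseteq> b" if "g \<in> K" for g a b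
    using bij[OF that] by (simp add: bij_def inj_image_subset_iff)
  have img: "\<exists>e\<in>D. h = g ` e" if "g \<in> K" "h \<in> D" for g h
  proof
    show "h = g ` (inv_into UNIV g ` h)" using bij[OF that(1)] by (simp add: bij_def image_f_inv_f)
    then show "inv_into UNIV g ` h \<in> D" using KD[OF that(1), of "inv_into UNIV g ` h"] that(2) by simp
  qed
  have fin': "finite {h \<in> D. a \<subseteq> h \<and> h \<subset> b}" if "a \<in> D" "b \<in> D" for a b
    using fin[OF that] by (rule rev_finite_subset) auto
  have diff: "r b = r a + int (card {h \<in> D. a \<subseteq> h \<and> h \<subset> b})"
    if ab: "a \<in> D" "b \<in> D" "e0 \<subseteq> a" "a \<subseteq> b" for a b
  proof -
    have "{h \<in> D. e0 \<subseteq> h \<and> h \<subset> b} = {h \<in> D. e0 \<subseteq> h \<and> h \<subset> a} \<union> {h \<in> D. a \<subseteq> h \<and> h \<subset> b}"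
    proof
      show "{h \<in> D. e0 \<subseteq> h \<and> h \<subset> b} \<subseteq> {h \<in> D. e0 \<subseteq> h \<and> h \<subset> a} \<union> {h \<in> D. a \<subseteq> h \<and> h \<subset> b}"
        using ch[OF _ ab(1) _ ab(3)] by blast
    qed (use ab in auto)
    moreover have "{h \<in> D. e0 \<subseteq> h \<and> h \<subset> a} \<inter> {h \<in> D. a \<subseteq> h \<and> h \<subset> b} = {}" by auto
    ultimately show ?thesis unfolding r_def using card_Un_disjoint[OF fin'[OF e0 ab(1)] fin'[OF ab(1,2)]] by simp
  qed
  have trans: "card {h \<in> D. g ` a \<subseteq> h \<and> h \<subset> g ` b} = card {h \<in> D. a \<subseteq> h \<and> h \<subset> b}" if g: "g \<in> K" for g a b
  proof -
    have "{h \<in> D. g ` a \<subseteq> h \<and> h \<subset> g ` b} = (`) g ` {h \<in> D. a \<subseteq> h \<and> h \<subset> b}"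
    proof
      show "{h \<in> D. g ` a \<subseteq> h \<and> h \<subset> g ` b} \<subseteq> (`) g ` {h \<in> D. a \<subseteq> h \<and> h \<subset> b}"
      proof
        fix h assume h: "h \<in> {h \<in> D. g ` a \<subseteq> h \<and> h \<subset> g ` b}"
        then obtain e where e: "e \<in> D" "h = g ` e" using bexE[OF img[OF g, of h]] by blast
        have "a \<subseteq> e" "e \<subseteq> b" "e \<noteq> b" using h sub[OF g, of a e] sub[OF g, of e b] e(2) by auto
        then have "a \<subseteq> e \<and> e \<subset> b" by blast
        then show "h \<in> (`) g ` {h \<in> D. a \<subseteq> h \<and> h \<subset> b}" using e by auto
      qed
      show "(`) g ` {h \<in> D. a \<subseteq> h \<and> h \<subset> b} \<subseteq> {h \<in> D. g ` a \<subseteq> h \<and> h \<subset> g ` b}"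
      proof (rule image_subsetI)
        fix h assume "h \<in> {h \<in> D. a \<subseteq> h \<and> h \<subset> b}"
        then have h: "h \<in> D" "a \<subseteq> h" "h \<subseteq> b" "\<not> b \<subseteq> h" by auto
        have "g ` h \<in> D" "g ` a \<subseteq> g ` h" "g ` h \<subseteq> g ` b" "\<not> g ` b \<subseteq> g ` h"
          unfolding KD[OF g] sub[OF g] by (fact h)+
        then show "g ` h \<in> {h \<in> D. g ` a \<subseteq> h \<and> h \<subset> g ` b}" by simp
      qed
    qed
    moreover have "inj_on ((`) g) {h \<in> D. a \<subseteq> h \<and> h \<subset> b}"
      using bij[OF g] by (simp add: bij_def inj_on_image inj_on_def inj_image_eq_iff)
    ultimately show ?thesis by (simp add: card_image)
  qed
  have okD: "f \<in> D" "e0 \<subseteq> f" "g ` f \<in> D" "e0 \<subseteq> g ` f" if "g \<in> K" "ok g f" for g f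
    using that(2) KD[OF that(1), of f] unfolding ok_def by simp_all
  have up: "r (g ` b) - r b = r (g ` a) - r a" if g: "g \<in> K" and a: "ok g a" and b: "b \<in> D" "a \<subseteq> b" for g a b
  proof -
    have "r (g ` b) = r (g ` a) + int (card {h \<in> D. g ` a \<subseteq> h \<and> h \<subset> g ` b})"
      by (rule diff) (use okD[OF g a] KD[OF g, of b] sub[OF g, of a b] b in simp_all)
    then show ?thesis using diff[OF okD(1)[OF g a] b(1) okD(2)[OF g a] b(2)] trans[OF g] by simp
  qed
  have indep: "r (g ` b) - r b = r (g ` a) - r a" if g: "g \<in> K" and a: "ok g a" and b: "ok g b" for g a b
  proof -
    obtain c where c: "c \<in> D" "a \<subseteq> c" "b \<subseteq> c" using dir[OF okD(1)[OF g a] okD(1)[OF g b]] by auto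
    show ?thesis using up[OF g a c(1,2)] up[OF g b c(1,3)] by simp
  qed
  have big: "\<exists>b\<in>D. a \<subseteq> b \<and> c \<subseteq> g ` b" if g: "g \<in> K" and ac: "a \<in> D" "c \<in> D" for g a c
  proof -
    obtain d where d: "d \<in> D" "g ` a \<subseteq> d" "c \<subseteq> d" using bexE[OF dir[of "g ` a" c]] ac KD[OF g, of a] by metis
    obtain b where b: "b \<in> D" "d = g ` b" using bexE[OF img[OF g d(1)]] by blast
    have "a \<subseteq> b" using d(2) unfolding b(2) sub[OF g] .
    then show ?thesis using b d(3) by auto
  qed
  have ex: "\<exists>f. ok g f" if g: "g \<in> K" for g using big[OF g e0 e0] unfolding ok_def by auto
  \<comment> \<open>Directedness provides a member that lies above \<open>e0\<close> together with
    its image; by \<open>indep\<close> the value is the same for all such members.\<close>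
  define s where "s g = r (g ` (SOME f. ok g f)) - r (SOME f. ok g f)" for g
  have s: "s g = r (g ` f) - r f" if "g \<in> K" "ok g f" for g f
    unfolding s_def using indep[OF that(1) that(2) someI[of "ok g", OF that(2)]] .
  show ?thesis
  proof (intro exI[of _ s] conjI ballI impI)
    fix g h assume gh: "g \<in> K" "h \<in> K" "g \<circ> h \<in> K"
    obtain a where a: "ok (g \<circ> h) a" using ex[OF gh(3)] by auto
    obtain b where b: "b \<in> D" "a \<subseteq> b" "e0 \<subseteq> h ` b" using big[OF gh(2) okD(1)[OF gh(3) a] e0] by auto
    have ea: "e0 \<subseteq> a" "e0 \<subseteq> g ` h ` a" using okD[OF gh(3) a] by (simp_all add: image_comp)
    have "g ` h ` a \<subseteq> g ` h ` b" using b(2) by auto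
    then have e2: "e0 \<subseteq> g ` h ` b" using ea(2) by (rule order.trans[rotated])
    have e1: "e0 \<subseteq> b" using ea(1) b(2) by (rule order.trans)
    have E: "(g \<circ> h) ` b = g ` h ` b" by (rule image_comp[symmetric])
    have hb: "h ` b \<in> D" using KD[OF gh(2)] b(1) by simp
    have "ok (g \<circ> h) b" "ok h b" "ok g (h ` b)" unfolding ok_def E using b e1 e2 hb by simp_all
    then show "s (g \<circ> h) = s g + s h" using s[OF gh(3), of b] s[OF gh(2), of b] s[OF gh(1), of "h ` b"] unfolding E by simp
  next
    fix g assume g: "g \<in> K" "s g = 0"
    obtain a where a: "ok g a" using ex[OF g(1)] by auto
    have eq: "r (g ` a) = r a" using s[OF g(1) a] g(2) by simp
    note D = okD[OF g(1) a]
    have no: False if xy: "x \<in> D" "y \<in> D" "e0 \<subseteq> x" "x \<subset> y" "r x = r y" for x y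
    proof -
      have "{h \<in> D. x \<subseteq> h \<and> h \<subset> y} = {}" using diff[OF xy(1,2,3)] xy(4,5) card_eq_0_iff fin'[OF xy(1,2)] by simp
      then show False using xy(1,4) by blast
    qed
    have "\<not> a \<subset> g ` a" "\<not> g ` a \<subset> a" using no[OF D(1,3,2)] no[OF D(3,1,4)] eq by auto
    then have "g ` a = a" using ch[OF D(1,3,2,4)] by auto
    then show "\<exists>e\<in>D. g ` e = e" using D(1) by auto
  qed
qed

section \<open>Leaves spanned by end points of crossing leaves\<close>

definition tops :: "circ set set \<Rightarrow> circ \<Rightarrow> circ \<Rightarrow> circ set" where
  "tops M v0 v1 = {a. cyc v0 a v1 \<and> (\<exists>m. oarc m a \<in> M \<and> v0 \<in> oarc m a \<and> v1 \<notin> oarc m a)}"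

definition spanned :: "circ set set \<Rightarrow> circ \<Rightarrow> circ \<Rightarrow> circ set \<Rightarrow> circ set set" where
  "spanned L v0 v1 A = {e \<in> L. v0 \<notin> e \<and> v1 \<notin> e \<and> (\<exists>x\<in>A. \<exists>y\<in>A. x \<noteq> y \<and> x \<in> e \<and> y \<in> e \<and>
     (\<forall>N\<in>L. x \<in> N --> y \<in> N --> v0 \<notin> N --> v1 \<notin> N --> e \<subseteq> N))}"

context pf
begin

text \<open>The tops form a closed set, as limits of crossing leaves are leaves. The largest
  crossing leaf missing \<open>z\<close> ends before \<open>z\<close>, the smallest one containing
  \<open>z\<close> ends beyond it, and no top lies between these two ends.\<close>

lemma tops_isolated:
  assumes I: "oarc v0 v1 \<in> L" and z: "cyc v0 z v1" "\<not> endp M z"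
  shows "\<exists>p q. cyc p z q \<and> (\<forall>a\<in>tops M v0 v1. \<not> cyc p a q)"
proof -
  have vne: "v0 \<noteq> v1" using A.ne_oarc[OF I] .
  have e: "\<not> endp M v0" "\<not> endp M v1" using ends_disj A.endp1[OF I] A.endp2[OF I] by auto
  have zv: "z \<noteq> v0" "z \<noteq> v1" using z(1) by (auto simp: cyc_ang)
  \<comment> \<open>If no crossing leaf misses \<open>z\<close>, no top precedes \<open>z\<close>,
    and \<open>v0\<close> itself serves as the lower bound; likewise \<open>v1\<close> below for the
    upper bound.\<close>
  have "\<exists>p. (p = v0 \<or> cyc v0 p z) \<and> (\<forall>a\<in>tops M v0 v1. \<not> cyc p a z)"
  proof (cases "\<exists>N\<in>M. v0 \<in> N \<and> v1 \<notin> N \<and> z \<notin> N")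
    case False
    then have no: "\<forall>N\<in>M. \<not> (v0 \<in> N \<and> v1 \<notin> N \<and> z \<notin> N)" by simp
    have "\<not> cyc v0 a z" if a: "a \<in> tops M v0 v1" for a
    proof
      assume az: "cyc v0 a z"
      obtain m where m: "oarc m a \<in> M" "cyc m v0 a" "\<not> cyc m v1 a" using a unfolding tops_def by auto
      have "v1 \<noteq> m" using e(2) B.endp1[OF m(1)] by auto
      then have "\<not> cyc m z a" using m(2,3) az z(1) unfolding cyc_ang circ_eq_iff by (smt (z3))
      then show False using bspec[OF no m(1)] m(2,3) by simp
    qed
    then show ?thesis by (intro exI[of _ v0] conjI ballI disjI1 HOL.refl)
  next
    case True
    define C where "C = {N \<in> M. v0 \<in> N \<and> v1 \<notin> N \<and> z \<notin> N}"
    have U: "\<Union>C \<in> M"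
    proof (rule B.sup[of _ z v1])
      show "C \<subseteq> M" "C \<noteq> {}" using True unfolding C_def by blast+
      fix P Q assume "P \<in> C" "Q \<in> C"
      then show "P \<subseteq> Q \<or> Q \<subseteq> P" unfolding C_def using B.nested'[of P Q v0 v1] e(2) by simp
    qed (use zv in \<open>auto simp: C_def\<close>)
    obtain m p where mp: "m \<noteq> p" "\<Union>C = oarc m p" "oarc m p \<in> M" "co (\<Union>C) = oarc p m" "oarc p m \<in> M"
      by (rule B.L_cases[OF U])
    have "v0 \<in> \<Union>C" "v1 \<notin> \<Union>C" "z \<notin> \<Union>C" using True unfolding C_def by auto
    then have c: "cyc m v0 p" "\<not> cyc m v1 p" "\<not> cyc m z p" unfolding mp(2) by auto
    have ne: "z \<noteq> p" "z \<noteq> m" "v1 \<noteq> p" "v1 \<noteq> m" using z(2) e(2) B.endp1[OF mp(3)] B.endp2[OF mp(3)] by auto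
    have p: "cyc v0 p z" using c ne z(1) unfolding cyc_ang circ_eq_iff by (smt (z3))
    have "\<not> cyc p a z" if a: "a \<in> tops M v0 v1" for a
    proof
      assume az: "cyc p a z"
      obtain m' where m: "oarc m' a \<in> M" "cyc m' v0 a" "\<not> cyc m' v1 a" using a unfolding tops_def by auto
      have m'a: "m' \<noteq> a" using B.ne_oarc[OF m(1)] .
      have "v1 \<noteq> m'" using e(2) B.endp1[OF m(1)] by auto
      then have "\<not> cyc m' z a" using m(2,3) az z(1) p unfolding cyc_ang circ_eq_iff by (smt (z3))
      then have "oarc m' a \<in> C" unfolding C_def using m by simp
      then have "oarc m' a \<subseteq> oarc m p" using Union_upper[of "oarc m' a" C] unfolding mp(2) by simp
      then show False unfolding oarc_subset_iff[OF m'a] using az p z(1) c ne unfolding cyc_ang circ_eq_iff by (smt (z3))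
    qed
    then show ?thesis using p by (intro exI[of _ p] conjI ballI disjI2)
  qed
  then obtain p where p: "p = v0 \<or> cyc v0 p z" "\<And>a. a \<in> tops M v0 v1 ==> \<not> cyc p a z" by auto
  have "\<exists>q. (q = v1 \<or> cyc z q v1) \<and> (\<forall>a\<in>tops M v0 v1. \<not> cyc z a q)"
  proof (cases "\<exists>N\<in>M. v0 \<in> N \<and> v1 \<notin> N \<and> z \<in> N")
    case False
    then have no: "\<forall>N\<in>M. \<not> (v0 \<in> N \<and> v1 \<notin> N \<and> z \<in> N)" by simp
    have "\<not> cyc z a v1" if a: "a \<in> tops M v0 v1" for a
    proof
      assume az: "cyc z a v1"
      obtain m where m: "oarc m a \<in> M" "cyc m v0 a" "\<not> cyc m v1 a" using a unfolding tops_def by auto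
      have "cyc m z a" using m(2,3) az z(1) unfolding cyc_ang circ_eq_iff by (smt (z3))
      then show False using bspec[OF no m(1)] m(2,3) by simp
    qed
    then show ?thesis by (intro exI[of _ v1] conjI ballI disjI1 HOL.refl)
  next
    case True
    define C where "C = {co N | N. N \<in> M \<and> v0 \<in> N \<and> v1 \<notin> N \<and> z \<in> N}"
    have U: "\<Union>C \<in> M"
    proof (rule B.sup[of _ z v0])
      show "C \<subseteq> M" "C \<noteq> {}" using True B.co_in unfolding C_def by blast+
      fix P Q assume "P \<in> C" "Q \<in> C"
      then obtain P' Q' where PQ: "P = co P'" "Q = co Q'" "P' \<in> M" "Q' \<in> M" "v0 \<in> P'" "v0 \<in> Q'" "v1 \<notin> P'" "v1 \<notin> Q'"
        unfolding C_def by auto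
      show "P \<subseteq> Q \<or> Q \<subseteq> P"
        using B.nested'[OF PQ(3-8) e(2)] B.co_anti[OF PQ(3,4)] B.co_anti[OF PQ(4,3)] PQ(1,2) by auto
    next
      fix P assume "P \<in> C"
      then obtain P' where P: "P = co P'" "P' \<in> M" "v0 \<in> P'" "z \<in> P'" unfolding C_def by auto
      then show "z \<notin> P \<and> v0 \<notin> P" using B.co_disj[OF P(2)] by auto
    qed (use zv in auto)
    obtain q m where mp: "q \<noteq> m" "\<Union>C = oarc q m" "oarc q m \<in> M" "co (\<Union>C) = oarc m q" "oarc m q \<in> M"
      by (rule B.L_cases[OF U])
    obtain N where N: "N \<in> M" "v0 \<in> N" "v1 \<notin> N" "z \<in> N" using True by auto
    have "v1 \<in> \<Union>C" using B.in_co_iff[OF N(1) e(2)] N unfolding C_def by auto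
    moreover have "v0 \<notin> P \<and> z \<notin> P" if PC: "P \<in> C" for P
    proof -
      obtain P' where P: "P = co P'" "P' \<in> M" "v0 \<in> P'" "z \<in> P'" using PC unfolding C_def by auto
      then show ?thesis using B.co_disj[OF P(2)] by auto
    qed
    then have "v0 \<notin> \<Union>C" "z \<notin> \<Union>C" by auto
    ultimately have c: "cyc q v1 m" "\<not> cyc q v0 m" "\<not> cyc q z m" unfolding mp(2) by auto
    have ne: "z \<noteq> q" "z \<noteq> m" "v0 \<noteq> q" "v0 \<noteq> m" using z(2) e(1) B.endp1[OF mp(3)] B.endp2[OF mp(3)] by auto
    have q: "cyc z q v1" using c ne z(1) unfolding cyc_ang circ_eq_iff by (smt (z3))
    have "\<not> cyc z a q" if a: "a \<in> tops M v0 v1" for a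
    proof
      assume az: "cyc z a q"
      obtain m' where m: "oarc m' a \<in> M" "cyc m' v0 a" "\<not> cyc m' v1 a" using a unfolding tops_def by auto
      have m'a: "a \<noteq> m'" using B.ne_oarc[OF m(1)] by simp
      have "v1 \<noteq> m'" using e(2) B.endp1[OF m(1)] by auto
      then have "cyc m' z a" using m(2,3) az z(1) q unfolding cyc_ang circ_eq_iff by (smt (z3))
      then have "co (oarc m' a) \<in> C" unfolding C_def using m by (intro CollectI exI[of _ "oarc m' a"]) simp
      then have "oarc a m' \<subseteq> oarc q m" using Union_upper[of "co (oarc m' a)" C] m'a unfolding mp(2) by simp
      then show False unfolding oarc_subset_iff[OF m'a] using az q z(1) c ne unfolding cyc_ang circ_eq_iff by (smt (z3))
    qed
    then show ?thesis using q by (intro exI[of _ q] conjI ballI disjI2)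
  qed
  then obtain q where q: "q = v1 \<or> cyc z q v1" "\<And>a. a \<in> tops M v0 v1 ==> \<not> cyc z a q" by auto
  have "cyc p z q" using p(1) q(1) z(1) unfolding cyc_ang circ_eq_iff by (smt (z3))
  moreover have "\<not> cyc p a q" if a: "a \<in> tops M v0 v1" for a
  proof -
    have "a \<noteq> z" using a z(2) B.endp2 unfolding tops_def by auto
    then show ?thesis using p(2)[OF a] q(2)[OF a] \<open>cyc p z q\<close> unfolding cyc_ang circ_eq_iff by (smt (z3))
  qed
  ultimately show ?thesis by auto
qed

text \<open>A least separating leaf borders a gap from inside. By \<open>nog\<close> it is therefore
  not the leaf \<open>v0 v1\<close>, and by \<open>leaf_off_vertex\<close> it has no end point in
  common with that leaf.\<close>

lemma spanned_in:
  assumes I: "oarc v0 v1 \<in> L" and nog: "\<And>\<G>. nlg L \<G> ==> oarc v1 v0 \<notin> \<G>"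
    and e: "e \<in> spanned L v0 v1 (tops M v0 v1)"
  obtains c d where "e = oarc c d" "oarc c d \<in> L" "c \<noteq> d" "cyc v0 c d" "cyc c d v1" "cyc v0 c v1" "cyc v0 d v1"
    "co e \<in> L" "\<exists>\<G>. nlg L \<G> \<and> co e \<in> \<G>"
proof -
  have vne: "v0 \<noteq> v1" using A.ne_oarc[OF I] .
  obtain x y where xy: "x \<in> tops M v0 v1" "y \<in> tops M v0 v1" "x \<noteq> y" "x \<in> e" "y \<in> e"
    "\<forall>N\<in>L. x \<in> N --> y \<in> N --> v0 \<notin> N --> v1 \<notin> N --> e \<subseteq> N" and eL: "e \<in> L" "v0 \<notin> e" "v1 \<notin> e"
    using e unfolding spanned_def by blast
  have xI: "x \<in> oarc v0 v1" "y \<in> oarc v0 v1" using xy(1,2) unfolding tops_def by auto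
  have ex: "\<not> endp L x" "\<not> endp L y" using xy(1,2) B.endp2 ends_disj unfolding tops_def by blast+
  obtain N where N: "N \<in> L" "x \<in> N" "y \<in> N" "v0 \<notin> N" "v1 \<notin> N"
    "\<forall>N'\<in>L. x \<in> N' --> y \<in> N' --> v0 \<notin> N' --> v1 \<notin> N' --> N \<subseteq> N'"
    "\<exists>\<G>. nlg L \<G> \<and> co N \<in> \<G> \<and> (\<forall>K\<in>\<G>. \<not> (x \<in> K \<and> y \<in> K))"
    using A.least_arc[OF xy(3) ex eL(1) xy(4,5) eL(2,3)] vne by blast
  have eN: "e = N" using bspec[OF xy(6) N(1)] bspec[OF N(6) eL(1)] xy(4,5) eL N(2-5) by auto
  obtain \<G> where G: "nlg L \<G>" "co e \<in> \<G>" using N(7) eN by auto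
  have eI: "e \<subseteq> oarc v0 v1" using bspec[OF xy(6) I] xI by (simp add: cyc_irrefl)
  have "e \<noteq> oarc v0 v1" using nog[OF G(1)] G(2) vne by auto
  then have es: "e \<subset> oarc v0 v1" using eI by auto
  have b: "bd e \<inter> bd (oarc v0 v1) = {}" using leaf_off_vertex[OF G(1) eL(1) es G(2) I] .
  obtain c d where cd: "c \<noteq> d" "e = oarc c d" "oarc c d \<in> L" "co e = oarc d c" "oarc d c \<in> L"
    by (rule A.L_cases[OF eL(1)])
  have ne: "c \<noteq> v0" "c \<noteq> v1" "d \<noteq> v0" "d \<noteq> v1" using b unfolding cd(2) bd_oarc[OF cd(1)] bd_oarc[OF vne] by auto
  have "oarc c d \<subseteq> oarc v0 v1" using eI cd(2) by simp
  then have "cyc v0 c d" "cyc c d v1" "cyc v0 c v1" "cyc v0 d v1" unfolding oarc_subset_iff[OF cd(1)]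
    using ne vne cd(1) unfolding cyc_ang circ_eq_iff by (smt (z3))+
  moreover have "co e \<in> L" using cd(4,5) by simp
  ultimately show thesis using that[OF cd(2,3,1)] G by blast
qed

text \<open>If \<open>f'\<close> contained both points spanning \<open>f\<close>, minimality of
  \<open>f\<close> would give \<open>f \<subseteq> f'\<close>.\<close>

lemma spanned_grows:
  assumes e: "f \<in> spanned L v0 v1 (tops M v0 v1)" "f' \<in> L" "f' \<subset> f"
  shows "\<exists>x\<in>tops M v0 v1. x \<in> f \<and> x \<notin> f'"
proof -
  obtain x y where xy: "x \<in> tops M v0 v1" "y \<in> tops M v0 v1" "x \<noteq> y" "x \<in> f" "y \<in> f"
    "\<forall>N\<in>L. x \<in> N --> y \<in> N --> v0 \<notin> N --> v1 \<notin> N --> f \<subseteq> N" and eL: "f \<in> L" "v0 \<notin> f" "v1 \<notin> f"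
    using e unfolding spanned_def by blast
  have "x \<notin> f' \<or> y \<notin> f'" using bspec[OF xy(6) e(2)] e(3) eL by auto
  then show ?thesis using xy by auto
qed

text \<open>The union of a chain without greatest member is a leaf \<open>c d\<close> of
  \<open>L\<close> whose ends, thanks to the bound \<open>b\<close>, lie strictly between
  \<open>v0\<close> and \<open>v1\<close>. These ends are not end points of \<open>M\<close>, so no
  tops are near them. But by \<open>spanned_grows\<close> every strict enlargement takes in a new
  top, and late ones have to be near \<open>c\<close> or \<open>d\<close>.\<close>

lemma spanned_max:
  assumes I: "oarc v0 v1 \<in> L" and nog: "\<And>\<G>. nlg L \<G> ==> oarc v1 v0 \<notin> \<G>"
    and Y: "Y \<subseteq> spanned L v0 v1 (tops M v0 v1)" "Y \<noteq> {}" and ch: "\<And>a b. a \<in> Y ==> b \<in> Y ==> a \<subseteq> b \<or> b \<subseteq> a"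
    and b: "b \<in> spanned L v0 v1 (tops M v0 v1)" "\<And>a. a \<in> Y ==> a \<subseteq> b"
  shows "\<exists>a\<in>Y. \<forall>a'\<in>Y. a' \<subseteq> a"
proof (rule ccontr)
  assume no: "\<not> ?thesis"
  have up: "\<exists>a'\<in>Y. a \<subset> a'" if a: "a \<in> Y" for a
  proof -
    obtain a' where a': "a' \<in> Y" "\<not> a' \<subseteq> a" using no a by blast
    then have "a \<subset> a'" using ch[OF a a'(1)] by auto
    then show ?thesis using a'(1) by auto
  qed
  have YL: "a \<in> L" "v0 \<notin> a" "v1 \<notin> a" if "a \<in> Y" for a using that Y(1) unfolding spanned_def by auto
  have U: "\<Union>Y \<in> L"
  proof (rule A.sup[of _ v0 v1])
    show "Y \<subseteq> L" using YL(1) by (rule subsetI)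
  qed (use YL(2,3) Y(2) A.ne_oarc[OF I] ch in simp_all)
  obtain c d where cd: "c \<noteq> d" "\<Union>Y = oarc c d" "oarc c d \<in> L" "co (\<Union>Y) = oarc d c" "oarc d c \<in> L"
    by (rule A.L_cases[OF U])
  obtain c' d' where b': "b = oarc c' d'" "c' \<noteq> d'" "cyc v0 c' d'" "cyc c' d' v1" "cyc v0 c' v1" "cyc v0 d' v1"
    by (rule spanned_in[OF I nog b(1)])
  have "oarc c d \<subseteq> oarc c' d'" using Union_least[of Y b, OF b(2)] unfolding cd(2) b'(1) .
  then have cI: "cyc v0 c v1" "cyc v0 d v1"
    unfolding oarc_subset_iff[OF cd(1)] using b' unfolding cyc_ang circ_eq_iff by (smt (z3))+
  have en: "\<not> endp M c" "\<not> endp M d" using ends_disj A.endp1[OF cd(3)] A.endp2[OF cd(3)] by auto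
  obtain p q where p: "cyc p c q" "\<forall>a\<in>tops M v0 v1. \<not> cyc p a q" using tops_isolated[OF I cI(1) en(1)] by (elim exE conjE)
  obtain p' q' where p': "cyc p' d q'" "\<forall>a\<in>tops M v0 v1. \<not> cyc p' a q'" using tops_isolated[OF I cI(2) en(2)] by (elim exE conjE)
  \<comment> \<open>\<open>w1\<close> and \<open>w2\<close> are chosen inside \<open>c d\<close>
    within the top-free neighbourhoods of \<open>c\<close> and \<open>d\<close>. Beyond a member
    containing both there is only room inside these neighbourhoods.\<close>
  have "\<exists>w. cyc c w q \<and> cyc c w d"
  proof (cases "cyc c q d")
    case True
    obtain w where "cyc c w q" by (rule cyc_dense[of c q]) (use True in \<open>auto simp: cyc_ang\<close>)
    then show ?thesis using True unfolding cyc_ang circ_eq_iff by (smt (z3))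
  next
    case False
    obtain w where "cyc c w d" by (rule cyc_dense[OF cd(1)])
    then show ?thesis using False p(1) unfolding cyc_ang circ_eq_iff by (smt (z3))
  qed
  then obtain w1 where w1: "cyc c w1 q" "cyc c w1 d" by auto
  have "\<exists>w. cyc p' w d \<and> cyc c w d"
  proof (cases "cyc c p' d")
    case True
    obtain w where "cyc p' w d" by (rule cyc_dense[of p' d]) (use True in \<open>auto simp: cyc_ang\<close>)
    then show ?thesis using True unfolding cyc_ang circ_eq_iff by (smt (z3))
  next
    case False
    obtain w where "cyc c w d" by (rule cyc_dense[OF cd(1)])
    then show ?thesis using False p'(1) unfolding cyc_ang circ_eq_iff by (smt (z3))
  qed
  then obtain w2 where w2: "cyc p' w2 d" "cyc c w2 d" by auto
  have "w1 \<in> \<Union>Y" "w2 \<in> \<Union>Y" unfolding cd(2) using w1 w2 by auto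
  then obtain f1 f2 where f: "f1 \<in> Y" "w1 \<in> f1" "f2 \<in> Y" "w2 \<in> f2" by auto
  then obtain f where f: "f \<in> Y" "w1 \<in> f" "w2 \<in> f" using ch[OF f(1,3)] by auto
  obtain f' where f': "f' \<in> Y" "f \<subset> f'" using up[OF f(1)] by auto
  obtain x where x: "x \<in> tops M v0 v1" "x \<in> f'" "x \<notin> f"
    using spanned_grows[OF _ YL(1)[OF f(1)] f'(2)] Y(1) f'(1) by blast
  obtain c1 d1 where c1: "c1 \<noteq> d1" "f = oarc c1 d1" using A.oarcs[OF YL(1)[OF f(1)]] by auto
  have "x \<in> oarc c d" using x(2) f'(1) cd(2) by blast
  moreover have "oarc c1 d1 \<subseteq> oarc c d" using f(1) c1(2) cd(2) by blast
  moreover have "cyc c1 w1 d1" "cyc c1 w2 d1" "\<not> cyc c1 x d1" using f(2,3) x(3) c1(2) by auto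
  ultimately have "cyc c x w1 \<or> cyc w2 x d"
    unfolding oarc_subset_iff[OF c1(1)] mem_oarc unfolding cyc_ang circ_eq_iff by (smt (z3))
  then have "cyc p x q \<or> cyc p' x q'" using w1(1) w2(1) p(1) p'(1) unfolding cyc_ang circ_eq_iff by (smt (z3))
  then show False using bspec[OF p(2) x(1)] bspec[OF p'(2) x(1)] by auto
qed

text \<open>The argument of \<open>spanned_max\<close> for complements. The lower bound
  \<open>b\<close> contains two points missed by all complements, so that their union is a side, and
  its complement \<open>c d\<close> is the limit leaf.\<close>

lemma spanned_min:
  assumes I: "oarc v0 v1 \<in> L" and nog: "\<And>\<G>. nlg L \<G> ==> oarc v1 v0 \<notin> \<G>"
    and Y: "Y \<subseteq> spanned L v0 v1 (tops M v0 v1)" "Y \<noteq> {}" and ch: "\<And>a b. a \<in> Y ==> b \<in> Y ==> a \<subseteq> b \<or> b \<subseteq> a"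
    and b: "b \<in> spanned L v0 v1 (tops M v0 v1)" "\<And>a. a \<in> Y ==> b \<subseteq> a"
  shows "\<exists>a\<in>Y. \<forall>a'\<in>Y. a \<subseteq> a'"
proof (rule ccontr)
  assume no: "\<not> ?thesis"
  have dn: "\<exists>a'\<in>Y. a' \<subset> a" if a: "a \<in> Y" for a
  proof -
    obtain a' where a': "a' \<in> Y" "\<not> a \<subseteq> a'" using no a by blast
    then have "a' \<subset> a" using ch[OF a a'(1)] by auto
    then show ?thesis using a'(1) by auto
  qed
  have YL: "a \<in> L" "v0 \<notin> a" "v1 \<notin> a" if "a \<in> Y" for a using that Y(1) unfolding spanned_def by auto
  obtain y1 y2 where y12: "y1 \<noteq> y2" "y1 \<in> b" "y2 \<in> b" using b(1) unfolding spanned_def by blast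
  have U: "\<Union>(co ` Y) \<in> L"
  proof (rule A.sup[of _ y1 y2])
    show "co ` Y \<subseteq> L" "co ` Y \<noteq> {}" using A.co_in[OF YL(1)] Y(2) by auto
    fix P Q assume "P \<in> co ` Y" "Q \<in> co ` Y"
    then obtain P' Q' where PQ: "P = co P'" "Q = co Q'" "P' \<in> Y" "Q' \<in> Y" by auto
    then show "P \<subseteq> Q \<or> Q \<subseteq> P" using ch[OF PQ(3,4)] A.co_anti[of P' Q'] A.co_anti[of Q' P'] YL(1) by auto
  next
    fix P assume "P \<in> co ` Y"
    then obtain P' where P: "P = co P'" "P' \<in> Y" by auto
    then have "P' \<inter> P = {}" "b \<subseteq> P'" using A.co_disj[OF YL(1)] b(2) by auto
    then show "y1 \<notin> P \<and> y2 \<notin> P" using y12 by auto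
  qed (rule y12(1))
  obtain d c where cd: "d \<noteq> c" "\<Union>(co ` Y) = oarc d c" "oarc d c \<in> L" "co (\<Union>(co ` Y)) = oarc c d" "oarc c d \<in> L"
    by (rule A.L_cases[OF U])
  have below: "oarc c d \<subseteq> a" if a: "a \<in> Y" for a
  proof -
    have "co a \<subseteq> \<Union>(co ` Y)" using a by auto
    then have "co (\<Union>(co ` Y)) \<subseteq> co (co a)" using A.co_anti[OF A.co_in[OF YL(1)[OF a]] U] by simp
    then show ?thesis using cd(4) A.co_co[OF YL(1)[OF a]] by simp
  qed
  obtain b0 where b0: "b0 \<in> Y" using Y(2) by auto
  then have b0s: "b0 \<in> spanned L v0 v1 (tops M v0 v1)" using Y(1) by auto
  obtain c' d' where b': "b0 = oarc c' d'" "c' \<noteq> d'" "cyc v0 c' d'" "cyc c' d' v1" "cyc v0 c' v1" "cyc v0 d' v1"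
    by (rule spanned_in[OF I nog b0s])
  have "oarc c d \<subseteq> oarc c' d'" using below[OF b0] b'(1) by simp
  then have cI: "cyc v0 c v1" "cyc v0 d v1"
    unfolding oarc_subset_iff[OF cd(1)[symmetric]] using b' unfolding cyc_ang circ_eq_iff by (smt (z3))+
  have en: "\<not> endp M c" "\<not> endp M d" using ends_disj A.endp1[OF cd(3)] A.endp2[OF cd(3)] by auto
  obtain p q where p: "cyc p c q" "\<forall>a\<in>tops M v0 v1. \<not> cyc p a q" using tops_isolated[OF I cI(1) en(1)] by (elim exE conjE)
  obtain p' q' where p': "cyc p' d q'" "\<forall>a\<in>tops M v0 v1. \<not> cyc p' a q'" using tops_isolated[OF I cI(2) en(2)] by (elim exE conjE)
  have "\<exists>w. cyc p w c \<and> cyc d w c"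
  proof (cases "cyc d p c")
    case True
    obtain w where "cyc p w c" by (rule cyc_dense[of p c]) (use True in \<open>auto simp: cyc_ang\<close>)
    then show ?thesis using True unfolding cyc_ang circ_eq_iff by (smt (z3))
  next
    case False
    obtain w where "cyc d w c" by (rule cyc_dense[OF cd(1)])
    then show ?thesis using False p(1) unfolding cyc_ang circ_eq_iff by (smt (z3))
  qed
  then obtain w1 where w1: "cyc p w1 c" "cyc d w1 c" by auto
  have "\<exists>w. cyc d w q' \<and> cyc d w c"
  proof (cases "cyc d q' c")
    case True
    obtain w where "cyc d w q'" by (rule cyc_dense[of d q']) (use True in \<open>auto simp: cyc_ang\<close>)
    then show ?thesis using True unfolding cyc_ang circ_eq_iff by (smt (z3))
  next
    case False
    obtain w where "cyc d w c" by (rule cyc_dense[OF cd(1)])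
    then show ?thesis using False p'(1) unfolding cyc_ang circ_eq_iff by (smt (z3))
  qed
  then obtain w2 where w2: "cyc d w2 q'" "cyc d w2 c" by auto
  have "w1 \<in> \<Union>(co ` Y)" "w2 \<in> \<Union>(co ` Y)" unfolding cd(2) using w1 w2 by auto
  then obtain f1 f2 where f: "f1 \<in> Y" "w1 \<in> co f1" "f2 \<in> Y" "w2 \<in> co f2" by auto
  then have "co f1 \<subseteq> co f2 \<or> co f2 \<subseteq> co f1" using ch[OF f(1,3)] A.co_anti[OF YL(1)[OF f(1)] YL(1)[OF f(3)]] A.co_anti[OF YL(1)[OF f(3)] YL(1)[OF f(1)]] by auto
  then obtain f where f: "f \<in> Y" "w1 \<in> co f" "w2 \<in> co f" using f by auto
  obtain f' where f': "f' \<in> Y" "f' \<subset> f" using dn[OF f(1)] by auto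
  obtain x where x: "x \<in> tops M v0 v1" "x \<in> f" "x \<notin> f'"
    using spanned_grows[OF _ YL(1)[OF f'(1)] f'(2)] Y(1) f(1) by blast
  obtain c1 d1 where c1: "c1 \<noteq> d1" "f = oarc c1 d1" "oarc c1 d1 \<in> L" "co f = oarc d1 c1" "oarc d1 c1 \<in> L"
    by (rule A.L_cases[OF YL(1)[OF f(1)]])
  have "x \<notin> oarc c d" using x(3) below[OF f'(1)] by auto
  moreover have "oarc c d \<subseteq> oarc c1 d1" using below[OF f(1)] c1(2) by simp
  moreover have "cyc d1 w1 c1" "cyc d1 w2 c1" "cyc c1 x d1" using f(2,3) x(2) c1(2,4) by auto
  ultimately have "x = c \<or> x = d \<or> cyc w1 x c \<or> cyc d x w2"
    unfolding oarc_subset_iff[OF cd(1)[symmetric]] mem_oarc using w1(2) w2(2) unfolding cyc_ang circ_eq_iff by (smt (z3))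
  then have "cyc p x q \<or> cyc p' x q'" using w1(1) w2(1) p(1) p'(1) unfolding cyc_ang circ_eq_iff by (smt (z3))
  then show False using bspec[OF p(2) x(1)] bspec[OF p'(2) x(1)] by auto
qed

lemma spanned_ex:
  assumes I: "oarc v0 v1 \<in> L" and xy: "x \<in> tops M v0 v1" "y \<in> tops M v0 v1" "x \<noteq> y"
  shows "\<exists>e\<in>spanned L v0 v1 (tops M v0 v1). x \<in> e \<and> y \<in> e"
proof -
  have xI: "x \<in> oarc v0 v1" "y \<in> oarc v0 v1" using xy(1,2) unfolding tops_def by auto
  have ex: "endp M x" "endp M y" using xy(1,2) B.endp2 unfolding tops_def by blast+
  have ex': "\<not> endp L x" "\<not> endp L y" using ends_disj[of x] ends_disj[of y] ex by auto
  have vI: "v0 \<notin> oarc v0 v1" "v1 \<notin> oarc v0 v1" by (simp_all add: cyc_irrefl)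
  obtain N where N: "N \<in> L" "x \<in> N" "y \<in> N" "v0 \<notin> N" "v1 \<notin> N"
    "\<forall>N'\<in>L. x \<in> N' --> y \<in> N' --> v0 \<notin> N' --> v1 \<notin> N' --> N \<subseteq> N'"
    using A.least_arc[OF xy(3) ex' I xI vI] A.ne_oarc[OF I] by blast
  have "N \<in> spanned L v0 v1 (tops M v0 v1)" unfolding spanned_def
    using N xy by (intro CollectI conjI bexI[of _ x] bexI[of _ y])
  then show ?thesis using N(2,3) by auto
qed

text \<open>\<open>u\<close> and \<open>w\<close> are the extreme points in the order from
  \<open>v0\<close> to \<open>v1\<close>; an arc that avoids \<open>v0\<close> and \<open>v1\<close>
  and contains the extremes contains the middle point.\<close>

lemma spans_three:
  assumes "a \<noteq> b" "cyc v0 a v1" "cyc v0 b v1" "cyc v0 c v1"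
  shows "\<exists>u w. u \<in> {a, b, c} \<and> w \<in> {a, b, c} \<and> u \<noteq> w \<and>
    (\<forall>p q. \<not> cyc p v0 q --> \<not> cyc p v1 q --> cyc p u q --> cyc p w q --> cyc p a q \<and> cyc p b q \<and> cyc p c q)"
proof -
  have key: "cyc p z q" if "cyc v0 x z" "cyc v0 z y" "cyc v0 y v1" "cyc v0 z v1" "cyc v0 x v1"
    "\<not> cyc p v0 q" "\<not> cyc p v1 q" "cyc p x q" "cyc p y q" for p q x y z
    using that unfolding cyc_ang by (smt (z3))
  have o: "cyc v0 a b \<and> cyc a b v1 \<or> cyc v0 b a \<and> cyc b a v1" using assms unfolding cyc_ang circ_eq_iff by (smt (z3))
  have oc: "c = a \<or> cyc v0 c a \<and> cyc c a v1 \<or> cyc v0 a c \<and> cyc a c v1" "c = b \<or> cyc v0 c b \<and> cyc c b v1 \<or> cyc v0 b c \<and> cyc b c v1"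
    using assms unfolding cyc_ang circ_eq_iff by (smt (z3))+
  have tr: "cyc x y z" if "cyc v0 x y" "cyc v0 y z" for x y z using that unfolding cyc_ang by (smt (z3))
  consider "c = a \<or> c = b" | "cyc v0 a b" "cyc v0 b c" | "cyc v0 a c" "cyc v0 c b" | "cyc v0 c a" "cyc v0 a b"
    | "cyc v0 b a" "cyc v0 a c" | "cyc v0 b c" "cyc v0 c a" | "cyc v0 c b" "cyc v0 b a"
    using o oc by blast
  then show ?thesis
  proof cases
    case 1 then show ?thesis using assms(1) by blast
  next
    case 2 show ?thesis using key[OF 2 assms(4,3,2)] tr[OF 2] by (intro exI[of _ a] exI[of _ c]) (auto simp: cyc_irrefl)
  next
    case 3 show ?thesis using key[OF 3 assms(3,4,2)] tr[OF 3] assms(1) by (intro exI[of _ a] exI[of _ b]) auto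
  next
    case 4 show ?thesis using key[OF 4 assms(3,2,4)] tr[OF 4] by (intro exI[of _ c] exI[of _ b]) (auto simp: cyc_irrefl)
  next
    case 5 show ?thesis using key[OF 5 assms(4,2,3)] tr[OF 5] by (intro exI[of _ b] exI[of _ c]) (auto simp: cyc_irrefl)
  next
    case 6 show ?thesis using key[OF 6 assms(2,4,3)] tr[OF 6] assms(1) by (intro exI[of _ b] exI[of _ a]) auto
  next
    case 7 show ?thesis using key[OF 7 assms(2,3,4)] tr[OF 7] by (intro exI[of _ c] exI[of _ a]) (auto simp: cyc_irrefl)
  qed
qed

text \<open>Two applications of \<open>spans_three\<close> select the extreme ones of the four
  points spanning \<open>e1\<close> and \<open>e2\<close>. The leaf spanned by these contains all
  four, hence both \<open>e1\<close> and \<open>e2\<close>.\<close>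

lemma spanned_directed:
  assumes I: "oarc v0 v1 \<in> L" and e: "e1 \<in> spanned L v0 v1 (tops M v0 v1)" "e2 \<in> spanned L v0 v1 (tops M v0 v1)"
  shows "\<exists>e\<in>spanned L v0 v1 (tops M v0 v1). e1 \<subseteq> e \<and> e2 \<subseteq> e"
proof -
  let ?A = "tops M v0 v1"
  obtain x1 y1 where 1: "x1 \<in> ?A" "y1 \<in> ?A" "x1 \<noteq> y1"
    "\<forall>N\<in>L. x1 \<in> N --> y1 \<in> N --> v0 \<notin> N --> v1 \<notin> N --> e1 \<subseteq> N" using e(1) unfolding spanned_def by blast
  obtain x2 y2 where 2: "x2 \<in> ?A" "y2 \<in> ?A"
    "\<forall>N\<in>L. x2 \<in> N --> y2 \<in> N --> v0 \<notin> N --> v1 \<notin> N --> e2 \<subseteq> N" using e(2) unfolding spanned_def by blast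
  have AI: "cyc v0 x v1" if "x \<in> ?A" for x using that unfolding tops_def by simp
  obtain u w where u: "u \<in> {x1, y1, x2}" "w \<in> {x1, y1, x2}" "u \<noteq> w" "\<And>p q. \<not> cyc p v0 q ==> \<not> cyc p v1 q ==> cyc p u q ==> cyc p w q ==> cyc p x1 q \<and> cyc p y1 q \<and> cyc p x2 q"
    using spans_three[OF 1(3) AI[OF 1(1)] AI[OF 1(2)] AI[OF 2(1)]] by blast
  have uA: "u \<in> ?A" "w \<in> ?A" using u(1,2) 1 2 by auto
  obtain u' w' where u': "u' \<in> {u, w, y2}" "w' \<in> {u, w, y2}" "u' \<noteq> w'" "\<And>p q. \<not> cyc p v0 q ==> \<not> cyc p v1 q ==> cyc p u' q ==> cyc p w' q ==> cyc p u q \<and> cyc p w q \<and> cyc p y2 q"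
    using spans_three[OF u(3) AI[OF uA(1)] AI[OF uA(2)] AI[OF 2(2)]] by blast
  have u'A: "u' \<in> ?A" "w' \<in> ?A" using u'(1,2) uA 2 by auto
  obtain e where e: "e \<in> spanned L v0 v1 ?A" "u' \<in> e" "w' \<in> e" using spanned_ex[OF I u'A u'(3)] by auto
  have eL: "e \<in> L" "v0 \<notin> e" "v1 \<notin> e" using e(1) unfolding spanned_def by auto
  obtain p q where pq: "e = oarc p q" using A.oarcs[OF eL(1)] by auto
  have "cyc p u q \<and> cyc p w q \<and> cyc p y2 q" by (rule u'(4)) (use eL e pq in simp_all)
  moreover from this have "cyc p x1 q \<and> cyc p y1 q \<and> cyc p x2 q" by (intro u(4)) (use eL pq in simp_all)
  ultimately have "x1 \<in> e" "y1 \<in> e" "x2 \<in> e" "y2 \<in> e" unfolding pq by simp_all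
  then have "e1 \<subseteq> e" "e2 \<subseteq> e" using bspec[OF 1(4) eL(1)] bspec[OF 2(3) eL(1)] eL(2,3) by simp_all
  then show ?thesis using e(1) by auto
qed

lemma tops_image:
  assumes g: "auto_on M g" "g v0 = v0" "g v1 = v1" and a: "a \<in> tops M v0 v1" shows "g a \<in> tops M v0 v1"
proof -
  have gc: "cycauto g" using g(1) by (rule auto_on_cyc)
  obtain m where m: "oarc m a \<in> M" "cyc m v0 a" "\<not> cyc m v1 a" and ca: "cyc v0 a v1" using a unfolding tops_def by auto
  have "oarc (g m) (g a) \<in> M" using B.image_in[OF g(1)] m(1) unfolding cycauto_image[OF gc, symmetric] by simp
  moreover have "cyc v0 (g a) v1" "cyc (g m) v0 (g a)" "\<not> cyc (g m) v1 (g a)"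
    using cycauto_cyc[OF gc, of v0 a v1] cycauto_cyc[OF gc, of m v0 a] cycauto_cyc[OF gc, of m v1 a] g(2,3) ca m(2,3) by simp_all
  ultimately show ?thesis unfolding tops_def by auto
qed

lemma spanned_image:
  assumes gL: "auto_on L g" and gM: "auto_on M g" and v: "g v0 = v0" "g v1 = v1"
    and e: "e \<in> spanned L v0 v1 (tops M v0 v1)" shows "g ` e \<in> spanned L v0 v1 (tops M v0 v1)"
proof -
  let ?A = "tops M v0 v1"
  have gc: "cycauto g" using gL by (rule auto_on_cyc)
  obtain x y where xy: "x \<in> ?A" "y \<in> ?A" "x \<noteq> y" "x \<in> e" "y \<in> e"
    "\<forall>N\<in>L. x \<in> N --> y \<in> N --> v0 \<notin> N --> v1 \<notin> N --> e \<subseteq> N" and eL: "e \<in> L" "v0 \<notin> e" "v1 \<notin> e"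
    using e unfolding spanned_def by blast
  have "g ` e \<in> L" using A.image_in[OF gL] eL(1) by simp
  moreover have "v0 \<notin> g ` e" "v1 \<notin> g ` e" using A.fixed_mem[OF gc v(1)] A.fixed_mem[OF gc v(2)] eL by simp_all
  moreover have "g ` e \<subseteq> N" if N: "N \<in> L" "g x \<in> N" "g y \<in> N" "v0 \<notin> N" "v1 \<notin> N" for N
  proof -
    have 1: "inv_into UNIV g ` N \<in> L" using A.image_in[OF auto_on_inv[OF gL]] N(1) by simp
    have "x \<in> inv_into UNIV g ` N" "y \<in> inv_into UNIV g ` N" "v0 \<notin> inv_into UNIV g ` N" "v1 \<notin> inv_into UNIV g ` N"
      unfolding A.mem_inv_image[OF gc] using N v by simp_all
    then have sub: "e \<subseteq> inv_into UNIV g ` N" using bspec[OF xy(6) 1] by simp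
    show ?thesis
    proof (rule image_subsetI)
      fix z assume "z \<in> e"
      then have "z \<in> inv_into UNIV g ` N" by (rule subsetD[OF sub])
      then show "g z \<in> N" unfolding A.mem_inv_image[OF gc] .
    qed
  qed
  moreover have "g x \<in> ?A" "g y \<in> ?A" using tops_image[OF gM v] xy(1,2) by simp_all
  moreover have "g x \<noteq> g y" using cycauto_eq[OF gc] xy(3) by simp
  moreover have "g x \<in> g ` e" "g y \<in> g ` e" using xy by simp_all
  ultimately show ?thesis unfolding spanned_def by (intro CollectI conjI bexI[of _ "g x"] bexI[of _ "g y"]) simp_all
qed

text \<open>Two different tops are needed. One comes from any crossing leaf, the other from a small
  leaf around \<open>v1\<close>, whose complement is a crossing side; if the two coincide, a leaf
  still closer to \<open>v1\<close> gives another.\<close>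

lemma spanned_nonempty:
  assumes gL: "auto_on L g" and gM: "auto_on M g" and g: "g \<noteq> id"
    and I: "oarc v0 v1 \<in> L" "g v0 = v0" "g v1 = v1"
  shows "\<exists>e. e \<in> spanned L v0 v1 (tops M v0 v1)"
proof -
  have vne: "v0 \<noteq> v1" using A.ne_oarc[OF I(1)] .
  have e: "\<not> endp M v0" "\<not> endp M v1" using ends_disj A.endp1[OF I(1)] A.endp2[OF I(1)] by auto
  have top: "b \<in> tops M v0 v1" if mb: "oarc m b \<in> M" "cyc m v0 b" "\<not> cyc m v1 b" for m b
  proof -
    have "v1 \<noteq> m" "v1 \<noteq> b" using e(2) B.endp1[OF mb(1)] B.endp2[OF mb(1)] by auto
    then have "cyc v0 b v1" using mb(2,3) vne unfolding cyc_ang circ_eq_iff by (smt (z3))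
    then show ?thesis unfolding tops_def using mb by auto
  qed
  obtain N where N: "N \<in> M" "v0 \<in> N" "v1 \<notin> N" using crossing_exists[OF I(1)] by auto
  obtain m a where ma: "m \<noteq> a" "N = oarc m a" using B.oarcs[OF N(1)] by auto
  have a: "a \<in> tops M v0 v1" by (rule top[of m]) (use N ma in simp_all)
  have "finite {v0, a}" "v1 \<notin> {v0, a}" using a vne by (auto simp: tops_def cyc_irrefl)
  then obtain N' where N': "N' \<in> M" "v1 \<in> N'" "N' \<inter> {v0, a} = {}" using rainbow[OF gL gM g I] by blast
  obtain b m' where b: "b \<noteq> m'" "N' = oarc b m'" "oarc b m' \<in> M" "co N' = oarc m' b" "oarc m' b \<in> M"
    by (rule B.L_cases[OF N'(1)])
  have bm: "cyc b v1 m'" "\<not> cyc b v0 m'" "\<not> cyc b a m'" using N'(2,3) b(2) by auto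
  have "v0 \<noteq> b" "v0 \<noteq> m'" using e(1) B.endp1[OF b(3)] B.endp2[OF b(3)] by auto
  then have "cyc m' v0 b" "\<not> cyc m' v1 b" using bm b(1) unfolding cyc_ang circ_eq_iff by (smt (z3))+
  then have bt: "b \<in> tops M v0 v1" by (rule top[OF b(5)])
  show ?thesis
  proof (cases "a = b")
    case False
    then show ?thesis using spanned_ex[OF I(1) a bt] by auto
  next
    case True
    obtain w where w: "cyc b w v1" by (rule cyc_dense[of b v1]) (use bm(1) in \<open>auto simp: cyc_ang\<close>)
    have "finite {v0, w}" "v1 \<notin> {v0, w}" using w vne by (auto simp: cyc_ang)
    then obtain N2 where N2: "N2 \<in> M" "v1 \<in> N2" "N2 \<inter> {v0, w} = {}" using rainbow[OF gL gM g I] by blast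
    obtain b2 m2 where b2: "b2 \<noteq> m2" "N2 = oarc b2 m2" "oarc b2 m2 \<in> M" "co N2 = oarc m2 b2" "oarc m2 b2 \<in> M"
      by (rule B.L_cases[OF N2(1)])
    have bm2: "cyc b2 v1 m2" "\<not> cyc b2 v0 m2" "\<not> cyc b2 w m2" using N2(2,3) b2(2) by auto
    have ne2: "v0 \<noteq> b2" "v0 \<noteq> m2" using e(1) B.endp1[OF b2(3)] B.endp2[OF b2(3)] by auto
    then have "cyc m2 v0 b2" "\<not> cyc m2 v1 b2" using bm2 b2(1) unfolding cyc_ang circ_eq_iff by (smt (z3))+
    then have "b2 \<in> tops M v0 v1" by (rule top[OF b2(5)])
    moreover have "cyc v0 b v1" using bt unfolding tops_def by simp
    then have "b2 \<noteq> b" using bm2 w ne2 unfolding cyc_ang circ_eq_iff by (smt (z3))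
    ultimately show ?thesis using spanned_ex[OF I(1) bt] by auto
  qed
qed

text \<open>An element with translation number zero fixes a spanned leaf. This leaf and
  \<open>v0 v1\<close> have no common end point, and the leaf of \<open>M\<close> that ends at a top
  inside the spanned leaf crosses both, so rigidity gives the identity.\<close>

lemma translation_number_aux:
  assumes I: "oarc v0 v1 \<in> L" and nog: "\<And>\<G>. nlg L \<G> ==> oarc v1 v0 \<notin> \<G>"
    and h: "auto_on L h" "auto_on M h" "h \<noteq> id" "h v0 = v0" "h v1 = v1"
    and K: "K = {g. auto_on L g \<and> auto_on M g \<and> g v0 = v0 \<and> g v1 = v1}"
  shows "\<exists>s :: (circ \<Rightarrow> circ) \<Rightarrow> int. (\<forall>f\<in>K. \<forall>g\<in>K. s (f \<circ> g) = s f + s g) \<and> (\<forall>g\<in>K. s g = 0 --> g = id)"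
proof -
  let ?D = "spanned L v0 v1 (tops M v0 v1)"
  have vne: "v0 \<noteq> v1" using A.ne_oarc[OF I] .
  have e: "\<not> endp M v1" using ends_disj A.endp2[OF I] by auto
  obtain e0 where e0: "e0 \<in> ?D" using spanned_nonempty[OF h(1-3) I h(4,5)] by auto
  have DL: "a \<in> L" "v0 \<notin> a" "v1 \<notin> a" if "a \<in> ?D" for a using that unfolding spanned_def by auto
  have ch: "a \<subseteq> b \<or> b \<subseteq> a" if abc: "a \<in> ?D" "b \<in> ?D" "c \<in> ?D" "c \<subseteq> a" "c \<subseteq> b" for a b c
  proof -
    obtain x where x: "x \<in> c" using A.in_ne[OF DL(1)[OF abc(3)]] by auto
    then have "x \<in> a" "x \<in> b" using abc(4,5) by auto
    then show ?thesis by (rule A.nested[OF DL(1)[OF abc(1)] DL(1)[OF abc(2)] _ _ DL(2)[OF abc(1)] DL(2)[OF abc(2)] DL(3)[OF abc(1)] DL(3)[OF abc(2)] vne])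
  qed
  have fin: "finite {f \<in> ?D. a \<subseteq> f \<and> f \<subseteq> b}" if ab: "a \<in> ?D" "b \<in> ?D" for a b
  proof (rule finite_chain_if_wf_both)
    let ?Xs = "{f \<in> ?D. a \<subseteq> f \<and> f \<subseteq> b}"
    show c: "A \<subseteq> B \<or> B \<subseteq> A" if "A \<in> ?Xs" "B \<in> ?Xs" for A B using ch[of A B a] that ab by simp
    fix Y assume Y: "Y \<subseteq> ?Xs" "Y \<noteq> {}"
    have cY: "A \<subseteq> B \<or> B \<subseteq> A" if "A \<in> Y" "B \<in> Y" for A B using c[OF subsetD[OF Y(1) that(1)] subsetD[OF Y(1) that(2)]] .
    have YD: "Y \<subseteq> ?D" using Y(1) by auto
    show "\<exists>A\<in>Y. \<forall>B\<in>Y. B \<subseteq> A" by (rule spanned_max[OF I nog YD Y(2) cY ab(2)]) (use Y(1) in auto)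
    show "\<exists>A\<in>Y. \<forall>B\<in>Y. A \<subseteq> B" by (rule spanned_min[OF I nog YD Y(2) cY ab(1)]) (use Y(1) in auto)
  qed
  have bij: "bij g" if "g \<in> K" for g using that unfolding K auto_on_def cycauto_def by simp
  have KD: "g ` a \<in> ?D \<longleftrightarrow> a \<in> ?D" if g: "g \<in> K" for g a
  proof
    have g': "auto_on L g" "auto_on M g" "g v0 = v0" "g v1 = v1" using g unfolding K by auto
    show "a \<in> ?D ==> g ` a \<in> ?D" by (rule spanned_image[OF g'])
    have gc: "cycauto g" using g'(1) by (rule auto_on_cyc)
    assume "g ` a \<in> ?D"
    then have "inv_into UNIV g ` g ` a \<in> ?D"
      by (rule spanned_image[OF auto_on_inv[OF g'(1)] auto_on_inv[OF g'(2)] A.fixed_inv[OF gc g'(3)] A.fixed_inv[OF gc g'(4)]])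
    moreover have "inv_into UNIV g ` g ` a = a" by (simp add: image_image cycauto_inv(3)[OF gc])
    ultimately show "a \<in> ?D" by simp
  qed
  obtain s :: "(circ \<Rightarrow> circ) \<Rightarrow> int" where s: "\<forall>f\<in>K. \<forall>g\<in>K. f \<circ> g \<in> K --> s (f \<circ> g) = s f + s g"
    "\<forall>g\<in>K. s g = 0 --> (\<exists>e\<in>?D. g ` e = e)"
    using translation_hom[of e0 ?D K, OF e0 spanned_directed[OF I] ch[OF _ _ e0] fin bij KD] by auto
  have "f \<circ> g \<in> K" if "f \<in> K" "g \<in> K" for f g using that auto_on_comp unfolding K by auto
  then have "\<forall>f\<in>K. \<forall>g\<in>K. s (f \<circ> g) = s f + s g" using s(1) by blast
  moreover have "g = id" if g: "g \<in> K" "s g = 0" for g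
  proof -
    have g': "auto_on L g" "auto_on M g" "g v0 = v0" "g v1 = v1" using g unfolding K by auto
    have gc: "cycauto g" using g'(1) by (rule auto_on_cyc)
    obtain a where a: "a \<in> ?D" "g ` a = a" using s(2) g by auto
    obtain c d where cd: "a = oarc c d" "c \<noteq> d" "cyc v0 c d" "cyc c d v1" "cyc v0 c v1" "cyc v0 d v1"
      by (rule spanned_in[OF I nog a(1)])
    obtain x where x: "x \<in> tops M v0 v1" "x \<in> a" using a(1) unfolding spanned_def by blast
    obtain m where m: "oarc m x \<in> M" "cyc m v0 x" "\<not> cyc m v1 x" and xI: "cyc v0 x v1" using x(1) unfolding tops_def by auto
    have "m \<noteq> v1" using e B.endp1[OF m(1)] by auto
    then have mI: "\<not> cyc v0 m v1" using m(2,3) xI unfolding cyc_ang circ_eq_iff by (smt (z3))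
    then have ma: "\<not> cyc c m d" using cd unfolding cyc_ang by (smt (z3))
    have gI: "g ` oarc v0 v1 = oarc v0 v1" by (simp add: cycauto_image[OF gc] g')
    have bdd: "bd (oarc v0 v1) \<inter> bd (oarc c d) = {}" unfolding bd_oarc[OF vne] bd_oarc[OF cd(2)]
      using cd by (auto simp: cyc_irrefl)
    have "rig L M g (oarc v0 v1)" unfolding rig_def
      using I gI bdd DL(1)[OF a(1)] a(2) B.dual[OF m(1)] xI x(2) mI ma unfolding cd(1)
      by (intro conjI bexI[of _ "oarc c d"] exI[of _ x] exI[of _ m]) simp_all
    then show ?thesis using rig_id[OF g'(1,2)] by simp
  qed
  ultimately show ?thesis by (intro exI[of _ s] conjI ballI impI) simp_all
qed

text \<open>The spanned leaves are studied on a side of the leaf without a bordering non-leaf gap.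
  By looseness at least one side is of this kind, so the end points are exchanged if necessary. If
  only the identity fixes both end points, the zero function serves.\<close>

lemma translation_number:
  assumes I: "oarc v0 v1 \<in> L"
  shows "\<exists>s :: (circ \<Rightarrow> circ) \<Rightarrow> int.
    (\<forall>f g. auto_on L f --> auto_on M f --> auto_on L g --> auto_on M g -->
      f v0 = v0 --> f v1 = v1 --> g v0 = v0 --> g v1 = v1 --> s (f \<circ> g) = s f + s g) \<and>
    (\<forall>g. auto_on L g --> auto_on M g --> g v0 = v0 --> g v1 = v1 --> s g = 0 --> g = id)"
proof -
  define K where "K = {g. auto_on L g \<and> auto_on M g \<and> g v0 = v0 \<and> g v1 = v1}"
  have K': "K = {g. auto_on L g \<and> auto_on M g \<and> g v1 = v1 \<and> g v0 = v0}" unfolding K_def by auto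
  have "\<exists>s :: (circ \<Rightarrow> circ) \<Rightarrow> int. (\<forall>f\<in>K. \<forall>g\<in>K. s (f \<circ> g) = s f + s g) \<and> (\<forall>g\<in>K. s g = 0 --> g = id)"
  proof (cases "\<exists>h\<in>K. h \<noteq> id")
    case False
    then have "\<forall>f\<in>K. f = id" by auto
    then show ?thesis by (intro exI[of _ "\<lambda>_. 0"]) simp
  next
    case True
    then obtain h where h: "auto_on L h" "auto_on M h" "h \<noteq> id" "h v0 = v0" "h v1 = v1" unfolding K_def by auto
    show ?thesis
    proof (cases "\<exists>\<G>. nlg L \<G> \<and> oarc v1 v0 \<in> \<G>")
      case False
      then show ?thesis by (intro translation_number_aux[OF I _ h K_def]) blast
    next
      case True
      then obtain \<G> where G: "nlg L \<G>" "oarc v1 v0 \<in> \<G>" by auto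
      have "oarc v0 v1 \<notin> \<H>" if H: "nlg L \<H>" for \<H>
      proof
        assume H': "oarc v0 v1 \<in> \<H>"
        have "v0 \<in> verts \<G>" "v0 \<in> verts \<H>"
          using A.gap_verts(2)[OF A.nlg_gap[OF G(1)] G(2)] A.gap_verts(1)[OF A.nlg_gap[OF H] H'] by simp_all
        then have "\<G> = \<H>" using A.loose[OF G(1) H] by simp
        moreover have "co (oarc v0 v1) = oarc v1 v0" using A.ne_oarc[OF I] by simp
        ultimately show False using A.leaf_gapI[OF A.nlg_gap[OF H] H'] H G(2) by simp
      qed
      then show ?thesis by (rule translation_number_aux[OF A.dual[OF I] _ h(1-3) h(5,4) K'])
    qed
  qed
  then show ?thesis unfolding K_def by auto
qed

end

section \<open>Stabilizers of gaps\<close>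

lemma period_dvd:
  fixes v :: "int \<Rightarrow> 'a" and n :: int
  assumes n: "0 < n" and i: "inj_on v {0..<n}" and p: "\<And>k. v (k + n) = v k"
  shows "v i = v j \<longleftrightarrow> n dvd (j - i)"
proof -
  have up: "v (k + int m * n) = v k" for k m
  proof (induction m)
    case (Suc m)
    have "k + int (Suc m) * n = (k + int m * n) + n" by (simp add: algebra_simps)
    then show ?case using p[of "k + int m * n"] Suc by metis
  qed simp
  have per: "v (k + m * n) = v k" for k m
  proof (cases "0 \<le> m")
    case True then show ?thesis using up[of k "nat m"] by simp
  next
    case False then show ?thesis using up[of "k + m * n" "nat (- m)"] by simp
  qed
  have r: "v k = v (k mod n)" for k using per[of "k mod n" "k div n"] by (simp add: add.commute)
  have "v i = v j \<longleftrightarrow> i mod n = j mod n"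
    using inj_on_eq_iff[OF i, of "i mod n" "j mod n"] n r[of i] r[of j] by simp
  then show ?thesis by (metis mod_eq_dvd_iff)
qed

text \<open>Cut at the fixed point, \<open>f\<close> is monotone, so the orbit of a moved point
  never returns to it.\<close>

lemma cycauto_fixed_periodic:
  assumes f: "cycauto f" and x: "f x = x" and w: "(f ^^ n) w = w" "0 < n" shows "f w = w"
proof (rule ccontr)
  assume fw: "f w \<noteq> w"
  then have "x \<noteq> w" using x by auto
  moreover have "f w \<noteq> x" using cycauto_eq[OF f, of w x] x \<open>x \<noteq> w\<close> by simp
  ultimately have or: "cyc x w (f w) \<or> cyc x (f w) w" using fw unfolding cyc_ang circ_eq_iff by (smt (z3))
  have "cyc x w ((f ^^ Suc m) w) \<or> cyc x ((f ^^ Suc m) w) w" for m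
  proof -
    have "(cyc x w (f w) --> cyc x w ((f ^^ Suc m) w)) \<and> (cyc x (f w) w --> cyc x ((f ^^ Suc m) w) w)"
    proof (induction m)
      case (Suc m)
      have "cyc x (f w) (f ((f ^^ Suc m) w)) \<longleftrightarrow> cyc x w ((f ^^ Suc m) w)"
        "cyc x (f ((f ^^ Suc m) w)) (f w) \<longleftrightarrow> cyc x ((f ^^ Suc m) w) w"
        using cycauto_cyc[OF f, of x w "(f ^^ Suc m) w"] cycauto_cyc[OF f, of x "(f ^^ Suc m) w" w] x by simp_all
      moreover have "(f ^^ Suc (Suc m)) w = f ((f ^^ Suc m) w)" by simp
      moreover have "cyc x w (f w) ==> cyc x (f w) z ==> cyc x w z" "cyc x (f w) w ==> cyc x z (f w) ==> cyc x z w" for z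
        unfolding cyc_ang by (smt (z3))+
      ultimately show ?case using Suc by metis
    qed simp
    then show ?thesis using or by auto
  qed
  from this[of "n - 1"] show False using w by (simp add: cyc_ang)
qed

context qlam
begin

text \<open>\<open>n = 0\<close> encodes a crown: divisibility by zero is equality, so the
  coincidences of the enumeration are described by one formula for both kinds of gaps.\<close>

lemma gseq_period:
  assumes G: "isgap L \<G>" and v: "gseq \<G> v"
  shows "\<exists>n\<ge>0. (\<forall>i j. v i = v j \<longleftrightarrow> n dvd (j - i)) \<and> (n = 0 \<longleftrightarrow> infinite (verts \<G>)) \<and>
    (n = 0 --> (\<exists>p. verts \<G> = insert p (range v) \<and> pivot \<G> p))"
proof -
  have "(\<exists>n\<ge>2. verts \<G> = range v \<and> inj_on v {0..<n} \<and> (\<forall>k. v (k + n) = v k)) \<or>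
     (\<exists>p. verts \<G> = insert p (range v) \<and> p \<notin> range v \<and> inj v \<and> pivot \<G> p)"
    using v unfolding gseq_def by (elim conjE)
  then show ?thesis
  proof (elim disjE exE conjE)
    fix n :: int assume n: "2 \<le> n" "verts \<G> = range v" "inj_on v {0..<n}" "\<forall>k. v (k + n) = v k"
    have d: "v i = v j \<longleftrightarrow> n dvd (j - i)" for i j by (rule period_dvd) (use n in simp_all)
    have "v k \<in> v ` {0..<n}" for k
    proof -
      have "v (k mod n) = v k" using d[of "k mod n" k] by (simp add: minus_mod_eq_mult_div)
      moreover have "k mod n \<in> {0..<n}" using n(1) by simp
      ultimately show ?thesis by (metis imageI)
    qed
    then have "range v \<subseteq> v ` {0..<n}" by auto
    then have "finite (verts \<G>)" unfolding n(2) by (rule finite_subset) simp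
    then show ?thesis using n(1) d by (intro exI[of _ n]) simp
  next
    fix p assume p: "verts \<G> = insert p (range v)" "inj v" "pivot \<G> p"
    have "infinite (verts \<G>)" unfolding p(1) using range_inj_infinite[OF inj_compose[OF p(2) inj_of_nat]]
      by (metis finite_insert finite_subset image_comp image_mono subset_UNIV)
    moreover have "v i = v j \<longleftrightarrow> (0::int) dvd (j - i)" for i j using inj_eq[OF p(2), of i j] by auto
    ultimately show ?thesis using p by (intro exI[of _ 0]) auto
  qed
qed

text \<open>A power of \<open>f\<close> fixes every vertex of a polygon; with a fixed point present,
  \<open>cycauto_fixed_periodic\<close> makes \<open>f\<close> itself fix them.\<close>

lemma polygon_fixed:
  assumes f: "auto_on L f" and G: "isgap L \<G>" "finite (verts \<G>)" and st: "(`) f ` \<G> = \<G>" and v: "gseq \<G> v"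
    and x: "f x = x"
  shows "f (v k) = v k"
proof -
  obtain n where n: "n \<ge> 0" "\<And>i j. v i = v j \<longleftrightarrow> n dvd (j - i)" "n \<noteq> 0" using gseq_period[OF G(1) v] G(2) by auto
  obtain r where r: "\<And>k. f (v k) = v (k + r)" using gap_maps_seq[OF f G(1) st v] by auto
  have p: "(f ^^ m) (v k) = v (k + int m * r)" for m
  proof (induction m)
    case (Suc m) then show ?case using r by (simp add: algebra_simps)
  qed simp
  show ?thesis
  proof (rule cycauto_fixed_periodic[OF auto_on_cyc[OF f] x])
    show "(f ^^ nat n) (v k) = v k" unfolding p n(2) using n(1) by simp
    show "0 < nat n" using n by simp
  qed
qed

text \<open>A shifted vertex is not fixed, and an element containing a fixed point would be mapped
  to itself, so its end points would not be shifted. Only the pivot remains; this makes shifting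
  automorphisms of a crown parabolic.\<close>

lemma crown_fixed:
  assumes f: "auto_on L f" and G: "isgap L \<G>" "pivot \<G> p" and v: "gseq \<G> v" "inj v"
    and r: "\<And>k. f (v k) = v (k + r)" "r \<noteq> 0" and x: "f x = x"
  shows "x = p"
proof (rule ccontr)
  assume xp: "x \<noteq> p"
  have fc: "cycauto f" using f by (rule auto_on_cyc)
  have nv: "x \<noteq> v k" for k using r(1)[of k] x inj_eq[OF v(2), of "k + r" k] r(2) by auto
  have "x \<notin> verts \<G>"
  proof
    assume "x \<in> verts \<G>"
    then have "pivot \<G> x" using gseq_vert[OF v(1)] nv by auto
    then show False using pivot_unique[OF G] xp by simp
  qed
  then obtain a b where ab: "oarc a b \<in> \<G>" "cyc a x b" using verts_cases[OF G(1)] by metis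
  obtain k where k: "a = v k" "b = v (k + 1)" using gseq_cases[OF G(1) v(1) ab(1)] by auto
  have kk: "k + 1 + r = (k + r) + 1" by simp
  have fx: "cyc (v (k + r)) x (v ((k + r) + 1))" using cycauto_cyc[OF fc, of a x b] ab(2) unfolding k r(1) x kk by simp
  have "oarc (v (k + r)) (v ((k + r) + 1)) = oarc a b"
    by (rule gap_disj[OF G(1) gseq_el[OF v(1)] ab(1), of x]) (use fx ab(2) in simp_all)
  then have "oarc a b = oarc (v (k + r)) (v ((k + r) + 1))" by (rule HOL.sym)
  then have "v (k + r) = v k" unfolding oarc_eq_iff[OF ne_oarc[OF gap_in[OF G(1) ab(1)]]] using k by simp
  then show False using inj_eq[OF v(2), of "k + r" k] r(2) by simp
qed

end

context pf
begin

lemma attr_all: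
  assumes gL: "auto_on L g" and gM: "auto_on M g" and g: "g \<noteq> id"
    and G: "isgap L \<G>" and v: "gseq \<G> v" "\<And>k. g (v k) = v k" and a: "attr M g (v 0)"
  shows "attr M g (v k)"
proof (rule int_induct_both[where P = "\<lambda>k. attr M g (v k)", OF a])
  have el: "oarc (v k) (v (k + 1)) \<in> L" for k using A.gap_in[OF G A.gseq_el[OF v(1)]] .
  show "attr M g (v (k + 1))" if "attr M g (v k)" for k
    using attr_other_end[OF gL gM g A.dual[OF el] v(2,2) that] .
  show "attr M g (v k)" if "attr M g (v (k + 1))" for k
    using attr_other_end[OF gL gM g el v(2,2) that] .
qed

text \<open>Attraction spreads along the whole gap by \<open>attr_other_end\<close>, whereas
  conjugation by \<open>f\<close> carries it from \<open>v 0\<close> to another vertex of the same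
  gap. An inverting \<open>f\<close> would make that vertex attracting for \<open>g\<close> and for
  its inverse.\<close>

lemma no_inversion:
  assumes gL: "auto_on L g" and gM: "auto_on M g" and g: "g \<noteq> id"
    and G: "isgap L \<G>" and v: "gseq \<G> v" "\<And>k. g (v k) = v k"
    and f: "auto_on L f" "auto_on M f" "(`) f ` \<G> = \<G>" and cj: "f \<circ> g \<circ> inv_into UNIV f = inv_into UNIV g"
  shows False
proof -
  have gc: "cycauto g" using gL by (rule auto_on_cyc)
  have el: "oarc (v (- 1)) (v 0) \<in> L" using A.gap_in[OF G A.gseq_el[OF v(1)], of "- 1"] by simp
  have ii: "inv_into UNIV (inv_into UNIV g) = g" using gc unfolding cycauto_def by (simp add: inv_inv_eq)
  have inj: "f \<circ> inv_into UNIV g \<circ> inv_into UNIV f = g"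
  proof -
    have fc: "cycauto f" using f(1) by (rule auto_on_cyc)
    have "bij f" "bij g" "bij (inv_into UNIV f)" using fc gc cycauto_inv(1)[OF fc] unfolding cycauto_def by auto
    then have "inv_into UNIV (f \<circ> g \<circ> inv_into UNIV f) = f \<circ> inv_into UNIV g \<circ> inv_into UNIV f" by (simp add: o_inv_distrib bij_comp inv_inv_eq o_assoc)
    then show ?thesis unfolding cj ii by simp
  qed
  \<comment> \<open>\<open>h\<close> is whichever of \<open>g\<close> and its inverse attracts at
    \<open>v 0\<close>; conjugation by \<open>f\<close> inverts either of them.\<close>
  have main: False if h: "h = g \<or> h = inv_into UNIV g" and a: "attr M h (v 0)" and fh: "f \<circ> h \<circ> inv_into UNIV f = inv_into UNIV h" for h
  proof -
    have hh: "auto_on L h" "auto_on M h" "\<And>k. h (v k) = v k"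
      using h gL gM v(2) auto_on_inv A.fixed_inv[OF gc] by auto
    have hid: "h \<noteq> id" using h g ii by auto
    obtain r where r: "f (v 0) = v r" using A.gap_maps_seq[OF f(1) G f(3) v(1)] by auto
    have 1: "attr M (inv_into UNIV h) (v r)" using B.attr_conj[OF f(2) a] unfolding fh r .
    have 2: "attr M h (v r)" by (rule attr_all[OF hh(1,2) hid G v(1) hh(3) a])
    have elr: "oarc (v (r - 1)) (v r) \<in> L" using A.gap_in[OF G A.gseq_el[OF v(1)], of "r - 1"] by simp
    show False by (rule B.attr_exclusive[OF rainbow[OF hh(1,2) hid elr hh(3,3)] auto_on_cyc[OF hh(1)] 2 1])
  qed
  show False using attr_or[OF gL gM g el v(2,2)] main[of g] main[of "inv_into UNIV g"] cj inj ii by auto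
qed

text \<open>For a leaf the pair may consist of gaps other than the given one, hence
  \<open>\<G>'\<close>. It is built from leaves fixed by \<open>g\<close>, which is why its
  stability is asserted for maps commuting with \<open>g\<close>.\<close>

lemma interleaving_stab:
  assumes gL: "auto_on L g" and gM: "auto_on M g" and g: "g \<noteq> id"
    and G: "isgap L \<G>" and v: "gseq \<G> v" "\<And>k. g (v k) = v k"
  shows "\<exists>\<G>' \<H>. isgap L \<G>' \<and> isgap M \<H> \<and> inter \<G>' \<H> \<and>
    (\<forall>f. auto_on L f --> auto_on M f --> (`) f ` \<G> = \<G> --> f \<circ> g = g \<circ> f --> (`) f ` \<G>' = \<G>' \<and> (`) f ` \<H> = \<H>)"
proof (cases "nlg L \<G>")
  case True
  have "g w = w" if "w \<in> verts \<G>" for w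
    using A.nlg_fix(2)[OF gL True A.gseq_el[OF v(1), of 0] _ that] v(2) by simp
  then obtain \<H> where H: "isgap M \<H>" "inter \<G> \<H>"
    "\<forall>f. auto_on L f --> auto_on M f --> (`) f ` \<G> = \<G> --> (`) f ` \<H> = \<H>"
    using interleaving_nonleaf[OF gL gM g True] by blast
  show ?thesis using G H by (intro exI[of _ \<G>] exI[of _ \<H>]) simp
next
  case False
  then obtain I where I: "I \<in> L" "\<G> = {I, co I}" using G unfolding nlg_def by auto
  obtain a b where ab: "a \<noteq> b" "I = oarc a b" "oarc a b \<in> L" "co I = oarc b a" "oarc b a \<in> L"
    by (rule A.L_cases[OF I(1)])
  have GG: "\<G> = {oarc a b, oarc b a}" using I(2) ab(2,4) by simp
  obtain k where k: "a = v k" "b = v (k + 1)" using A.gseq_cases[OF G v(1), of a b] GG by auto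
  have "g a = a" "g b = b" unfolding k v(2) by simp_all
  from interleaving_leaf[OF gL gM g ab(3) this] show ?thesis unfolding GG .
qed

end

section \<open>Generators of the stabilizer\<close>

text \<open>The group is abstract and acts on angles through \<open>\<phi>\<close>, because the
  group elements of the final statement are functions on the complex numbers.\<close>

locale stab = pf + S: group S for S (structure) +
  fixes \<phi> :: "'a \<Rightarrow> circ \<Rightarrow> circ" and \<G> :: "circ set set" and v :: "int \<Rightarrow> circ"
  assumes aL: "f \<in> carrier S ==> auto_on L (\<phi> f)" and aM: "f \<in> carrier S ==> auto_on M (\<phi> f)"
    and G: "isgap L \<G>" and st: "f \<in> carrier S ==> (`) (\<phi> f) ` \<G> = \<G>"
    and hom: "f \<in> carrier S ==> g \<in> carrier S ==> \<phi> (f \<otimes> g) = \<phi> f \<circ> \<phi> g"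
    and faithful: "f \<in> carrier S ==> \<phi> f = id ==> f = \<one>"
    and v: "gseq \<G> v" and nontrivial: "carrier S \<noteq> {\<one>}"
begin

lemma cyc_phi: "f \<in> carrier S ==> cycauto (\<phi> f)"
  using aL auto_on_cyc by blast

lemma phi_one: "\<phi> \<one> = id"
proof
  fix c
  have "\<phi> \<one> (\<phi> \<one> c) = \<phi> \<one> c" using hom[of \<one> \<one>] by (simp add: fun_eq_iff)
  then show "\<phi> \<one> c = id c" using cycauto_eq[OF cyc_phi[OF S.one_closed]] by simp
qed

lemma phi_inv: assumes f: "f \<in> carrier S" shows "\<phi> (inv f) = inv_into UNIV (\<phi> f)"
proof
  fix c
  have "\<phi> f (\<phi> (inv f) c) = c" using hom[OF f S.inv_closed[OF f]] f phi_one by (simp add: fun_eq_iff)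
  then show "\<phi> (inv f) c = inv_into UNIV (\<phi> f) c" using cycauto_inv(3)[OF cyc_phi[OF f], of "\<phi> (inv f) c"] by simp
qed

definition shifts :: "'a \<Rightarrow> int \<Rightarrow> bool" where
  "shifts f r \<longleftrightarrow> (\<forall>k. \<phi> f (v k) = v (k + r))"

lemma basis:
  obtains x y and n d :: int where "x \<in> carrier S" "y \<in> carrier S" "x \<otimes> y = y \<otimes> x" "0 \<le> d" "shifts x d" "shifts y 0"
    "\<And>f. f \<in> carrier S ==> \<exists>a b. f = x [^] (a::int) \<otimes> y [^] (b::int)"
    "\<And>b::int. y [^] b = \<one> ==> y \<noteq> \<one> ==> b = 0"
    "\<And>f r. f \<in> carrier S ==> shifts f r ==> d dvd r"
    "\<And>h. h \<in> carrier S ==> shifts h 0 ==> \<exists>b::int. h = y [^] b"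
    "\<And>a::int. shifts (x [^] a) (a * d)"
    "0 \<le> n" "\<And>i j. v i = v j \<longleftrightarrow> n dvd (j - i)" "n = 0 \<longleftrightarrow> infinite (verts \<G>)"
    "\<And>f r t. f \<in> carrier S ==> shifts f r ==> shifts f t \<longleftrightarrow> n dvd (t - r)"
proof -
  obtain n where n: "0 \<le> n" "\<And>i j. v i = v j \<longleftrightarrow> n dvd (j - i)" "n = 0 \<longleftrightarrow> infinite (verts \<G>)"
    using A.gseq_period[OF G v] by blast
  have el: "oarc (v 0) (v 1) \<in> L" using A.gap_in[OF G A.gseq_el[OF v], of 0] by simp
  obtain s :: "(circ \<Rightarrow> circ) \<Rightarrow> int" where s: "\<forall>f g. auto_on L f --> auto_on M f --> auto_on L g --> auto_on M g -->
      f (v 0) = v 0 --> f (v 1) = v 1 --> g (v 0) = v 0 --> g (v 1) = v 1 --> s (f \<circ> g) = s f + s g"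
    "\<forall>g. auto_on L g --> auto_on M g --> g (v 0) = v 0 --> g (v 1) = v 1 --> s g = 0 --> g = id"
    using translation_number[OF el] by (elim exE conjE)
  have fx: "\<phi> f (v k) = v k" if "shifts f 0" for f k using that unfolding shifts_def by simp
  have uniq: "shifts f t \<longleftrightarrow> n dvd (t - r)" if "f \<in> carrier S" "shifts f r" for f r t
    using that(2) n(2) unfolding shifts_def by simp
  have ex: "\<exists>r. shifts f r" if f: "f \<in> carrier S" for f
      using A.gap_maps_seq[OF aL[OF f] G st[OF f] v] unfolding shifts_def .
  have mult: "shifts (f \<otimes> g) (r + t)" if "f \<in> carrier S" "g \<in> carrier S" "shifts f r" "shifts g t" for f g r t
      using that hom[OF that(1,2)] unfolding shifts_def by (simp add: ac_simps)
  have one: "shifts \<one> 0" unfolding shifts_def by (simp add: phi_one)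
  have add: "(s \<circ> \<phi>) (f \<otimes> g) = (s \<circ> \<phi>) f + (s \<circ> \<phi>) g" if h: "f \<in> carrier S" "g \<in> carrier S" "shifts f 0" "shifts g 0" for f g
      using s(1) aL[OF h(1)] aM[OF h(1)] aL[OF h(2)] aM[OF h(2)] fx[OF h(3)] fx[OF h(4)] hom[OF h(1,2)] by simp
  have inj: "f = \<one>" if h: "f \<in> carrier S" "shifts f 0" "(s \<circ> \<phi>) f = 0" for f
      using s(2) aL[OF h(1)] aM[OF h(1)] fx[OF h(2)] h(3) by (intro faithful[OF h(1)]) simp
  have noinv: "h = \<one>" if h: "f \<in> carrier S" "h \<in> carrier S" "shifts h 0" "f \<otimes> h \<otimes> inv f = inv h" for f h
    proof (rule ccontr)
      assume "h \<noteq> \<one>"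
      then have "\<phi> h \<noteq> id" using faithful[OF h(2)] by auto
      moreover have "\<phi> f \<circ> \<phi> h \<circ> inv_into UNIV (\<phi> f) = inv_into UNIV (\<phi> h)"
        using arg_cong[OF h(4), of \<phi>] h(1,2) by (simp add: hom phi_inv)
      ultimately show False
        by (rule no_inversion[OF aL[OF h(2)] aM[OF h(2)] _ G v fx[OF h(3)] aL[OF h(1)] aM[OF h(1)] st[OF h(1)]])
    qed
  show thesis
    by (rule S.translation_extension[OF ex uniq mult one add inj noinv], assumption+,
        rule that[OF _ _ _ _ _ _ _ _ _ _ _ n uniq], assumption+)
qed

lemma shifts_zero_pow: assumes y: "y \<in> carrier S" "shifts y 0" shows "shifts (y [^] (c::int)) 0"
proof -
  have nat: "\<phi> (y [^] j) (v k) = v k" for j :: nat and k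
  proof (induction j)
    case (Suc j) then show ?case using y by (simp add: hom shifts_def)
  qed (simp add: phi_one)
  have ni: "\<phi> (inv (y [^] j)) (v k) = v k" for j :: nat and k
    using A.fixed_inv[OF cyc_phi nat] y(1) by (simp add: phi_inv)
  obtain j where "c = int j \<or> c = - int j" by (metis int_cases2)
  then show ?thesis
  proof
    assume "c = int j" then show ?thesis unfolding shifts_def using nat by (simp add: int_pow_int)
  next
    assume "c = - int j" then show ?thesis unfolding shifts_def using ni y(1) by (simp add: S.int_pow_neg_int)
  qed
qed

lemma interleaving:
  assumes y: "y \<in> carrier S" "y \<noteq> \<one>" "shifts y 0" and f: "f \<in> carrier S" "f \<otimes> y = y \<otimes> f"
  shows "\<exists>\<G>' \<H>. isgap L \<G>' \<and> isgap M \<H> \<and> inter \<G>' \<H> \<and> (`) (\<phi> f) ` \<G>' = \<G>' \<and> (`) (\<phi> f) ` \<H> = \<H>"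
proof -
  have yi: "\<phi> y \<noteq> id" using faithful[OF y(1)] y(2) by auto
  have fx: "\<phi> y (v k) = v k" for k using y(3) unfolding shifts_def by simp
  obtain \<G>' \<H> where I: "isgap L \<G>'" "isgap M \<H>" "inter \<G>' \<H>"
    "\<forall>f. auto_on L f --> auto_on M f --> (`) f ` \<G> = \<G> --> f \<circ> \<phi> y = \<phi> y \<circ> f --> (`) f ` \<G>' = \<G>' \<and> (`) f ` \<H> = \<H>"
    using interleaving_stab[OF aL[OF y(1)] aM[OF y(1)] yi G v fx] by (elim exE conjE)
  have cm: "\<phi> f \<circ> \<phi> y = \<phi> y \<circ> \<phi> f" using hom[OF f(1) y(1)] hom[OF y(1) f(1)] f(2) by simp
  have "(`) (\<phi> f) ` \<G>' = \<G>' \<and> (`) (\<phi> f) ` \<H> = \<H>"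
    by (rule I(4)[rule_format, OF aL[OF f(1)] aM[OF f(1)] st[OF f(1)] cm])
  then show ?thesis using I(1-3) by (intro exI[of _ \<G>'] exI[of _ \<H>] conjI) simp_all
qed

text \<open>\<open>m = n / d\<close> is the order of \<open>x\<close> modulo the kernel. With
  trivial kernel \<open>x\<close> generates a finite group. Otherwise \<open>rotation_basis\<close>
  splits off the torsion; \<open>g\<close> commutes with the kernel generator \<open>y\<close> and
  so preserves the interleaving pair that belongs to \<open>y\<close>.\<close>

lemma polygon:
  assumes fin: "finite (verts \<G>)"
  shows "(\<exists>x m. x \<in> carrier S \<and> carrier S = generate S {x} \<and> 0 < m \<and> x [^] (m::int) = \<one>) \<or>
    (\<exists>g e d. 0 < d \<and> g \<in> carrier S \<and> e \<in> carrier S \<and> g \<otimes> e = e \<otimes> g \<and>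
      (\<forall>f\<in>carrier S. \<exists>a b. f = g [^] (a::int) \<otimes> e [^] (b::int)) \<and>
      (\<forall>a b. g [^] (a::int) \<otimes> e [^] (b::int) = \<one> \<longleftrightarrow> a = 0 \<and> int d dvd b) \<and>
      (\<exists>\<G>' \<H>. isgap L \<G>' \<and> isgap M \<H> \<and> inter \<G>' \<H> \<and> (`) (\<phi> g) ` \<G>' = \<G>' \<and> (`) (\<phi> g) ` \<H> = \<H>))"
proof -
  obtain x y and n d :: int where b: "x \<in> carrier S" "y \<in> carrier S" "x \<otimes> y = y \<otimes> x" "0 \<le> d" "shifts x d" "shifts y 0"
    "\<And>f. f \<in> carrier S ==> \<exists>a b. f = x [^] (a::int) \<otimes> y [^] (b::int)"
    "\<And>b::int. y [^] b = \<one> ==> y \<noteq> \<one> ==> b = 0"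
    "\<And>f r. f \<in> carrier S ==> shifts f r ==> d dvd r"
    "\<And>h. h \<in> carrier S ==> shifts h 0 ==> \<exists>b::int. h = y [^] b"
    "\<And>a::int. shifts (x [^] a) (a * d)"
    "0 \<le> n" "\<And>i j. v i = v j \<longleftrightarrow> n dvd (j - i)" "n = 0 \<longleftrightarrow> infinite (verts \<G>)"
    "\<And>f r t. f \<in> carrier S ==> shifts f r ==> shifts f t \<longleftrightarrow> n dvd (t - r)"
    by (rule basis) (rule that)
  have n: "0 < n" using b(12,14) fin by simp
  \<comment> \<open>The identity shifts by \<open>0\<close> and hence also by the period
    \<open>n\<close>, which forces \<open>d\<close> to divide \<open>n\<close>.\<close>
  have "shifts \<one> 0" unfolding shifts_def by (simp add: phi_one)
  then have "shifts \<one> n" using b(15)[OF S.one_closed, of 0 n] by simp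
  then have "d dvd n" by (rule b(9)[OF S.one_closed])
  then obtain m where m: "n = d * m" by (elim dvdE)
  have dm: "0 < d" "0 < m" using n b(4) m by (auto simp: zero_less_mult_iff)
  have xN: "shifts (x [^] a) 0 \<longleftrightarrow> m dvd a" for a :: int
  proof -
    have "shifts (x [^] a) 0 \<longleftrightarrow> n dvd (0 - a * d)" by (rule b(15)[OF _ b(11)]) (use b(1) in simp)
    also have "\<dots> \<longleftrightarrow> d * m dvd d * a" unfolding m by (simp add: mult.commute)
    finally show ?thesis using dm(1) by simp
  qed
  obtain k :: int where k: "x [^] m = y [^] k" using b(10)[of "x [^] m"] xN[of m] b(1) by auto
  show ?thesis
  proof (cases "y = \<one>")
    case True
    have xm: "x [^] m = \<one>" using k True by simp
    have "\<exists>a. f = x [^] (a::int)" if "f \<in> carrier S" for f using b(7)[OF that] b(1) True by auto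
    then have "carrier S = generate S {x}" unfolding S.generate_pow[OF b(1)] using b(1) by auto
    then show ?thesis using b(1) xm dm(2) by blast
  next
    case False
    have dvd: "m dvd a" if "x [^] a = y [^] c" for a c :: int
    proof -
      have "shifts (x [^] a) 0" unfolding that by (rule shifts_zero_pow[OF b(2,6)])
      then show ?thesis using xN by simp
    qed
    obtain g e and d' :: nat where g: "0 < d'" "g \<in> carrier S" "e \<in> carrier S" "g \<otimes> e = e \<otimes> g"
      "\<And>f. f \<in> carrier S ==> \<exists>a b. f = g [^] (a::int) \<otimes> e [^] (b::int)"
      "\<And>a b. g [^] (a::int) \<otimes> e [^] (b::int) = \<one> \<longleftrightarrow> a = 0 \<and> int d' dvd b"
      by (rule S.rotation_basis[OF b(1-3) b(7) b(8)[OF _ False] dm(2) k dvd], assumption+, rule that)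
    obtain a c where ac: "g = x [^] (a::int) \<otimes> y [^] (c::int)" using b(7)[OF g(2)] by blast
    have "(x [^] a \<otimes> y [^] c) \<otimes> (x [^] (0::int) \<otimes> y [^] (1::int)) = (x [^] (0::int) \<otimes> y [^] (1::int)) \<otimes> (x [^] a \<otimes> y [^] c)"
      unfolding S.commuting_mult[OF b(1-3)] by (simp only: add.commute)
    then have cm: "g \<otimes> y = y \<otimes> g" unfolding ac[symmetric] using b(2) by simp
    show ?thesis
      by (rule disjI2, rule exI[of _ g], rule exI[of _ e], rule exI[of _ d'])
        (intro conjI ballI allI g interleaving[OF b(2) False b(6) g(2) cm])
  qed
qed

text \<open>For a crown the shift is an honest integer. If all shifts vanish, the group is the
  kernel generated by \<open>y\<close>, which fixes at least two vertices. Otherwise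
  \<open>x\<close> fixes the pivot only and has no non-trivial power in the kernel, so the group is
  free abelian on \<open>x\<close> or on \<open>y\<close> and \<open>x\<close>.\<close>

lemma crown:
  assumes inf: "infinite (verts \<G>)"
  shows "(\<exists>x. x \<in> carrier S \<and> carrier S = generate S {x} \<and> (\<forall>a. x [^] (a::int) = \<one> \<longleftrightarrow> a = 0) \<and> (\<exists>!p. \<phi> x p = p)) \<or>
    (\<exists>y. y \<in> carrier S \<and> carrier S = generate S {y} \<and> (\<forall>a. y [^] (a::int) = \<one> \<longleftrightarrow> a = 0) \<and> (\<exists>p q. p \<noteq> q \<and> \<phi> y p = p \<and> \<phi> y q = q) \<and>
      (\<exists>\<G>' \<H>. isgap L \<G>' \<and> isgap M \<H> \<and> inter \<G>' \<H> \<and> (`) (\<phi> y) ` \<G>' = \<G>' \<and> (`) (\<phi> y) ` \<H> = \<H>)) \<or>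
    (\<exists>y x. x \<in> carrier S \<and> y \<in> carrier S \<and> y \<otimes> x = x \<otimes> y \<and>
      (\<forall>f\<in>carrier S. \<exists>a b. f = y [^] (a::int) \<otimes> x [^] (b::int)) \<and>
      (\<forall>a b. y [^] (a::int) \<otimes> x [^] (b::int) = \<one> \<longleftrightarrow> a = 0 \<and> b = 0) \<and>
      (\<exists>!p. \<phi> x p = p) \<and> (\<exists>p q. p \<noteq> q \<and> \<phi> y p = p \<and> \<phi> y q = q) \<and>
      (\<exists>\<G>' \<H>. isgap L \<G>' \<and> isgap M \<H> \<and> inter \<G>' \<H> \<and> (`) (\<phi> y) ` \<G>' = \<G>' \<and> (`) (\<phi> y) ` \<H> = \<H>))"
proof -
  obtain x y and n d :: int where b: "x \<in> carrier S" "y \<in> carrier S" "x \<otimes> y = y \<otimes> x" "0 \<le> d" "shifts x d" "shifts y 0"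
    "\<And>f. f \<in> carrier S ==> \<exists>a b. f = x [^] (a::int) \<otimes> y [^] (b::int)"
    "\<And>b::int. y [^] b = \<one> ==> y \<noteq> \<one> ==> b = 0"
    "\<And>f r. f \<in> carrier S ==> shifts f r ==> d dvd r"
    "\<And>h. h \<in> carrier S ==> shifts h 0 ==> \<exists>b::int. h = y [^] b"
    "\<And>a::int. shifts (x [^] a) (a * d)"
    "0 \<le> n" "\<And>i j. v i = v j \<longleftrightarrow> n dvd (j - i)" "n = 0 \<longleftrightarrow> infinite (verts \<G>)"
    "\<And>f r t. f \<in> carrier S ==> shifts f r ==> shifts f t \<longleftrightarrow> n dvd (t - r)"
    by (rule basis) (rule that)
  have n: "n = 0" using b(14) inf by simp
  have iv: "inj v" using b(13) n by (auto intro: injI)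
  have "0 \<le> (0::int) \<and> (\<exists>p. verts \<G> = insert p (range v) \<and> pivot \<G> p)"
    using A.gseq_period[OF G v] inf by auto
  then obtain p where p: "pivot \<G> p" by auto
  have two: "\<exists>p q. p \<noteq> q \<and> \<phi> y p = p \<and> \<phi> y q = q"
    using b(6) b(13)[of 0 1] n unfolding shifts_def by (intro exI[of _ "v 0"] exI[of _ "v 1"]) simp
  have Iy: "\<exists>\<G>' \<H>. isgap L \<G>' \<and> isgap M \<H> \<and> inter \<G>' \<H> \<and> (`) (\<phi> y) ` \<G>' = \<G>' \<and> (`) (\<phi> y) ` \<H> = \<H>" if "y \<noteq> \<one>"
    by (rule interleaving[OF b(2) that b(6) b(2) HOL.refl])
  show ?thesis
  proof (cases "d = 0")
    case True
    have "\<exists>a. f = y [^] (a::int)" if f: "f \<in> carrier S" for f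
    proof -
      obtain r where r: "shifts f r" using A.gap_maps_seq[OF aL[OF f] G st[OF f] v] unfolding shifts_def by auto
      then have "r = 0" using b(9)[OF f r] True by simp
      then show ?thesis using b(10)[OF f] r by simp
    qed
    then have gen: "carrier S = generate S {y}" unfolding S.generate_pow[OF b(2)] using b(2) by auto
    have "y \<noteq> \<one>" using gen nontrivial S.generate_one by auto
    then have tr: "\<forall>a. y [^] (a::int) = \<one> \<longleftrightarrow> a = 0" using b(8) by auto
    show ?thesis by (rule disjI2, rule disjI1, rule exI[of _ y], intro conjI b(2) gen tr two Iy[OF \<open>y \<noteq> \<one>\<close>])
  next
    case False
    have "\<exists>!q. \<phi> x q = q"
    proof (rule ex1I[of _ p])
      show "\<phi> x p = p" by (rule A.pivot_fixed[OF aL[OF b(1)] G st[OF b(1)] p])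
      show "q = p" if "\<phi> x q = q" for q
        by (rule A.crown_fixed[OF aL[OF b(1)] G p v iv _ False that]) (use b(5) in \<open>simp add: shifts_def\<close>)
    qed
    have x0: "a = 0" if a: "shifts (x [^] a) 0" for a :: int
    proof -
      have "shifts (x [^] a) 0 \<longleftrightarrow> n dvd (0 - a * d)" by (rule b(15)[OF _ b(11)]) (use b(1) in simp)
      then have "n dvd (0 - a * d)" using a by simp
      then show ?thesis using n False by simp
    qed
    have x1: "a = 0 \<and> y [^] c = \<one>" if e: "x [^] a \<otimes> y [^] c = \<one>" for a c :: int
    proof -
      have "x [^] a = inv (y [^] c)" using S.inv_equality[OF e] b(1,2) by simp
      also have "\<dots> = y [^] (- c)" using b(2) by (simp add: S.int_pow_neg)
      finally have "a = 0" using x0[of a] shifts_zero_pow[OF b(2,6), of "- c"] by simp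
      then show ?thesis using e b(2) by simp
    qed
    show ?thesis
    proof (cases "y = \<one>")
      case True
      have "\<exists>a. f = x [^] (a::int)" if f: "f \<in> carrier S" for f
      proof -
        obtain a c where "f = x [^] (a::int) \<otimes> y [^] (c::int)" using b(7)[OF f] by blast
        then have "f = x [^] a" using True b(1) by simp
        then show ?thesis by blast
      qed
      then have gen: "carrier S = generate S {x}" unfolding S.generate_pow[OF b(1)] using b(1) by auto
      have tr: "\<forall>a. x [^] (a::int) = \<one> \<longleftrightarrow> a = 0" using x1[of _ 0] b(1) by auto
      show ?thesis by (rule disjI1, rule exI[of _ x], intro conjI b(1) gen tr \<open>\<exists>!q. \<phi> x q = q\<close>)
    next
      case y: False
      have sw: "y [^] a \<otimes> x [^] c = x [^] c \<otimes> y [^] a" for a c :: int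
        using S.commuting_pow2[OF b(1,2,3)] by simp
      have all: "\<forall>f\<in>carrier S. \<exists>a c. f = y [^] (a::int) \<otimes> x [^] (c::int)"
      proof
        fix f assume "f \<in> carrier S"
        then obtain a c where "f = x [^] (a::int) \<otimes> y [^] (c::int)" using b(7) by blast
        then have "f = y [^] c \<otimes> x [^] a" unfolding sw .
        then show "\<exists>a c. f = y [^] (a::int) \<otimes> x [^] (c::int)" by blast
      qed
      have triv: "\<forall>a c. y [^] (a::int) \<otimes> x [^] (c::int) = \<one> \<longleftrightarrow> a = 0 \<and> c = 0"
      proof (intro allI iffI)
        fix a c :: int assume "y [^] a \<otimes> x [^] c = \<one>"
        then have "c = 0 \<and> y [^] a = \<one>" unfolding sw by (rule x1)
        then show "a = 0 \<and> c = 0" using b(8)[OF _ y] by simp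
      qed (use b(1,2) in simp)
      show ?thesis
        by (rule disjI2, rule disjI2, rule exI[of _ y], rule exI[of _ x])
          (intro conjI b(1,2) b(3)[symmetric] all triv \<open>\<exists>!q. \<phi> x q = q\<close> two Iy[OF y])
    qed
  qed
qed

end

section \<open>Transfer to the unit circle\<close>

definition pt :: "circ \<Rightarrow> complex" where
  "pt c = cis (ang c)"

lemma pt_circle: "pt c \<in> circle"
  by (simp add: pt_def)

lemma pt_inj [simp]: "pt x = pt y \<longleftrightarrow> x = y"
  using cis_inj_interval[of "ang x" "ang y" 0] ang_bounds[of x] ang_bounds[of y] by (auto simp: pt_def circ_eq_iff)

lemma pt_surj: assumes "z \<in> circle" obtains c where "z = pt c"
proof -
  obtain b where b: "0 \<le> b" "b < 0 + 2 * pi" "z = cis b" using circle_cis_from[OF assms] .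
  then have "ang (Circ b) = b" by (intro Circ_inverse) simp
  then show thesis using that[of "Circ b"] b(3) by (simp add: pt_def)
qed

lemma pt_image_subset [simp]: "pt ` A \<subseteq> pt ` B \<longleftrightarrow> A \<subseteq> B"
  by (rule inj_image_subset_iff) (simp add: inj_def)

lemma pt_image_eq [simp]: "pt ` A = pt ` B \<longleftrightarrow> A = B"
  by (rule inj_image_eq_iff) (simp add: inj_def)

lemma push_inj: "(`) pt ` \<G> = (`) pt ` \<H> \<longleftrightarrow> \<G> = \<H>"
  by (rule inj_image_eq_iff) (simp add: inj_def)

lemma setcompr_range: "{F k | k. True} = range F"
  by auto

lemma norm_pt [simp]: "norm (pt c) = 1"
  by (simp add: pt_def)

lemma pt_mem [simp]: "pt x \<in> pt ` A \<longleftrightarrow> x \<in> A"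
  by auto

lemma ccw_pt: "ccw (pt x) (pt y) (pt z) \<longleftrightarrow> cyc x y z"
proof
  assume "ccw (pt x) (pt y) (pt z)"
  then obtain a b c where abc: "pt x = cis a" "pt y = cis b" "pt z = cis c" "a < b" "b < c" "c < a + 2 * pi"
    unfolding ccw_def by blast
  have "cis (ang x) = cis a" using abc(1) by (simp add: pt_def)
  then obtain k :: int where k: "ang x = a + 2 * pi * k" using cis_eq_cis by blast
  have sh: "cis t = cis (t + 2 * pi * k)" for t by (metis cis_eq_cis)
  \<comment> \<open>After a common shift by \<open>k\<close> turns the first angle is the standard
    one; the other two exceed it by less than a full turn, so at most one turn has to be
    subtracted.\<close>
  have bd: "ang w = t \<or> ang w = t - 2 * pi" if "pt w = cis t" "0 \<le> t" "t < 4 * pi" for w t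
  proof (cases "t < 2 * pi")
    case True
    then show ?thesis using cis_inj_interval[of "ang w" t 0] that ang_bounds[of w] by (simp add: pt_def)
  next
    case False
    have "t - 2 * pi = t + 2 * pi * of_int (- 1)" by simp
    then have "cis t = cis (t - 2 * pi)" using cis_eq_cis by metis
    then show ?thesis using cis_inj_interval[of "ang w" "t - 2 * pi" 0] that False ang_bounds[of w] by (simp add: pt_def)
  qed
  have "ang y = b + 2 * pi * k \<or> ang y = b + 2 * pi * k - 2 * pi"
    by (rule bd) (use abc k sh[of b] ang_bounds[of x] in simp_all)
  moreover have "ang z = c + 2 * pi * k \<or> ang z = c + 2 * pi * k - 2 * pi"
    by (rule bd) (use abc k sh[of c] ang_bounds[of x] in simp_all)
  ultimately show "cyc x y z" unfolding cyc_ang using abc(4-6) k ang_bounds[of x] ang_bounds[of y] ang_bounds[of z] by argo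
next
  assume c: "cyc x y z"
  have s: "pt w = cis (ang w + 2 * pi)" for w
  proof -
    have "ang w + 2 * pi = ang w + 2 * pi * of_int 1" by simp
    then show ?thesis unfolding pt_def using cis_eq_cis by metis
  qed
  have b: "0 \<le> ang w \<and> ang w < 2 * pi" for w using ang_bounds by simp
  show "ccw (pt x) (pt y) (pt z)"
  proof -
    consider "ang x < ang y" "ang y < ang z" | "ang y < ang z" "ang z < ang x" | "ang z < ang x" "ang x < ang y"
      using c unfolding cyc_ang by blast
    then show ?thesis
    proof cases
      case 1
      then show ?thesis unfolding ccw_def using b[of x] b[of z]
        by (intro exI[of _ "ang x"] exI[of _ "ang y"] exI[of _ "ang z"]) (simp add: pt_def)
    next
      case 2
      then show ?thesis unfolding ccw_def using b[of x] b[of y] b[of z] s[of y] s[of z]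
        by (intro exI[of _ "ang x"] exI[of _ "ang y + 2 * pi"] exI[of _ "ang z + 2 * pi"]) (simp add: pt_def)
    next
      case 3
      then show ?thesis unfolding ccw_def using b[of x] b[of y] b[of z] s[of z]
        by (intro exI[of _ "ang x"] exI[of _ "ang y"] exI[of _ "ang z + 2 * pi"]) (simp add: pt_def)
    qed
  qed
qed

lemma arc_pt: "arc_between (pt a) (pt b) = pt ` oarc a b"
proof
  show "arc_between (pt a) (pt b) \<subseteq> pt ` oarc a b"
  proof
    fix z assume z: "z \<in> arc_between (pt a) (pt b)"
    then have "z \<in> circle" unfolding arc_between_def ccw_def by auto
    then obtain c where "z = pt c" by (rule pt_surj)
    then show "z \<in> pt ` oarc a b" using z unfolding arc_between_def by (simp add: ccw_pt)
  qed
qed (auto simp: arc_between_def ccw_pt)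

lemma good_interval_pt: "good_interval I \<longleftrightarrow> (\<exists>a b. a \<noteq> b \<and> I = pt ` oarc a b)"
proof
  assume "good_interval I"
  then obtain u v where uv: "u \<in> circle" "v \<in> circle" "u \<noteq> v" "I = arc_between u v" unfolding good_interval_def by blast
  obtain a where a: "u = pt a" using pt_surj[OF uv(1)] .
  obtain b where b: "v = pt b" using pt_surj[OF uv(2)] .
  show "\<exists>a b. a \<noteq> b \<and> I = pt ` oarc a b" using uv a b arc_pt by auto
next
  assume "\<exists>a b. a \<noteq> b \<and> I = pt ` oarc a b"
  then obtain a b where ab: "a \<noteq> b" "I = pt ` oarc a b" by blast
  show "good_interval I" unfolding good_interval_def
    by (rule bexI[of _ "pt a"], rule bexI[of _ "pt b"]) (use ab in \<open>simp_all add: arc_pt\<close>)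
qed

lemma dual_pt: "a \<noteq> b ==> dual (pt ` oarc a b) = pt ` oarc b a"
  using dual_arc_between[OF pt_circle pt_circle, of a b] by (simp add: arc_pt)

text \<open>Every element of a lamination system is the image of a set of angles, so that a gap can
  be recovered from its pullback by \<open>push_pull\<close>.\<close>

definition pull :: "complex set set \<Rightarrow> circ set set" where
  "pull L = {A. pt ` A \<in> L}"

lemma mem_pull [simp]: "A \<in> pull L \<longleftrightarrow> pt ` A \<in> L"
  by (simp add: pull_def)

locale lamsys =
  fixes L :: "complex set set"
  assumes lamination: "lamination_system L"
begin

lemma good: assumes "I \<in> L" shows "\<exists>a b. a \<noteq> b \<and> I = pt ` oarc a b"
proof -
  have "\<forall>I\<in>L. good_interval I" using lamination[unfolded lamination_system_def] by (elim conjE)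
  then show ?thesis using assms good_interval_pt by simp
qed

lemma push_pull: "\<G> \<subseteq> L ==> (`) pt ` pull \<G> = \<G>"
proof
  assume G: "\<G> \<subseteq> L"
  show "\<G> \<subseteq> (`) pt ` pull \<G>"
  proof
    fix I assume I: "I \<in> \<G>"
    then obtain a b where "I = pt ` oarc a b" using good G by blast
    then show "I \<in> (`) pt ` pull \<G>" using I by (intro image_eqI[of _ _ "oarc a b"]) simp_all
  qed
qed auto

lemma pull_arc: "I \<in> pull L ==> \<exists>a b. a \<noteq> b \<and> I = oarc a b"
  using good by fastforce

lemma dual_pull: assumes "I \<in> pull L" shows "dual (pt ` I) = pt ` co I"
proof -
  obtain a b where "a \<noteq> b" "I = oarc a b" using pull_arc[OF assms] by blast
  then show ?thesis using dual_pt by simp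
qed

lemma lies_on_pull: "I \<in> pull L ==> lies_on (pt ` I) (pt ` J) \<longleftrightarrow> I \<subseteq> J \<or> co I \<subseteq> J"
  unfolding lies_on_def by (simp add: dual_pull)

lemma gap_pull: "gap L \<G> \<longleftrightarrow> \<G> \<subseteq> L \<and> isgap (pull L) (pull \<G>)"
proof (cases "\<G> \<subseteq> L")
  case True
  have G: "\<G> = (`) pt ` pull \<G>" using push_pull[OF True] by simp
  have L: "L = (`) pt ` pull L" using push_pull[of L] by simp
  have "gap L \<G> \<longleftrightarrow> (\<forall>I\<in>\<G>. \<forall>J\<in>\<G>. I \<noteq> J --> I \<inter> J = {}) \<and> (\<forall>I\<in>L. \<exists>J\<in>\<G>. lies_on I J)"
    unfolding gap_def using True by simp
  also have "(\<forall>I\<in>\<G>. \<forall>J\<in>\<G>. I \<noteq> J --> I \<inter> J = {}) \<longleftrightarrow> (\<forall>I\<in>pull \<G>. \<forall>J\<in>pull \<G>. I \<noteq> J --> I \<inter> J = {})"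
  proof -
    have "pt ` I \<inter> pt ` J = {} \<longleftrightarrow> I \<inter> J = {}" for I J by auto
    then show ?thesis by (subst (1 2) G) (simp add: ball_simps(9) del: mem_pull)
  qed
  also have "(\<forall>I\<in>L. \<exists>J\<in>\<G>. lies_on I J) \<longleftrightarrow> (\<forall>I\<in>pull L. \<exists>J\<in>pull \<G>. I \<subseteq> J \<or> co I \<subseteq> J)"
  proof -
    have "(\<forall>I\<in>L. \<exists>J\<in>\<G>. lies_on I J) \<longleftrightarrow> (\<forall>I\<in>pull L. \<exists>J\<in>pull \<G>. lies_on (pt ` I) (pt ` J))"
      by (subst L, subst G) (simp del: mem_pull)
    also have "\<dots> \<longleftrightarrow> (\<forall>I\<in>pull L. \<exists>J\<in>pull \<G>. I \<subseteq> J \<or> co I \<subseteq> J)"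
      by (intro ball_cong bex_cong HOL.refl lies_on_pull)
    finally show ?thesis .
  qed
  also have "(\<forall>I\<in>pull \<G>. \<forall>J\<in>pull \<G>. I \<noteq> J --> I \<inter> J = {}) \<and> (\<forall>I\<in>pull L. \<exists>J\<in>pull \<G>. I \<subseteq> J \<or> co I \<subseteq> J)
      \<longleftrightarrow> isgap (pull L) (pull \<G>)" unfolding isgap_def using True by auto
  finally show ?thesis using True by simp
qed (simp add: gap_def)

lemma gap_push: assumes "isgap (pull L) \<H>" shows "gap L ((`) pt ` \<H>)" "pull ((`) pt ` \<H>) = \<H>"
proof -
  show p: "pull ((`) pt ` \<H>) = \<H>" unfolding pull_def by (auto simp: image_iff)
  have "(`) pt ` \<H> \<subseteq> L" using assms unfolding isgap_def by auto
  then show "gap L ((`) pt ` \<H>)" using gap_pull p assms by simp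
qed

lemma vertices_pull: assumes "\<G> \<subseteq> L" shows "vertices \<G> = pt ` verts (pull \<G>)"
proof
  show "vertices \<G> \<subseteq> pt ` verts (pull \<G>)"
  proof
    fix z assume z: "z \<in> vertices \<G>"
    then have "z \<in> circle" unfolding vertices_def by simp
    then obtain c where c: "z = pt c" by (rule pt_surj)
    have "c \<notin> I" if "I \<in> pull \<G>" for I using z that unfolding vertices_def c by auto
    then show "z \<in> pt ` verts (pull \<G>)" unfolding c verts_def by auto
  qed
  show "pt ` verts (pull \<G>) \<subseteq> vertices \<G>"
  proof (rule image_subsetI)
    fix c assume c: "c \<in> verts (pull \<G>)"
    have "pt c \<notin> I" if I: "I \<in> \<G>" for I
    proof -
      obtain a b where ab: "I = pt ` oarc a b" using good assms I by blast
      then have "oarc a b \<in> pull \<G>" using I by simp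
      then have "c \<notin> oarc a b" using c unfolding verts_def by blast
      then show ?thesis unfolding ab pt_mem .
    qed
    then have "pt c \<notin> \<Union>\<G>" by blast
    then show "pt c \<in> vertices \<G>" unfolding vertices_def using pt_circle by (intro DiffI)
  qed
qed

text \<open>The closure axiom for chains is obtained from the one for sequences:
  \<open>chain_Union_seq\<close> replaces the chain by a sequence, and
  \<open>chain_Union_oarc\<close> shows that the union is a good interval.\<close>

lemma lam_pull: "lam (pull L)"
proof
  note D = lamination[unfolded lamination_system_def]
  have L1: "L \<noteq> {}" using D by (elim conjE)
  have L2: "\<forall>I\<in>L. dual I \<in> L" using D by (elim conjE)
  have L3: "\<forall>I\<in>L. \<forall>J\<in>L. lies_on I J \<or> lies_on I (dual J)" using D by (elim conjE)
  have L4: "\<forall>A :: nat \<Rightarrow> complex set. (\<forall>k. A k \<in> L) \<and> (\<forall>k. A k \<subseteq> A (Suc k)) \<and> good_interval (\<Union>k. A k) --> (\<Union>k. A k) \<in> L"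
    using D by (elim conjE)
  obtain I where I: "I \<in> L" using L1 by blast
  obtain a b where "I = pt ` oarc a b" using good[OF I] by blast
  then have "oarc a b \<in> pull L" using I by simp
  then show "pull L \<noteq> {}" by blast
  show "\<exists>a b. a \<noteq> b \<and> I = oarc a b" if "I \<in> pull L" for I using pull_arc[OF that] .
  have ne: "a \<noteq> b" if "oarc a b \<in> pull L" for a b using pull_arc[OF that] oarc_eq_empty_iff by metis
  show d: "oarc b a \<in> pull L" if "oarc a b \<in> pull L" for a b
    using bspec[OF L2, of "pt ` oarc a b"] that dual_pt[OF ne[OF that]] by simp
  show False if ab: "oarc a b \<in> pull L" and cd: "oarc c d \<in> pull L" and cy: "cyc a c b" "cyc b d a" for a b c d
  proof -
    have "lies_on (pt ` oarc a b) (pt ` oarc c d) \<or> lies_on (pt ` oarc a b) (pt ` oarc d c)"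
      using bspec[OF bspec[OF L3, of "pt ` oarc a b"], of "pt ` oarc c d"] ab cd dual_pt[OF ne[OF cd]] by simp
    then have "oarc a b \<subseteq> oarc c d \<or> oarc b a \<subseteq> oarc c d \<or> oarc a b \<subseteq> oarc d c \<or> oarc b a \<subseteq> oarc d c"
      unfolding lies_on_pull[OF ab] using ne[OF ab] by auto
    then show False using ne[OF ab] ne[OF cd] cy
      unfolding oarc_subset_iff[OF ne[OF ab]] oarc_subset_iff[OF ne[OF ab, symmetric]] cyc_ang circ_eq_iff by (smt (z3))
  qed
  show "\<Union>C \<in> pull L" if C: "C \<subseteq> pull L" "C \<noteq> {}" and ch: "\<And>I J. I \<in> C ==> J \<in> C ==> I \<subseteq> J \<or> J \<subseteq> I"
    and uv: "u \<noteq> v" "\<And>I. I \<in> C ==> u \<notin> I \<and> v \<notin> I" for C and u v :: circ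
  proof -
    have arcs: "\<exists>a b. a \<noteq> b \<and> I = oarc a b" if "I \<in> C" for I using pull_arc[OF subsetD[OF C(1) that]] .
    obtain A :: "nat \<Rightarrow> circ set" where A: "\<forall>k. A k \<in> C" "\<forall>k. A k \<subseteq> A (Suc k)" "(\<Union>k. A k) = \<Union>C"
      using chain_Union_seq[OF C(2) arcs ch conjunct1[OF uv(2)]] by blast
    obtain a b where ab: "a \<noteq> b" "\<Union>C = oarc a b" using chain_Union_oarc[OF C(2) arcs ch uv] by blast
    have e: "(\<Union>k. pt ` A k) = pt ` oarc a b" unfolding ab(2)[symmetric] A(3)[symmetric] by (rule image_UN[symmetric])
    have "(\<Union>k. pt ` A k) \<in> L"
    proof (rule L4[rule_format], intro conjI)
      show "\<forall>k. pt ` A k \<in> L" using A(1) C(1) by auto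
      show "\<forall>k. pt ` A k \<subseteq> pt ` A (Suc k)" using A(2) by simp
      show "good_interval (\<Union>k. pt ` A k)" unfolding e good_interval_pt using ab(1) by blast
    qed
    then show ?thesis unfolding e ab(2) by simp
  qed
qed

lemma ends_pull: assumes "endp (pull L) x" shows "pt x \<in> end_points L"
proof -
  obtain y where y: "oarc x y \<in> pull L" using assms unfolding endp_def by blast
  then have xy: "x \<noteq> y" using lam.ne_oarc[OF lam_pull] by blast
  have I: "pt ` oarc x y \<in> L" using y by simp
  have "pt x \<in> vertices (leaf_of (pt ` oarc x y))"
    unfolding vertices_def leaf_of_def dual_pt[OF xy] using pt_circle[of x] by simp
  then show ?thesis unfolding end_points_def using I by blast
qed

lemma qlam_pull: assumes qf: "quite_full L" and lo: "loose L" shows "qlam (pull L)"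
proof -
  interpret lam "pull L" by (rule lam_pull)
  show ?thesis
  proof
    fix \<G> assume G: "isgap (pull L) \<G>"
    note p = gap_push[OF G]
    have sub: "(`) pt ` \<G> \<subseteq> L" using p(1) unfolding gap_def by (elim conjE)
    have vs: "vertices ((`) pt ` \<G>) = pt ` verts \<G>" using vertices_pull[OF sub] p(2) by simp
    have "ideal_polygon L ((`) pt ` \<G>) \<or> crown L ((`) pt ` \<G>)" using qf p(1) unfolding quite_full_def by blast
    then show "finite (verts \<G>) \<or> (\<exists>(t :: int \<Rightarrow> circ) p. (\<forall>k. p \<noteq> t k) \<and> \<G> = {oarc (t k) (t (k + 1)) | k. True} \<and> verts \<G> = range t \<union> {p})"
    proof
      assume "ideal_polygon L ((`) pt ` \<G>)"
      then have "finite (pt ` verts \<G>)" unfolding ideal_polygon_def vs by simp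
      then have "finite (verts \<G>)" by (rule finite_imageD) (simp add: inj_on_def)
      then show ?thesis ..
    next
      assume "crown L ((`) pt ` \<G>)"
      then obtain t q where t: "\<forall>k::int. t k \<in> circle" "q \<in> circle" "\<forall>k. q \<noteq> t k"
        "(`) pt ` \<G> = {arc_between (t k) (t (k + 1)) | k. True}" "vertices ((`) pt ` \<G>) = range t \<union> {q}"
        unfolding crown_def by (elim conjE exE)
      have "\<forall>k. \<exists>c. t k = pt c" using t(1) pt_surj by metis
      then obtain t' where t': "\<And>k. t k = pt (t' k)" by metis
      obtain q' where q': "q = pt q'" using pt_surj[OF t(2)] .
      have "range t = pt ` range t'" using t' by (simp add: image_image)
      then have "pt ` verts \<G> = pt ` (range t' \<union> {q'})" using t(5) vs q' by simp
      then have "verts \<G> = range t' \<union> {q'}" by (simp only: pt_image_eq)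
      moreover have "\<G> = {oarc (t' k) (t' (k + 1)) | k. True}"
      proof -
        have "(`) pt ` \<G> = (`) pt ` {oarc (t' k) (t' (k + 1)) | k. True}"
          unfolding t(4) t' arc_pt setcompr_range image_image ..
        then show ?thesis unfolding push_inj .
      qed
      moreover have "\<forall>k. q' \<noteq> t' k" using t(3) q' t' by auto
      ultimately show ?thesis by blast
    qed
  next
    have push: "non_leaf_gap L ((`) pt ` \<G>) \<and> vertices ((`) pt ` \<G>) = pt ` verts \<G>" if G: "nlg (pull L) \<G>" for \<G>
    proof -
      have g: "isgap (pull L) \<G>" using G by (rule nlg_gap)
      note p = gap_push[OF g]
      have sub: "(`) pt ` \<G> \<subseteq> L" using p(1) unfolding gap_def by (elim conjE)
      have "(`) pt ` \<G> \<notin> leaves L"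
      proof
        assume "(`) pt ` \<G> \<in> leaves L"
        then obtain I where "(`) pt ` \<G> = leaf_of I" "I \<in> L" unfolding leaves_def by (rule imageE)
        then have I: "I \<in> L" "(`) pt ` \<G> = {I, dual I}" unfolding leaf_of_def by simp_all
        obtain a b where ab: "a \<noteq> b" "I = pt ` oarc a b" using good[OF I(1)] by blast
        have "\<G> = pull {I, dual I}" using p(2) I(2) by simp
        also have "\<dots> = {oarc a b, co (oarc a b)}" unfolding ab(2) dual_pt[OF ab(1)] pull_def using ab(1) by auto
        finally have "\<G> = {oarc a b, co (oarc a b)}" .
        moreover have "oarc a b \<in> pull L" using I(1) ab(2) by simp
        ultimately show False using G unfolding nlg_def by blast
      qed
      then show ?thesis using p vertices_pull[OF sub] unfolding non_leaf_gap_def by simp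
    qed
    fix \<G> \<H> x assume GH: "nlg (pull L) \<G>" "nlg (pull L) \<H>" "x \<in> verts \<G>" "x \<in> verts \<H>"
    have "pt x \<in> vertices ((`) pt ` \<G>) \<inter> vertices ((`) pt ` \<H>)" using push[OF GH(1)] push[OF GH(2)] GH(3,4) by simp
    moreover have "vertices ((`) pt ` \<G>) \<inter> vertices ((`) pt ` \<H>) = {}" if ne: "(`) pt ` \<G> \<noteq> (`) pt ` \<H>"
      by (rule lo[unfolded loose_def, rule_format]) (intro conjI conjunct1[OF push[OF GH(1)]] conjunct1[OF push[OF GH(2)]] ne)
    ultimately have "(`) pt ` \<G> = (`) pt ` \<H>" by blast
    then show "\<G> = \<H>" unfolding push_inj .
  qed
qed

end

lemma pf_pull: assumes "pseudo_fibered L1 L2" shows "pf (pull L1) (pull L2)"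
proof -
  interpret A: lamsys L1 using assms unfolding pseudo_fibered_def by unfold_locales simp
  interpret B: lamsys L2 using assms unfolding pseudo_fibered_def by unfold_locales simp
  have q: "qlam (pull L1)" "qlam (pull L2)"
    using A.qlam_pull B.qlam_pull assms unfolding pseudo_fibered_def by auto
  have "\<not> (endp (pull L1) x \<and> endp (pull L2) x)" for x
    using A.ends_pull B.ends_pull assms unfolding pseudo_fibered_def by blast
  then show ?thesis using q unfolding pf_def pf_axioms_def by blast
qed

section \<open>Automorphisms as maps of angles and the automorphism group\<close>

definition circle_map :: "(complex \<Rightarrow> complex) \<Rightarrow> circ \<Rightarrow> circ" where
  "circle_map g c = inv_into UNIV pt (g (pt c))"

locale circle_auto =
  fixes g :: "complex \<Rightarrow> complex"
  assumes bij: "bij_betw g circle circle" and op: "orientation_preserving g"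
begin

lemma pt_map: "pt (circle_map g c) = g (pt c)"
proof -
  have "g (pt c) \<in> circle" using bij pt_circle unfolding bij_betw_def by blast
  then obtain d where "g (pt c) = pt d" by (rule pt_surj)
  then have "g (pt c) \<in> range pt" by simp
  then show ?thesis unfolding circle_map_def by (rule f_inv_into_f)
qed

lemma pt_map_image: "pt ` circle_map g ` A = g ` pt ` A"
  unfolding image_image pt_map ..

lemma map_cycauto: "cycauto (circle_map g)"
  unfolding cycauto_def
proof (intro conjI allI)
  show "cyc (circle_map g x) (circle_map g y) (circle_map g z) = cyc x y z" for x y z
    using op pt_circle[of x] pt_circle[of y] pt_circle[of z] unfolding orientation_preserving_def ccw_pt[symmetric] pt_map by blast
  show "bij (circle_map g)" unfolding bij_def
  proof
    show "inj (circle_map g)"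
    proof (rule injI)
      fix x y assume "circle_map g x = circle_map g y"
      then have "g (pt x) = g (pt y)" using pt_map[of x] pt_map[of y] by simp
      then have "pt x = pt y" using bij pt_circle unfolding bij_betw_def inj_on_def by blast
      then show "x = y" by simp
    qed
    show "surj (circle_map g)" unfolding surj_def
    proof
      fix y
      have "pt y \<in> g ` circle" using bij pt_circle[of y] unfolding bij_betw_def by simp
      then obtain z where z: "z \<in> circle" "pt y = g z" by blast
      obtain c where c: "z = pt c" using pt_surj[OF z(1)] .
      have "pt y = pt (circle_map g c)" using z(2) c pt_map by simp
      then show "\<exists>x. y = circle_map g x" by auto
    qed
  qed
qed

lemma map_inj_image: "g ` pt ` A = g ` pt ` B \<longleftrightarrow> A = B"
  unfolding pt_map_image[symmetric] pt_image_eq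
  by (rule inj_image_eq_iff) (use map_cycauto in \<open>simp add: cycauto_def bij_def\<close>)

lemma act_pull: assumes "lamination_system L" "\<G> \<subseteq> L" "act g \<G> = \<G>" shows "(`) (circle_map g) ` pull \<G> = pull \<G>"
proof -
  interpret lamsys L using assms(1) by unfold_locales
  have G: "\<G> = (`) pt ` pull \<G>" using push_pull[OF assms(2)] by simp
  have "(`) pt ` (`) (circle_map g) ` pull \<G> = (\<lambda>I. g ` I) ` (`) pt ` pull \<G>"
    by (simp add: image_image pt_map)
  also have "\<dots> = (`) pt ` pull \<G>" using assms(3) G unfolding act_def by simp
  finally show ?thesis unfolding push_inj .
qed

lemma act_push: assumes "(`) (circle_map g) ` \<H> = \<H>" shows "act g ((`) pt ` \<H>) = (`) pt ` \<H>"
proof -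
  have "act g ((`) pt ` \<H>) = (`) pt ` (`) (circle_map g) ` \<H>" by (simp add: act_def image_image pt_map)
  then show ?thesis using assms by simp
qed

lemma map_auto_on: assumes L: "lamination_system L" "act g L = L" shows "auto_on (pull L) (circle_map g)"
  unfolding auto_on_def
proof (intro conjI allI map_cycauto)
  fix a b
  have "pt ` oarc (circle_map g a) (circle_map g b) = g ` pt ` oarc a b"
    unfolding cycauto_image[OF map_cycauto, symmetric] pt_map_image ..
  moreover have "g ` pt ` oarc a b \<in> L \<longleftrightarrow> pt ` oarc a b \<in> L"
  proof
    assume "pt ` oarc a b \<in> L"
    then have "g ` pt ` oarc a b \<in> act g L" unfolding act_def by (rule imageI)
    then show "g ` pt ` oarc a b \<in> L" using L(2) by simp
  next
    assume "g ` pt ` oarc a b \<in> L"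
    then have "g ` pt ` oarc a b \<in> act g L" using L(2) by simp
    then obtain I where I: "I \<in> L" "g ` pt ` oarc a b = g ` I" unfolding act_def by auto
    interpret lamsys L using L(1) by unfold_locales
    obtain A where "I = pt ` A" using good[OF I(1)] by blast
    then show "pt ` oarc a b \<in> L" using I map_inj_image by auto
  qed
  ultimately show "oarc (circle_map g a) (circle_map g b) \<in> pull L \<longleftrightarrow> oarc a b \<in> pull L" by simp
qed

lemma fixed_map: "circle_map g c = c \<longleftrightarrow> pt c \<in> fixed_points g"
proof -
  have "circle_map g c = c \<longleftrightarrow> pt (circle_map g c) = pt c" by simp
  then show ?thesis unfolding pt_map fixed_points_def using pt_circle by simp
qed

end

lemma inter_pull:
  assumes "lamination_system L1" "lamination_system L2" "isgap (pull L1) \<G>" "isgap (pull L2) \<H>" "inter \<G> \<H>"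
  shows "interleaving_pair L1 L2 ((`) pt ` \<G>) ((`) pt ` \<H>)"
proof -
  interpret A: lamsys L1 using assms(1) by unfold_locales
  interpret B: lamsys L2 using assms(2) by unfold_locales
  note p = A.gap_push[OF assms(3)] B.gap_push[OF assms(4)]
  have s: "(`) pt ` \<G> \<subseteq> L1" "(`) pt ` \<H> \<subseteq> L2" using p(1,3) unfolding gap_def by auto
  have vs: "vertices ((`) pt ` \<G>) = pt ` verts \<G>" "vertices ((`) pt ` \<H>) = pt ` verts \<H>"
    using A.vertices_pull[OF s(1)] B.vertices_pull[OF s(2)] p(2,4) by simp_all
  have sing: "is_singleton (pt ` I \<inter> pt ` V)" if e: "\<exists>!x. x \<in> I \<and> x \<in> V" for I V
  proof -
    obtain x where x: "I \<inter> V = {x}" using e by blast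
    have "pt ` I \<inter> pt ` V = pt ` (I \<inter> V)" by auto
    then show ?thesis unfolding x by (simp add: is_singleton_def)
  qed
  show ?thesis unfolding interleaving_pair_def vs using p(1,3) sing assms(5) unfolding inter_def by auto
qed

lemma arc_subset_circle: "good_interval I ==> I \<subseteq> circle"
  unfolding good_interval_pt using pt_circle by blast

lemma act_compose:
  assumes "\<And>I. I \<in> \<A> ==> I \<subseteq> circle" shows "act (compose circle f g) \<A> = act f (act g \<A>)"
proof -
  have "compose circle f g ` I = f ` g ` I" if I: "I \<in> \<A>" for I
  proof -
    have "compose circle f g ` I = (\<lambda>x. f (g x)) ` I"
      by (rule image_cong) (use assms[OF I] in \<open>auto simp: compose_def\<close>)
    then show ?thesis by (simp add: image_image)
  qed
  then have "act (compose circle f g) \<A> = (\<lambda>I. f ` g ` I) ` \<A>" unfolding act_def by (rule image_cong[OF HOL.refl])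
  also have "\<dots> = act f (act g \<A>)" unfolding act_def by (rule image_image[symmetric])
  finally show ?thesis .
qed

lemma act_inverse:
  assumes g: "bij_betw g circle circle" and A: "\<And>I. I \<in> \<A> ==> I \<subseteq> circle" and act: "act g \<A> = \<A>"
  shows "act (\<lambda>x\<in>circle. inv_into circle g x) \<A> = \<A>"
proof -
  have inj: "inj_on g circle" using g by (rule bij_betw_imp_inj_on)
  have e: "(\<lambda>x\<in>circle. inv_into circle g x) ` g ` I = I" if I: "I \<in> \<A>" for I
  proof -
    have "(\<lambda>x\<in>circle. inv_into circle g x) (g x) = x" if x: "x \<in> I" for x
      using x A[OF I] bij_betwE[OF g] inv_into_f_f[OF inj] by auto
    then have "(\<lambda>x. (\<lambda>x\<in>circle. inv_into circle g x) (g x)) ` I = (\<lambda>x. x) ` I" by (rule image_cong[OF HOL.refl])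
    moreover have "(\<lambda>x\<in>circle. inv_into circle g x) ` g ` I = (\<lambda>x. (\<lambda>x\<in>circle. inv_into circle g x) (g x)) ` I" by (rule image_image)
    ultimately show ?thesis by (simp only: image_ident)
  qed
  have "act (\<lambda>x\<in>circle. inv_into circle g x) (act g \<A>) = (\<lambda>I. (\<lambda>x\<in>circle. inv_into circle g x) ` g ` I) ` \<A>"
    unfolding act_def by (rule image_image)
  also have "\<dots> = (\<lambda>I. I) ` \<A>" by (rule image_cong[OF HOL.refl e])
  finally show ?thesis unfolding act by (simp only: image_ident)
qed

lemma act_ident:
  assumes A: "\<And>I. I \<in> A ==> I \<subseteq> circle" shows "act (\<lambda>x\<in>circle. x) A = A"
proof -
  have "(\<lambda>x\<in>circle. x) ` I = I" if I: "I \<in> A" for I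
  proof -
    have "(\<lambda>x\<in>circle. x) x = x" if "x \<in> I" for x using subsetD[OF A[OF I] that] by (rule restrict_apply')
    then have "(\<lambda>x\<in>circle. x) ` I = (\<lambda>x. x) ` I" by (rule image_cong[OF HOL.refl])
    then show ?thesis by (simp only: image_ident)
  qed
  then have "act (\<lambda>x\<in>circle. x) A = (\<lambda>I. I) ` A" unfolding act_def by (rule image_cong[OF HOL.refl])
  then show ?thesis by (simp only: image_ident)
qed

lemma homeomorphism_circle_cong:
  assumes h: "homeomorphism circle circle f h" and f': "\<And>x. x \<in> circle ==> f' x = f x" and h': "\<And>x. x \<in> circle ==> h' x = h x"
  shows "homeomorphism circle circle f' h'"
proof -
  have i: "f ` circle = circle" "h ` circle = circle" using homeomorphism_image1[OF h] homeomorphism_image2[OF h] .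
  have mem: "f x \<in> circle" "h x \<in> circle" if "x \<in> circle" for x
    using imageI[OF that, of f] imageI[OF that, of h] unfolding i .
  show ?thesis unfolding homeomorphism_def
  proof (intro conjI ballI)
    show "h' (f' x) = x" if "x \<in> circle" for x
      unfolding f'[OF that] h'[OF mem(1)[OF that]] by (rule homeomorphism_apply1[OF h that])
    show "f' (h' x) = x" if "x \<in> circle" for x
      unfolding h'[OF that] f'[OF mem(2)[OF that]] by (rule homeomorphism_apply2[OF h that])
    show "f' ` circle = circle" by (rule HOL.trans[OF image_cong[OF HOL.refl f'] i(1)])
    show "h' ` circle = circle" by (rule HOL.trans[OF image_cong[OF HOL.refl h'] i(2)])
    show "continuous_on circle f'" by (rule iffD2[OF continuous_on_cong[OF HOL.refl f'] homeomorphism_cont1[OF h]])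
    show "continuous_on circle h'" by (rule iffD2[OF continuous_on_cong[OF HOL.refl h'] homeomorphism_cont2[OF h]])
  qed
qed

text \<open>The carrier is a subgroup of \<open>BijGroup circle\<close>. Products and inverses there
  are extensional functions that agree with the usual ones on the circle only, and
  \<open>homeomorphism_circle_cong\<close> transfers continuity to them.\<close>

lemma group_Aut:
  assumes L1: "lamination_system L1" and L2: "lamination_system L2"
  shows "group (Aut L1 L2)"
proof -
  interpret B: group "BijGroup circle" by (rule group_BijGroup)
  define H where "H = {g \<in> Bij circle. (\<exists>h. homeomorphism circle circle g h) \<and> orientation_preserving g \<and>
        act g L1 = L1 \<and> act g L2 = L2}"
  have gi: "\<forall>I\<in>L1. good_interval I" using L1[unfolded lamination_system_def] by (elim conjE)
  have gi': "\<forall>I\<in>L2. good_interval I" using L2[unfolded lamination_system_def] by (elim conjE)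
  note sub1 = arc_subset_circle[OF bspec[OF gi]] and sub2 = arc_subset_circle[OF bspec[OF gi']]
  have bij: "bij_betw g circle circle" if "g \<in> Bij circle" for g using that unfolding Bij_def by simp
  have "subgroup H (BijGroup circle)"
  proof (rule B.subgroupI)
    show "H \<subseteq> carrier (BijGroup circle)" unfolding H_def BijGroup_def by auto
    have h: "homeomorphism circle circle (\<lambda>x\<in>circle. x) (\<lambda>x. x)"
      by (rule homeomorphism_circle_cong[OF homeomorphism_ident[of circle]]) simp_all
    have orp: "orientation_preserving (\<lambda>x\<in>circle. x)" by (simp add: orientation_preserving_def)
    have "(\<lambda>x\<in>circle. x) \<in> H" unfolding H_def
      by (intro CollectI conjI id_Bij exI[of "homeomorphism circle circle (\<lambda>x\<in>circle. x)", OF h] orp act_ident[OF sub1] act_ident[OF sub2])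
    then show "H \<noteq> {}" by blast
  next
    fix g assume g: "g \<in> H"
    then have gB: "g \<in> Bij circle" unfolding H_def by simp
    let ?i = "\<lambda>x\<in>circle. inv_into circle g x"
    note b = bij[OF gB]
    obtain h where h: "homeomorphism circle circle g h" using g unfolding H_def by auto
    have hc: "h x \<in> circle" "g (h x) = x" if "x \<in> circle" for x
      using imageI[OF that, of h] homeomorphism_apply2[OF h that] unfolding homeomorphism_image2[OF h] .
    have ih: "?i x = h x" if "x \<in> circle" for x
    proof -
      note hx = hc[OF that]
      have "inv_into circle g (g (h x)) = h x" by (rule inv_into_f_f[OF bij_betw_imp_inj_on[OF b] hx(1)])
      then show ?thesis using hx(2) that by simp
    qed
    have "homeomorphism circle circle ?i g"
      by (rule homeomorphism_circle_cong[OF homeomorphism_symD[OF h] ih]) (assumption | rule HOL.refl)+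
    note 1 = exI[of "homeomorphism circle circle ?i" g, OF this]
    have "orientation_preserving g" using g unfolding H_def by simp
    note op = this[unfolded orientation_preserving_def, rule_format]
    have 2: "orientation_preserving ?i" unfolding orientation_preserving_def
    proof (intro ballI)
      fix u z v assume c: "u \<in> circle" "z \<in> circle" "v \<in> circle"
      show "ccw (?i u) (?i z) (?i v) \<longleftrightarrow> ccw u z v"
        using op[OF hc(1)[OF c(1)] hc(1)[OF c(2)] hc(1)[OF c(3)]]
        unfolding ih[OF c(1)] ih[OF c(2)] ih[OF c(3)] hc(2)[OF c(1)] hc(2)[OF c(2)] hc(2)[OF c(3)] by (rule HOL.sym)
    qed
    have ga: "act g L1 = L1" "act g L2 = L2" using g unfolding H_def by simp_all
    have "?i \<in> H" unfolding H_def
      by (intro CollectI conjI restrict_inv_into_Bij[OF gB] 1 2 act_inverse[OF b sub1 ga(1)] act_inverse[OF b sub2 ga(2)])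
    then show "inv\<^bsub>BijGroup circle\<^esub> g \<in> H" unfolding inv_BijGroup[OF gB] .
  next
    fix f g assume fg: "f \<in> H" "g \<in> H"
    then have B: "f \<in> Bij circle" "g \<in> Bij circle" unfolding H_def by simp_all
    obtain f' g' where h: "homeomorphism circle circle f f'" "homeomorphism circle circle g g'" using fg unfolding H_def by auto
    have "homeomorphism circle circle (compose circle f g) (g' \<circ> f')"
      by (rule homeomorphism_circle_cong[OF homeomorphism_compose[OF h(2,1)]]) (simp_all add: compose_def)
    note 1 = exI[of "homeomorphism circle circle (compose circle f g)", OF this]
    have "orientation_preserving f" "orientation_preserving g" using fg unfolding H_def by simp_all
    note op = this[unfolded orientation_preserving_def, rule_format]
    have gc: "g x \<in> circle" if "x \<in> circle" for x
      using imageI[OF that, of g] unfolding homeomorphism_image1[OF h(2)] .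
    have 2: "orientation_preserving (compose circle f g)" unfolding orientation_preserving_def
    proof (intro ballI)
      fix u z v assume c: "u \<in> circle" "z \<in> circle" "v \<in> circle"
      show "ccw (compose circle f g u) (compose circle f g z) (compose circle f g v) \<longleftrightarrow> ccw u z v"
        unfolding compose_eq[OF c(1)] compose_eq[OF c(2)] compose_eq[OF c(3)] op(1)[OF gc[OF c(1)] gc[OF c(2)] gc[OF c(3)]]
        by (rule op(2)[OF c])
    qed
    have "act f L1 = L1" "act g L1 = L1" "act f L2 = L2" "act g L2 = L2" using fg unfolding H_def by simp_all
    then have 3: "act (compose circle f g) L1 = L1" "act (compose circle f g) L2 = L2"
      using act_compose[of L1 f g, OF sub1] act_compose[of L2 f g, OF sub2] by simp_all
    have "compose circle f g \<in> H" unfolding H_def by (intro CollectI conjI compose_Bij[OF B] 1 2 3)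
    then show "f \<otimes>\<^bsub>BijGroup circle\<^esub> g \<in> H" using B by (simp add: BijGroup_def)
  qed
  then show ?thesis unfolding Aut_def H_def[symmetric] by (rule B.subgroup_imp_group)
qed

lemma Aut_mult: "f \<in> carrier (Aut L1 L2) ==> g \<in> carrier (Aut L1 L2) ==> f \<otimes>\<^bsub>Aut L1 L2\<^esub> g = compose circle f g"
  by (simp add: Aut_def BijGroup_def)

lemma Aut_inv:
  assumes L: "lamination_system L1" "lamination_system L2" and f: "f \<in> carrier (Aut L1 L2)"
  shows "inv\<^bsub>Aut L1 L2\<^esub> f = (\<lambda>x\<in>circle. inv_into circle f x)"
proof -
  interpret A: group "Aut L1 L2" by (rule group_Aut[OF L])
  have fB: "f \<in> Bij circle" using f by (simp add: Aut_def)
  then have b: "bij_betw f circle circle" unfolding Bij_def by simp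
  define g where "g = inv\<^bsub>Aut L1 L2\<^esub> f"
  have g: "g \<in> carrier (Aut L1 L2)" unfolding g_def using f by simp
  have "g \<otimes>\<^bsub>Aut L1 L2\<^esub> f = \<one>\<^bsub>Aut L1 L2\<^esub>" unfolding g_def using f by simp
  then have gf: "compose circle g f = (\<lambda>x\<in>circle. x)" unfolding Aut_mult[OF g f] by (simp add: Aut_def BijGroup_def)
  have "g x = inv_into circle f x" if x: "x \<in> circle" for x
  proof -
    obtain y where y: "y \<in> circle" "x = f y" using b x unfolding bij_betw_def by blast
    have "g (f y) = y" using fun_cong[OF gf, of y] y(1) by (simp add: compose_def)
    then show ?thesis using inv_into_f_f[OF bij_betw_imp_inj_on[OF b] y(1)] y(2) by simp
  qed
  moreover have "g x = undefined" if "x \<notin> circle" for x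
    using g that unfolding Aut_def Bij_def extensional_def by simp
  ultimately show ?thesis unfolding g_def[symmetric] by (auto simp: restrict_def fun_eq_iff)
qed

text \<open>The definition of a crown does not mention infinitely many vertices. In a gap with
  finitely many vertices every vertex is the start of an element, hence one of the
  \<open>t k\<close>, whereas \<open>p\<close> is not.\<close>

lemma (in lamsys) crown_infinite:
  assumes c: "crown L \<G>" and q: "qlam (pull L)" shows "infinite (verts (pull \<G>))"
proof
  assume fin: "finite (verts (pull \<G>))"
  interpret Q: qlam "pull L" by (rule q)
  obtain t p where t: "gap L \<G>" "\<forall>k::int. t k \<in> circle" "p \<in> circle" "\<forall>k. p \<noteq> t k"
    "\<G> = {arc_between (t k) (t (k + 1)) | k. True}" "vertices \<G> = range t \<union> {p}"
    using c unfolding crown_def by (elim conjE exE)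
  have sub: "\<G> \<subseteq> L" and G: "isgap (pull L) (pull \<G>)" using t(1) gap_pull by auto
  obtain v where v: "gseq (pull \<G>) v" using Q.gap_seq[OF G] by blast
  obtain p' where p': "p = pt p'" using pt_surj[OF t(3)] .
  have "pt p' \<in> pt ` verts (pull \<G>)" using t(6) vertices_pull[OF sub] p' by auto
  then have pv: "p' \<in> verts (pull \<G>)" unfolding pt_mem .
  have "verts (pull \<G>) = range v \<or> inj v \<and> range v \<subseteq> verts (pull \<G>)" using v unfolding gseq_def by blast
  then have "p' \<in> range v"
  proof
    assume "inj v \<and> range v \<subseteq> verts (pull \<G>)"
    then have "finite (range v)" "inj v" using fin finite_subset by auto
    then have "finite (UNIV :: int set)" using finite_imageD by blast
    then show ?thesis by simp
  qed (use pv in simp)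
  then obtain j where j: "p' = v j" by blast
  have "oarc (v j) (v (j + 1)) \<in> pull \<G>" by (rule Q.gseq_el[OF v])
  then obtain k where k: "pt ` oarc (v j) (v (j + 1)) = arc_between (t k) (t (k + 1))" using t(5) by auto
  obtain a where a: "t k = pt a" using pt_surj t(2) by metis
  obtain b where b: "t (k + 1) = pt b" using pt_surj t(2) by metis
  have "oarc (v j) (v (j + 1)) = oarc a b" using k unfolding a b arc_pt by simp
  moreover have "v j \<noteq> v (j + 1)" using v unfolding gseq_def by blast
  ultimately have "v j = a" using oarc_eq_iff[of "v j" "v (j + 1)"] by blast
  then show False using t(4)[rule_format, of k] a j p' by simp
qed

section \<open>The classification of stabilizers\<close>

theorem theorem15p22:
  fixes L1 L2 :: "complex set set" and G :: "(complex \<Rightarrow> complex) set" and \<G> :: "complex set set"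
    and S :: "(complex \<Rightarrow> complex) monoid"
  assumes pair: "pseudo_fibered L1 L2"
    and G: "subgroup G (Aut L1 L2)"
    and gap: "gap L \<G>" "L = L1 \<or> L = L2"
    and S: "S = stabilizer_group L1 L2 G \<G>"
    and nontrivial: "carrier S \<noteq> {\<one>\<^bsub>S\<^esub>}"
  shows
    "(ideal_polygon L \<G> \<longrightarrow>
        (\<exists>e n. e \<in> carrier S \<and> elliptic L1 L2 e \<and> group.ord (Aut L1 L2) e = n \<and>
           carrier S = generate S {e} \<and> S \<cong> integer_mod_group n)
      \<or> (\<exists>g. g \<in> carrier S \<and> pA_like L1 L2 g \<and> fixed_points g = {} \<and>
           carrier S = generate S {g} \<and> S \<cong> integer_group)
      \<or> (\<exists>g. g \<in> carrier (Aut L1 L2) \<and> properly_pseudo_Anosov L1 L2 g \<and>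
           carrier S = generate S {g} \<and> S \<cong> integer_group)
      \<or> (\<exists>g e n. g \<in> carrier S \<and> e \<in> carrier S \<and> pA_like L1 L2 g \<and>
           elliptic L1 L2 e \<and> group.ord (Aut L1 L2) e = n \<and>
           carrier S = generate S {g, e} \<and>
           presents S (two_gens g e) {commutator_word, power_word n} \<and>
           S \<cong> integer_group \<times>\<times> integer_mod_group n))
     \<and>
     (crown L \<G> \<longrightarrow>
        (\<exists>h. h \<in> carrier S \<and> parabolic L1 L2 h \<and>
           carrier S = generate S {h} \<and> S \<cong> integer_group)
      \<or> (\<exists>g. g \<in> carrier S \<and> properly_pseudo_Anosov L1 L2 g \<and>
           carrier S = generate S {g} \<and> S \<cong> integer_group)
      \<or> (\<exists>g h. g \<in> carrier S \<and> h \<in> carrier S \<and> properly_pseudo_Anosov L1 L2 g \<and>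
           parabolic L1 L2 h \<and> carrier S = generate S {g, h} \<and>
           presents S (two_gens g h) {commutator_word} \<and>
           S \<cong> integer_group \<times>\<times> integer_group))"
proof -
  let ?A = "Aut L1 L2"
  note D = pair[unfolded pseudo_fibered_def]
  have lam1: "lamination_system L1" using D by (elim conjE)
  have lam2: "lamination_system L2" using D by (elim conjE)
  \<comment> \<open>The other lamination of the pair: the analysis of gaps is symmetric, and
    \<open>pf_swap\<close> lets the gap belong to either of them.\<close>
  define L' where "L' = (if L = L1 then L2 else L1)"
  have LL: "L = L1 \<and> L' = L2 \<or> L = L2 \<and> L' = L1" using gap(2) unfolding L'_def by auto
  have pf: "pf (pull L) (pull L')" using LL
  proof
    assume "L = L1 \<and> L' = L2" then show ?thesis using pf_pull[OF pair] by simp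
  next
    assume "L = L2 \<and> L' = L1" then show ?thesis using pf_swap[OF pf_pull[OF pair]] by simp
  qed
  have lamL: "lamination_system L" "lamination_system L'" using LL lam1 lam2 by auto
  interpret lamsys L by unfold_locales (rule lamL(1))
  interpret P: pf "pull L" "pull L'" by (rule pf)
  interpret A: group ?A by (rule group_Aut[OF lam1 lam2])
  have sub: "\<G> \<subseteq> L" and gp: "isgap (pull L) (pull \<G>)" using gap(1) unfolding gap_pull by simp_all
  have gi: "\<forall>I\<in>L. good_interval I" using lamL(1)[unfolded lamination_system_def] by (elim conjE)
  have circ: "I \<subseteq> circle" if "I \<in> \<G>" for I by (rule arc_subset_circle[OF bspec[OF gi subsetD[OF sub that]]])
  define H where "H = {g \<in> G. act g \<G> = \<G>}"
  have SH: "S = ?A\<lparr>carrier := H\<rparr>" unfolding S stabilizer_group_def H_def ..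
  have HG: "g \<in> G" "act g \<G> = \<G>" if "g \<in> H" for g using that unfolding H_def by simp_all
  have HA: "g \<in> carrier ?A" if "g \<in> H" for g using subsetD[OF subgroup.subset[OF G] HG(1)[OF that]] .
  have Ac: "bij_betw g circle circle" "orientation_preserving g" "act g L1 = L1" "act g L2 = L2" "g \<in> Bij circle" if "g \<in> carrier ?A" for g
    using that unfolding Aut_def Bij_def by simp_all
  have one: "\<one>\<^bsub>?A\<^esub> = (\<lambda>x\<in>circle. x)" by (simp add: Aut_def BijGroup_def)
  have subH: "subgroup H ?A"
  proof (rule A.subgroupI)
    show "H \<subseteq> carrier ?A" using HA by (rule subsetI)
    have "\<one>\<^bsub>?A\<^esub> \<in> H" unfolding H_def using subgroup.one_closed[OF G] act_ident[OF circ] one by simp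
    then show "H \<noteq> {}" by blast
    show "inv\<^bsub>?A\<^esub> g \<in> H" if g: "g \<in> H" for g
      unfolding H_def using subgroup.m_inv_closed[OF G HG(1)[OF g]] act_inverse[OF Ac(1)[OF HA[OF g]] circ HG(2)[OF g]]
      unfolding Aut_inv[OF lam1 lam2 HA[OF g]] by simp
    show "f \<otimes>\<^bsub>?A\<^esub> g \<in> H" if f: "f \<in> H" and g: "g \<in> H" for f g
      unfolding H_def using subgroup.m_closed[OF G HG(1)[OF f] HG(1)[OF g]] act_compose[of \<G> f g, OF circ] HG(2)[OF f] HG(2)[OF g]
      unfolding Aut_mult[OF HA[OF f] HA[OF g]] by simp
  qed
  have cS: "carrier S = H" and oS: "\<one>\<^bsub>S\<^esub> = \<one>\<^bsub>?A\<^esub>" and mS: "f \<otimes>\<^bsub>S\<^esub> g = f \<otimes>\<^bsub>?A\<^esub> g" for f g unfolding SH by simp_all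
  have gS: "group S" unfolding SH by (rule A.subgroup_imp_group[OF subH])
  have ca: "circle_auto g" if "g \<in> H" for g by (rule circle_auto.intro[OF Ac(1)[OF HA[OF that]] Ac(2)[OF HA[OF that]]])
  have aL: "act g L = L" "act g L' = L'" if "g \<in> H" for g using LL Ac(3,4)[OF HA[OF that]] by auto
  obtain v where v: "gseq (pull \<G>) v" using P.A.gap_seq[OF gp] by blast
  have T: "stab (pull L) (pull L') S circle_map (pull \<G>) v"
  proof (rule stab.intro[OF pf gS], rule stab_axioms.intro)
    fix f assume f: "f \<in> carrier S"
    then have fH: "f \<in> H" unfolding cS .
    show "auto_on (pull L) (circle_map f)" by (rule circle_auto.map_auto_on[OF ca[OF fH] lamL(1) aL(1)[OF fH]])
    show "auto_on (pull L') (circle_map f)" by (rule circle_auto.map_auto_on[OF ca[OF fH] lamL(2) aL(2)[OF fH]])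
    show "(`) (circle_map f) ` pull \<G> = pull \<G>" by (rule circle_auto.act_pull[OF ca[OF fH] lamL(1) sub HG(2)[OF fH]])
    show "f = \<one>\<^bsub>S\<^esub>" if id: "circle_map f = id"
    proof
      fix x
      show "f x = \<one>\<^bsub>S\<^esub> x"
      proof (cases "x \<in> circle")
        case True
        then obtain c where c: "x = pt c" by (rule pt_surj)
        have "f (pt c) = pt (circle_map f c)" by (rule circle_auto.pt_map[OF ca[OF fH], symmetric])
        then show ?thesis unfolding oS one id c using pt_circle[of c] by simp
      next
        case False
        have "f \<in> extensional circle" using Ac(5)[OF HA[OF fH]] unfolding Bij_def by simp
        then have "f x = undefined" using False by (rule extensional_arb)
        moreover have "\<one>\<^bsub>S\<^esub> x = undefined" unfolding oS one restrict_def using False by (rule if_not_P)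
        ultimately show ?thesis by simp
      qed
    qed
    fix g assume "g \<in> carrier S"
    then have gH: "g \<in> H" unfolding cS .
    have fg: "f \<otimes>\<^bsub>S\<^esub> g \<in> H" unfolding mS by (rule subgroup.m_closed[OF subH fH gH])
    show "circle_map (f \<otimes>\<^bsub>S\<^esub> g) = circle_map f \<circ> circle_map g"
    proof
      fix c
      have "pt (circle_map (f \<otimes>\<^bsub>S\<^esub> g) c) = compose circle f g (pt c)"
        unfolding circle_auto.pt_map[OF ca[OF fg]] unfolding mS Aut_mult[OF HA[OF fH] HA[OF gH]] ..
      also have "\<dots> = f (g (pt c))" by (rule compose_eq[OF pt_circle])
      also have "\<dots> = pt (circle_map f (circle_map g c))"
        unfolding circle_auto.pt_map[OF ca[OF fH]] circle_auto.pt_map[OF ca[OF gH]] ..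
      finally show "circle_map (f \<otimes>\<^bsub>S\<^esub> g) c = (circle_map f \<circ> circle_map g) c" by simp
    qed
  qed (rule gp, rule v, rule nontrivial)
  interpret S: group S by (rule gS)
  have pow: "x [^]\<^bsub>S\<^esub> (k::int) = x [^]\<^bsub>?A\<^esub> k" if "x \<in> H" for x k
    unfolding SH by (rule A.int_pow_consistent[OF subH that, symmetric])
  have ord: "A.ord x = d" if x: "x \<in> H" and o: "\<And>k::int. x [^]\<^bsub>S\<^esub> k = \<one>\<^bsub>S\<^esub> \<longleftrightarrow> int d dvd k" for x d
  proof -
    have "int (A.ord x) dvd k \<longleftrightarrow> int d dvd k" for k :: int
      using A.int_pow_eq_id[OF HA[OF x], of k] o[of k] unfolding pow[OF x] oS by simp
    from this[of "int d"] this[of "int (A.ord x)"] show ?thesis by (simp add: dvd_antisym)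
  qed
  have ell: "elliptic L1 L2 x" if x: "x \<in> H" "x \<noteq> \<one>\<^bsub>S\<^esub>" "x [^]\<^bsub>S\<^esub> (k::int) = \<one>\<^bsub>S\<^esub>" "0 < k" for x k
  proof -
    have "x [^]\<^bsub>?A\<^esub> int (nat k) = \<one>\<^bsub>?A\<^esub>" using x(3,4) unfolding pow[OF x(1)] oS by simp
    then have "x [^]\<^bsub>?A\<^esub> nat k = \<one>\<^bsub>?A\<^esub>" unfolding int_pow_int .
    then show ?thesis unfolding elliptic_def using HA[OF x(1)] x(2,4) unfolding oS by (intro conjI exI[of _ "nat k"]) simp_all
  qed
  have nell: "\<not> elliptic L1 L2 x" if x: "x \<in> H" "\<And>k::int. x [^]\<^bsub>S\<^esub> k = \<one>\<^bsub>S\<^esub> \<Longrightarrow> k = 0" for x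
  proof
    assume "elliptic L1 L2 x"
    then obtain n :: nat where n: "n > 0" "x [^]\<^bsub>?A\<^esub> n = \<one>\<^bsub>?A\<^esub>" unfolding elliptic_def by blast
    have "x [^]\<^bsub>?A\<^esub> int n = \<one>\<^bsub>?A\<^esub>" unfolding int_pow_int by (rule n(2))
    then have "x [^]\<^bsub>S\<^esub> int n = \<one>\<^bsub>S\<^esub>" unfolding pow[OF x(1)] oS .
    then show False using x(2)[of "int n"] n(1) by simp
  qed
  have pA: "pA_like L1 L2 x" if x: "x \<in> H" "\<And>k::int. x [^]\<^bsub>S\<^esub> k = \<one>\<^bsub>S\<^esub> \<Longrightarrow> k = 0" and ns: "\<not> is_singleton (fixed_points x)"
    and ip: "\<exists>\<G>' \<H>. isgap (pull L) \<G>' \<and> isgap (pull L') \<H> \<and> inter \<G>' \<H> \<and> (`) (circle_map x) ` \<G>' = \<G>' \<and> (`) (circle_map x) ` \<H> = \<H>" for x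
  proof -
    obtain \<G>' \<H> where I: "isgap (pull L) \<G>'" "isgap (pull L') \<H>" "inter \<G>' \<H>" "(`) (circle_map x) ` \<G>' = \<G>'" "(`) (circle_map x) ` \<H> = \<H>"
      using ip by (elim exE conjE)
    note ac = circle_auto.act_push[OF ca[OF x(1)] I(4)] circle_auto.act_push[OF ca[OF x(1)] I(5)]
    have "\<exists>\<G>1 \<G>2. interleaving_pair L1 L2 \<G>1 \<G>2 \<and> act x \<G>1 = \<G>1 \<and> act x \<G>2 = \<G>2" using LL
    proof
      assume e: "L = L1 \<and> L' = L2"
      have "interleaving_pair L1 L2 ((`) pt ` \<G>') ((`) pt ` \<H>)"
        by (rule inter_pull[OF lam1 lam2 _ _ I(3)]) (use I(1,2) e in simp_all)
      then show ?thesis using ac by (intro exI conjI)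
    next
      assume e: "L = L2 \<and> L' = L1"
      have "interleaving_pair L1 L2 ((`) pt ` \<H>) ((`) pt ` \<G>')"
        by (rule inter_pull[OF lam1 lam2 _ _ iffD1[OF inter_sym I(3)]]) (use I(1,2) e in simp_all)
      then show ?thesis using ac by (intro exI conjI)
    qed
    moreover have "x \<noteq> \<one>\<^bsub>?A\<^esub>" using x(2)[of 1] S.int_pow_1[of x] x(1) unfolding cS oS[symmetric] by auto
    ultimately show ?thesis unfolding pA_like_def parabolic_def using HA[OF x(1)] nell[OF x] ns by (intro conjI) simp_all
  qed
  have fx: "circle_map x c = c \<longleftrightarrow> pt c \<in> fixed_points x" if "x \<in> H" for x c by (rule circle_auto.fixed_map[OF ca[OF that]])
  have two: "\<not> is_singleton (fixed_points x)" "fixed_points x \<noteq> {}" if x: "x \<in> H" "p \<noteq> q" "circle_map x p = p" "circle_map x q = q" for x p q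
  proof -
    have m: "pt p \<in> fixed_points x" "pt q \<in> fixed_points x" using x(3,4) unfolding fx[OF x(1)] .
    then show "fixed_points x \<noteq> {}" by auto
    show "\<not> is_singleton (fixed_points x)"
    proof
      assume "is_singleton (fixed_points x)"
      then have "pt p = pt q" using m unfolding is_singleton_def by auto
      then show False using x(2) by simp
    qed
  qed
  have par: "parabolic L1 L2 x" if x: "x \<in> H" "x \<noteq> \<one>\<^bsub>S\<^esub>" "\<exists>!p. circle_map x p = p" for x
  proof -
    obtain p where p: "circle_map x p = p" "\<And>q. circle_map x q = q \<Longrightarrow> q = p" using x(3) by blast
    have "fixed_points x = {pt p}"
    proof
      show "fixed_points x \<subseteq> {pt p}"
      proof
        fix z assume z: "z \<in> fixed_points x"
        then have "z \<in> circle" unfolding fixed_points_def by simp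
        then obtain c where c: "z = pt c" by (rule pt_surj)
        have "circle_map x c = c" using z unfolding fx[OF x(1)] c .
        then show "z \<in> {pt p}" using p(2) c by simp
      qed
      show "{pt p} \<subseteq> fixed_points x" using p(1) unfolding fx[OF x(1)] by simp
    qed
    then show ?thesis unfolding parabolic_def using HA[OF x(1)] x(2) unfolding oS is_singleton_def by blast
  qed
  have Z: "integer_mod_group 0 = integer_group" by (simp add: integer_mod_group_def)
  have e0: "g \<otimes>\<^bsub>S\<^esub> e [^]\<^bsub>S\<^esub> (0::int) = g" "e [^]\<^bsub>S\<^esub> (0::int) \<otimes>\<^bsub>S\<^esub> g = g" if "g \<in> carrier S" for g e using that by simp_all
  let "(_ \<longrightarrow> ?P) \<and> (_ \<longrightarrow> ?Q)" = ?thesis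
  show ?thesis
  proof (intro conjI impI)
    assume "ideal_polygon L \<G>"
    then have "finite (pt ` verts (pull \<G>))" unfolding ideal_polygon_def vertices_pull[OF sub] by simp
    then have fin: "finite (verts (pull \<G>))" by (rule finite_imageD) (simp add: inj_on_def)
    from stab.polygon[OF T fin] show ?P
    proof
      assume "\<exists>x m. x \<in> carrier S \<and> carrier S = generate S {x} \<and> 0 < m \<and> x [^]\<^bsub>S\<^esub> (m::int) = \<one>\<^bsub>S\<^esub>"
      then obtain x and m :: int where x: "x \<in> carrier S" "carrier S = generate S {x}" "0 < m" "x [^]\<^bsub>S\<^esub> m = \<one>\<^bsub>S\<^esub>" by (elim exE conjE)
      have xH: "x \<in> H" using x(1) unfolding cS .
      have x1: "x \<noteq> \<one>\<^bsub>S\<^esub>" using x(2) nontrivial S.generate_one by auto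
      have iso: "S \<cong> integer_mod_group (A.ord x)"
        by (rule S.cyclic_iso[OF x(1,2)]) (simp add: pow[OF xH] oS A.int_pow_eq_id[OF HA[OF xH]])
      show ?thesis
        by (rule disjI1, rule exI[of _ x], rule exI[of _ "A.ord x"]) (intro conjI x(1,2) ell[OF xH x1 x(4,3)] iso HOL.refl)
    next
      assume "\<exists>g e d. 0 < d \<and> g \<in> carrier S \<and> e \<in> carrier S \<and> g \<otimes>\<^bsub>S\<^esub> e = e \<otimes>\<^bsub>S\<^esub> g \<and>
        (\<forall>f\<in>carrier S. \<exists>a b. f = g [^]\<^bsub>S\<^esub> (a::int) \<otimes>\<^bsub>S\<^esub> e [^]\<^bsub>S\<^esub> (b::int)) \<and>
        (\<forall>a b. g [^]\<^bsub>S\<^esub> (a::int) \<otimes>\<^bsub>S\<^esub> e [^]\<^bsub>S\<^esub> (b::int) = \<one>\<^bsub>S\<^esub> \<longleftrightarrow> a = 0 \<and> int d dvd b) \<and>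
        (\<exists>\<G>' \<H>. isgap (pull L) \<G>' \<and> isgap (pull L') \<H> \<and> inter \<G>' \<H> \<and> (`) (circle_map g) ` \<G>' = \<G>' \<and> (`) (circle_map g) ` \<H> = \<H>)"
      then obtain g e d where d: "0 < d" and g: "g \<in> carrier S" and e: "e \<in> carrier S" and c: "g \<otimes>\<^bsub>S\<^esub> e = e \<otimes>\<^bsub>S\<^esub> g"
        and all': "\<forall>f\<in>carrier S. \<exists>a b. f = g [^]\<^bsub>S\<^esub> (a::int) \<otimes>\<^bsub>S\<^esub> e [^]\<^bsub>S\<^esub> (b::int)"
        and triv': "\<forall>a b. g [^]\<^bsub>S\<^esub> (a::int) \<otimes>\<^bsub>S\<^esub> e [^]\<^bsub>S\<^esub> (b::int) = \<one>\<^bsub>S\<^esub> \<longleftrightarrow> a = 0 \<and> int d dvd b"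
        and ip: "\<exists>\<G>' \<H>. isgap (pull L) \<G>' \<and> isgap (pull L') \<H> \<and> inter \<G>' \<H> \<and> (`) (circle_map g) ` \<G>' = \<G>' \<and> (`) (circle_map g) ` \<H> = \<H>"
        by (elim exE conjE) (rule that, assumption+, intro exI conjI, assumption+)
      note all = bspec[OF all'] and triv = triv'[rule_format]
      have gH: "g \<in> H" and eH: "e \<in> H" using g e unfolding cS .
      have g0: "g [^]\<^bsub>S\<^esub> k = \<one>\<^bsub>S\<^esub> \<longleftrightarrow> k = 0" for k :: int using triv[of k 0] g by simp
      have ek: "e [^]\<^bsub>S\<^esub> k = \<one>\<^bsub>S\<^esub> \<longleftrightarrow> int d dvd k" for k :: int using triv[of 0 k] e by simp
      \<comment> \<open>By \<open>polygon_fixed\<close> a single fixed point would make all vertices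
        fixed, and there are at least two.\<close>
      have "\<not> is_singleton (fixed_points g)"
      proof
        assume "is_singleton (fixed_points g)"
        then obtain z where z: "z \<in> fixed_points g" unfolding is_singleton_def by auto
        then have "z \<in> circle" unfolding fixed_points_def by simp
        then obtain c where c: "z = pt c" by (rule pt_surj)
        have gc: "circle_map g c = c" using z unfolding fx[OF gH] c .
        have vk: "circle_map g (v k) = v k" for k
          by (rule P.A.polygon_fixed[OF stab.aL[OF T g] gp fin stab.st[OF T g] v gc])
        have "v 0 \<noteq> v (0 + 1)" using v unfolding gseq_def by (elim conjE) (erule spec)
        from two(1)[OF gH this vk vk] \<open>is_singleton (fixed_points g)\<close> show False by simp
      qed
      then have pAg: "pA_like L1 L2 g" by (intro pA[OF gH _ _ ip]) (simp_all add: g0)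
      \<comment> \<open>For \<open>d = 1\<close> the elliptic factor is trivial and the group is
        infinite cyclic; the presence of fixed points of \<open>g\<close> then decides between cases
        (b) and (c).\<close>
      show ?thesis
      proof (cases "d = 1")
        case True
        have "e = \<one>\<^bsub>S\<^esub>" using ek[of 1] e True by simp
        then have "\<exists>a. f = g [^]\<^bsub>S\<^esub> (a::int)" if "f \<in> carrier S" for f using all[OF that] g by auto
        then have gen: "carrier S = generate S {g}" unfolding S.generate_pow[OF g] using g by auto
        have iso: "S \<cong> integer_group" using S.cyclic_iso[OF g gen, of 0] g0 unfolding Z by simp
        show ?thesis
        proof (cases "fixed_points g = {}")
          case True
          show ?thesis by (rule disjI2, rule disjI1, rule exI[of _ g]) (intro conjI g pAg True gen iso)
        next
          case False
          have "properly_pseudo_Anosov L1 L2 g" unfolding properly_pseudo_Anosov_def using pAg False by simp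
          then show ?thesis using HA[OF gH] gen iso by blast
        qed
      next
        case False
        have e1: "e \<noteq> \<one>\<^bsub>S\<^esub>"
        proof
          assume "e = \<one>\<^bsub>S\<^esub>"
          then have "int d dvd 1" using ek[of 1] by simp
          then show False using False d by simp
        qed
        have ed: "e [^]\<^bsub>S\<^esub> int d = \<one>\<^bsub>S\<^esub>" using ek by simp
        have R: "presents S (two_gens g e) {commutator_word, power_word d}"
          by (rule S.presents_product[OF g e c all triv]) simp_all
        show ?thesis
          by (rule disjI2, rule disjI2, rule disjI2, rule exI[of _ g], rule exI[of _ e], rule exI[of _ d])
            (intro conjI g e pAg ell[OF eH e1 ed] ord[OF eH ek] S.two_generators[OF g e all] R S.product_iso[OF g e c all triv], use d in simp_all)
      qed
    qed
  next
    assume "crown L \<G>"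
    then have inf: "infinite (verts (pull \<G>))" by (rule crown_infinite) (rule P.A.qlam_axioms)
    from stab.crown[OF T inf] show ?Q
    proof (elim disjE exE conjE)
      fix x assume x: "x \<in> carrier S" and gen: "carrier S = generate S {x}"
        and tr: "\<forall>a. x [^]\<^bsub>S\<^esub> (a::int) = \<one>\<^bsub>S\<^esub> \<longleftrightarrow> a = 0" and u: "\<exists>!p. circle_map x p = p"
      have xH: "x \<in> H" using x unfolding cS .
      have x1: "x \<noteq> \<one>\<^bsub>S\<^esub>" using spec[OF tr, of 1] x by auto
      have iso: "S \<cong> integer_group" using S.cyclic_iso[OF x gen, of 0] tr unfolding Z by simp
      show ?thesis by (rule disjI1, rule exI[of _ x]) (intro conjI x par[OF xH x1 u] gen iso)
    next
      fix y p q \<G>' \<H> assume y: "y \<in> carrier S" and gen: "carrier S = generate S {y}"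
        and tr: "\<forall>a. y [^]\<^bsub>S\<^esub> (a::int) = \<one>\<^bsub>S\<^esub> \<longleftrightarrow> a = 0" and pq: "p \<noteq> q" "circle_map y p = p" "circle_map y q = q"
        and ip: "isgap (pull L) \<G>'" "isgap (pull L') \<H>" "inter \<G>' \<H>" "(`) (circle_map y) ` \<G>' = \<G>'" "(`) (circle_map y) ` \<H> = \<H>"
      have yH: "y \<in> H" using y unfolding cS .
      have iso: "S \<cong> integer_group" using S.cyclic_iso[OF y gen, of 0] tr unfolding Z by simp
      have "pA_like L1 L2 y"
        by (rule pA[OF yH _ two(1)[OF yH pq]]) (use tr ip in auto)
      then have "properly_pseudo_Anosov L1 L2 y" unfolding properly_pseudo_Anosov_def using two(2)[OF yH pq] by simp
      then show ?thesis using y gen iso by blast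
    next
      fix y x p q \<G>' \<H> assume x: "x \<in> carrier S" and y: "y \<in> carrier S" and c: "y \<otimes>\<^bsub>S\<^esub> x = x \<otimes>\<^bsub>S\<^esub> y"
        and all': "\<forall>f\<in>carrier S. \<exists>a b. f = y [^]\<^bsub>S\<^esub> (a::int) \<otimes>\<^bsub>S\<^esub> x [^]\<^bsub>S\<^esub> (b::int)"
        and triv': "\<forall>a b. y [^]\<^bsub>S\<^esub> (a::int) \<otimes>\<^bsub>S\<^esub> x [^]\<^bsub>S\<^esub> (b::int) = \<one>\<^bsub>S\<^esub> \<longleftrightarrow> a = 0 \<and> b = 0"
        and u: "\<exists>!p. circle_map x p = p" and pq: "p \<noteq> q" "circle_map y p = p" "circle_map y q = q"
        and ip: "isgap (pull L) \<G>'" "isgap (pull L') \<H>" "inter \<G>' \<H>" "(`) (circle_map y) ` \<G>' = \<G>'" "(`) (circle_map y) ` \<H> = \<H>"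
      have xH: "x \<in> H" and yH: "y \<in> H" using x y unfolding cS .
      note all = bspec[OF all']
      have triv: "y [^]\<^bsub>S\<^esub> a \<otimes>\<^bsub>S\<^esub> x [^]\<^bsub>S\<^esub> b = \<one>\<^bsub>S\<^esub> \<longleftrightarrow> a = 0 \<and> int 0 dvd b" for a b :: int using triv' by simp
      have y0: "y [^]\<^bsub>S\<^esub> k = \<one>\<^bsub>S\<^esub> \<longleftrightarrow> k = 0" for k :: int using triv[of k 0] y by simp
      have x0: "x [^]\<^bsub>S\<^esub> k = \<one>\<^bsub>S\<^esub> \<longleftrightarrow> k = 0" for k :: int using triv[of 0 k] x by simp
      have x1: "x \<noteq> \<one>\<^bsub>S\<^esub>" using x0[of 1] x by auto
      have "pA_like L1 L2 y"
        by (rule pA[OF yH _ two(1)[OF yH pq]]) (use y0 ip in auto)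
      then have pr: "properly_pseudo_Anosov L1 L2 y" unfolding properly_pseudo_Anosov_def using two(2)[OF yH pq] by simp
      have R: "presents S (two_gens y x) {commutator_word}"
        by (rule S.presents_product[OF y x c all triv]) simp_all
      have iso: "S \<cong> integer_group \<times>\<times> integer_group" using S.product_iso[OF y x c all triv] unfolding Z .
      show ?thesis
        by (rule disjI2, rule disjI2, rule exI[of _ y], rule exI[of _ x])
          (intro conjI y x pr par[OF xH x1 u] S.two_generators[OF y x all] R iso)
    qed
  qed
qed


end
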